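(* Assume $s>\frac72$ and $1\le r<s$. Then the solution map for the Cauchy problem of the two-component system stated in the context is H\"older continuous with exponent $$ \beta= \begin{cases} 1, & \text{if } 1\le r\le s-1 \text{ and } s+r\ge 5,\\ \frac{2s-5}{s-r}, & \text{if } \frac72<s<4 \text{ and } 1\le r\le 5-s,\\ s-r, & \text{if } s-1<r<s \end{cases} $$ as a map from $$B(0,h):=\{(u,\rho)\in H^{s}(\mathbb{R})\times H^{s-2}(\mathbb{R}) : \|u\|_{H^{s}(\mathbb{R})}+\|\rho\|_{H^{s-2}(\mathbb{R})}\le h\}$$ with the $H^{r}(\mathbb{R})\times H^{r-2}(\mathbb{R})$-norm to $C([0,T_0];H^{r}(\mathbb{R})\times H^{r-2}(\mathbb{R}))$, where $T_0>0$ is defined by $$ T_0:=\frac{1}{2c_s}\ln\left(1+\frac{1}{\|u_0\|_{H^{s}(\mathbb{R})}+\|\rho_0\|_{H^{s-2}(\mathbb{R})}}\right), $$ with $(u_0,\rho_0)$ the initial data and $c_s$ the constant depending on $s$ described in the context. More precisely, $$ \|(u(t),\rho(t))-(v(t),\theta(t))\|_{C([0,T_0];H^{r}(\mathbb{R})\times H^{r-2}(\mathbb{R}))}\le c\,\|(u(0),\rho(0))-(v(0),\theta(0))\|_{H^{r}(\mathbb{R})\times H^{r-2}(\mathbb{R})}^{\beta} $$ for all $(u(0),\rho(0)),(v(0),\theta(0))\in B(0,h)$ and $(u(t),\rho(t)),(v(t),\theta(t))$ the solutions corresponding to the initial data $(u(0),\rho(0)),(v(0),\theta(0))$, respectively.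 The constant $c$ depends on $s$, $r$, $T_0$ and $h$.
   Context: For real $q$, $H^q(\mathbb{R})$ is the $L^2$-based Sobolev space, and $\|(f,g)\|_{H^{r}\times H^{r-2}}=\|f\|_{H^{r}}+\|g\|_{H^{r-2}}$. Write $\Lambda^{-4}:=(1-\partial_x^2)^{-2}$. The parameters $b\in\mathbb{R}\setminus\{1\}$ and $\kappa,\alpha\in\mathbb{R}$ are fixed constants. The Cauchy problem (two-component higher order Camassa-Holm system with inertia operator $(1-\partial_x^2)^2$) is, for $u(t,x),\rho(t,x)$, $t>0$, $x\in\mathbb{R}$: $$ \begin{cases} u_t+uu_x+\partial_x\Lambda^{-4}\left(\frac b2u^2+(3-b)u_x^2-\frac{b+5}{2}u_{xx}^2+(b-5)u_xu_{xxx}+\frac{\kappa}{2}\rho^2-\alpha u\right)=0,\\ \rho_t+u\rho_x+(b-1)u_x\rho=0,\\ u(0,x)=u_0(x),\quad \rho(0,x)=\rho_0(x). \end{cases} $$ Well-posedness (known): for $(u_0,\rho_0)\in H^{s}(\mathbb{R})\times H^{s-2}(\mathbb{R})$, $s>\frac72$, there are a maximal existence time $T=T(u_0,\rho_0)>0$ (independent of $s$) and a unique solution $(u,\rho)\in C([0,T);H^{s}\times H^{s-2})\cap C^1([0,T);H^{s-1}\times H^{s-3})$, depending continuously on the initial data. "The solution" with given data means this solution, and the solution map sends initial data to it. The constant $c_s$ is a constant depending on $s$ for which the following separate lifespan result holds: for the solution with initial data $(u_0,\rho_0)\in H^{s}(\mathbb{R})\times H^{s-2}(\mathbb{R})$,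 $s>\frac72$, and $T_0=\frac{1}{2c_s}\ln\left(1+\frac{1}{\|u_0\|_{H^{s}}+\|\rho_0\|_{H^{s-2}}}\right)$, the maximal existence time satisfies $T\ge T_0$ and $\|u(t)\|_{H^{s}}+\|\rho(t)\|_{H^{s-2}}\le 2e^{c_sT_0}(\|u_0\|_{H^{s}}+\|\rho_0\|_{H^{s-2}})$ for $t\in[0,T_0]$. *)

theory Defs
  imports "HOL-Analysis.Analysis"
begin

section \<open>Sobolev spaces on the real line\<close>

text \<open>
  Functions are not quotiented by almost-everywhere equality. All notions below are
  invariant under changing a function on a null set, and identities between functions are
  stated almost everywhere.
\<close>

definition L2 :: "(real \<Rightarrow> 'a::{real_normed_vector, second_countable_topology}) \<Rightarrow> bool" where
  "L2 f \<longleftrightarrow> f \<in> borel_measurable lborel \<and> integrable lborel (\<lambda>x. (norm (f x))\<^sup>2)"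

definition truncated_fourier :: "nat \<Rightarrow> (real \<Rightarrow> real) \<Rightarrow> real \<Rightarrow> complex" where
  "truncated_fourier n f \<xi> =
     complex_of_real (1 / sqrt (2 * pi)) *
       (\<integral>x. indicator {- real n..real n} x * (complex_of_real (f x) * cis (- (x * \<xi>))) \<partial>lborel)"

text \<open>
  The Fourier transform on \<open>L\<^sup>2\<close>, as the \<open>L\<^sup>2\<close> limit of the truncated Fourier integrals. The
  unitary normalisation makes \<open>H\<^sup>0\<close> isometric to \<open>L\<^sup>2\<close>. The choice operator only selects a
  representative, since the limit is unique up to null sets.
\<close>

definition is_fourier :: "(real \<Rightarrow> real) \<Rightarrow> (real \<Rightarrow> complex) \<Rightarrow> bool" where
  "is_fourier f g \<longleftrightarrow> L2 g \<and>
     (\<lambda>n. \<integral>\<^sup>+ \<xi>. ennreal ((cmod (g \<xi> - truncated_fourier n f \<xi>))\<^sup>2) \<partial>lborel) \<longlonglongrightarrow> 0"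

definition fourier :: "(real \<Rightarrow> real) \<Rightarrow> real \<Rightarrow> complex" where
  "fourier f = (SOME g. is_fourier f g)"

text \<open>
  For \<open>q \<ge> 0\<close> the set below is the usual space of real-valued functions in \<open>H\<^sup>q\<close>. For \<open>q < 0\<close>
  it is the intersection of \<open>H\<^sup>q\<close> with \<open>L\<^sup>2\<close>, carrying the usual \<open>H\<^sup>q\<close> norm. A negative index
  occurs only as \<open>r - 2\<close> with \<open>1 \<le> r < 2\<close>, and there the norm is only applied to elements of
  \<open>H\<^bsup>s-2\<^esup>\<close> with \<open>s > 7/2\<close>, which lie in \<open>L\<^sup>2\<close>.
\<close>

definition sobolev :: "real \<Rightarrow> (real \<Rightarrow> real) set" where
  "sobolev q = {f. L2 f \<and>
     integrable lborel (\<lambda>\<xi>. (1 + \<xi>\<^sup>2) powr q * (cmod (fourier f \<xi>))\<^sup>2)}"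

definition sobolev_norm :: "real \<Rightarrow> (real \<Rightarrow> real) \<Rightarrow> real" where
  "sobolev_norm q f = sqrt (\<integral>\<xi>. (1 + \<xi>\<^sup>2) powr q * (cmod (fourier f \<xi>))\<^sup>2 \<partial>lborel)"

definition pair_norm :: "real \<Rightarrow> (real \<Rightarrow> real) \<Rightarrow> (real \<Rightarrow> real) \<Rightarrow> real" where
  "pair_norm q f g = sobolev_norm q f + sobolev_norm (q - 2) g"

definition data_ball :: "real \<Rightarrow> real \<Rightarrow> ((real \<Rightarrow> real) \<times> (real \<Rightarrow> real)) set" where
  "data_ball s h = {(f, g). f \<in> sobolev s \<and> g \<in> sobolev (s - 2) \<and> pair_norm s f g \<le> h}"


section \<open>Spatial operators\<close>

definition test_function :: "(real \<Rightarrow> real) \<Rightarrow> bool" where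
  "test_function \<phi> \<longleftrightarrow>
     (\<forall>k x. (deriv ^^ k) \<phi> differentiable (at x)) \<and> (\<exists>R. \<forall>x. \<bar>x\<bar> > R \<longrightarrow> \<phi> x = 0)"

text \<open>The distributional derivative, for functions whose derivative is again in \<open>L\<^sup>2\<close>.\<close>

definition weak_deriv :: "(real \<Rightarrow> real) \<Rightarrow> real \<Rightarrow> real" where
  "weak_deriv f = (SOME g. L2 g \<and>
     (\<forall>\<phi>. test_function \<phi> \<longrightarrow>
        (\<integral>x. f x * deriv \<phi> x \<partial>lborel) = - (\<integral>x. g x * \<phi> x \<partial>lborel)))"

text \<open>The operator \<open>\<Lambda>\<^bsup>-4\<^esup> = (1 - \<partial>\<^sub>x\<^sup>2)\<^bsup>-2\<^esup>\<close>, a Fourier multiplier.\<close>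

definition Lambda_inv4 :: "(real \<Rightarrow> real) \<Rightarrow> real \<Rightarrow> real" where
  "Lambda_inv4 f = (SOME g. L2 g \<and>
     (AE \<xi> in lborel. fourier g \<xi> = fourier f \<xi> / complex_of_real ((1 + \<xi>\<^sup>2)\<^sup>2)))"


section \<open>Curves in Sobolev spaces\<close>

text \<open>A function of time and space is a curve \<open>t \<mapsto> f t\<close>; its values outside \<open>I\<close> are irrelevant.\<close>

definition sobolev_C :: "real \<Rightarrow> real set \<Rightarrow> (real \<Rightarrow> real \<Rightarrow> real) \<Rightarrow> bool" where
  "sobolev_C q I f \<longleftrightarrow> (\<forall>t\<in>I. f t \<in> sobolev q) \<and>
     (\<forall>t\<in>I. ((\<lambda>\<tau>. sobolev_norm q (\<lambda>x. f \<tau> x - f t x)) \<longlongrightarrow> 0) (at t within I))"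

text \<open>\<open>f\<close> is continuously differentiable in \<open>H\<^sup>q\<close> on \<open>I\<close> with time derivative \<open>f'\<close>.\<close>

definition sobolev_C1 ::
  "real \<Rightarrow> real set \<Rightarrow> (real \<Rightarrow> real \<Rightarrow> real) \<Rightarrow> (real \<Rightarrow> real \<Rightarrow> real) \<Rightarrow> bool" where
  "sobolev_C1 q I f f' \<longleftrightarrow> sobolev_C q I f \<and> sobolev_C q I f' \<and>
     (\<forall>t\<in>I. ((\<lambda>\<tau>. sobolev_norm q (\<lambda>x. (f \<tau> x - f t x) / (\<tau> - t) - f' t x)) \<longlongrightarrow> 0)
              (at t within I))"

text \<open>
  The norm of \<open>C([0,T]; H\<^sup>q \<times> H\<^bsup>q-2\<^esup>)\<close>; meaningful for pairs that are continuous in this sense,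
  for which the supremum is that of a bounded set.
\<close>

definition C_pair_norm ::
  "real \<Rightarrow> real \<Rightarrow> (real \<Rightarrow> real \<Rightarrow> real) \<Rightarrow> (real \<Rightarrow> real \<Rightarrow> real) \<Rightarrow> real" where
  "C_pair_norm q T f g = (SUP t\<in>{0..T}. pair_norm q (f t) (g t))"


section \<open>The Cauchy problem\<close>

definition nonlocal_term ::
  "real \<Rightarrow> real \<Rightarrow> real \<Rightarrow> (real \<Rightarrow> real) \<Rightarrow> (real \<Rightarrow> real) \<Rightarrow> real \<Rightarrow> real" where
  "nonlocal_term b \<kappa> \<alpha> v \<eta> = weak_deriv (Lambda_inv4 (\<lambda>x.
     let v1 = weak_deriv v; v2 = weak_deriv v1; v3 = weak_deriv v2 in
       b / 2 * (v x)\<^sup>2 + (3 - b) * (v1 x)\<^sup>2 - (b + 5) / 2 * (v2 x)\<^sup>2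
       + (b - 5) * (v1 x * v3 x) + \<kappa> / 2 * (\<eta> x)\<^sup>2 - \<alpha> * v x))"

text \<open>
  Solutions on \<open>[0,T)\<close> in \<open>C([0,T); H\<^sup>s \<times> H\<^bsup>s-2\<^esup>) \<inter> C\<^sup>1([0,T); H\<^bsup>s-1\<^esup> \<times> H\<^bsup>s-3\<^esup>)\<close>,
  where \<open>T\<close> may be infinite.
\<close>

definition CH_solution ::
  "real \<Rightarrow> real \<Rightarrow> real \<Rightarrow> real \<Rightarrow> (real \<Rightarrow> real) \<Rightarrow> (real \<Rightarrow> real) \<Rightarrow> ereal \<Rightarrow>
   (real \<Rightarrow> real \<Rightarrow> real) \<Rightarrow> (real \<Rightarrow> real \<Rightarrow> real) \<Rightarrow> bool" where
  "CH_solution b \<kappa> \<alpha> s u0 \<rho>0 T u \<rho> \<longleftrightarrow> 0 < T \<and>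
     (let I = {t. 0 \<le> t \<and> ereal t < T} in
        sobolev_C s I u \<and> sobolev_C (s - 2) I \<rho> \<and>
        (\<exists>ut \<rho>t. sobolev_C1 (s - 1) I u ut \<and> sobolev_C1 (s - 3) I \<rho> \<rho>t \<and>
           (\<forall>t. 0 < t \<and> ereal t < T \<longrightarrow>
              (AE x in lborel.
                 ut t x + u t x * weak_deriv (u t) x + nonlocal_term b \<kappa> \<alpha> (u t) (\<rho> t) x = 0) \<and>
              (AE x in lborel.
                 \<rho>t t x + u t x * weak_deriv (\<rho> t) x
                 + (b - 1) * weak_deriv (u t) x * \<rho> t x = 0)))) \<and>
     (AE x in lborel. u 0 x = u0 x) \<and> (AE x in lborel. \<rho> 0 x = \<rho>0 x)"

text \<open>
  The solution with data \<open>(u0, \<rho>0)\<close>, together with its maximal existence time \<open>T\<close>.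
\<close>

definition CH_maximal_solution ::
  "real \<Rightarrow> real \<Rightarrow> real \<Rightarrow> real \<Rightarrow> (real \<Rightarrow> real) \<Rightarrow> (real \<Rightarrow> real) \<Rightarrow> ereal \<Rightarrow>
   (real \<Rightarrow> real \<Rightarrow> real) \<Rightarrow> (real \<Rightarrow> real \<Rightarrow> real) \<Rightarrow> bool" where
  "CH_maximal_solution b \<kappa> \<alpha> s u0 \<rho>0 T u \<rho> \<longleftrightarrow> CH_solution b \<kappa> \<alpha> s u0 \<rho>0 T u \<rho> \<and>
     (\<forall>T' u' \<rho>'. CH_solution b \<kappa> \<alpha> s u0 \<rho>0 T' u' \<rho>' \<longrightarrow> T' \<le> T)"


section \<open>Lifespan and Hoelder exponent\<close>

definition lifespan_bound :: "real \<Rightarrow> real \<Rightarrow> (real \<Rightarrow> real) \<Rightarrow> (real \<Rightarrow> real) \<Rightarrow> real" where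
  "lifespan_bound cs s u0 \<rho>0 = 1 / (2 * cs) * ln (1 + 1 / pair_norm s u0 \<rho>0)"

text \<open>
  For data of norm zero the formula for \<open>T\<^sub>0\<close> reads as \<open>\<infinity>\<close>, whereas \<open>1 / 0 = 0\<close> in HOL.
\<close>

definition lifespan :: "real \<Rightarrow> real \<Rightarrow> (real \<Rightarrow> real) \<Rightarrow> (real \<Rightarrow> real) \<Rightarrow> ereal" where
  "lifespan cs s u0 \<rho>0 =
     (if pair_norm s u0 \<rho>0 = 0 then \<infinity> else ereal (lifespan_bound cs s u0 \<rho>0))"

text \<open>
  The constant \<open>c\<^sub>s\<close> for which the lifespan estimate holds. Data of norm zero are left out, since
  the estimate would contain the product of \<open>\<infinity>\<close> and \<open>0\<close> for them. As the values of \<open>u\<close> and \<open>\<rho>\<close>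
  outside \<open>[0,T)\<close> are arbitrary, the bound on the closed interval \<open>[0,T\<^sub>0]\<close> entails \<open>T\<^sub>0 < T\<close>.
\<close>

definition lifespan_constant :: "real \<Rightarrow> real \<Rightarrow> real \<Rightarrow> real \<Rightarrow> real \<Rightarrow> bool" where
  "lifespan_constant b \<kappa> \<alpha> s cs \<longleftrightarrow> 0 < cs \<and>
     (\<forall>u0 \<rho>0 T u \<rho>.
        u0 \<in> sobolev s \<and> \<rho>0 \<in> sobolev (s - 2) \<and> pair_norm s u0 \<rho>0 \<noteq> 0 \<and>
        CH_maximal_solution b \<kappa> \<alpha> s u0 \<rho>0 T u \<rho> \<longrightarrow>
        ereal (lifespan_bound cs s u0 \<rho>0) \<le> T \<and>
        (\<forall>t\<in>{0..lifespan_bound cs s u0 \<rho>0}.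
           pair_norm s (u t) (\<rho> t)
             \<le> 2 * exp (cs * lifespan_bound cs s u0 \<rho>0) * pair_norm s u0 \<rho>0))"

text \<open>
  For \<open>s > 7/2\<close> and \<open>1 \<le> r < s\<close> the last branch is exactly the range \<open>s - 1 < r < s\<close>. The first
  two ranges meet where \<open>r + s = 5\<close>, and there both values are \<open>1\<close>.
\<close>

definition holder_exponent :: "real \<Rightarrow> real \<Rightarrow> real" where
  "holder_exponent s r =
     (if 1 \<le> r \<and> r \<le> s - 1 \<and> s + r \<ge> 5 then 1
      else if 7 / 2 < s \<and> s < 4 \<and> 1 \<le> r \<and> r \<le> 5 - s then (2 * s - 5) / (s - r)
      else s - r)"

end

theory Submission
  imports Defs "HOL-Probability.Probability"
begin

text \<open>
  The difference of two solutions solves a linear system whose coefficients are the solutions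
  themselves, and these stay bounded in \<open>H\<^sup>s \<times> H\<^bsup>s-2\<^esup>\<close> up to the common time
  (\<open>lifespan_a_priori_bound\<close>). For \<open>1 \<le> r \<le> s - 1\<close> the time derivatives lie in
  \<open>H\<^bsup>s-1\<^esup> \<times> H\<^bsup>s-3\<^esup> \<subseteq> H\<^sup>r \<times> H\<^bsup>r-2\<^esup>\<close>, so the squared \<open>H\<^sup>r \<times> H\<^bsup>r-2\<^esup>\<close> norm of the
  difference is differentiable in time. Its derivative is at most a multiple of itself
  (\<open>energy_estimate\<close>), and Gronwall's lemma makes the solution map Lipschitz
  (\<open>lipschitz_estimate\<close>).

  Three kinds of terms occur in the energy estimate. The transport terms pair \<open>u w\<^sub>x\<close> with \<open>w\<close> and
  seem to lose a derivative; symmetrising the double integral over frequencies recovers it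
  (\<open>transport_estimate\<close>). The remaining products are bounded by distributing the frequency weight
  over the factors and applying Young's inequality to the convolution of the transforms
  (\<open>sobolev_mult\<close>). The nonlocal operator gains three derivatives, so the products inside it need to
  be bounded only in \<open>H\<^bsup>r-3\<^esup>\<close>, the space that contains the third derivative of the difference.

  All three exponents follow. Distances within the ball of data are bounded, so a Lipschitz map is
  Hoelder continuous with every exponent in \<open>(0,1]\<close>; the exponent \<open>(2s - 5) / (s - r)\<close> of the
  second range is at most \<open>1\<close> because \<open>r \<le> 5 - s\<close> there. For \<open>s - 1 < r < s\<close> one interpolates
  between \<open>H\<^bsup>s-1\<^esup>\<close>, where the distance is controlled by the Lipschitz estimate, and \<open>H\<^sup>s\<close>, where
  it is bounded; the resulting exponent is \<open>s - r\<close>.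

  All estimates are made on the Fourier side. The analysis that this takes is built from
  Gaussian damping: Plancherel's identity (\<open>ft1_isometry\<close>), inversion (\<open>F_F_inv\<close>), the weak
  derivative as multiplication by \<open>\<i>\<xi>\<close> (\<open>weak_deriv_fourier\<close>) and the product as a convolution
  (\<open>fourier_mult\<close>).
\<close>

section \<open>Square integrable functions\<close>

definition l2n :: "(real \<Rightarrow> 'a::{real_normed_vector, second_countable_topology}) \<Rightarrow> real" where
  "l2n f = sqrt (\<integral>x. (norm (f x))\<^sup>2 \<partial>lborel)"

lemma L2_measurable [measurable_dest]: "L2 f \<Longrightarrow> f \<in> borel_measurable borel"
  by (simp add: L2_def)

lemma L2_integrable: "L2 f \<Longrightarrow> integrable lborel (\<lambda>x. (norm (f x))\<^sup>2)"
  by (simp add: L2_def)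

lemma L2_I: "f \<in> borel_measurable borel \<Longrightarrow> integrable lborel (\<lambda>x. (norm (f x))\<^sup>2) \<Longrightarrow> L2 f"
  by (simp add: L2_def)

lemma l2n_nonneg [simp]: "0 \<le> l2n f"
  by (simp add: l2n_def)

lemma l2n_sq: "(l2n f)\<^sup>2 = (\<integral>x. (norm (f x))\<^sup>2 \<partial>lborel)"
  by (simp add: l2n_def)

lemma L2_bound:
  assumes "L2 g" "f \<in> borel_measurable borel" "AE x in lborel. norm (f x) \<le> K * norm (g x)"
  shows "L2 f"
proof (rule L2_I)
  show "integrable lborel (\<lambda>x. (norm (f x))\<^sup>2)"
  proof (rule Bochner_Integration.integrable_bound)
    show "integrable lborel (\<lambda>x. K\<^sup>2 * (norm (g x))\<^sup>2)"
      using L2_integrable[OF assms(1)] by simp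
    show "AE x in lborel. norm ((norm (f x))\<^sup>2) \<le> norm (K\<^sup>2 * (norm (g x))\<^sup>2)"
      using assms(3)
    proof eventually_elim
      case (elim x)
      have "(norm (f x))\<^sup>2 \<le> (K * norm (g x))\<^sup>2"
        using elim by (intro power_mono) auto
      then show ?case by (simp add: power_mult_distrib)
    qed
  qed (use assms in measurable)
qed fact

lemma L2_zero [simp]: "L2 (\<lambda>x. 0)" by (simp add: L2_def)

lemma L2_add:
  assumes "L2 f" "L2 g" shows "L2 (\<lambda>x. f x + g x)"
proof (rule L2_I)
  note [measurable] = L2_measurable[OF assms(1)] L2_measurable[OF assms(2)]
  show "(\<lambda>x. f x + g x) \<in> borel_measurable borel" by measurable
  show "integrable lborel (\<lambda>x. (norm (f x + g x))\<^sup>2)"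
  proof (rule Bochner_Integration.integrable_bound)
    show "integrable lborel (\<lambda>x. 2 * (norm (f x))\<^sup>2 + 2 * (norm (g x))\<^sup>2)"
      using assms[THEN L2_integrable] by simp
    have "(norm (f x + g x))\<^sup>2 \<le> 2 * (norm (f x))\<^sup>2 + 2 * (norm (g x))\<^sup>2" for x
    proof -
      have "(norm (f x + g x))\<^sup>2 \<le> (norm (f x) + norm (g x))\<^sup>2"
        by (intro power_mono norm_triangle_ineq) auto
      also have "\<dots> \<le> 2 * (norm (f x))\<^sup>2 + 2 * (norm (g x))\<^sup>2"
        using sum_squares_bound[of "norm (f x)" "norm (g x)"] by (simp add: power2_sum)
      finally show ?thesis .
    qed
    then show "AE x in lborel. norm ((norm (f x + g x))\<^sup>2) \<le> norm (2 * (norm (f x))\<^sup>2 + 2 * (norm (g x))\<^sup>2)"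
      by (intro AE_I2) (auto simp: abs_of_nonneg)
  qed measurable
qed

lemma L2_minus: assumes "L2 f" shows "L2 (\<lambda>x. - f x)"
  using assms by (auto simp: L2_def)

lemma L2_diff: "L2 f \<Longrightarrow> L2 g \<Longrightarrow> L2 (\<lambda>x. f x - g x)"
  using L2_add[of f "\<lambda>x. - g x"] L2_minus[of g] by simp

lemma L2_cmult: fixes f :: "real \<Rightarrow> 'a::{real_normed_field, second_countable_topology}"
  assumes "L2 f" shows "L2 (\<lambda>x. c * f x)"
  by (rule L2_bound[OF assms, of _ "norm c"]) (use L2_measurable[OF assms] in \<open>auto simp: norm_mult\<close>)

lemma L2_of_real: "L2 f \<Longrightarrow> L2 (\<lambda>x. complex_of_real (f x))"
  by (auto simp: L2_def)

lemma L2_norm: "L2 f \<Longrightarrow> L2 (\<lambda>x. norm (f x))"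
  by (auto simp: L2_def)

lemma borel_measurable_cnj [measurable]: "cnj \<in> borel_measurable borel"
  by (intro borel_measurable_continuous_onI continuous_intros)

lemma L2_cnj: "L2 f \<Longrightarrow> L2 (\<lambda>x. cnj (f x))"
  by (auto simp: L2_def)

lemma L2_cong_AE:
  assumes "L2 f" "g \<in> borel_measurable borel" "AE x in lborel. f x = g x" shows "L2 g"
  by (rule L2_bound[OF assms(1,2), of 1]) (use assms(3) in \<open>auto elim: eventually_mono\<close>)

lemma l2n_cong_AE:
  assumes "f \<in> borel_measurable borel" "g \<in> borel_measurable borel" "AE x in lborel. f x = g x"
  shows "l2n f = l2n g"
  unfolding l2n_def
  by (rule arg_cong[where f = sqrt], rule integral_cong_AE) (use assms in \<open>auto elim: eventually_mono\<close>)

lemma L2_mult_integrable: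
  fixes f g :: "real \<Rightarrow> 'a::{real_normed_field, second_countable_topology, banach}"
  assumes "L2 f" "L2 g" shows "integrable lborel (\<lambda>x. f x * g x)"
proof -
  note [measurable] = L2_measurable[OF assms(1)] L2_measurable[OF assms(2)]
  show ?thesis
  proof (rule Bochner_Integration.integrable_bound)
    show "integrable lborel (\<lambda>x. (norm (f x))\<^sup>2 + (norm (g x))\<^sup>2)"
      using assms[THEN L2_integrable] by simp
    have "norm (f x) * norm (g x) \<le> (norm (f x))\<^sup>2 + (norm (g x))\<^sup>2" for x
    proof -
      have "0 \<le> norm (f x) * norm (g x)" by simp
      then show ?thesis using sum_squares_bound[of "norm (f x)" "norm (g x)"] by linarith
    qed
    then show "AE x in lborel. norm (f x * g x) \<le> norm ((norm (f x))\<^sup>2 + (norm (g x))\<^sup>2)"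
      by (intro AE_I2) (auto simp: norm_mult)
  qed measurable
qed

lemma l2n_eq_0D:
  assumes "L2 f" "l2n f = 0" shows "AE x in lborel. f x = 0"
proof -
  have "(\<integral>x. (norm (f x))\<^sup>2 \<partial>lborel) = 0" using l2n_sq[of f] assms(2) by simp
  then have "AE x in lborel. (norm (f x))\<^sup>2 = 0"
    using integral_nonneg_eq_0_iff_AE[OF L2_integrable[OF assms(1)]] by simp
  then show ?thesis by (auto elim: eventually_mono)
qed

text \<open>The Cauchy-Schwarz inequality, from \<open>2pq \<le> tp\<^sup>2 + q\<^sup>2/t\<close> with the optimal \<open>t\<close>.\<close>

lemma l2n_Cauchy_Schwarz_norm:
  fixes f g :: "real \<Rightarrow> 'a::{real_normed_field, second_countable_topology, banach}"
  assumes f: "L2 f" and g: "L2 g"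
  shows "(\<integral>x. norm (f x) * norm (g x) \<partial>lborel) \<le> l2n f * l2n g"
proof (cases "l2n f = 0 \<or> l2n g = 0")
  case True
  then have "AE x in lborel. norm (f x) * norm (g x) = 0"
    using l2n_eq_0D[OF f] l2n_eq_0D[OF g] by (auto elim: eventually_mono)
  then have "(\<integral>x. norm (f x) * norm (g x) \<partial>lborel) = 0"
    by (rule integral_eq_zero_AE)
  then show ?thesis by simp
next
  case False
  define a b where "a = l2n f" and "b = l2n g"
  have ab: "a > 0" "b > 0" using False l2n_nonneg[of f] l2n_nonneg[of g] unfolding a_def b_def by linarith+
  have int: "integrable lborel (\<lambda>x. norm (f x) * norm (g x))"
    using L2_mult_integrable[OF L2_norm[OF f] L2_norm[OF g]] by simp
  have pt: "2 * (norm (f x) * norm (g x)) \<le> (b/a) * (norm (f x))\<^sup>2 + (a/b) * (norm (g x))\<^sup>2" for x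
  proof -
    have "0 \<le> (b * norm (f x) - a * norm (g x))\<^sup>2 / (a * b)" using ab by simp
    also have "\<dots> = (b/a) * (norm (f x))\<^sup>2 + (a/b) * (norm (g x))\<^sup>2 - 2 * (norm (f x) * norm (g x))"
      using ab by (simp add: field_simps power2_eq_square)
    finally show ?thesis by simp
  qed
  have "2 * (\<integral>x. norm (f x) * norm (g x) \<partial>lborel) = (\<integral>x. 2 * (norm (f x) * norm (g x)) \<partial>lborel)"
    by simp
  also have "\<dots> \<le> (\<integral>x. (b/a) * (norm (f x))\<^sup>2 + (a/b) * (norm (g x))\<^sup>2 \<partial>lborel)"
    using int L2_integrable[OF f] L2_integrable[OF g] pt by (intro integral_mono) auto
  also have "\<dots> = (b/a) * a\<^sup>2 + (a/b) * b\<^sup>2"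
    using L2_integrable[OF f] L2_integrable[OF g] by (simp add: l2n_sq a_def b_def)
  also have "\<dots> = 2 * (a * b)" using ab by (simp add: field_simps power2_eq_square)
  finally show ?thesis by (simp add: a_def b_def)
qed

lemma l2n_Cauchy_Schwarz:
  fixes f g :: "real \<Rightarrow> 'a::{real_normed_field, second_countable_topology, banach}"
  assumes "L2 f" "L2 g"
  shows "norm (\<integral>x. f x * g x \<partial>lborel) \<le> l2n f * l2n g"
proof -
  have "norm (\<integral>x. f x * g x \<partial>lborel) \<le> (\<integral>x. norm (f x * g x) \<partial>lborel)"
    by (rule integral_norm_bound)
  also have "\<dots> = (\<integral>x. norm (f x) * norm (g x) \<partial>lborel)" by (simp add: norm_mult)
  finally show ?thesis using l2n_Cauchy_Schwarz_norm[OF assms] by linarith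
qed

lemma l2n_mono:
  assumes "L2 g" "f \<in> borel_measurable borel" "AE x in lborel. norm (f x) \<le> K * norm (g x)" "0 \<le> K"
  shows "l2n f \<le> K * l2n g"
proof -
  have "(l2n f)\<^sup>2 \<le> (\<integral>x. K\<^sup>2 * (norm (g x))\<^sup>2 \<partial>lborel)"
    unfolding l2n_sq
  proof (rule integral_mono_AE)
    show "integrable lborel (\<lambda>x. (norm (f x))\<^sup>2)" using L2_bound[OF assms(1-3)] by (rule L2_integrable)
    show "integrable lborel (\<lambda>x. K\<^sup>2 * (norm (g x))\<^sup>2)" using L2_integrable[OF assms(1)] by simp
    show "AE x in lborel. (norm (f x))\<^sup>2 \<le> K\<^sup>2 * (norm (g x))\<^sup>2"
      using assms(3)
    proof eventually_elim
      case (elim x) then show ?case using power_mono[of "norm (f x)" "K * norm (g x)" 2]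
        by (simp add: power_mult_distrib)
    qed
  qed
  also have "\<dots> = (K * l2n g)\<^sup>2" by (simp add: l2n_sq power_mult_distrib)
  finally show ?thesis using assms(4) by (rule_tac power2_le_imp_le) auto
qed

lemma l2n_norm [simp]: "l2n (\<lambda>x. norm (f x)) = l2n f"
  by (simp add: l2n_def)

lemma l2n_triangle:
  assumes f: "L2 f" and g: "L2 g"
  shows "l2n (\<lambda>x. f x + g x) \<le> l2n f + l2n g"
proof -
  note [measurable] = L2_measurable[OF f] L2_measurable[OF g]
  have i: "integrable lborel (\<lambda>x. norm (f x) * norm (g x))"
    using L2_mult_integrable[OF L2_norm[OF f] L2_norm[OF g]] by simp
  have "(l2n (\<lambda>x. f x + g x))\<^sup>2 \<le> (\<integral>x. (norm (f x))\<^sup>2 + 2 * (norm (f x) * norm (g x)) + (norm (g x))\<^sup>2 \<partial>lborel)"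
    unfolding l2n_sq
  proof (rule integral_mono)
    show "integrable lborel (\<lambda>x. (norm (f x + g x))\<^sup>2)" using L2_add[OF f g] by (rule L2_integrable)
    show "integrable lborel (\<lambda>x. (norm (f x))\<^sup>2 + 2 * (norm (f x) * norm (g x)) + (norm (g x))\<^sup>2)"
      using i L2_integrable[OF f] L2_integrable[OF g] by simp
    show "(norm (f x + g x))\<^sup>2 \<le> (norm (f x))\<^sup>2 + 2 * (norm (f x) * norm (g x)) + (norm (g x))\<^sup>2" for x
      using power_mono[OF norm_triangle_ineq[of "f x" "g x"], of 2] by (simp add: power2_sum)
  qed
  also have "\<dots> = (l2n f)\<^sup>2 + 2 * (\<integral>x. norm (f x) * norm (g x) \<partial>lborel) + (l2n g)\<^sup>2"
    using i L2_integrable[OF f] L2_integrable[OF g] by (simp add: l2n_sq)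
  also have "\<dots> \<le> (l2n f)\<^sup>2 + 2 * (l2n f * l2n g) + (l2n g)\<^sup>2"
    using l2n_Cauchy_Schwarz_norm[OF L2_norm[OF f] L2_norm[OF g]] by simp
  also have "\<dots> = (l2n f + l2n g)\<^sup>2" by (simp add: power2_sum)
  finally show ?thesis by (rule power2_le_imp_le) simp
qed

lemma l2n_cmult: "l2n (\<lambda>x. c * f x) = norm c * l2n f" for f :: "real \<Rightarrow> 'a::{real_normed_field, second_countable_topology}"
proof -
  have "(\<integral>x. (norm (c * f x))\<^sup>2 \<partial>lborel) = (norm c)\<^sup>2 * (\<integral>x. (norm (f x))\<^sup>2 \<partial>lborel)"
    by (simp add: norm_mult power_mult_distrib)
  then show ?thesis by (simp add: l2n_def real_sqrt_mult)
qed

lemma l2n_diff_commute: "l2n (\<lambda>x. f x - g x) = l2n (\<lambda>x. g x - f x)"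
  by (simp add: l2n_def norm_minus_commute)

lemma l2n_triangle_diff:
  assumes "L2 f" "L2 g" "L2 h"
  shows "l2n (\<lambda>x. f x - h x) \<le> l2n (\<lambda>x. f x - g x) + l2n (\<lambda>x. g x - h x)"
  using l2n_triangle[OF L2_diff[OF assms(1,2)] L2_diff[OF assms(2,3)]] by simp

lemma l2n_reverse_triangle:
  assumes "L2 f" "L2 g"
  shows "\<bar>l2n f - l2n g\<bar> \<le> l2n (\<lambda>x. f x - g x)"
  using l2n_triangle[OF L2_diff[OF assms] assms(2)] l2n_triangle[OF L2_diff[OF assms(2,1)] assms(1)]
    l2n_diff_commute[of f g] by simp

lemma l2n_nn_integral: "L2 f \<Longrightarrow> (\<integral>\<^sup>+x. ennreal ((norm (f x))\<^sup>2) \<partial>lborel) = ennreal ((l2n f)\<^sup>2)"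
  unfolding l2n_sq by (rule nn_integral_eq_integral) (auto simp: L2_integrable)

lemma L2_from_nn_integral:
  assumes "f \<in> borel_measurable borel" "(\<integral>\<^sup>+x. ennreal ((norm (f x))\<^sup>2) \<partial>lborel) \<le> ennreal (C\<^sup>2)" "0 \<le> C"
  shows "L2 f" "l2n f \<le> C"
proof -
  have "(\<integral>\<^sup>+x. ennreal ((norm (f x))\<^sup>2) \<partial>lborel) < \<infinity>"
    using assms(2) by (simp add: le_less_trans)
  then show L: "L2 f" using assms(1) by (auto simp: L2_def integrable_iff_bounded)
  have "ennreal ((l2n f)\<^sup>2) \<le> ennreal (C\<^sup>2)" using assms(2) l2n_nn_integral[OF L] by simp
  then show "l2n f \<le> C" using assms(3) by (auto intro: power2_le_imp_le)
qed

lemma l2n_tendsto_0_iff_nn: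
  assumes "\<And>n::nat. L2 (f n)"
  shows "(\<lambda>n. \<integral>\<^sup>+x. ennreal ((norm (f n x))\<^sup>2) \<partial>lborel) \<longlonglongrightarrow> 0 \<longleftrightarrow> (\<lambda>n. l2n (f n)) \<longlonglongrightarrow> 0"
proof -
  have "(\<lambda>n. \<integral>\<^sup>+x. ennreal ((norm (f n x))\<^sup>2) \<partial>lborel) = (\<lambda>n. ennreal ((l2n (f n))\<^sup>2))"
    using l2n_nn_integral[OF assms] by auto
  moreover have "(\<lambda>n. ennreal ((l2n (f n))\<^sup>2)) \<longlonglongrightarrow> 0 \<longleftrightarrow> (\<lambda>n. (l2n (f n))\<^sup>2) \<longlonglongrightarrow> 0"
    using tendsto_ennreal_iff[of "\<lambda>n. (l2n (f n))\<^sup>2" sequentially 0] by simp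
  moreover have "(\<lambda>n. (l2n (f n))\<^sup>2) \<longlonglongrightarrow> 0 \<longleftrightarrow> (\<lambda>n. l2n (f n)) \<longlonglongrightarrow> 0"
  proof
    assume "(\<lambda>n. (l2n (f n))\<^sup>2) \<longlonglongrightarrow> 0"
    from tendsto_real_sqrt[OF this] show "(\<lambda>n. l2n (f n)) \<longlonglongrightarrow> 0" by simp
  next
    assume "(\<lambda>n. l2n (f n)) \<longlonglongrightarrow> 0"
    from tendsto_power[OF this, of 2] show "(\<lambda>n. (l2n (f n))\<^sup>2) \<longlonglongrightarrow> 0" by simp
  qed
  ultimately show ?thesis by simp
qed

lemma l2n_Fatou:
  fixes f :: "nat \<Rightarrow> real \<Rightarrow> 'a::{real_normed_vector, second_countable_topology}"
  assumes f: "\<And>n. L2 (f n)" and g: "g \<in> borel_measurable borel"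
    and lim: "AE x in lborel. (\<lambda>n. f n x) \<longlonglongrightarrow> g x"
    and C: "\<And>n. l2n (f n) \<le> C"
  shows "L2 g \<and> l2n g \<le> C"
proof -
  have C0: "0 \<le> C" using C[of 0] l2n_nonneg[of "f 0"] by linarith
  note [measurable] = L2_measurable[OF f] g
  have "(\<integral>\<^sup>+x. ennreal ((norm (g x))\<^sup>2) \<partial>lborel) = (\<integral>\<^sup>+x. liminf (\<lambda>n. ennreal ((norm (f n x))\<^sup>2)) \<partial>lborel)"
  proof (rule nn_integral_cong_AE, use lim in eventually_elim)
    case (elim x)
    then have "(\<lambda>n. ennreal ((norm (f n x))\<^sup>2)) \<longlonglongrightarrow> ennreal ((norm (g x))\<^sup>2)"
      by (intro tendsto_ennrealI tendsto_intros)
    from lim_imp_Liminf[OF _ this] show ?case by simp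
  qed
  also have "\<dots> \<le> liminf (\<lambda>n. \<integral>\<^sup>+x. ennreal ((norm (f n x))\<^sup>2) \<partial>lborel)"
    by (rule nn_integral_liminf) measurable
  also have "\<dots> \<le> liminf (\<lambda>n. ennreal (C\<^sup>2))"
  proof (rule Liminf_mono, rule always_eventually, rule allI)
    fix n show "(\<integral>\<^sup>+x. ennreal ((norm (f n x))\<^sup>2) \<partial>lborel) \<le> ennreal (C\<^sup>2)"
      using l2n_nn_integral[OF f[of n]] C[of n] by (simp add: power_mono)
  qed
  also have "\<dots> = ennreal (C\<^sup>2)" by (simp add: Liminf_const)
  finally show "L2 g \<and> l2n g \<le> C" using L2_from_nn_integral[OF g _ C0] by auto
qed

text \<open>
  An \<open>L\<^sup>2\<close> limit and a pointwise limit of the same sequence agree, by Fatou's lemma applied to the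
  differences.
\<close>

lemma l2n_limit_AE_eq:
  fixes f :: "nat \<Rightarrow> real \<Rightarrow> 'a::{real_normed_vector, second_countable_topology}"
  assumes f: "\<And>n. L2 (f n)" and h: "L2 h" and g: "g \<in> borel_measurable borel"
    and lim: "AE x in lborel. (\<lambda>n. f n x) \<longlonglongrightarrow> g x"
    and conv: "(\<lambda>n. l2n (\<lambda>x. f n x - h x)) \<longlonglongrightarrow> 0"
  shows "AE x in lborel. g x = h x"
proof -
  have *: "L2 (\<lambda>x. g x - h x) \<and> l2n (\<lambda>x. g x - h x) \<le> e" if e: "e > 0" for e
  proof -
    from conv e obtain N where N: "\<And>n. n \<ge> N \<Longrightarrow> l2n (\<lambda>x. f n x - h x) < e"
      by (auto simp: lim_sequentially dist_real_def)
    show ?thesis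
    proof (rule l2n_Fatou[where f = "\<lambda>n x. f (n + N) x - h x"])
      show "AE x in lborel. (\<lambda>n. f (n + N) x - h x) \<longlonglongrightarrow> g x - h x"
        using lim by eventually_elim (intro tendsto_intros LIMSEQ_ignore_initial_segment)
      show "l2n (\<lambda>x. f (n + N) x - h x) \<le> e" for n using N[of "n + N"] by simp
    qed (use f h g in \<open>auto intro!: L2_diff simp: L2_measurable\<close>)
  qed
  have "l2n (\<lambda>x. g x - h x) \<le> 0" by (rule field_le_epsilon) (use * in auto)
  then have "l2n (\<lambda>x. g x - h x) = 0" using l2n_nonneg[of "\<lambda>x. g x - h x"] by linarith
  from l2n_eq_0D[OF _ this] *[of 1] show ?thesis by (auto elim: eventually_mono)
qed

text \<open>
  Along a subsequence with increments \<open>d\<^sub>k\<close> of squared norm at most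
  \<open>16\<^bsup>-k\<^esup>\<close> the sum of \<open>4\<^bsup>k\<^esup>d\<^sub>k\<^sup>2\<close> is integrable, hence finite almost everywhere; there
  \<open>d\<^sub>k\<close> is dominated by a geometric sequence, and the subsequence converges pointwise.
\<close>

lemma L2_complete:
  fixes f :: "nat \<Rightarrow> real \<Rightarrow> complex"
  assumes f: "\<And>n. L2 (f n)"
    and cauchy: "\<And>e. e > 0 \<Longrightarrow> \<exists>N. \<forall>m\<ge>N. \<forall>n\<ge>N. l2n (\<lambda>x. f m x - f n x) < e"
  shows "\<exists>g. L2 g \<and> (\<lambda>n. l2n (\<lambda>x. f n x - g x)) \<longlonglongrightarrow> 0"
proof -
  note [measurable] = L2_measurable[OF f]
  obtain N where N: "\<And>k m n. m \<ge> N k \<Longrightarrow> n \<ge> N k \<Longrightarrow> l2n (\<lambda>x. f m x - f n x) < (1/4)^k"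
    using cauchy[of "(1/4)^_"] by (metis zero_less_divide_1_iff zero_less_numeral zero_less_power)
  \<comment> \<open>the partial sums make \<open>r\<close> exceed all earlier thresholds without assuming that \<open>N\<close> is monotone\<close>
  define r where "r k = (\<Sum>i\<le>k. N i) + k" for k
  have r: "r k \<ge> N k" "r k \<ge> k" for k
    unfolding r_def using member_le_sum[of k "{..k}" N] by auto
  have r': "r (Suc k) \<ge> N k" for k unfolding r_def using member_le_sum[of k "{..Suc k}" N] by simp
  define d where "d k x = f (r (Suc k)) x - f (r k) x" for k x
  have dL: "L2 (d k)" for k unfolding d_def using f by (intro L2_diff)
  note [measurable] = L2_measurable[OF dL]
  have dn: "l2n (d k) \<le> (1/4)^k" for k unfolding d_def using N[OF r'[of k] r(1)[of k]] by simp
  have "(\<integral>\<^sup>+x. (\<Sum>k. ennreal (4^k * (norm (d k x))\<^sup>2)) \<partial>lborel)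
      = (\<Sum>k. \<integral>\<^sup>+x. ennreal (4^k * (norm (d k x))\<^sup>2) \<partial>lborel)"
    by (rule nn_integral_suminf) measurable
  also have "\<dots> \<le> (\<Sum>k. ennreal ((1/4)^k))"
  proof (rule suminf_le)
    fix k
    have "(\<integral>\<^sup>+x. ennreal (4^k * (norm (d k x))\<^sup>2) \<partial>lborel) = ennreal (4^k) * ennreal ((l2n (d k))\<^sup>2)"
      by (simp add: ennreal_mult nn_integral_cmult l2n_nn_integral[OF dL])
    also have "\<dots> = ennreal (4^k * (l2n (d k))\<^sup>2)" by (simp add: ennreal_mult)
    also have "\<dots> \<le> ennreal ((1/4)^k)"
    proof (rule ennreal_leI)
      have "(l2n (d k))\<^sup>2 \<le> ((1/4)^k)\<^sup>2" by (intro power_mono dn) simp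
      then have "4^k * (l2n (d k))\<^sup>2 \<le> 4^k * ((1/4)^k)\<^sup>2" by (intro mult_left_mono) auto
      also have "\<dots> = (1/4)^k" by (simp add: power2_eq_square power_divide field_simps)
      finally show "4^k * (l2n (d k))\<^sup>2 \<le> (1/4)^k" .
    qed
    finally show "(\<integral>\<^sup>+x. ennreal (4^k * (norm (d k x))\<^sup>2) \<partial>lborel) \<le> ennreal ((1/4)^k)" .
  qed auto
  also have "\<dots> < \<infinity>"
    by (subst suminf_ennreal2) (auto intro!: summable_geometric)
  finally have fin: "(\<integral>\<^sup>+x. (\<Sum>k. ennreal (4^k * (norm (d k x))\<^sup>2)) \<partial>lborel) \<noteq> \<infinity>" by simp
  have "AE x in lborel. (\<Sum>k. ennreal (4^k * (norm (d k x))\<^sup>2)) \<noteq> \<infinity>"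
    by (rule nn_integral_PInf_AE[OF _ fin]) measurable
  then have conv: "AE x in lborel. convergent (\<lambda>k. f (r k) x)"
  proof eventually_elim
    case (elim x)
    define S where "S = enn2real (\<Sum>k. ennreal (4^k * (norm (d k x))\<^sup>2))"
    have S: "(\<Sum>k. ennreal (4^k * (norm (d k x))\<^sup>2)) = ennreal S"
      using elim by (simp add: S_def less_top)
    have S0: "0 \<le> S" by (simp add: S_def)
    have b: "4^k * (norm (d k x))\<^sup>2 \<le> S" for k
    proof -
      have "ennreal (4^k * (norm (d k x))\<^sup>2) \<le> (\<Sum>k. ennreal (4^k * (norm (d k x))\<^sup>2))"
      proof -
        have "sum (\<lambda>k. ennreal (4^k * (norm (d k x))\<^sup>2)) {k} \<le> (\<Sum>k. ennreal (4^k * (norm (d k x))\<^sup>2))"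
          by (rule sum_le_suminf) auto
        then show ?thesis by (simp only: sum.insert[OF finite.emptyI] empty_iff not_False_eq_True sum.empty add_0_right)
      qed
      then have "ennreal (4^k * (norm (d k x))\<^sup>2) \<le> ennreal S" by (simp only: S)
      then show ?thesis using S0 by (simp only: ennreal_le_iff)
    qed
    have "norm (d k x) \<le> sqrt S * (1/2)^k" for k
    proof (rule power2_le_imp_le)
      have "(norm (d k x))\<^sup>2 = (1/4)^k * (4^k * (norm (d k x))\<^sup>2)" by (simp add: power_divide)
      also have "\<dots> \<le> (1/4)^k * S" by (intro mult_left_mono b) simp
      also have "\<dots> = (sqrt S * (1/2)^k)\<^sup>2"
      proof -
        have "((1/2::real)^k)\<^sup>2 = (1/4)^k" by (simp add: power2_eq_square flip: power_mult_distrib)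
        moreover have "(sqrt S)\<^sup>2 = S" using S0 by simp
        ultimately show ?thesis by (simp only: power_mult_distrib mult.commute)
      qed
      finally show "(norm (d k x))\<^sup>2 \<le> (sqrt S * (1/2)^k)\<^sup>2" .
    qed (use S0 in simp)
    moreover have "summable (\<lambda>k. sqrt S * (1/2::real)^k)"
      by (rule summable_mult[OF summable_geometric]) simp
    ultimately have "summable (\<lambda>k. d k x)"
      using summable_comparison_test'[of "\<lambda>k. sqrt S * (1/2)^k" 0 "\<lambda>k. d k x"] by blast
    then have "convergent (\<lambda>n. (\<Sum>k<n. d k x))" by (simp only: summable_iff_convergent)
    moreover have "(\<Sum>k<n. d k x) = f (r n) x - f (r 0) x" for n
      by (induction n) (simp_all add: d_def)
    ultimately have "convergent (\<lambda>n. f (r n) x - f (r 0) x)" by (simp only:)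
    from convergent_add[OF this convergent_const[of "f (r 0) x"]]
    show ?case by (simp only: diff_add_cancel)
  qed
  define g where "g x = lim (\<lambda>k. f (r k) x)" for x
  have [measurable]: "g \<in> borel_measurable borel" unfolding g_def by measurable
  have lim: "AE x in lborel. (\<lambda>k. f (r k) x) \<longlonglongrightarrow> g x"
    using conv unfolding g_def by eventually_elim (simp add: convergent_LIMSEQ_iff)
  have close: "L2 (\<lambda>x. f n x - g x) \<and> l2n (\<lambda>x. f n x - g x) \<le> e"
    if "\<forall>m\<ge>M. \<forall>n\<ge>M. l2n (\<lambda>x. f m x - f n x) < e" "n \<ge> M" for M n e
  proof -
    show ?thesis
    proof (rule l2n_Fatou[where f = "\<lambda>k x. f n x - f (r (k + M)) x"])
      show "AE x in lborel. (\<lambda>k. f n x - f (r (k + M)) x) \<longlonglongrightarrow> f n x - g x"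
        using lim by eventually_elim (intro tendsto_intros LIMSEQ_ignore_initial_segment[where f = "\<lambda>k. f (r k) _"])
      show "l2n (\<lambda>x. f n x - f (r (k + M)) x) \<le> e" for k
        using that r(2)[of "k + M"] by (auto intro!: less_imp_le)
    qed (use f in \<open>auto intro!: L2_diff\<close>)
  qed
  obtain M1 where M1: "\<forall>m\<ge>M1. \<forall>n\<ge>M1. l2n (\<lambda>x. f m x - f n x) < 1" using cauchy[of 1] by auto
  have "L2 (\<lambda>x. f M1 x - (f M1 x - g x))" 
    by (rule L2_diff[OF f conjunct1[OF close[OF M1 order.refl]]])
  then have gL: "L2 g" by simp
  moreover have "(\<lambda>n. l2n (\<lambda>x. f n x - g x)) \<longlonglongrightarrow> 0"
  proof (rule LIMSEQ_I)
    fix e :: real assume "e > 0"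
    then obtain M where M: "\<forall>m\<ge>M. \<forall>n\<ge>M. l2n (\<lambda>x. f m x - f n x) < e/2" using cauchy[of "e/2"] by auto
    have "norm (l2n (\<lambda>x. f n x - g x) - 0) < e" if "n \<ge> M" for n
      using close[OF M that] \<open>e > 0\<close> by simp
    then show "\<exists>no. \<forall>n\<ge>no. norm (l2n (\<lambda>x. f n x - g x) - 0) < e" by auto
  qed
  ultimately show ?thesis by blast
qed

section \<open>Plancherel's identity\<close>

text \<open>
  The factor of the unitary normalisation, with which the transform is an isometry and is its own
  inverse up to reflection.
\<close>

definition fc :: real where "fc = 1 / sqrt (2 * pi)"

lemma fc_pos [simp]: "0 < fc" by (simp add: fc_def)

text \<open>
  The classical transform; its values are meaningful for integrable functions.
\<close>

definition ft1 :: "(real \<Rightarrow> complex) \<Rightarrow> real \<Rightarrow> complex" where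
  "ft1 f \<xi> = complex_of_real fc * (\<integral>x. f x * cis (- (x * \<xi>)) \<partial>lborel)"

lemma cis_measurable [measurable]: "cis \<in> borel_measurable borel"
  by (intro borel_measurable_continuous_onI continuous_intros)

lemma ft1_measurable [measurable]:
  assumes [measurable]: "f \<in> borel_measurable borel"
  shows "ft1 f \<in> borel_measurable borel"
  unfolding ft1_def by measurable

lemma integrable_mult_cis:
  fixes f :: "real \<Rightarrow> complex"
  assumes "integrable lborel f" "g \<in> borel_measurable borel"
  shows "integrable lborel (\<lambda>x. f x * cis (g x))"
proof (rule Bochner_Integration.integrable_bound[OF assms(1)])
  have [measurable]: "f \<in> borel_measurable borel" using assms(1) by auto
  show "(\<lambda>x. f x * cis (g x)) \<in> borel_measurable lborel" using assms(2) by measurable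
qed (simp add: norm_mult)

lemma ft1_bound:
  assumes "integrable lborel f"
  shows "cmod (ft1 f \<xi>) \<le> fc * (\<integral>x. cmod (f x) \<partial>lborel)"
proof -
  have "cmod (\<integral>x. f x * cis (- (x * \<xi>)) \<partial>lborel) \<le> (\<integral>x. cmod (f x * cis (- (x * \<xi>))) \<partial>lborel)"
    by (rule integral_norm_bound)
  then show ?thesis
    unfolding ft1_def norm_mult by (intro mult_mono) (auto simp: norm_mult less_imp_le)
qed

lemma ft1_add:
  assumes "integrable lborel f" "integrable lborel g"
  shows "ft1 (\<lambda>x. f x + g x) \<xi> = ft1 f \<xi> + ft1 g \<xi>"
  unfolding ft1_def distrib_right
  by (subst Bochner_Integration.integral_add) (auto intro!: integrable_mult_cis assms simp: distrib_left)

lemma ft1_cmult: "ft1 (\<lambda>x. c * f x) \<xi> = c * ft1 f \<xi>"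
proof -
  have "(\<integral>x. c * f x * cis (- (x * \<xi>)) \<partial>lborel) = c * (\<integral>x. f x * cis (- (x * \<xi>)) \<partial>lborel)"
    unfolding mult.assoc by (rule integral_mult_right_zero)
  then show ?thesis by (simp add: ft1_def)
qed

lemma ft1_diff:
  assumes "integrable lborel f" "integrable lborel g"
  shows "ft1 (\<lambda>x. f x - g x) \<xi> = ft1 f \<xi> - ft1 g \<xi>"
  using ft1_add[OF assms(1), of "\<lambda>x. (-1) * g x" \<xi>] assms(2) ft1_cmult[of "-1" g \<xi>] by simp

lemma integrable_pair_bounded_kernel:
  fixes f g :: "real \<Rightarrow> complex" and K :: "real \<Rightarrow> real \<Rightarrow> complex"
  assumes f: "integrable lborel f" and g: "integrable lborel g"
    and K: "(\<lambda>p. K (fst p) (snd p)) \<in> borel_measurable (borel \<Otimes>\<^sub>M borel)" "\<And>x y. cmod (K x y) \<le> 1"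
  shows "integrable (lborel \<Otimes>\<^sub>M lborel) (\<lambda>(x, y). f x * g y * K x y)"
proof -
  have [measurable]: "f \<in> borel_measurable borel" "g \<in> borel_measurable borel" using f g by auto
  note [measurable] = K(1)
  have int: "integrable (lborel \<Otimes>\<^sub>M lborel) (\<lambda>(x, y). f x * g y)"
  proof (rule lborel_pair.Fubini_integrable)
    show "(\<lambda>(x, y). f x * g y) \<in> borel_measurable (lborel \<Otimes>\<^sub>M lborel)" by measurable
    have "integrable lborel (\<lambda>x. cmod (f x) * (\<integral>y. cmod (g y) \<partial>lborel))"
      using f by simp
    then show "integrable lborel (\<lambda>x. \<integral>y. cmod (case (x, y) of (x, y) \<Rightarrow> f x * g y) \<partial>lborel)"
      by (simp add: norm_mult)
    show "AE x in lborel. integrable lborel (\<lambda>y. case (x, y) of (x, y) \<Rightarrow> f x * g y)"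
      using g by simp
  qed
  show ?thesis
  proof (rule Bochner_Integration.integrable_bound[OF int])
    have "(\<lambda>p. f (fst p) * g (snd p) * K (fst p) (snd p)) \<in> borel_measurable (lborel \<Otimes>\<^sub>M lborel)"
      by measurable
    then show "(\<lambda>(x, y). f x * g y * K x y) \<in> borel_measurable (lborel \<Otimes>\<^sub>M lborel)"
      by (simp add: case_prod_beta')
    show "AE p in lborel \<Otimes>\<^sub>M lborel. cmod (case p of (x, y) \<Rightarrow> f x * g y * K x y) \<le> cmod (case p of (x, y) \<Rightarrow> f x * g y)"
      using K(2) by (intro AE_I2) (auto simp: norm_mult mult_left_le)
  qed
qed

text \<open>The Fourier kernel is symmetric in both variables, so Fubini moves the transform to the other factor.\<close>

lemma ft1_multiplication_formula:
  assumes f: "integrable lborel f" and g: "integrable lborel g"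
  shows "(\<integral>\<xi>. ft1 f \<xi> * g \<xi> \<partial>lborel) = (\<integral>x. f x * ft1 g x \<partial>lborel)"
proof -
  let ?c = "complex_of_real fc"
  have "integrable (lborel \<Otimes>\<^sub>M lborel) (\<lambda>(x, y). f x * g y * cis (- (x * y)))"
    by (rule integrable_pair_bounded_kernel[OF f g]) auto
  then have "(\<integral>y. (\<integral>x. f x * g y * cis (- (x * y)) \<partial>lborel) \<partial>lborel) = (\<integral>x. (\<integral>y. f x * g y * cis (- (x * y)) \<partial>lborel) \<partial>lborel)"
    by (rule lborel_pair.Fubini_integral)
  moreover have "(\<integral>x. f x * g y * cis (- (x * y)) \<partial>lborel) = (\<integral>x. f x * cis (- (x * y)) \<partial>lborel) * g y" for y
  proof -
    have "(\<integral>x. f x * g y * cis (- (x * y)) \<partial>lborel) = (\<integral>x. f x * cis (- (x * y)) * g y \<partial>lborel)"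
      by (simp add: mult_ac)
    also have "\<dots> = (\<integral>x. f x * cis (- (x * y)) \<partial>lborel) * g y" by (rule integral_mult_left_zero)
    finally show ?thesis .
  qed
  moreover have "(\<integral>y. f x * g y * cis (- (x * y)) \<partial>lborel) = f x * (\<integral>y. g y * cis (- (y * x)) \<partial>lborel)" for x
  proof -
    have "(\<integral>y. f x * g y * cis (- (x * y)) \<partial>lborel) = (\<integral>y. f x * (g y * cis (- (y * x))) \<partial>lborel)"
      by (simp add: mult_ac)
    also have "\<dots> = f x * (\<integral>y. g y * cis (- (y * x)) \<partial>lborel)" by (rule integral_mult_right_zero)
    finally show ?thesis .
  qed
  ultimately have *: "(\<integral>y. (\<integral>x. f x * cis (- (x * y)) \<partial>lborel) * g y \<partial>lborel) = (\<integral>x. f x * (\<integral>y. g y * cis (- (y * x)) \<partial>lborel) \<partial>lborel)"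
    by simp
  have "(\<integral>\<xi>. ft1 f \<xi> * g \<xi> \<partial>lborel) = (\<integral>\<xi>. ?c * ((\<integral>x. f x * cis (- (x * \<xi>)) \<partial>lborel) * g \<xi>) \<partial>lborel)"
    unfolding ft1_def by (simp add: mult_ac)
  also have "\<dots> = ?c * (\<integral>\<xi>. (\<integral>x. f x * cis (- (x * \<xi>)) \<partial>lborel) * g \<xi> \<partial>lborel)"
    by (rule integral_mult_right_zero)
  also have "\<dots> = ?c * (\<integral>x. f x * (\<integral>y. g y * cis (- (y * x)) \<partial>lborel) \<partial>lborel)"
    unfolding * ..
  also have "\<dots> = (\<integral>x. ?c * (f x * (\<integral>y. g y * cis (- (y * x)) \<partial>lborel)) \<partial>lborel)"
    by (rule integral_mult_right_zero[symmetric])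
  also have "\<dots> = (\<integral>x. f x * ft1 g x \<partial>lborel)"
    unfolding ft1_def by (simp add: mult_ac)
  finally show ?thesis .
qed

lemma integrable_gaussian:
  "a \<noteq> 0 \<Longrightarrow> integrable lborel (\<lambda>x. exp (- ((a * x)\<^sup>2 / 2)) :: real)"
proof -
  assume a: "a \<noteq> 0"
  have "integrable lborel (\<lambda>x. sqrt (2 * pi) * std_normal_density x)" by simp
  then have "integrable lborel (\<lambda>x. exp (- (x\<^sup>2 / 2)) :: real)"
    by (simp add: std_normal_density_def)
  from lborel_integrable_real_affine[OF this a, of 0] show ?thesis by simp
qed

lemma integrable_gaussian_complex:
  assumes "a \<noteq> 0" shows "integrable lborel (\<lambda>x. complex_of_real (exp (- ((a * x)\<^sup>2 / 2))))"
  using integrable_gaussian[OF assms] by (rule integrable_of_real)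

text \<open>
  The characteristic function of the standard normal distribution, rescaled; the modulation by \<open>y\<close>
  moves the centre of the Gaussian to \<open>y\<close>.
\<close>

lemma ft1_gaussian:
  assumes a: "a > 0"
  shows "ft1 (\<lambda>x. complex_of_real (exp (- ((a * x)\<^sup>2 / 2))) * cis (x * y)) \<xi>
       = complex_of_real (exp (- (((\<xi> - y) / a)\<^sup>2 / 2)) / a)"
proof -
  define t where "t = (y - \<xi>) / a"
  have "char std_normal_distribution t = complex_of_real (exp (- (t^2) / 2))"
    by (simp add: char_std_normal_distribution)
  moreover have "char std_normal_distribution t = (\<integral>x. std_normal_density x *\<^sub>R iexp (t * x) \<partial>lborel)"
    unfolding char_def by (subst integral_density) (auto simp: normal_density_nonneg)
  ultimately have "(\<integral>x. std_normal_density x *\<^sub>R iexp (t * x) \<partial>lborel) = complex_of_real (exp (- (t^2) / 2))" by simp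
  moreover have "(\<integral>x. std_normal_density x *\<^sub>R iexp (t * x) \<partial>lborel)
      = \<bar>a\<bar> *\<^sub>R (\<integral>x. std_normal_density (0 + a * x) *\<^sub>R iexp (t * (0 + a * x)) \<partial>lborel)"
    using a by (intro lborel_integral_real_affine) auto
  moreover have "std_normal_density (0 + a * x) *\<^sub>R iexp (t * (0 + a * x))
     = complex_of_real fc * (complex_of_real (exp (- ((a * x)\<^sup>2 / 2))) * cis (x * y) * cis (- (x * \<xi>)))" for x
  proof -
    have "t * (0 + a * x) = x * y - x * \<xi>" using a by (simp add: t_def field_simps)
    moreover have "iexp (t * (0 + a * x)) = cis (t * (0 + a * x))" by (simp only: cis_conv_exp)
    ultimately have "iexp (t * (0 + a * x)) = cis (x * y) * cis (- (x * \<xi>))"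
      by (simp only: cis_mult) simp
    then show ?thesis by (simp add: std_normal_density_def fc_def scaleR_conv_of_real mult.assoc)
  qed
  ultimately have "a *\<^sub>R (\<integral>x. complex_of_real fc * (complex_of_real (exp (- ((a * x)\<^sup>2 / 2))) * cis (x * y) * cis (- (x * \<xi>))) \<partial>lborel)
      = complex_of_real (exp (- (t^2) / 2))"
    using a by (simp only: abs_of_pos)
  then have "complex_of_real a * ft1 (\<lambda>x. complex_of_real (exp (- ((a * x)\<^sup>2 / 2))) * cis (x * y)) \<xi>
       = complex_of_real (exp (- (t^2) / 2))"
    by (simp only: ft1_def scaleR_conv_of_real integral_mult_right_zero)
  then have "ft1 (\<lambda>x. complex_of_real (exp (- ((a * x)\<^sup>2 / 2))) * cis (x * y)) \<xi> = complex_of_real (exp (- (t^2) / 2) / a)"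
    using a by (simp add: nonzero_eq_divide_eq mult.commute)
  moreover have "t\<^sup>2 = ((\<xi> - y) / a)\<^sup>2" by (simp only: t_def power_divide power2_commute)
  ultimately show ?thesis by (simp only: minus_divide_left)
qed

lemma gaussian_convolution_tendsto:
  fixes f :: "real \<Rightarrow> complex"
  assumes cont: "continuous_on UNIV f" and M: "\<And>x. cmod (f x) \<le> M"
  shows "(\<lambda>n. \<integral>z. std_normal_density z *\<^sub>R f (x + z / real (Suc n)) \<partial>lborel) \<longlonglongrightarrow> f x"
proof -
  have [measurable]: "f \<in> borel_measurable borel" using cont by (rule borel_measurable_continuous_onI)
  have "(\<lambda>n. \<integral>z. std_normal_density z *\<^sub>R f (x + z / real (Suc n)) \<partial>lborel)
        \<longlonglongrightarrow> (\<integral>z. std_normal_density z *\<^sub>R f x \<partial>lborel)"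
  proof (rule integral_dominated_convergence[where w = "\<lambda>z. M * std_normal_density z"])
    show "integrable lborel (\<lambda>z. M * std_normal_density z)" by simp
    show "AE z in lborel. (\<lambda>n. std_normal_density z *\<^sub>R f (x + z / real (Suc n))) \<longlonglongrightarrow> std_normal_density z *\<^sub>R f x"
    proof (rule AE_I2)
      fix z
      have "(\<lambda>n. x + z * inverse (real (Suc n))) \<longlonglongrightarrow> x + z * 0"
        by (intro tendsto_intros LIMSEQ_inverse_real_of_nat)
      then have "(\<lambda>n. x + z / real (Suc n)) \<longlonglongrightarrow> x" by (simp add: divide_inverse)
      from continuous_on_tendsto_compose[OF cont this] have "(\<lambda>n. f (x + z / real (Suc n))) \<longlonglongrightarrow> f x" by simp
      then show "(\<lambda>n. std_normal_density z *\<^sub>R f (x + z / real (Suc n))) \<longlonglongrightarrow> std_normal_density z *\<^sub>R f x"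
        by (intro tendsto_intros)
    qed
    show "AE z in lborel. norm (std_normal_density z *\<^sub>R f (x + z / real (Suc n))) \<le> M * std_normal_density z" for n
    proof (rule AE_I2)
      fix z
      show "norm (std_normal_density z *\<^sub>R f (x + z / real (Suc n))) \<le> M * std_normal_density z"
        using mult_right_mono[OF M[of "x + z / real (Suc n)"] normal_density_nonneg[of 0 1 z]]
        by (simp add: mult.commute)
    qed
  qed measurable
  moreover have "(\<integral>z. std_normal_density z *\<^sub>R f x \<partial>lborel) = f x" by simp
  ultimately show ?thesis by simp
qed

text \<open>
  Damping \<open>\<bar>f^\<bar>\<^sup>2\<close> by a Gaussian \<open>\<gamma>\<close> and moving one transform to the other side turns
  \<open>\<integral>\<gamma>\<bar>f^\<bar>\<^sup>2\<close> into the pairing of \<open>f\<close> with its Gaussian average, which tends to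
  \<open>\<integral>\<bar>f\<bar>\<^sup>2\<close> as the damping is removed.
\<close>

lemma ft1_isometry_continuous:
  fixes f :: "real \<Rightarrow> complex"
  assumes cont: "continuous_on UNIV f" and M: "\<And>x. cmod (f x) \<le> M" and int: "integrable lborel f"
  shows "L2 (ft1 f) \<and> l2n (ft1 f) = l2n f"
proof -
  have [measurable]: "f \<in> borel_measurable borel" using cont by (rule borel_measurable_continuous_onI)
  let ?c = fc
  define \<gamma> :: "nat \<Rightarrow> real \<Rightarrow> real" where "\<gamma> n \<xi> = exp (- ((inverse (real (Suc n)) * \<xi>)\<^sup>2 / 2))" for n \<xi>
  have [measurable]: "\<gamma> n \<in> borel_measurable borel" for n unfolding \<gamma>_def by measurable
  define A where "A n x = (\<integral>z. std_normal_density z *\<^sub>R f (x + z / real (Suc n)) \<partial>lborel)" for n x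
  have \<gamma>int: "integrable lborel (\<lambda>\<xi>. h \<xi> * complex_of_real (\<gamma> n \<xi>))"
    if [measurable]: "h \<in> borel_measurable borel" and b: "\<And>\<xi>. cmod (h \<xi>) \<le> B" for h n B
  proof (rule Bochner_Integration.integrable_bound)
    show "integrable lborel (\<lambda>\<xi>. B * \<gamma> n \<xi>)" unfolding \<gamma>_def by (intro integrable_mult_right integrable_gaussian) simp
    have "0 \<le> B" using b[of 0] norm_ge_zero[of "h 0"] by linarith
    then show "AE \<xi> in lborel. norm (h \<xi> * complex_of_real (\<gamma> n \<xi>)) \<le> norm (B * \<gamma> n \<xi>)"
      using b by (intro AE_I2) (auto simp: norm_mult \<gamma>_def)
  qed measurable
  have A_eq: "complex_of_real ?c * (\<integral>\<xi>. ft1 f \<xi> * (complex_of_real (\<gamma> n \<xi>) * cis (\<xi> * x)) \<partial>lborel) = A n x" for n x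
  proof -
    have "(\<integral>\<xi>. ft1 f \<xi> * (complex_of_real (\<gamma> n \<xi>) * cis (\<xi> * x)) \<partial>lborel)
        = (\<integral>y. f y * ft1 (\<lambda>\<xi>. complex_of_real (\<gamma> n \<xi>) * cis (\<xi> * x)) y \<partial>lborel)"
      unfolding \<gamma>_def by (intro ft1_multiplication_formula int integrable_mult_cis integrable_gaussian_complex) auto
    also have "\<dots> = (\<integral>y. f y * complex_of_real (exp (- (((y - x) * real (Suc n))\<^sup>2 / 2)) * real (Suc n)) \<partial>lborel)"
    proof (intro refl Bochner_Integration.integral_cong)
      fix y
      have "ft1 (\<lambda>\<xi>. complex_of_real (\<gamma> n \<xi>) * cis (\<xi> * x)) y
          = complex_of_real (exp (- (((y - x) / inverse (real (Suc n)))\<^sup>2 / 2)) / inverse (real (Suc n)))"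
        unfolding \<gamma>_def by (rule ft1_gaussian) simp
      then show "f y * ft1 (\<lambda>\<xi>. complex_of_real (\<gamma> n \<xi>) * cis (\<xi> * x)) y
          = f y * complex_of_real (exp (- (((y - x) * real (Suc n))\<^sup>2 / 2)) * real (Suc n))"
        by (simp only: divide_inverse inverse_inverse_eq)
    qed
    also have "\<dots> = \<bar>inverse (real (Suc n))\<bar> *\<^sub>R (\<integral>z. f (x + inverse (real (Suc n)) * z)
        * complex_of_real (exp (- (((x + inverse (real (Suc n)) * z - x) * real (Suc n))\<^sup>2 / 2)) * real (Suc n)) \<partial>lborel)"
      by (rule lborel_integral_real_affine) simp
    also have "\<dots> = \<bar>inverse (real (Suc n))\<bar> *\<^sub>R (\<integral>z. complex_of_real (real (Suc n)) * (f (x + z / real (Suc n))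
        * complex_of_real (exp (- (z\<^sup>2 / 2)))) \<partial>lborel)"
    proof (intro arg_cong2[where f = "(*\<^sub>R)"] refl Bochner_Integration.integral_cong)
      fix z
      have "(x + inverse (real (Suc n)) * z - x) * real (Suc n) = z" by (simp del: of_nat_Suc)
      moreover have "inverse (real (Suc n)) * z = z / real (Suc n)" by (simp only: divide_inverse mult.commute)
      ultimately show "f (x + inverse (real (Suc n)) * z)
        * complex_of_real (exp (- (((x + inverse (real (Suc n)) * z - x) * real (Suc n))\<^sup>2 / 2)) * real (Suc n))
        = complex_of_real (real (Suc n)) * (f (x + z / real (Suc n)) * complex_of_real (exp (- (z\<^sup>2 / 2))))"
        by (simp only: of_real_mult mult_ac)
    qed
    also have "\<dots> = (\<integral>z. f (x + z / real (Suc n)) * complex_of_real (exp (- (z\<^sup>2 / 2))) \<partial>lborel)"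
      by (simp add: scaleR_conv_of_real del: of_nat_Suc)
    finally have "complex_of_real ?c * (\<integral>\<xi>. ft1 f \<xi> * (complex_of_real (\<gamma> n \<xi>) * cis (\<xi> * x)) \<partial>lborel)
      = complex_of_real ?c * (\<integral>z. f (x + z / real (Suc n)) * complex_of_real (exp (- (z\<^sup>2 / 2))) \<partial>lborel)" by (simp only:)
    also have "\<dots> = (\<integral>z. complex_of_real ?c * (f (x + z / real (Suc n)) * complex_of_real (exp (- (z\<^sup>2 / 2)))) \<partial>lborel)"
      by (rule integral_mult_right_zero[symmetric])
    also have "\<dots> = A n x"
      unfolding A_def
    proof (intro refl Bochner_Integration.integral_cong)
      fix z
      have "std_normal_density z = fc * exp (- (z\<^sup>2 / 2))" by (simp add: std_normal_density_def fc_def)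
      then show "complex_of_real fc * (f (x + z / real (Suc n)) * complex_of_real (exp (- (z\<^sup>2 / 2))))
        = std_normal_density z *\<^sub>R f (x + z / real (Suc n))"
        by (simp only: scaleR_conv_of_real of_real_mult mult_ac)
    qed
    finally show ?thesis .
  qed
  define B where "B = ?c * (\<integral>x. cmod (f x) \<partial>lborel)"
  have B: "cmod (ft1 f \<xi>) \<le> B" for \<xi> unfolding B_def by (rule ft1_bound[OF int])
  have key: "(\<integral>\<xi>. \<gamma> n \<xi> * (cmod (ft1 f \<xi>))\<^sup>2 \<partial>lborel) = Re (\<integral>x. f x * cnj (A n x) \<partial>lborel)" for n
  proof -
    have "complex_of_real (\<integral>\<xi>. \<gamma> n \<xi> * (cmod (ft1 f \<xi>))\<^sup>2 \<partial>lborel) = (\<integral>\<xi>. ft1 f \<xi> * (cnj (ft1 f \<xi>) * complex_of_real (\<gamma> n \<xi>)) \<partial>lborel)"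
      by (subst integral_complex_of_real[symmetric], rule Bochner_Integration.integral_cong)
        (auto simp: complex_norm_square mult_ac simp del: of_real_power)
    also have "\<dots> = (\<integral>x. f x * ft1 (\<lambda>\<xi>. cnj (ft1 f \<xi>) * complex_of_real (\<gamma> n \<xi>)) x \<partial>lborel)"
      by (intro ft1_multiplication_formula int \<gamma>int[of _ B]) (auto simp: B)
    also have "\<dots> = (\<integral>x. f x * cnj (A n x) \<partial>lborel)"
    proof -
      have "ft1 (\<lambda>\<xi>. cnj (ft1 f \<xi>) * complex_of_real (\<gamma> n \<xi>)) x = cnj (A n x)" for x
      proof -
        have "cnj (\<integral>\<xi>. ft1 f \<xi> * (complex_of_real (\<gamma> n \<xi>) * cis (\<xi> * x)) \<partial>lborel)
            = (\<integral>\<xi>. cnj (ft1 f \<xi> * (complex_of_real (\<gamma> n \<xi>) * cis (\<xi> * x))) \<partial>lborel)"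
          by (rule Bochner_Integration.integral_cnj[symmetric])
        also have "\<dots> = (\<integral>\<xi>. cnj (ft1 f \<xi>) * complex_of_real (\<gamma> n \<xi>) * cis (- (\<xi> * x)) \<partial>lborel)"
          by (rule Bochner_Integration.integral_cong) (auto simp: cis_cnj)
        finally show ?thesis unfolding A_eq[symmetric] complex_cnj_mult
          by (simp only: ft1_def complex_cnj_complex_of_real)
      qed
      then show ?thesis by simp
    qed
    finally show ?thesis by (metis Re_complex_of_real)
  qed
  have AM: "cmod (A n x) \<le> M" for n x
  proof -
    have "cmod (A n x) \<le> (\<integral>z. norm (std_normal_density z *\<^sub>R f (x + z / real (Suc n))) \<partial>lborel)"
      unfolding A_def by (rule integral_norm_bound)
    also have "\<dots> \<le> (\<integral>z. M * std_normal_density z \<partial>lborel)"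
    proof (rule Bochner_Integration.integral_mono')
      show "norm (std_normal_density z *\<^sub>R f (x + z / real (Suc n))) \<le> M * std_normal_density z" for z
        using mult_right_mono[OF M[of "x + z / real (Suc n)"] normal_density_nonneg[of 0 1 z]] by (simp add: mult.commute)
    qed (use order_trans[OF norm_ge_zero M[of 0]] in auto)
    finally show ?thesis by simp
  qed
  have [measurable]: "A n \<in> borel_measurable borel" for n unfolding A_def by measurable
  have conv: "(\<lambda>n. \<integral>x. f x * cnj (A n x) \<partial>lborel) \<longlonglongrightarrow> (\<integral>x. f x * cnj (f x) \<partial>lborel)"
  proof (rule integral_dominated_convergence[where w = "\<lambda>x. M * cmod (f x)"])
    show "integrable lborel (\<lambda>x. M * cmod (f x))" using int by simp
    show "AE x in lborel. (\<lambda>n. f x * cnj (A n x)) \<longlonglongrightarrow> f x * cnj (f x)"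
      unfolding A_def by (intro AE_I2 tendsto_intros gaussian_convolution_tendsto[OF cont M])
    show "AE x in lborel. norm (f x * cnj (A n x)) \<le> M * cmod (f x)" for n
    proof (rule AE_I2)
      fix x
      show "norm (f x * cnj (A n x)) \<le> M * cmod (f x)"
        using mult_right_mono[OF AM[of n x] norm_ge_zero[of "f x"]] by (simp add: norm_mult mult.commute)
    qed
  qed measurable
  have eq: "(\<integral>x. f x * cnj (f x) \<partial>lborel) = complex_of_real (\<integral>x. (cmod (f x))\<^sup>2 \<partial>lborel)"
    by (subst integral_complex_of_real[symmetric]) (simp add: complex_norm_square del: of_real_power)
  have lim: "(\<lambda>n. \<integral>\<xi>. \<gamma> n \<xi> * (cmod (ft1 f \<xi>))\<^sup>2 \<partial>lborel) \<longlonglongrightarrow> (\<integral>x. (cmod (f x))\<^sup>2 \<partial>lborel)"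
    unfolding key using tendsto_Re[OF conv] by (simp add: eq)
  have i: "integrable lborel (\<lambda>\<xi>. \<gamma> n \<xi> * (cmod (ft1 f \<xi>))\<^sup>2)" for n
  proof (rule Bochner_Integration.integrable_bound)
    show "integrable lborel (\<lambda>\<xi>. B\<^sup>2 * \<gamma> n \<xi>)" unfolding \<gamma>_def by (intro integrable_mult_right integrable_gaussian) simp
    show "AE \<xi> in lborel. norm (\<gamma> n \<xi> * (cmod (ft1 f \<xi>))\<^sup>2) \<le> norm (B\<^sup>2 * \<gamma> n \<xi>)"
    proof (rule AE_I2)
      fix \<xi>
      have "\<gamma> n \<xi> * (cmod (ft1 f \<xi>))\<^sup>2 \<le> \<gamma> n \<xi> * B\<^sup>2"
        by (intro mult_left_mono power_mono B) (auto simp: \<gamma>_def)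
      then show "norm (\<gamma> n \<xi> * (cmod (ft1 f \<xi>))\<^sup>2) \<le> norm (B\<^sup>2 * \<gamma> n \<xi>)"
        by (simp add: \<gamma>_def abs_mult mult.commute)
    qed
  qed measurable
  have m: "AE \<xi> in lborel. mono (\<lambda>n. \<gamma> n \<xi> * (cmod (ft1 f \<xi>))\<^sup>2)"
  proof (intro AE_I2 monoI mult_right_mono)
    fix \<xi> :: real and m n :: nat assume "m \<le> n"
    then have "inverse (real (Suc n)) \<le> inverse (real (Suc m))" by (intro le_imp_inverse_le) auto
    then have "(inverse (real (Suc n)))\<^sup>2 * \<xi>\<^sup>2 \<le> (inverse (real (Suc m)))\<^sup>2 * \<xi>\<^sup>2"
      by (intro mult_right_mono power_mono) auto
    then show "\<gamma> m \<xi> \<le> \<gamma> n \<xi>" unfolding \<gamma>_def by (simp add: power_mult_distrib del: of_nat_Suc)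
  qed simp
  have p: "AE \<xi> in lborel. (\<lambda>n. \<gamma> n \<xi> * (cmod (ft1 f \<xi>))\<^sup>2) \<longlonglongrightarrow> (cmod (ft1 f \<xi>))\<^sup>2"
  proof (rule AE_I2)
    fix \<xi> :: real
    have "(\<lambda>n. \<gamma> n \<xi>) \<longlonglongrightarrow> exp (- ((0 * \<xi>)\<^sup>2 / 2))"
      unfolding \<gamma>_def by (intro tendsto_intros LIMSEQ_inverse_real_of_nat) simp
    from tendsto_mult_right[OF this, of "(cmod (ft1 f \<xi>))\<^sup>2"]
    show "(\<lambda>n. \<gamma> n \<xi> * (cmod (ft1 f \<xi>))\<^sup>2) \<longlonglongrightarrow> (cmod (ft1 f \<xi>))\<^sup>2" by simp
  qed
  have "integrable lborel (\<lambda>\<xi>. (cmod (ft1 f \<xi>))\<^sup>2)"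
    by (rule integrable_monotone_convergence[OF i m p lim]) measurable
  moreover have "(\<integral>\<xi>. (cmod (ft1 f \<xi>))\<^sup>2 \<partial>lborel) = (\<integral>x. (cmod (f x))\<^sup>2 \<partial>lborel)"
    by (rule integral_monotone_convergence[OF i m p lim]) measurable
  ultimately show ?thesis by (auto intro!: L2_I simp: l2n_def)
qed

text \<open>The isometry property survives dominated limits: Fatou controls the transforms, dominated convergence the functions.\<close>

lemma ft1_isometry_limit:
  fixes f :: "nat \<Rightarrow> real \<Rightarrow> complex"
  assumes fm [measurable]: "\<And>n. f n \<in> borel_measurable borel" and gm [measurable]: "g \<in> borel_measurable borel"
    and w: "L2 w" "integrable lborel w" and dom: "\<And>n x. cmod (f n x) \<le> w x"
    and lim: "AE x in lborel. (\<lambda>n. f n x) \<longlonglongrightarrow> g x"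
    and iso: "\<And>n. L2 (ft1 (f n)) \<and> l2n (ft1 (f n)) = l2n (f n)"
    and iso_diff: "\<And>m n. l2n (ft1 (\<lambda>x. f m x - f n x)) = l2n (\<lambda>x. f m x - f n x)"
  shows "L2 (ft1 g) \<and> l2n (ft1 g) = l2n g"
proof -
  have w0: "0 \<le> w x" for x using dom[of 0 x] norm_ge_zero[of "f 0 x"] by linarith
  have gdom: "AE x in lborel. cmod (g x) \<le> w x"
    using lim by eventually_elim (rule LIMSEQ_le_const2[OF tendsto_norm], auto simp: dom)
  have fL: "L2 (f n)" for n by (rule L2_bound[OF w(1), of _ 1]) (use dom w0 in auto)
  have gL: "L2 g" by (rule L2_bound[OF w(1), of _ 1]) (use gdom w0 in auto)
  have fi: "integrable lborel (f n)" for n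
    by (rule Bochner_Integration.integrable_bound[OF w(2)]) (use dom w0 in auto)
  have gi: "integrable lborel g"
    by (rule Bochner_Integration.integrable_bound[OF w(2)]) (use gdom w0 in auto)
  have conv: "(\<lambda>n. l2n (\<lambda>x. f n x - g x)) \<longlonglongrightarrow> 0"
  proof -
    have "(\<lambda>n. \<integral>x. (cmod (f n x - g x))\<^sup>2 \<partial>lborel) \<longlonglongrightarrow> (\<integral>x. 0 \<partial>(lborel :: real measure))"
    proof (rule integral_dominated_convergence[where w = "\<lambda>x. 4 * (norm (w x))\<^sup>2"])
      show "integrable lborel (\<lambda>x. 4 * (norm (w x))\<^sup>2)" using L2_integrable[OF w(1)] by simp
      show "AE x in lborel. (\<lambda>n. (cmod (f n x - g x))\<^sup>2) \<longlonglongrightarrow> 0" using lim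
      proof eventually_elim
        case (elim x)
        then have "(\<lambda>n. (cmod (f n x - g x))\<^sup>2) \<longlonglongrightarrow> (cmod (g x - g x))\<^sup>2" by (intro tendsto_intros)
        then show ?case by simp
      qed
      show "AE x in lborel. norm ((cmod (f n x - g x))\<^sup>2) \<le> 4 * (norm (w x))\<^sup>2" for n using gdom
      proof eventually_elim
        case (elim x)
        have "cmod (f n x - g x) \<le> 2 * w x" using norm_triangle_ineq4[of "f n x" "g x"] dom[of n x] elim by linarith
        then have "(cmod (f n x - g x))\<^sup>2 \<le> (2 * w x)\<^sup>2" by (intro power_mono) auto
        then show ?case by (simp add: power_mult_distrib)
      qed
    qed measurable
    from tendsto_real_sqrt[OF this] show ?thesis by (simp add: l2n_def)
  qed
  have pt: "(\<lambda>n. ft1 (f n) \<xi>) \<longlonglongrightarrow> ft1 g \<xi>" for \<xi>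
    unfolding ft1_def
  proof (intro tendsto_intros integral_dominated_convergence[where w = w])
    show "AE x in lborel. (\<lambda>n. f n x * cis (- (x * \<xi>))) \<longlonglongrightarrow> g x * cis (- (x * \<xi>))"
      using lim by eventually_elim (intro tendsto_intros)
    show "AE x in lborel. norm (f n x * cis (- (x * \<xi>))) \<le> w x" for n using dom by (simp add: norm_mult)
  qed (use w in measurable)
  have close: "L2 (\<lambda>\<xi>. ft1 (f k) \<xi> - ft1 g \<xi>) \<and> l2n (\<lambda>\<xi>. ft1 (f k) \<xi> - ft1 g \<xi>) \<le> 2 * e"
    if N: "\<And>n. n \<ge> N \<Longrightarrow> l2n (\<lambda>x. f n x - g x) < e" and k: "k \<ge> N" for e N k
  proof (rule l2n_Fatou[where f = "\<lambda>m \<xi>. ft1 (f k) \<xi> - ft1 (f (m + N)) \<xi>"])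
    show "AE \<xi> in lborel. (\<lambda>m. ft1 (f k) \<xi> - ft1 (f (m + N)) \<xi>) \<longlonglongrightarrow> ft1 (f k) \<xi> - ft1 g \<xi>"
      by (intro AE_I2 tendsto_intros LIMSEQ_ignore_initial_segment[where f = "\<lambda>m. ft1 (f m) _"] pt)
    show "l2n (\<lambda>\<xi>. ft1 (f k) \<xi> - ft1 (f (m + N)) \<xi>) \<le> 2 * e" for m
    proof -
      have "l2n (\<lambda>\<xi>. ft1 (f k) \<xi> - ft1 (f (m + N)) \<xi>) = l2n (\<lambda>x. f k x - f (m + N) x)"
      proof -
        have "(\<lambda>\<xi>. ft1 (f k) \<xi> - ft1 (f (m + N)) \<xi>) = ft1 (\<lambda>x. f k x - f (m + N) x)"
          using ft1_diff[OF fi fi] by (intro ext) simp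
        then show ?thesis by (simp only: iso_diff)
      qed
      also have "\<dots> \<le> l2n (\<lambda>x. f k x - g x) + l2n (\<lambda>x. g x - f (m + N) x)"
        by (rule l2n_triangle_diff[OF fL gL fL])
      also have "\<dots> \<le> 2 * e" using N[OF k] N[of "m + N"] l2n_diff_commute[of g "f (m + N)"] by simp
      finally show ?thesis .
    qed
  qed (use iso in \<open>auto intro!: L2_diff\<close>)
  obtain N where N: "\<And>n. n \<ge> N \<Longrightarrow> l2n (\<lambda>x. f n x - g x) < 1"
    using LIMSEQ_D[OF conv, of 1] by auto
  have "L2 (\<lambda>\<xi>. ft1 (f N) \<xi> - (ft1 (f N) \<xi> - ft1 g \<xi>))"
    by (rule L2_diff[OF conjunct1[OF iso] conjunct1[OF close[where e = 1, OF N order.refl]]])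
  then have L: "L2 (ft1 g)" by simp
  have "\<bar>l2n (ft1 g) - l2n g\<bar> \<le> 0"
  proof (rule field_le_epsilon)
    fix e :: real assume e: "e > 0"
    obtain N where N: "\<And>n. n \<ge> N \<Longrightarrow> l2n (\<lambda>x. f n x - g x) < e / 3"
      using LIMSEQ_D[OF conv, of "e / 3"] e by auto
    have "\<bar>l2n (ft1 (f N)) - l2n (ft1 g)\<bar> \<le> 2 * (e / 3)"
      using l2n_reverse_triangle[of "ft1 (f N)" "ft1 g"] iso L close[OF N order.refl] by fastforce
    moreover have "\<bar>l2n (f N) - l2n g\<bar> \<le> e / 3"
      using l2n_reverse_triangle[OF fL[of N] gL] N[OF order.refl] by linarith
    ultimately show "\<bar>l2n (ft1 g) - l2n g\<bar> \<le> 0 + e" using iso[of N] by linarith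
  qed
  then show ?thesis using L by simp
qed

lemma integrable_bounded_support:
  fixes f :: "real \<Rightarrow> 'a::{banach, second_countable_topology}"
  assumes f: "L2 f" and supp: "\<And>x. \<bar>x\<bar> > R \<Longrightarrow> f x = 0"
  shows "integrable lborel f"
proof (rule Bochner_Integration.integrable_bound)
  have "integrable lborel (indicat_real {-R..R})"
    by (rule integrable_real_indicator) (auto simp: emeasure_lborel_Icc_eq)
  then show "integrable lborel (\<lambda>x. indicat_real {-R..R} x + (norm (f x))\<^sup>2)"
    using L2_integrable[OF f] by simp
  have "norm (f x) \<le> indicat_real {-R..R} x + (norm (f x))\<^sup>2" for x
  proof (cases "\<bar>x\<bar> > R")
    case False
    have "norm (f x) \<le> 1 + (norm (f x))\<^sup>2"
      using sum_squares_bound[of "norm (f x)" 1] norm_ge_zero[of "f x"]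
      by (simp only: power_one mult_1_right)
    then show ?thesis using False by (auto simp: indicator_def)
  qed (simp add: supp)
  then show "AE x in lborel. norm (f x) \<le> norm (indicat_real {-R..R} x + (norm (f x))\<^sup>2)"
    by (intro AE_I2) (simp add: abs_of_nonneg)
qed (use L2_measurable[OF f] in measurable)

lemma L2_bounded_support:
  assumes "f \<in> borel_measurable borel" "\<And>x. norm (f x) \<le> M" "\<And>x. \<bar>x\<bar> > R \<Longrightarrow> f x = 0"
  shows "L2 f"
proof (rule L2_bound[of "indicat_real {-R..R}" _ M])
  show "L2 (indicat_real {-R..R})"
  proof (rule L2_I)
    have "integrable lborel (indicat_real {-R..R})"
      by (rule integrable_real_indicator) (auto simp: emeasure_lborel_Icc_eq)
    moreover have "(\<lambda>x. (norm (indicat_real {-R..R} x))\<^sup>2) = indicat_real {-R..R}" by (auto simp: indicator_def)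
    ultimately show "integrable lborel (\<lambda>x. (norm (indicat_real {-R..R} x))\<^sup>2)" by simp
  qed measurable
  have "norm (f x) \<le> M * norm (indicat_real {-R..R} x)" for x
    using assms(2)[of x] assms(3)[of x] by (auto simp: indicator_def)
  then show "AE x in lborel. norm (f x) \<le> M * norm (indicat_real {-R..R} x)" by simp
qed fact

text \<open>Bounded functions are almost everywhere limits of continuous ones, which may be clamped and cut off.\<close>

lemma ft1_isometry_bounded:
  fixes f :: "real \<Rightarrow> complex"
  assumes [measurable]: "f \<in> borel_measurable borel" and M: "\<And>x. cmod (f x) \<le> M"
    and supp: "\<And>x. \<bar>x\<bar> > R \<Longrightarrow> f x = 0"
  shows "L2 (ft1 f) \<and> l2n (ft1 f) = l2n f"
proof -
  define K where "K = max M 1"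
  have K: "K > 0" "cmod (f x) \<le> K" for x unfolding K_def using M[of x] by auto
  have "f \<in> borel_measurable lebesgue" by (simp add: measurable_completion)
  then have "f measurable_on UNIV" using measurable_on_UNIV lebesgue_measurable_imp_measurable_on[of f UNIV] by simp
  then obtain N g where N: "negligible N" and g: "\<And>n. continuous_on UNIV (g n)"
    and lim: "\<And>x. x \<notin> N \<Longrightarrow> (\<lambda>n. g n x) \<longlonglongrightarrow> f x"
    unfolding measurable_on_def by auto
  have N': "AE x in lborel. x \<notin> N"
  proof -
    have "AE x in lebesgue. x \<notin> N" using N by (simp add: negligible_iff_null_sets AE_not_in)
    then show ?thesis by (simp add: AE_completion_iff)
  qed
  \<comment> \<open>the first factor is a continuous cutoff that is \<open>1\<close> on \<open>[-R, R]\<close>, the second clamps the modulus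
    to \<open>K\<close>; \<open>K\<close> is at least \<open>1\<close> to keep the denominator positive\<close>
  define h where "h n x = complex_of_real (max 0 (min 1 (R + 1 - \<bar>x\<bar>)) * K / max K (cmod (g n x))) * g n x" for n x
  have hc: "continuous_on UNIV (h n)" for n
    unfolding h_def using g[of n] K by (intro continuous_intros) auto
  have hb: "cmod (h n x) \<le> K * indicator {-(R+1)..R+1} x" for n x
  proof -
    have "cmod (h n x) = max 0 (min 1 (R + 1 - \<bar>x\<bar>)) * (K / max K (cmod (g n x)) * cmod (g n x))"
      using K by (simp add: h_def norm_mult norm_divide abs_of_nonneg)
    also have "\<dots> \<le> indicator {-(R+1)..R+1} x * K"
    proof (rule mult_mono)
      show "K / max K (cmod (g n x)) * cmod (g n x) \<le> K" using K by (simp add: field_simps max_def)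
    qed (use K in \<open>auto simp: indicator_def\<close>)
    finally show ?thesis by (simp add: mult.commute)
  qed
  have [measurable]: "h n \<in> borel_measurable borel" for n using hc by (rule borel_measurable_continuous_onI)
  have hb': "cmod (h n x) \<le> K" for n x
    using hb[of n x] K(1) by (cases "x \<in> {-(R+1)..R+1}") auto
  have hs: "h n x = 0" if "\<bar>x\<bar> > R + 1" for n x using hb[of n x] that by (cases "x \<in> {-(R+1)..R+1}") auto
  have hL: "L2 (h n)" for n by (rule L2_bounded_support[of _ K "R + 1"]) (use hb' hs in auto)
  have iso: "L2 (ft1 (h n)) \<and> l2n (ft1 (h n)) = l2n (h n)" for n
    by (rule ft1_isometry_continuous[OF hc hb' integrable_bounded_support[OF hL hs]])
  have iso2: "L2 (ft1 (\<lambda>x. h m x - h n x)) \<and> l2n (ft1 (\<lambda>x. h m x - h n x)) = l2n (\<lambda>x. h m x - h n x)" for m n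
  proof (rule ft1_isometry_continuous[where M = "K + K"])
    show "continuous_on UNIV (\<lambda>x. h m x - h n x)" using hc by (intro continuous_intros)
    show "cmod (h m x - h n x) \<le> K + K" for x using norm_triangle_ineq4[of "h m x" "h n x"] hb'[of m x] hb'[of n x] by linarith
    show "integrable lborel (\<lambda>x. h m x - h n x)" by (intro Bochner_Integration.integrable_diff integrable_bounded_support[OF hL hs])
  qed
  define w where "w x = K * indicat_real {-(R+1)..R+1} x" for x
  have wL: "L2 w" unfolding w_def by (rule L2_bounded_support[of _ K "R + 1"]) (use K in \<open>auto simp: indicator_def\<close>)
  show ?thesis
  proof (rule ft1_isometry_limit[of h f w])
    show "integrable lborel w" by (rule integrable_bounded_support[OF wL, of "R + 1"]) (auto simp: w_def indicator_def)
    show "AE x in lborel. (\<lambda>n. h n x) \<longlonglongrightarrow> f x" using N'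
    proof eventually_elim
      case (elim x)
      have "(\<lambda>n. h n x) \<longlonglongrightarrow> complex_of_real (max 0 (min 1 (R + 1 - \<bar>x\<bar>)) * K / max K (cmod (f x))) * f x"
        unfolding h_def using lim[OF elim] K by (intro tendsto_intros) auto
      moreover have "complex_of_real (max 0 (min 1 (R + 1 - \<bar>x\<bar>)) * K / max K (cmod (f x))) * f x = f x"
      proof (cases "\<bar>x\<bar> > R")
        case False
        then have "max 0 (min 1 (R + 1 - \<bar>x\<bar>)) = 1" by auto
        then show ?thesis using K(1) K(2)[of x] by (simp add: max_absorb1)
      qed (simp add: supp)
      ultimately show ?case by simp
    qed
    show "cmod (h n x) \<le> w x" for n x using hb[of n x] by (simp add: w_def)
  qed (use iso iso2 wL in auto)
qed

text \<open>
  Removing the large values of \<open>f\<close> leaves bounded functions, dominated by \<open>\<bar>f\<bar>\<close>, which is integrable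
  as the support is bounded.
\<close>

lemma ft1_isometry:
  fixes f :: "real \<Rightarrow> complex"
  assumes f: "L2 f" and supp: "\<And>x. \<bar>x\<bar> > R \<Longrightarrow> f x = 0"
  shows "L2 (ft1 f) \<and> l2n (ft1 f) = l2n f"
proof -
  note [measurable] = L2_measurable[OF f]
  define h where "h n x = (if cmod (f x) \<le> real n then f x else 0)" for n :: nat and x
  have [measurable]: "h n \<in> borel_measurable borel" for n unfolding h_def by measurable
  show ?thesis
  proof (rule ft1_isometry_limit[of h f "\<lambda>x. cmod (f x)"])
    show "integrable lborel (\<lambda>x. cmod (f x))" using integrable_bounded_support[OF f supp] by simp
    show "AE x in lborel. (\<lambda>n. h n x) \<longlonglongrightarrow> f x"
    proof (rule AE_I2, rule tendsto_eventually)
      fix x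
      obtain N where "cmod (f x) \<le> real N" using real_arch_simple by blast
      then show "\<forall>\<^sub>F n in sequentially. h n x = f x"
        by (intro eventually_sequentiallyI[of N]) (auto simp: h_def)
    qed
    show "L2 (ft1 (h n)) \<and> l2n (ft1 (h n)) = l2n (h n)" for n
      by (rule ft1_isometry_bounded[where M = "real n" and R = R]) (auto simp: h_def supp)
    have "L2 (ft1 (\<lambda>x. h m x - h n x)) \<and> l2n (ft1 (\<lambda>x. h m x - h n x)) = l2n (\<lambda>x. h m x - h n x)" for m n
    proof (rule ft1_isometry_bounded[where M = "real m + real n" and R = R])
      have "cmod (h k x) \<le> real k" for k x by (auto simp: h_def)
      then show "cmod (h m x - h n x) \<le> real m + real n" for x
        using norm_triangle_ineq4[of "h m x" "h n x"] add_mono order_trans by metis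
    qed (auto simp: h_def supp)
    then show "l2n (ft1 (\<lambda>x. h m x - h n x)) = l2n (\<lambda>x. h m x - h n x)" for m n by blast
  qed (use f in \<open>auto simp: h_def intro: L2_norm\<close>)
qed

section \<open>The Fourier transform of square integrable functions\<close>

definition trunc :: "nat \<Rightarrow> (real \<Rightarrow> complex) \<Rightarrow> real \<Rightarrow> complex" where
  "trunc n f x = indicator {- real n..real n} x * f x"

lemma truncated_fourier_eq: "truncated_fourier n f = ft1 (trunc n (\<lambda>x. complex_of_real (f x)))"
  by (intro ext) (simp add: truncated_fourier_def ft1_def trunc_def fc_def mult.assoc)

lemma trunc_measurable [measurable]:
  "f \<in> borel_measurable borel \<Longrightarrow> trunc n f \<in> borel_measurable borel"
  unfolding trunc_def by measurable

lemma trunc_norm_le: "cmod (trunc n f x) \<le> cmod (f x)"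
  by (simp add: trunc_def indicator_def)

lemma L2_trunc: "L2 f \<Longrightarrow> L2 (trunc n f)"
  by (rule L2_bound[of f _ 1]) (auto simp: trunc_norm_le L2_measurable)

lemma trunc_supp: "\<bar>x\<bar> > real n \<Longrightarrow> trunc n f x = 0"
  by (auto simp: trunc_def indicator_def)

lemma integrable_trunc: "L2 f \<Longrightarrow> integrable lborel (trunc n f)"
  by (rule integrable_bounded_support[of _ "real n"]) (auto simp: L2_trunc trunc_supp)

lemma trunc_tendsto: "(\<lambda>n. trunc n f x) \<longlonglongrightarrow> f x"
proof (rule tendsto_eventually)
  obtain N where "\<bar>x\<bar> \<le> real N" using real_arch_simple by blast
  then show "\<forall>\<^sub>F n in sequentially. trunc n f x = f x"
    by (intro eventually_sequentiallyI[of N]) (auto simp: trunc_def indicator_def)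
qed

lemma trunc_L2_tendsto:
  assumes f: "L2 f" shows "(\<lambda>n. l2n (\<lambda>x. trunc n f x - f x)) \<longlonglongrightarrow> 0"
proof -
  note [measurable] = L2_measurable[OF f]
  have "(\<lambda>n. \<integral>x. (cmod (trunc n f x - f x))\<^sup>2 \<partial>lborel) \<longlonglongrightarrow> (\<integral>x. 0 \<partial>(lborel :: real measure))"
  proof (rule integral_dominated_convergence[where w = "\<lambda>x. (cmod (f x))\<^sup>2"])
    show "AE x in lborel. (\<lambda>n. (cmod (trunc n f x - f x))\<^sup>2) \<longlonglongrightarrow> 0"
    proof (rule AE_I2)
      fix x
      have "(\<lambda>n. (cmod (trunc n f x - f x))\<^sup>2) \<longlonglongrightarrow> (cmod (f x - f x))\<^sup>2" by (intro tendsto_intros trunc_tendsto)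
      then show "(\<lambda>n. (cmod (trunc n f x - f x))\<^sup>2) \<longlonglongrightarrow> 0" by simp
    qed
    show "AE x in lborel. norm ((cmod (trunc n f x - f x))\<^sup>2) \<le> (cmod (f x))\<^sup>2" for n
      by (intro AE_I2) (auto simp: trunc_def indicator_def)
  qed (use L2_integrable[OF f] in measurable)
  from tendsto_real_sqrt[OF this] show ?thesis by (simp add: l2n_def)
qed

lemma ft1_trunc_L2: "L2 f \<Longrightarrow> L2 (ft1 (trunc n f))"
  using ft1_isometry[OF L2_trunc trunc_supp] by blast

lemma ft1_trunc_l2n: "L2 f \<Longrightarrow> l2n (ft1 (trunc n f)) = l2n (trunc n f)"
  using ft1_isometry[OF L2_trunc trunc_supp] by blast

text \<open>
  The notion \<open>is_fourier\<close> for complex-valued functions: inversion applies the transform twice, and the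
  transform of a real function is complex.
\<close>

definition is_F :: "(real \<Rightarrow> complex) \<Rightarrow> (real \<Rightarrow> complex) \<Rightarrow> bool" where
  "is_F f g \<longleftrightarrow> L2 g \<and> (\<lambda>n. l2n (\<lambda>\<xi>. ft1 (trunc n f) \<xi> - g \<xi>)) \<longlonglongrightarrow> 0"

definition F :: "(real \<Rightarrow> complex) \<Rightarrow> real \<Rightarrow> complex" where
  "F f = (SOME g. is_F f g)"

lemma is_fourier_iff:
  assumes "L2 f" shows "is_fourier f g \<longleftrightarrow> is_F (\<lambda>x. complex_of_real (f x)) g"
proof (cases "L2 g")
  case True
  have "(\<lambda>n. \<integral>\<^sup>+ \<xi>. ennreal ((cmod (g \<xi> - truncated_fourier n f \<xi>))\<^sup>2) \<partial>lborel) \<longlonglongrightarrow> 0 \<longleftrightarrow>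
      (\<lambda>n. l2n (\<lambda>\<xi>. g \<xi> - truncated_fourier n f \<xi>)) \<longlonglongrightarrow> 0"
    by (rule l2n_tendsto_0_iff_nn) (simp add: truncated_fourier_eq L2_diff True ft1_trunc_L2 L2_of_real assms)
  then show ?thesis using True
    by (simp add: is_fourier_def is_F_def truncated_fourier_eq l2n_diff_commute[of g])
qed (auto simp: is_fourier_def is_F_def)

lemma fourier_eq_F: "L2 f \<Longrightarrow> fourier f = F (\<lambda>x. complex_of_real (f x))"
  by (simp add: fourier_def F_def is_fourier_iff)

text \<open>
  The transforms of the truncations form a Cauchy sequence by Plancherel's identity for functions of
  bounded support.
\<close>

lemma is_F_exists:
  assumes f: "L2 f" shows "\<exists>g. is_F f g"
proof -
  have "\<exists>g. L2 g \<and> (\<lambda>n. l2n (\<lambda>\<xi>. ft1 (trunc n f) \<xi> - g \<xi>)) \<longlonglongrightarrow> 0"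
  proof (rule L2_complete[OF ft1_trunc_L2[OF f]])
    fix e :: real assume "e > 0"
    then obtain N where N: "\<And>n. n \<ge> N \<Longrightarrow> l2n (\<lambda>x. trunc n f x - f x) < e / 2"
      using LIMSEQ_D[OF trunc_L2_tendsto[OF f], of "e / 2"] by auto
    have "l2n (\<lambda>x. ft1 (trunc m f) x - ft1 (trunc n f) x) < e" if "m \<ge> N" "n \<ge> N" for m n
    proof -
      have "l2n (ft1 (\<lambda>x. trunc m f x - trunc n f x)) = l2n (\<lambda>x. trunc m f x - trunc n f x)"
        using ft1_isometry[of "\<lambda>x. trunc m f x - trunc n f x" "real (max m n)"]
        by (auto simp: L2_diff L2_trunc f trunc_supp)
      also have "\<dots> \<le> l2n (\<lambda>x. trunc m f x - f x) + l2n (\<lambda>x. f x - trunc n f x)"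
        by (rule l2n_triangle_diff) (auto simp: L2_trunc f)
      also have "\<dots> < e" using N[OF that(1)] N[OF that(2)] l2n_diff_commute[of f "trunc n f"] by simp
      also have "ft1 (\<lambda>x. trunc m f x - trunc n f x) = (\<lambda>x. ft1 (trunc m f) x - ft1 (trunc n f) x)"
        by (intro ext ft1_diff integrable_trunc f)
      finally show ?thesis .
    qed
    then show "\<exists>N. \<forall>m\<ge>N. \<forall>n\<ge>N. l2n (\<lambda>x. ft1 (trunc m f) x - ft1 (trunc n f) x) < e" by blast
  qed
  then show ?thesis unfolding is_F_def .
qed

lemma is_F_F: assumes "L2 f" shows "is_F f (F f)"
  using someI_ex[OF is_F_exists[OF assms]] by (simp add: F_def)

lemma L2_F [simp]: "L2 f \<Longrightarrow> L2 (F f)"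
  using is_F_F by (simp add: is_F_def)

lemma L2_limit_unique:
  assumes "\<And>n::nat. L2 (a n)" "L2 g" "L2 h"
    and "(\<lambda>n. l2n (\<lambda>\<xi>. a n \<xi> - g \<xi>)) \<longlonglongrightarrow> 0" "(\<lambda>n. l2n (\<lambda>\<xi>. a n \<xi> - h \<xi>)) \<longlonglongrightarrow> 0"
  shows "AE x in lborel. g x = h x"
proof -
  have "l2n (\<lambda>x. g x - h x) \<le> 0"
  proof (rule LIMSEQ_le_const)
    show "(\<lambda>n. l2n (\<lambda>\<xi>. a n \<xi> - g \<xi>) + l2n (\<lambda>\<xi>. a n \<xi> - h \<xi>)) \<longlonglongrightarrow> 0"
      using tendsto_add[OF assms(4,5)] by simp
    show "\<exists>N. \<forall>n\<ge>N. l2n (\<lambda>x. g x - h x) \<le> l2n (\<lambda>\<xi>. a n \<xi> - g \<xi>) + l2n (\<lambda>\<xi>. a n \<xi> - h \<xi>)"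
      using l2n_triangle_diff[OF assms(2,1,3)] l2n_diff_commute[of g] by auto
  qed
  then have "l2n (\<lambda>x. g x - h x) = 0" using l2n_nonneg[of "\<lambda>x. g x - h x"] by linarith
  from l2n_eq_0D[OF L2_diff[OF assms(2,3)] this] show ?thesis by simp
qed

lemma F_eqI: "L2 f \<Longrightarrow> is_F f g \<Longrightarrow> AE x in lborel. F f x = g x"
  using L2_limit_unique[of "\<lambda>n. ft1 (trunc n f)" "F f" g] is_F_F[of f] ft1_trunc_L2[of f]
  by (auto simp: is_F_def)

lemma l2n_tendsto:
  assumes "\<And>n::nat. L2 (a n)" "L2 g" "(\<lambda>n. l2n (\<lambda>\<xi>. a n \<xi> - g \<xi>)) \<longlonglongrightarrow> 0"
  shows "(\<lambda>n. l2n (a n)) \<longlonglongrightarrow> l2n g"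
proof (rule LIM_zero_cancel, rule Lim_null_comparison[OF _ assms(3)])
  show "\<forall>\<^sub>F n in sequentially. norm (l2n (a n) - l2n g) \<le> l2n (\<lambda>\<xi>. a n \<xi> - g \<xi>)"
    using l2n_reverse_triangle[OF assms(1,2)] by (auto intro: always_eventually)
qed

lemma l2n_F [simp]:
  assumes f: "L2 f" shows "l2n (F f) = l2n f"
proof (rule LIMSEQ_unique)
  show "(\<lambda>n. l2n (trunc n f)) \<longlonglongrightarrow> l2n f"
    by (rule l2n_tendsto[OF L2_trunc[OF f] f trunc_L2_tendsto[OF f]])
  have "(\<lambda>n. l2n (ft1 (trunc n f))) \<longlonglongrightarrow> l2n (F f)"
    by (rule l2n_tendsto[OF ft1_trunc_L2[OF f] L2_F[OF f]]) (use is_F_F[OF f] in \<open>simp add: is_F_def\<close>)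
  then show "(\<lambda>n. l2n (trunc n f)) \<longlonglongrightarrow> l2n (F f)" by (simp add: ft1_trunc_l2n f)
qed

lemma F_add:
  assumes f: "L2 f" and g: "L2 g"
  shows "AE \<xi> in lborel. F (\<lambda>x. f x + g x) \<xi> = F f \<xi> + F g \<xi>"
proof (rule F_eqI[OF L2_add[OF f g]])
  have eq: "ft1 (trunc n (\<lambda>x. f x + g x)) \<xi> - (F f \<xi> + F g \<xi>)
      = (ft1 (trunc n f) \<xi> - F f \<xi>) + (ft1 (trunc n g) \<xi> - F g \<xi>)" for n \<xi>
  proof -
    have "trunc n (\<lambda>x. f x + g x) = (\<lambda>x. trunc n f x + trunc n g x)" by (auto simp: trunc_def algebra_simps)
    then show ?thesis by (simp add: ft1_add integrable_trunc f g)
  qed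
  have "(\<lambda>n. l2n (\<lambda>\<xi>. ft1 (trunc n (\<lambda>x. f x + g x)) \<xi> - (F f \<xi> + F g \<xi>))) \<longlonglongrightarrow> 0"
  proof (rule Lim_null_comparison)
    show "\<forall>\<^sub>F n in sequentially. norm (l2n (\<lambda>\<xi>. ft1 (trunc n (\<lambda>x. f x + g x)) \<xi> - (F f \<xi> + F g \<xi>)))
      \<le> l2n (\<lambda>\<xi>. ft1 (trunc n f) \<xi> - F f \<xi>) + l2n (\<lambda>\<xi>. ft1 (trunc n g) \<xi> - F g \<xi>)"
      unfolding eq by (intro always_eventually allI)
        (simp add: l2n_triangle[OF L2_diff[OF ft1_trunc_L2[OF f] L2_F[OF f]] L2_diff[OF ft1_trunc_L2[OF g] L2_F[OF g]]])
    show "(\<lambda>n. l2n (\<lambda>\<xi>. ft1 (trunc n f) \<xi> - F f \<xi>) + l2n (\<lambda>\<xi>. ft1 (trunc n g) \<xi> - F g \<xi>)) \<longlonglongrightarrow> 0"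
      using tendsto_add[of _ 0 _ _ 0] is_F_F[OF f] is_F_F[OF g] by (fastforce simp: is_F_def)
  qed
  then show "is_F (\<lambda>x. f x + g x) (\<lambda>\<xi>. F f \<xi> + F g \<xi>)" by (simp add: is_F_def L2_add f g)
qed

lemma F_cmult:
  assumes f: "L2 f"
  shows "AE \<xi> in lborel. F (\<lambda>x. c * f x) \<xi> = c * F f \<xi>"
proof (rule F_eqI[OF L2_cmult[OF f]])
  have eq: "ft1 (trunc n (\<lambda>x. c * f x)) \<xi> - c * F f \<xi> = c * (ft1 (trunc n f) \<xi> - F f \<xi>)" for n \<xi>
  proof -
    have "trunc n (\<lambda>x. c * f x) = (\<lambda>x. c * trunc n f x)" by (auto simp: trunc_def)
    then show ?thesis by (simp add: ft1_cmult algebra_simps)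
  qed
  have "(\<lambda>n. cmod c * l2n (\<lambda>\<xi>. ft1 (trunc n f) \<xi> - F f \<xi>)) \<longlonglongrightarrow> 0"
    using is_F_F[OF f] by (auto simp: is_F_def intro: tendsto_mult_right_zero)
  then show "is_F (\<lambda>x. c * f x) (\<lambda>\<xi>. c * F f \<xi>)"
    unfolding is_F_def eq l2n_cmult by (simp add: L2_cmult f)
qed

lemma F_cong_AE:
  assumes f: "L2 f" and g: "g \<in> borel_measurable borel" and eq: "AE x in lborel. f x = g x"
  shows "AE \<xi> in lborel. F g \<xi> = F f \<xi>"
proof (rule F_eqI)
  show "L2 g" by (rule L2_cong_AE[OF f g eq])
  have "ft1 (trunc n g) \<xi> = ft1 (trunc n f) \<xi>" for n \<xi>
    unfolding ft1_def
  proof (intro arg_cong2[where f = "(*)"] refl integral_cong_AE)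
    show "AE x in lborel. trunc n g x * cis (- (x * \<xi>)) = trunc n f x * cis (- (x * \<xi>))"
      using eq by eventually_elim (simp add: trunc_def)
  qed (use g L2_measurable[OF f] in measurable)
  then show "is_F g (F f)" using is_F_F[OF f] by (simp add: is_F_def)
qed

lemma F_diff:
  assumes f: "L2 f" and g: "L2 g"
  shows "AE \<xi> in lborel. F (\<lambda>x. f x - g x) \<xi> = F f \<xi> - F g \<xi>"
  using F_add[OF f L2_cmult[OF g, of "-1"]] F_cmult[OF g, of "-1"] by (auto elim!: eventually_elim2)

lemma AE_affine:
  fixes P :: "real \<Rightarrow> bool"
  assumes "AE x in lborel. P x" and c: "c \<noteq> 0" shows "AE x in lborel. P (t + c * x)"
proof -
  obtain N where N: "{x \<in> space lborel. \<not> P x} \<subseteq> N" "emeasure lborel N = 0" "N \<in> sets lborel"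
    using assms(1) by (rule AE_E)
  have [measurable]: "N \<in> sets borel" using N(3) by simp
  have "AE x in lborel. x \<notin> N" using N by (intro AE_not_in) (auto simp: null_sets_def)
  then have "AE x in lborel. t + c * x \<notin> N"
    by (intro AE_borel_affine[of c "\<lambda>x. x \<notin> N"] c) auto
  then show ?thesis by eventually_elim (use N(1) in auto)
qed

lemma AE_reflect: "AE x in lborel. P x \<Longrightarrow> AE x in lborel. P (- x)" for P :: "real \<Rightarrow> bool"
  using AE_affine[of P "-1" 0] by simp

lemma L2_reflect:
  assumes f: "L2 f" shows "L2 (\<lambda>x. f (- x))"
proof (rule L2_I)
  note [measurable] = L2_measurable[OF f]
  show "(\<lambda>x. f (- x)) \<in> borel_measurable borel" by measurable
  show "integrable lborel (\<lambda>x. (norm (f (- x)))\<^sup>2)"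
    using lborel_integrable_real_affine[OF L2_integrable[OF f], of "-1" 0] by simp
qed

lemma l2n_reflect [simp]: "l2n (\<lambda>x. f (- x)) = l2n f"
  unfolding l2n_def using lborel_integral_real_affine[of "-1" "\<lambda>x. (norm (f x))\<^sup>2" 0] by simp

lemma l2n_cnj: "l2n (\<lambda>x. cnj (f x)) = l2n f"
  by (simp add: l2n_def)

lemma ft1_reflect: "ft1 (\<lambda>x. f (- x)) \<xi> = ft1 f (- \<xi>)"
  unfolding ft1_def using lborel_integral_real_affine[of "-1" "\<lambda>x. f x * cis (- (x * - \<xi>))" 0] by simp

lemma ft1_cnj: "ft1 (\<lambda>x. cnj (f x)) \<xi> = cnj (ft1 f (- \<xi>))"
proof -
  have "cnj (\<integral>x. f x * cis (- (x * - \<xi>)) \<partial>lborel) = (\<integral>x. cnj (f x * cis (- (x * - \<xi>))) \<partial>lborel)"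
    by (rule Bochner_Integration.integral_cnj[symmetric])
  also have "\<dots> = (\<integral>x. cnj (f x) * cis (- (x * \<xi>)) \<partial>lborel)"
    by (rule Bochner_Integration.integral_cong) (auto simp: cis_cnj)
  finally show ?thesis by (simp only: ft1_def complex_cnj_mult complex_cnj_complex_of_real)
qed

lemma F_reflect:
  assumes f: "L2 f" shows "AE \<xi> in lborel. F (\<lambda>x. f (- x)) \<xi> = F f (- \<xi>)"
proof (rule F_eqI[OF L2_reflect[OF f]])
  have t: "trunc n (\<lambda>x. f (- x)) = (\<lambda>x. trunc n f (- x))" for n by (intro ext) (auto simp: trunc_def indicator_def)
  have "l2n (\<lambda>\<xi>. ft1 (trunc n f) (- \<xi>) - F f (- \<xi>)) = l2n (\<lambda>\<xi>. ft1 (trunc n f) \<xi> - F f \<xi>)" for n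
    by (rule l2n_reflect)
  then have "(\<lambda>n. l2n (\<lambda>\<xi>. ft1 (trunc n f) (- \<xi>) - F f (- \<xi>))) \<longlonglongrightarrow> 0"
    using is_F_F[OF f] by (simp add: is_F_def)
  then show "is_F (\<lambda>x. f (- x)) (\<lambda>\<xi>. F f (- \<xi>))"
    by (simp add: is_F_def L2_reflect f t ft1_reflect)
qed

lemma F_cnj:
  assumes f: "L2 f" shows "AE \<xi> in lborel. F (\<lambda>x. cnj (f x)) \<xi> = cnj (F f (- \<xi>))"
proof (rule F_eqI[OF L2_cnj[OF f]])
  have t: "trunc n (\<lambda>x. cnj (f x)) = (\<lambda>x. cnj (trunc n f x))" for n by (intro ext) (auto simp: trunc_def indicator_def)
  have "l2n (\<lambda>\<xi>. cnj (ft1 (trunc n f) (- \<xi>)) - cnj (F f (- \<xi>))) = l2n (\<lambda>\<xi>. ft1 (trunc n f) \<xi> - F f \<xi>)" for n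
    using l2n_reflect[of "\<lambda>\<xi>. cnj (ft1 (trunc n f) \<xi> - F f \<xi>)"] l2n_cnj[of "\<lambda>\<xi>. ft1 (trunc n f) \<xi> - F f \<xi>"]
    by (simp only: complex_cnj_diff)
  then have "(\<lambda>n. l2n (\<lambda>\<xi>. cnj (ft1 (trunc n f) (- \<xi>)) - cnj (F f (- \<xi>)))) \<longlonglongrightarrow> 0"
    using is_F_F[OF f] by (simp add: is_F_def)
  then show "is_F (\<lambda>x. cnj (f x)) (\<lambda>\<xi>. cnj (F f (- \<xi>)))"
    by (simp add: is_F_def L2_reflect L2_cnj f t ft1_cnj)
qed

lemma L2_tendsto_integral_mult:
  fixes a b :: "nat \<Rightarrow> real \<Rightarrow> complex"
  assumes an: "\<And>n. L2 (a n)" and bn: "\<And>n. L2 (b n)" and g: "L2 g" and h: "L2 h"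
    and lim: "(\<lambda>n. l2n (\<lambda>x. a n x - g x)) \<longlonglongrightarrow> 0" "(\<lambda>n. l2n (\<lambda>x. b n x - h x)) \<longlonglongrightarrow> 0"
  shows "(\<lambda>n. \<integral>x. a n x * b n x \<partial>lborel) \<longlonglongrightarrow> (\<integral>x. g x * h x \<partial>lborel)"
proof (rule LIM_zero_cancel, rule Lim_null_comparison)
  show "(\<lambda>n. l2n (\<lambda>x. a n x - g x) * l2n (b n) + l2n g * l2n (\<lambda>x. b n x - h x)) \<longlonglongrightarrow> 0"
    using tendsto_add[OF tendsto_mult[OF lim(1) l2n_tendsto[OF bn h lim(2)]] tendsto_mult[OF tendsto_const lim(2), of "l2n g"]]
    by simp
  show "\<forall>\<^sub>F n in sequentially. norm ((\<integral>x. a n x * b n x \<partial>lborel) - (\<integral>x. g x * h x \<partial>lborel))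
      \<le> l2n (\<lambda>x. a n x - g x) * l2n (b n) + l2n g * l2n (\<lambda>x. b n x - h x)"
  proof (intro always_eventually allI)
    fix n
    note i = L2_mult_integrable[OF L2_diff[OF an[of n] g] bn[of n]] L2_mult_integrable[OF g L2_diff[OF bn[of n] h]]
      L2_mult_integrable[OF an[of n] bn[of n]] L2_mult_integrable[OF g h]
    have "(\<integral>x. a n x * b n x \<partial>lborel) - (\<integral>x. g x * h x \<partial>lborel) = (\<integral>x. a n x * b n x - g x * h x \<partial>lborel)"
      using i by (intro Bochner_Integration.integral_diff[symmetric])
    also have "\<dots> = (\<integral>x. (a n x - g x) * b n x + g x * (b n x - h x) \<partial>lborel)"
      by (rule Bochner_Integration.integral_cong) (auto simp: algebra_simps)
    also have "\<dots> = (\<integral>x. (a n x - g x) * b n x \<partial>lborel) + (\<integral>x. g x * (b n x - h x) \<partial>lborel)"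
      using i by (intro Bochner_Integration.integral_add)
    also have "norm \<dots> \<le> norm (\<integral>x. (a n x - g x) * b n x \<partial>lborel) + norm (\<integral>x. g x * (b n x - h x) \<partial>lborel)"
      by (rule norm_triangle_ineq)
    also have "\<dots> \<le> l2n (\<lambda>x. a n x - g x) * l2n (b n) + l2n g * l2n (\<lambda>x. b n x - h x)"
      by (intro add_mono l2n_Cauchy_Schwarz L2_diff an bn g h)
    finally show "norm ((\<integral>x. a n x * b n x \<partial>lborel) - (\<integral>x. g x * h x \<partial>lborel))
      \<le> l2n (\<lambda>x. a n x - g x) * l2n (b n) + l2n g * l2n (\<lambda>x. b n x - h x)" .
  qed
qed

lemma F_multiplication_formula:
  assumes f: "L2 f" and g: "L2 g"
  shows "(\<integral>\<xi>. F f \<xi> * g \<xi> \<partial>lborel) = (\<integral>x. f x * F g x \<partial>lborel)"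
proof (rule LIMSEQ_unique)
  show "(\<lambda>n. \<integral>\<xi>. ft1 (trunc n f) \<xi> * trunc n g \<xi> \<partial>lborel) \<longlonglongrightarrow> (\<integral>\<xi>. F f \<xi> * g \<xi> \<partial>lborel)"
    using is_F_F[OF f] by (intro L2_tendsto_integral_mult ft1_trunc_L2 L2_trunc f g L2_F trunc_L2_tendsto) (auto simp: is_F_def)
  have "(\<lambda>n. \<integral>x. trunc n f x * ft1 (trunc n g) x \<partial>lborel) \<longlonglongrightarrow> (\<integral>x. f x * F g x \<partial>lborel)"
    using is_F_F[OF g] by (intro L2_tendsto_integral_mult ft1_trunc_L2 L2_trunc f g L2_F trunc_L2_tendsto) (auto simp: is_F_def)
  then show "(\<lambda>n. \<integral>\<xi>. ft1 (trunc n f) \<xi> * trunc n g \<xi> \<partial>lborel) \<longlonglongrightarrow> (\<integral>x. f x * F g x \<partial>lborel)"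
    by (simp only: ft1_multiplication_formula[OF integrable_trunc[OF f] integrable_trunc[OF g]])
qed

lemma F_L1:
  assumes f: "L2 f" and i: "integrable lborel f"
  shows "AE \<xi> in lborel. F f \<xi> = ft1 f \<xi>"
proof -
  note [measurable] = L2_measurable[OF f]
  have "AE \<xi> in lborel. ft1 f \<xi> = F f \<xi>"
  proof (rule l2n_limit_AE_eq[OF ft1_trunc_L2[OF f] L2_F[OF f]])
    show "AE \<xi> in lborel. (\<lambda>n. ft1 (trunc n f) \<xi>) \<longlonglongrightarrow> ft1 f \<xi>"
    proof (rule AE_I2)
      fix \<xi>
      show "(\<lambda>n. ft1 (trunc n f) \<xi>) \<longlonglongrightarrow> ft1 f \<xi>"
        unfolding ft1_def
      proof (rule tendsto_mult[OF tendsto_const], rule integral_dominated_convergence[where w = "\<lambda>x. cmod (f x)"])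
        show "AE x in lborel. (\<lambda>n. trunc n f x * cis (- (x * \<xi>))) \<longlonglongrightarrow> f x * cis (- (x * \<xi>))"
          by (intro AE_I2 tendsto_intros trunc_tendsto)
        show "AE x in lborel. norm (trunc n f x * cis (- (x * \<xi>))) \<le> cmod (f x)" for n
          by (simp add: norm_mult trunc_norm_le)
      qed (use i in \<open>simp_all\<close>)
    qed
    show "(\<lambda>n. l2n (\<lambda>x. ft1 (trunc n f) x - F f x)) \<longlonglongrightarrow> 0" using is_F_F[OF f] by (simp add: is_F_def)
  qed measurable
  then show ?thesis by eventually_elim simp
qed

definition F_inv :: "(real \<Rightarrow> complex) \<Rightarrow> real \<Rightarrow> complex" where
  "F_inv g x = F g (- x)"

lemma L2_F_inv [simp]: "L2 g \<Longrightarrow> L2 (F_inv g)"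
  using L2_reflect[OF L2_F] by (simp add: F_inv_def[abs_def])

lemma l2n_F_inv [simp]: "L2 g \<Longrightarrow> l2n (F_inv g) = l2n g"
  by (simp add: F_inv_def[abs_def])

lemma integral_mult_cnj_self: "(\<integral>x. f x * cnj (f x) \<partial>lborel) = complex_of_real ((l2n f)\<^sup>2)"
  unfolding l2n_sq by (subst integral_complex_of_real[symmetric]) (simp add: complex_norm_square del: of_real_power)

text \<open>
  With \<open>h = F (F_inv g)\<close> the multiplication formula gives \<open>\<langle>h, g\<rangle> = \<parallel>g\<parallel>\<^sup>2\<close>, and \<open>h\<close> has the same norm as
  \<open>g\<close>; expanding the square shows \<open>\<parallel>h - g\<parallel> = 0\<close>.
\<close>

lemma F_F_inv:
  assumes g: "L2 g" shows "AE x in lborel. F (F_inv g) x = g x"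
proof -
  define h where "h = F (F_inv g)"
  have h: "L2 h" "l2n h = l2n g" by (simp_all add: h_def g)
  have "(\<integral>x. h x * cnj (g x) \<partial>lborel) = (\<integral>x. F_inv g x * F (\<lambda>x. cnj (g x)) x \<partial>lborel)"
    unfolding h_def by (rule F_multiplication_formula) (simp_all add: g L2_cnj)
  also have "\<dots> = (\<integral>x. F_inv g x * cnj (F_inv g x) \<partial>lborel)"
  proof (rule integral_cong_AE)
    show "AE x in lborel. F_inv g x * F (\<lambda>x. cnj (g x)) x = F_inv g x * cnj (F_inv g x)"
      using F_cnj[OF g] by eventually_elim (simp add: F_inv_def)
  qed (use L2_measurable[OF L2_F_inv[OF g]] L2_measurable[OF L2_F[OF L2_cnj[OF g]]] in measurable)
  also have "\<dots> = complex_of_real ((l2n g)\<^sup>2)" by (simp only: integral_mult_cnj_self l2n_F_inv[OF g])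
  finally have ip: "(\<integral>x. h x * cnj (g x) \<partial>lborel) = complex_of_real ((l2n g)\<^sup>2)" .
  have "(l2n (\<lambda>x. h x - g x))\<^sup>2 = (\<integral>x. (cmod (h x))\<^sup>2 + (cmod (g x))\<^sup>2 - 2 * Re (h x * cnj (g x)) \<partial>lborel)"
    unfolding l2n_sq
  proof (rule Bochner_Integration.integral_cong[OF refl])
    fix x
    show "(cmod (h x - g x))\<^sup>2 = (cmod (h x))\<^sup>2 + (cmod (g x))\<^sup>2 - 2 * Re (h x * cnj (g x))"
      unfolding cmod_power2 by (simp add: power2_eq_square algebra_simps)
  qed
  also have "\<dots> = (l2n h)\<^sup>2 + (l2n g)\<^sup>2 - 2 * Re (\<integral>x. h x * cnj (g x) \<partial>lborel)"
  proof -
    have i: "integrable lborel (\<lambda>x. h x * cnj (g x))" by (rule L2_mult_integrable[OF h(1) L2_cnj[OF g]])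
    define C where "C x = Re (h x * cnj (g x))" for x
    have "integrable lborel C" unfolding C_def using i by (rule integrable_Re)
    moreover have "(\<integral>x. C x \<partial>lborel) = Re (\<integral>x. h x * cnj (g x) \<partial>lborel)"
      unfolding C_def by (rule integral_Re[OF i])
    ultimately show ?thesis
      using L2_integrable[OF h(1)] L2_integrable[OF g] unfolding C_def[symmetric] by (simp add: l2n_sq)
  qed
  also have "\<dots> = 0" unfolding ip by (simp add: h)
  finally have "l2n (\<lambda>x. h x - g x) = 0" by simp
  from l2n_eq_0D[OF L2_diff[OF h(1) g] this] show ?thesis by (simp add: h_def)
qed

lemma F_inv_F:
  assumes g: "L2 g" shows "AE x in lborel. F_inv (F g) x = g x"
  using F_F_inv[OF g] F_reflect[OF L2_F[OF g]]
  by eventually_elim (simp add: F_inv_def[abs_def])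

lemma parseval:
  assumes f: "L2 f" and g: "L2 g"
  shows "(\<integral>x. f x * cnj (g x) \<partial>lborel) = (\<integral>\<xi>. F f \<xi> * cnj (F g \<xi>) \<partial>lborel)"
proof -
  have "(\<integral>\<xi>. F f \<xi> * cnj (F g \<xi>) \<partial>lborel) = (\<integral>x. f x * F (\<lambda>\<xi>. cnj (F g \<xi>)) x \<partial>lborel)"
    by (rule F_multiplication_formula) (simp_all add: f g L2_cnj)
  also have "\<dots> = (\<integral>x. f x * cnj (g x) \<partial>lborel)"
  proof (rule integral_cong_AE)
    show "AE x in lborel. f x * F (\<lambda>\<xi>. cnj (F g \<xi>)) x = f x * cnj (g x)"
      using F_cnj[OF L2_F[OF g]] F_inv_F[OF g] by eventually_elim (simp add: F_inv_def)
  qed (use L2_measurable[OF f] L2_measurable[OF g] L2_measurable[OF L2_F[OF L2_cnj[OF L2_F[OF g]]]] in measurable)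
  finally show ?thesis by simp
qed

lemma F_injective:
  assumes f: "L2 f" and g: "L2 g" and eq: "AE \<xi> in lborel. F f \<xi> = F g \<xi>"
  shows "AE x in lborel. f x = g x"
proof -
  have "AE \<xi> in lborel. F (\<lambda>x. f x - g x) \<xi> = 0"
    using F_diff[OF f g] eq by eventually_elim simp
  then have "l2n (F (\<lambda>x. f x - g x)) = l2n (\<lambda>\<xi>. 0 :: complex)"
    by (intro l2n_cong_AE) (auto simp: L2_measurable L2_diff f g)
  then have "l2n (\<lambda>x. f x - g x) = 0" by (simp add: L2_diff f g) (simp add: l2n_def)
  from l2n_eq_0D[OF L2_diff[OF f g] this] show ?thesis by simp
qed

section \<open>The transform of real functions\<close>

lemma L2_fourier [simp]: "L2 f \<Longrightarrow> L2 (fourier f)"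
  by (simp add: fourier_eq_F L2_of_real)

lemma fourier_measurable [measurable]: "L2 f \<Longrightarrow> fourier f \<in> borel_measurable borel"
  by (simp add: L2_measurable)

lemma fourier_hermitian:
  assumes f: "L2 f" shows "AE \<xi> in lborel. fourier f (- \<xi>) = cnj (fourier f \<xi>)"
  using AE_reflect[OF F_cnj[OF L2_of_real[OF f]]] by (simp add: fourier_eq_F[OF f])

lemma fourier_add:
  "L2 f \<Longrightarrow> L2 g \<Longrightarrow> AE \<xi> in lborel. fourier (\<lambda>x. f x + g x) \<xi> = fourier f \<xi> + fourier g \<xi>"
  using F_add[OF L2_of_real L2_of_real, of f g] by (simp add: fourier_eq_F L2_add)

lemma fourier_diff:
  "L2 f \<Longrightarrow> L2 g \<Longrightarrow> AE \<xi> in lborel. fourier (\<lambda>x. f x - g x) \<xi> = fourier f \<xi> - fourier g \<xi>"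
  using F_diff[OF L2_of_real L2_of_real, of f g] by (simp add: fourier_eq_F L2_diff)

lemma fourier_cmult:
  "L2 f \<Longrightarrow> AE \<xi> in lborel. fourier (\<lambda>x. c * f x) \<xi> = complex_of_real c * fourier f \<xi>"
  using F_cmult[OF L2_of_real, of f "complex_of_real c"] by (simp add: fourier_eq_F L2_cmult)

lemma fourier_cong_AE:
  assumes "L2 f" "g \<in> borel_measurable borel" "AE x in lborel. f x = g x"
  shows "AE \<xi> in lborel. fourier g \<xi> = fourier f \<xi>"
proof -
  have "L2 g" by (rule L2_cong_AE[OF assms])
  moreover have "AE x in lborel. complex_of_real (f x) = complex_of_real (g x)"
    using assms(3) by eventually_elim simp
  ultimately show ?thesis using F_cong_AE[OF L2_of_real[OF assms(1)], of "\<lambda>x. complex_of_real (g x)"] assms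
    by (simp add: fourier_eq_F)
qed

lemma fourier_injective:
  assumes "L2 f" "L2 g" "AE \<xi> in lborel. fourier f \<xi> = fourier g \<xi>"
  shows "AE x in lborel. f x = g x"
  using F_injective[OF L2_of_real[OF assms(1)] L2_of_real[OF assms(2)]] assms by (simp add: fourier_eq_F)

text \<open>
  Hermitian symmetry is exactly what makes the inverse transform real.
\<close>

lemma fourier_surjective:
  assumes h: "L2 h" and herm: "AE \<xi> in lborel. h (- \<xi>) = cnj (h \<xi>)"
  shows "\<exists>g. L2 g \<and> (AE \<xi> in lborel. fourier g \<xi> = h \<xi>)"
proof -
  have "AE \<xi> in lborel. F (\<lambda>\<xi>. cnj (h \<xi>)) \<xi> = F (\<lambda>\<xi>. h (- \<xi>)) \<xi>"
    by (rule F_cong_AE[OF L2_reflect[OF h]]) (use herm L2_measurable[OF L2_cnj[OF h]] in auto)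
  then have real: "AE x in lborel. F_inv h x = complex_of_real (Re (F_inv h x))"
    using F_cnj[OF h] F_reflect[OF h]
  proof eventually_elim
    case (elim x)
    then have "cnj (F_inv h x) = F_inv h x" by (simp add: F_inv_def)
    then show ?case by (simp add: complex_eq_iff)
  qed
  define g where "g x = Re (F_inv h x)" for x
  have [measurable]: "F_inv h \<in> borel_measurable borel" using h by (simp add: L2_measurable)
  have [measurable]: "g \<in> borel_measurable borel" unfolding g_def by measurable
  have "L2 g"
    by (rule L2_bound[OF L2_F_inv[OF h], of _ 1]) (auto simp: g_def abs_Re_le_cmod)
  moreover have "AE \<xi> in lborel. F (\<lambda>x. complex_of_real (g x)) \<xi> = F (F_inv h) \<xi>"
    by (rule F_cong_AE[OF L2_F_inv[OF h]]) (use real in \<open>auto simp: g_def\<close>)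
  ultimately show ?thesis using F_F_inv[OF h]
    by (intro exI[of _ g]) (auto simp: fourier_eq_F elim!: eventually_elim2)
qed

lemma fourier_zero: "AE \<xi> in lborel. fourier (\<lambda>x. 0) \<xi> = 0"
  using fourier_cmult[OF L2_zero, of 0] by simp

section \<open>Smooth bump functions\<close>

text \<open>
  The polynomial in \<open>1/x\<close> is carried along because differentiation produces it.
\<close>

definition flat_exp :: "real poly \<Rightarrow> real \<Rightarrow> real" where
  "flat_exp p x = (if x > 0 then poly p (1 / x) * exp (- (1 / x)) else 0)"

lemma poly_exp_tendsto_0: "((\<lambda>y::real. poly p y * exp (- y)) \<longlongrightarrow> 0) at_top"
proof -
  have "((\<lambda>y::real. \<Sum>i\<le>degree p. coeff p i * (y ^ i / exp y)) \<longlongrightarrow> (\<Sum>i\<le>degree p. coeff p i * 0)) at_top"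
    by (intro tendsto_sum tendsto_mult tendsto_const tendsto_power_div_exp_0)
  then show ?thesis
    by (simp add: poly_altdef sum_distrib_right exp_minus divide_inverse mult.assoc)
qed

lemma flat_exp_deriv:
  "(flat_exp p has_real_derivative flat_exp (monom 1 2 * (p - pderiv p)) x) (at x)"
proof -
  consider "x > 0" | "x < 0" | "x = 0" by linarith
  then show ?thesis
  proof cases
    case 1
    have "((\<lambda>x. poly p (1 / x) * exp (- (1 / x))) has_real_derivative
        poly (monom 1 2 * (p - pderiv p)) (1 / x) * exp (- (1 / x))) (at x)"
      using 1 by (auto intro!: derivative_eq_intros poly_DERIV[THEN DERIV_chain2] simp: poly_monom power2_eq_square field_simps)
    then have "((\<lambda>x. poly p (1 / x) * exp (- (1 / x))) has_real_derivative flat_exp (monom 1 2 * (p - pderiv p)) x) (at x)"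
      using 1 by (simp add: flat_exp_def)
    moreover have "\<forall>\<^sub>F y in nhds x. flat_exp p y = poly p (1 / y) * exp (- (1 / y))"
      using eventually_nhds_in_open[of "{0<..}" x] 1 by (auto elim!: eventually_mono simp: flat_exp_def)
    ultimately show ?thesis by (subst DERIV_cong_ev[OF refl _ refl]) auto
  next
    case 2
    have "\<forall>\<^sub>F y in nhds x. flat_exp p y = 0"
      using eventually_nhds_in_open[of "{..<0}" x] 2 by (auto elim!: eventually_mono simp: flat_exp_def)
    then have "(flat_exp p has_real_derivative 0) (at x)" by (subst DERIV_cong_ev[OF refl _ refl]) auto
    then show ?thesis using 2 by (simp add: flat_exp_def)
  next
    case 3
    have "((\<lambda>y. flat_exp p y / y) \<longlongrightarrow> 0) (at 0)"
    proof (rule filterlim_split_at)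
      have "\<forall>\<^sub>F y in at_left (0::real). y < 0" by (simp add: eventually_at_filter)
      then have "\<forall>\<^sub>F y in at_left 0. flat_exp p y / y = 0" by eventually_elim (simp add: flat_exp_def)
      then show "((\<lambda>y. flat_exp p y / y) \<longlongrightarrow> 0) (at_left 0)" by (rule tendsto_eventually)
      have "((\<lambda>y. poly (p * [:0, 1:]) (inverse y) * exp (- inverse y)) \<longlongrightarrow> 0) (at_right (0::real))"
        by (rule filterlim_compose[OF poly_exp_tendsto_0 filterlim_inverse_at_top_right])
      moreover have "\<forall>\<^sub>F y in at_right (0::real). y > 0" by (simp add: eventually_at_filter)
      then have "\<forall>\<^sub>F y in at_right 0. poly (p * [:0, 1:]) (inverse y) * exp (- inverse y) = flat_exp p y / y"
        by eventually_elim (simp add: flat_exp_def divide_inverse)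
      ultimately show "((\<lambda>y. flat_exp p y / y) \<longlongrightarrow> 0) (at_right 0)" by (rule Lim_transform_eventually)
    qed
    then show ?thesis using 3 by (simp add: has_field_derivative_iff flat_exp_def[of _ 0])
  qed
qed

text \<open>
  Functions supported where \<open>\<bar>a x + b\<bar> \<le> 1\<close>. Admitting polynomial factors and sums closes the set under
  differentiation, so all its elements are smooth.
\<close>

inductive_set bumps :: "real \<Rightarrow> real \<Rightarrow> (real \<Rightarrow> real) set" for a b where
  base: "(\<lambda>x. c * (flat_exp p (1 + (a * x + b)) * flat_exp q (1 - (a * x + b)))) \<in> bumps a b"
| add: "f \<in> bumps a b \<Longrightarrow> g \<in> bumps a b \<Longrightarrow> (\<lambda>x. f x + g x) \<in> bumps a b"

lemma bumps_deriv: "f \<in> bumps a b \<Longrightarrow> \<exists>f'\<in>bumps a b. \<forall>x. (f has_real_derivative f' x) (at x)"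
proof (induction rule: bumps.induct)
  case (base c p q)
  define p' q' where "p' = monom 1 2 * (p - pderiv p)" and "q' = monom 1 2 * (q - pderiv q)"
  define D where "D x = (c * a) * (flat_exp p' (1 + (a * x + b)) * flat_exp q (1 - (a * x + b)))
      + (- c * a) * (flat_exp p (1 + (a * x + b)) * flat_exp q' (1 - (a * x + b)))" for x
  have "((\<lambda>x. c * (flat_exp p (1 + (a * x + b)) * flat_exp q (1 - (a * x + b)))) has_real_derivative D x) (at x)" for x
    unfolding p'_def q'_def D_def
    by (rule derivative_eq_intros DERIV_chain2[OF flat_exp_deriv] refl)+ (simp add: algebra_simps)
  moreover have "D \<in> bumps a b" unfolding D_def by (rule bumps.add[OF bumps.base bumps.base])
  ultimately show ?case by blast
next
  case (add f g)
  then obtain f' g' where "f' \<in> bumps a b" "g' \<in> bumps a b"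
    "\<forall>x. (f has_real_derivative f' x) (at x)" "\<forall>x. (g has_real_derivative g' x) (at x)" by blast
  then show ?case
    by (intro bexI[of _ "\<lambda>x. f' x + g' x"]) (auto intro!: DERIV_add bumps.add)
qed

lemma bumps_deriv_in:
  assumes "f \<in> bumps a b" shows "deriv f \<in> bumps a b" "(f has_real_derivative deriv f x) (at x)"
proof -
  obtain f' where f': "f' \<in> bumps a b" "\<forall>x. (f has_real_derivative f' x) (at x)"
    using bumps_deriv[OF assms] by blast
  then have "deriv f = f'" by (intro ext DERIV_imp_deriv) auto
  then show "deriv f \<in> bumps a b" "(f has_real_derivative deriv f x) (at x)" using f' by auto
qed

lemma bumps_supp: "f \<in> bumps a b \<Longrightarrow> \<bar>a * x + b\<bar> \<ge> 1 \<Longrightarrow> f x = 0"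
  by (induction rule: bumps.induct) (auto simp: flat_exp_def)

lemma bumps_test_function:
  assumes f: "f \<in> bumps a b" and a: "a \<noteq> 0" shows "test_function f"
  unfolding test_function_def
proof (intro conjI allI)
  fix k x
  have "(deriv ^^ k) f \<in> bumps a b" by (induction k) (auto simp: f bumps_deriv_in)
  from bumps_deriv_in(2)[OF this] show "(deriv ^^ k) f differentiable (at x)"
    by (auto simp: real_differentiable_def)
next
  show "\<exists>R. \<forall>x. R < \<bar>x\<bar> \<longrightarrow> f x = 0"
  proof (intro exI[of _ "(1 + \<bar>b\<bar>) / \<bar>a\<bar>"] allI impI)
    fix x assume "(1 + \<bar>b\<bar>) / \<bar>a\<bar> < \<bar>x\<bar>"
    then have "1 + \<bar>b\<bar> < \<bar>a * x\<bar>" using a by (simp add: field_simps abs_mult)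
    then show "f x = 0" by (intro bumps_supp[OF f]) linarith
  qed
qed

definition bump :: "real \<Rightarrow> real" where
  "bump x = flat_exp 1 (1 + x) * flat_exp 1 (1 - x)"

lemma bump_test: "a \<noteq> 0 \<Longrightarrow> test_function (\<lambda>x. bump (a * x + b))"
  using bumps_test_function[OF bumps.base[of 1 1 a b 1]] by (simp add: bump_def)

lemma test_function_has_derivative:
  assumes "test_function \<phi>"
  shows "(\<phi> has_real_derivative deriv \<phi> x) (at x)" "continuous_on UNIV \<phi>" "continuous_on UNIV (deriv \<phi>)"
proof -
  have d: "(deriv ^^ k) \<phi> differentiable (at x)" for k x using assms by (simp add: test_function_def)
  show "(\<phi> has_real_derivative deriv \<phi> x) (at x)"
    using d[of 0 x] by (auto simp: real_differentiable_def DERIV_imp_deriv)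
  show "continuous_on UNIV \<phi>" "continuous_on UNIV (deriv \<phi>)"
    using d[of 0] d[of 1] by (auto intro!: continuous_at_imp_continuous_on differentiable_imp_continuous_within)
qed

lemma test_function_support:
  assumes "test_function \<phi>"
  obtains R where "R > 0" "\<And>x. \<bar>x\<bar> > R \<Longrightarrow> \<phi> x = 0" "\<And>x. \<bar>x\<bar> > R \<Longrightarrow> deriv \<phi> x = 0"
proof -
  obtain R0 where R0: "\<And>x. \<bar>x\<bar> > R0 \<Longrightarrow> \<phi> x = 0" using assms by (auto simp: test_function_def)
  define R where "R = max R0 1"
  have R: "R > 0" "\<And>x. \<bar>x\<bar> > R \<Longrightarrow> \<phi> x = 0" using R0 by (auto simp: R_def)
  have "deriv \<phi> x = 0" if "\<bar>x\<bar> > R" for x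
  proof (rule DERIV_imp_deriv)
    have "open {y::real. R < \<bar>y\<bar>}" by (intro open_Collect_less continuous_intros)
    then have "\<forall>\<^sub>F y in nhds x. \<phi> y = 0"
      using eventually_nhds_in_open[of "{y. R < \<bar>y\<bar>}" x] that R(2) by (auto elim!: eventually_mono)
    then show "(\<phi> has_real_derivative 0) (at x)" by (subst DERIV_cong_ev[OF refl _ refl]) auto
  qed
  with R that show ?thesis by blast
qed

lemma continuous_compact_support_L2:
  fixes f :: "real \<Rightarrow> real"
  assumes c: "continuous_on UNIV f" and s: "\<And>x. \<bar>x\<bar> > R \<Longrightarrow> f x = 0"
  shows "L2 f" "integrable lborel f"
proof -
  have "compact (f ` {-R..R})" using c by (intro compact_continuous_image) (auto intro: continuous_on_subset)
  then obtain M where "\<forall>y\<in>f ` {-R..R}. norm y \<le> M"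
    using compact_imp_bounded[of "f ` {-R..R}"] unfolding bounded_iff by blast
  then have M: "\<bar>f x\<bar> \<le> M" if "x \<in> {-R..R}" for x using that by auto
  have "\<bar>f x\<bar> \<le> max M 0" for x
  proof (cases "\<bar>x\<bar> > R")
    case False
    then have "\<bar>f x\<bar> \<le> M" by (intro M) auto
    then show ?thesis by simp
  qed (simp add: s)
  then show L: "L2 f" using s by (intro L2_bounded_support[of f "max M 0" R] borel_measurable_continuous_onI c) auto
  show "integrable lborel f" by (rule integrable_bounded_support[OF L s])
qed

lemma test_function_L2:
  assumes "test_function \<phi>"
  shows "L2 \<phi>" "L2 (deriv \<phi>)" "integrable lborel \<phi>" "integrable lborel (deriv \<phi>)"
proof -
  obtain R where R: "R > 0" "\<And>x. \<bar>x\<bar> > R \<Longrightarrow> \<phi> x = 0" "\<And>x. \<bar>x\<bar> > R \<Longrightarrow> deriv \<phi> x = 0"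
    using test_function_support[OF assms] by blast
  note c = test_function_has_derivative[OF assms]
  show "L2 \<phi>" "L2 (deriv \<phi>)" "integrable lborel \<phi>" "integrable lborel (deriv \<phi>)"
    using continuous_compact_support_L2[OF c(2) R(2)] continuous_compact_support_L2[OF c(3) R(3)] by auto
qed

text \<open>
  Integration by parts, in the form that the derivative of \<open>\<phi>(x) e\<^bsup>-\<i>x\<xi>\<^esup>\<close> has integral zero.
\<close>

lemma ft1_deriv_test_function:
  assumes t: "test_function \<phi>"
  shows "ft1 (\<lambda>x. complex_of_real (deriv \<phi> x)) \<xi> = \<i> * complex_of_real \<xi> * ft1 (\<lambda>x. complex_of_real (\<phi> x)) \<xi>"
proof -
  obtain R where R: "R > 0" "\<And>x. \<bar>x\<bar> > R \<Longrightarrow> \<phi> x = 0" "\<And>x. \<bar>x\<bar> > R \<Longrightarrow> deriv \<phi> x = 0"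
    using test_function_support[OF t] by blast
  note d = test_function_has_derivative[OF t]
  define \<Phi> where "\<Phi> x = complex_of_real (\<phi> x) * cis (- (x * \<xi>))" for x
  define \<Phi>' where "\<Phi>' x = complex_of_real (deriv \<phi> x) * cis (- (x * \<xi>)) - \<i> * complex_of_real \<xi> * (complex_of_real (\<phi> x) * cis (- (x * \<xi>)))" for x
  have cis_d: "((\<lambda>x. cis (- (x * \<xi>))) has_vector_derivative (- \<i> * complex_of_real \<xi> * cis (- (x * \<xi>)))) (at x)" for x
  proof -
    have "((\<lambda>z. exp (- \<i> * complex_of_real \<xi> * z)) has_field_derivative
        (- \<i> * complex_of_real \<xi> * exp (- \<i> * complex_of_real \<xi> * complex_of_real x))) (at (complex_of_real x))"
      by (auto intro!: derivative_eq_intros)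
    from has_vector_derivative_real_field[OF this] show ?thesis
      by (simp add: cis_conv_exp mult_ac)
  qed
  have der: "(\<Phi> has_vector_derivative \<Phi>' x) (at x)" for x
  proof -
    have "((\<lambda>x. complex_of_real (\<phi> x)) has_vector_derivative complex_of_real (deriv \<phi> x)) (at x)"
      by (rule has_vector_derivative_of_real[OF d(1)[of x]])
    from has_vector_derivative_mult[OF this cis_d[of x]] show ?thesis
      by (simp add: \<Phi>_def[abs_def] \<Phi>'_def algebra_simps)
  qed
  have cont: "continuous_on UNIV \<Phi>'"
    unfolding \<Phi>'_def using d(2,3) by (intro continuous_intros) auto
  have "(\<integral>x. indicator {-(R+1)..R+1} x *\<^sub>R \<Phi>' x \<partial>lborel) = \<Phi> (R+1) - \<Phi> (-(R+1))"
    using R(1) der cont by (intro integral_FTC_Icc) (auto intro: has_vector_derivative_at_within continuous_on_subset)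
  also have "\<dots> = 0" using R by (simp add: \<Phi>_def)
  also have "(\<lambda>x. indicator {-(R+1)..R+1} x *\<^sub>R \<Phi>' x) = \<Phi>'"
    using R by (intro ext) (auto simp: \<Phi>'_def indicator_def)
  finally have z: "(\<integral>x. \<Phi>' x \<partial>lborel) = 0" .
  have i: "integrable lborel (\<lambda>x. complex_of_real (deriv \<phi> x) * cis (- (x * \<xi>)))"
      "integrable lborel (\<lambda>x. complex_of_real (\<phi> x) * cis (- (x * \<xi>)))"
    using test_function_L2[OF t] by (auto intro!: integrable_mult_cis)
  have "(\<integral>x. \<Phi>' x \<partial>lborel) = (\<integral>x. complex_of_real (deriv \<phi> x) * cis (- (x * \<xi>)) \<partial>lborel)
      - \<i> * complex_of_real \<xi> * (\<integral>x. complex_of_real (\<phi> x) * cis (- (x * \<xi>)) \<partial>lborel)"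
    unfolding \<Phi>'_def using i by (subst Bochner_Integration.integral_diff) (auto simp: integral_mult_right_zero)
  with z have "(\<integral>x. complex_of_real (deriv \<phi> x) * cis (- (x * \<xi>)) \<partial>lborel)
      = \<i> * complex_of_real \<xi> * (\<integral>x. complex_of_real (\<phi> x) * cis (- (x * \<xi>)) \<partial>lborel)" by simp
  then show ?thesis by (simp only: ft1_def mult_ac)
qed

lemma fourier_L1:
  assumes "L2 f" "integrable lborel f"
  shows "AE \<xi> in lborel. fourier f \<xi> = ft1 (\<lambda>x. complex_of_real (f x)) \<xi>"
  using F_L1[OF L2_of_real[OF assms(1)]] assms by (simp add: fourier_eq_F)

lemma fourier_deriv_test_function:
  assumes t: "test_function \<phi>"
  shows "AE \<xi> in lborel. fourier (deriv \<phi>) \<xi> = \<i> * complex_of_real \<xi> * fourier \<phi> \<xi>"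
  using fourier_L1[OF test_function_L2(1,3)[OF t]] fourier_L1[OF test_function_L2(2,4)[OF t]]
  by eventually_elim (simp add: ft1_deriv_test_function[OF t])

lemma parseval_real:
  assumes "L2 f" "L2 g"
  shows "complex_of_real (\<integral>x. f x * g x \<partial>lborel) = (\<integral>\<xi>. fourier f \<xi> * cnj (fourier g \<xi>) \<partial>lborel)"
  using parseval[OF L2_of_real[OF assms(1)] L2_of_real[OF assms(2)]] assms
  by (simp add: fourier_eq_F flip: of_real_mult)

lemma bump_nonneg: "0 \<le> bump x" and bump_pos: "\<bar>x\<bar> < 1 \<Longrightarrow> 0 < bump x"
  by (auto simp: bump_def flat_exp_def)

lemma integral_bump_pos: "0 < (\<integral>x. bump x \<partial>lborel)"
proof -
  have t: "test_function bump" using bump_test[of 1 0] by simp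
  have "(\<integral>x. bump x \<partial>lborel) \<noteq> 0"
  proof
    assume "(\<integral>x. bump x \<partial>lborel) = 0"
    then have "AE x in lborel. bump x = 0"
      using integral_nonneg_eq_0_iff_AE[OF test_function_L2(3)[OF t]] by (simp add: bump_nonneg)
    then have "AE x in lborel. x \<notin> {-1<..<1::real}"
      by eventually_elim (use bump_pos in \<open>auto simp: abs_less_iff, fastforce\<close>)
    then have "{-1<..<1::real} \<in> null_sets lborel"
      by (subst AE_iff_null_sets) auto
    then show False by (simp add: null_sets_def)
  qed
  moreover have "0 \<le> (\<integral>x. bump x \<partial>lborel)" by (intro Bochner_Integration.integral_nonneg bump_nonneg)
  ultimately show ?thesis by linarith
qed

text \<open>
  Testing against all translates of a rescaled bump \<open>P\<close> says that the integrable function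
  \<open>d^ \<cdot> cnj P^\<close> has vanishing Fourier transform, hence vanishes; as the scale shrinks,
  \<open>P^\<close> is eventually nonzero at any given frequency.
\<close>

lemma test_functions_separate:
  assumes d: "L2 d" and z: "\<And>\<phi>. test_function \<phi> \<Longrightarrow> (\<integral>x. d x * \<phi> x \<partial>lborel) = 0"
  shows "AE x in lborel. d x = 0"
proof -
  have zero: "AE \<xi> in lborel. fourier d \<xi> * cnj (ft1 (\<lambda>x. complex_of_real (bump (real (Suc n) * x))) \<xi>) = 0" for n
  proof -
    define P where "P x = complex_of_real (bump (real (Suc n) * x))" for x
    have t: "test_function (\<lambda>x. bump (real (Suc n) * x + b))" for b by (rule bump_test) simp
    have PL: "integrable lborel P" unfolding P_def using test_function_L2(3)[OF t[of 0]] by simp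
    define H where "H \<xi> = fourier d \<xi> * cnj (ft1 P \<xi>)" for \<xi>
    have [measurable]: "P \<in> borel_measurable borel" using PL by auto
    note [measurable] = fourier_measurable[OF d]
    have FP: "AE \<xi> in lborel. fourier (\<lambda>x. bump (real (Suc n) * x)) \<xi> = ft1 P \<xi>"
      using fourier_L1[OF test_function_L2(1,3)[OF t[of 0]]] by (simp add: P_def[abs_def])
    have ftP: "L2 (ft1 P)"
      using L2_cong_AE[OF L2_fourier[OF test_function_L2(1)[OF t[of 0]]], of "ft1 P"] FP by simp
    have Hi: "integrable lborel H"
      unfolding H_def by (rule L2_mult_integrable[OF L2_fourier[OF d] L2_cnj[OF ftP]])
    have [measurable]: "H \<in> borel_measurable borel" unfolding H_def by measurable
    have HL: "L2 H"
    proof (rule L2_bound[OF L2_fourier[OF d]])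
      show "AE \<xi> in lborel. norm (H \<xi>) \<le> fc * (\<integral>x. cmod (P x) \<partial>lborel) * norm (fourier d \<xi>)"
        using mult_right_mono[OF ft1_bound[OF PL] norm_ge_zero] by (intro AE_I2) (simp add: H_def norm_mult mult.commute)
    qed measurable
    have ftH: "ft1 H (- y) = 0" for y
    proof -
      have sh: "ft1 (\<lambda>x. P (x - y)) \<xi> = cis (- (y * \<xi>)) * ft1 P \<xi>" for \<xi>
      proof -
        have "(\<integral>x. P (x - y) * cis (- (x * \<xi>)) \<partial>lborel) = (\<integral>x. cis (- (y * \<xi>)) * (P x * cis (- (x * \<xi>))) \<partial>lborel)"
        proof -
          have "(\<integral>x. P (x - y) * cis (- (x * \<xi>)) \<partial>lborel) = (\<integral>x. P x * cis (- ((y + x) * \<xi>)) \<partial>lborel)"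
            using lborel_integral_real_affine[of 1 "\<lambda>x. P (x - y) * cis (- (x * \<xi>))" y] by simp
          also have "\<dots> = (\<integral>x. cis (- (y * \<xi>)) * (P x * cis (- (x * \<xi>))) \<partial>lborel)"
          proof (rule Bochner_Integration.integral_cong[OF refl])
            fix x
            have "cis (- ((y + x) * \<xi>)) = cis (- (y * \<xi>)) * cis (- (x * \<xi>))" by (simp add: cis_mult algebra_simps)
            then show "P x * cis (- ((y + x) * \<xi>)) = cis (- (y * \<xi>)) * (P x * cis (- (x * \<xi>)))" by (simp only: mult_ac)
          qed
          finally show ?thesis .
        qed
        also have "\<dots> = cis (- (y * \<xi>)) * (\<integral>x. P x * cis (- (x * \<xi>)) \<partial>lborel)" by (rule integral_mult_right_zero)
        finally show ?thesis by (simp only: ft1_def mult_ac)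
      qed
      have ty: "test_function (\<lambda>x. bump (real (Suc n) * x + (- real (Suc n) * y)))" by (rule t)
      have eqy: "complex_of_real (bump (real (Suc n) * x + (- real (Suc n) * y))) = P (x - y)" for x
        by (simp add: P_def algebra_simps)
      have "AE \<xi> in lborel. fourier (\<lambda>x. bump (real (Suc n) * x + (- real (Suc n) * y))) \<xi> = cis (- (y * \<xi>)) * ft1 P \<xi>"
        using fourier_L1[OF test_function_L2(1,3)[OF ty]] unfolding eqy sh .
      then have "(\<integral>\<xi>. fourier d \<xi> * cnj (fourier (\<lambda>x. bump (real (Suc n) * x + (- real (Suc n) * y))) \<xi>) \<partial>lborel)
          = (\<integral>\<xi>. H \<xi> * cis (- (\<xi> * - y)) \<partial>lborel)"
      proof (intro integral_cong_AE, goal_cases)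
        case 3 then show ?case by eventually_elim (simp add: H_def cis_cnj mult_ac)
      qed (use fourier_measurable[OF test_function_L2(1)[OF ty]] in \<open>auto simp: H_def\<close>)
      moreover have "(\<integral>\<xi>. fourier d \<xi> * cnj (fourier (\<lambda>x. bump (real (Suc n) * x + (- real (Suc n) * y))) \<xi>) \<partial>lborel) = 0"
        using parseval_real[OF d test_function_L2(1)[OF ty]] z[OF ty] by simp
      ultimately show ?thesis by (simp add: ft1_def)
    qed
    have "AE \<xi> in lborel. F H \<xi> = 0"
      using F_L1[OF HL Hi]
    proof eventually_elim
      case (elim \<xi>) then show ?case using ftH[of "- \<xi>"] by simp
    qed
    then have "AE \<xi> in lborel. F H \<xi> = F (\<lambda>x. 0) \<xi>"
      using F_cmult[OF L2_zero, of 0] by eventually_elim simp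
    from F_injective[OF HL L2_zero this] show ?thesis by (simp add: H_def P_def[abs_def])
  qed
  have nonzero: "\<exists>n. ft1 (\<lambda>x. complex_of_real (bump (real (Suc n) * x))) \<xi> \<noteq> 0" for \<xi>
  proof -
    have t: "test_function bump" using bump_test[of 1 0] by simp
    have [measurable]: "bump \<in> borel_measurable borel" using test_function_L2(3)[OF t] by auto
    have "(\<lambda>n. \<integral>x. complex_of_real (bump x) * cis (- (inverse (real (Suc n)) * (x * \<xi>))) \<partial>lborel)
        \<longlonglongrightarrow> (\<integral>x. complex_of_real (bump x) * cis (- (0 * (x * \<xi>))) \<partial>lborel)"
    proof (rule integral_dominated_convergence[where w = bump])
      show "AE x in lborel. (\<lambda>n. complex_of_real (bump x) * cis (- (inverse (real (Suc n)) * (x * \<xi>))))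
          \<longlonglongrightarrow> complex_of_real (bump x) * cis (- (0 * (x * \<xi>)))"
        by (intro AE_I2 tendsto_intros LIMSEQ_inverse_real_of_nat)
      show "AE x in lborel. norm (complex_of_real (bump x) * cis (- (inverse (real (Suc n)) * (x * \<xi>)))) \<le> bump x" for n
        by (simp add: norm_mult bump_nonneg)
    qed (use test_function_L2(3)[OF t] in auto)
    then have lim: "(\<lambda>n. \<integral>x. complex_of_real (bump x) * cis (- (inverse (real (Suc n)) * (x * \<xi>))) \<partial>lborel)
        \<longlonglongrightarrow> complex_of_real (\<integral>x. bump x \<partial>lborel)" by simp
    have "complex_of_real (\<integral>x. bump x \<partial>lborel) \<noteq> 0" using integral_bump_pos by simp
    from tendsto_imp_eventually_ne[OF lim this]
    obtain n where n: "(\<integral>x. complex_of_real (bump x) * cis (- (inverse (real (Suc n)) * (x * \<xi>))) \<partial>lborel) \<noteq> 0"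
      by (auto simp: eventually_sequentially)
    have "(\<integral>x. complex_of_real (bump x) * cis (- (inverse (real (Suc n)) * (x * \<xi>))) \<partial>lborel)
       = real (Suc n) *\<^sub>R (\<integral>x. complex_of_real (bump (real (Suc n) * x)) * cis (- (x * \<xi>)) \<partial>lborel)"
      using lborel_integral_real_affine[of "real (Suc n)" "\<lambda>x. complex_of_real (bump x) * cis (- (inverse (real (Suc n)) * (x * \<xi>)))" 0]
      by (simp add: mult.assoc[symmetric] del: of_nat_Suc)
    then have "(\<integral>x. complex_of_real (bump (real (Suc n) * x)) * cis (- (x * \<xi>)) \<partial>lborel) \<noteq> 0" using n by auto
    then show ?thesis using fc_pos unfolding ft1_def by (intro exI[of _ n]) (simp del: fc_pos of_nat_Suc)
  qed
  have "AE \<xi> in lborel. \<forall>n. fourier d \<xi> * cnj (ft1 (\<lambda>x. complex_of_real (bump (real (Suc n) * x))) \<xi>) = 0"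
    unfolding AE_all_countable using zero by blast
  then have "AE \<xi> in lborel. fourier d \<xi> = fourier (\<lambda>x. 0) \<xi>" using fourier_zero
  proof eventually_elim
    case (elim \<xi>)
    then show ?case using nonzero[of \<xi>] by auto
  qed
  from fourier_injective[OF d L2_zero this] show ?thesis .
qed

section \<open>Derivatives, inverse elliptic operator and products\<close>

text \<open>
  The function with transform \<open>\<i>\<xi>f^\<close> satisfies the defining identity of the weak derivative by
  Parseval's formula, and any other function satisfying it agrees with this one because test
  functions separate.
\<close>

lemma weak_deriv_fourier:
  assumes f: "L2 f" and x: "L2 (\<lambda>\<xi>. complex_of_real \<xi> * fourier f \<xi>)"
  shows "L2 (weak_deriv f) \<and> (AE \<xi> in lborel. fourier (weak_deriv f) \<xi> = \<i> * complex_of_real \<xi> * fourier f \<xi>)"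
proof -
  define h where "h \<xi> = \<i> * (complex_of_real \<xi> * fourier f \<xi>)" for \<xi>
  have hL: "L2 h" unfolding h_def by (rule L2_cmult[OF x])
  have "AE \<xi> in lborel. h (- \<xi>) = cnj (h \<xi>)"
    using fourier_hermitian[OF f] by eventually_elim (simp add: h_def)
  from fourier_surjective[OF hL this] obtain g where g: "L2 g" "AE \<xi> in lborel. fourier g \<xi> = h \<xi>" by blast
  have gw: "(\<integral>x. f x * deriv \<phi> x \<partial>lborel) = - (\<integral>x. g x * \<phi> x \<partial>lborel)" if t: "test_function \<phi>" for \<phi>
  proof -
    have "complex_of_real (\<integral>x. f x * deriv \<phi> x \<partial>lborel) = (\<integral>\<xi>. fourier f \<xi> * cnj (fourier (deriv \<phi>) \<xi>) \<partial>lborel)"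
      by (rule parseval_real[OF f test_function_L2(2)[OF t]])
    also have "\<dots> = (\<integral>\<xi>. - (fourier g \<xi> * cnj (fourier \<phi> \<xi>)) \<partial>lborel)"
    proof (rule integral_cong_AE)
      show "AE \<xi> in lborel. fourier f \<xi> * cnj (fourier (deriv \<phi>) \<xi>) = - (fourier g \<xi> * cnj (fourier \<phi> \<xi>))"
        using fourier_deriv_test_function[OF t] g(2) by eventually_elim (simp add: h_def)
    qed (use fourier_measurable[OF f] fourier_measurable[OF g(1)] fourier_measurable[OF test_function_L2(1)[OF t]]
          fourier_measurable[OF test_function_L2(2)[OF t]] in measurable)
    also have "\<dots> = - complex_of_real (\<integral>x. g x * \<phi> x \<partial>lborel)"
      by (simp add: parseval_real[OF g(1) test_function_L2(1)[OF t]])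
    finally show ?thesis by (metis of_real_eq_iff of_real_minus)
  qed
  define W where "W = weak_deriv f"
  have W: "L2 W \<and> (\<forall>\<phi>. test_function \<phi> \<longrightarrow> (\<integral>x. f x * deriv \<phi> x \<partial>lborel) = - (\<integral>x. W x * \<phi> x \<partial>lborel))"
    unfolding W_def weak_deriv_def by (rule someI[of _ g]) (use g gw in blast)
  have "AE x in lborel. W x - g x = 0"
  proof (rule test_functions_separate)
    show "L2 (\<lambda>x. W x - g x)" using W g by (intro L2_diff) auto
    fix \<phi> assume t: "test_function \<phi>"
    have i: "integrable lborel (\<lambda>x. W x * \<phi> x)" "integrable lborel (\<lambda>x. g x * \<phi> x)"
      using W g test_function_L2(1)[OF t] by (auto intro: L2_mult_integrable)
    have "(\<integral>x. (W x - g x) * \<phi> x \<partial>lborel) = (\<integral>x. W x * \<phi> x - g x * \<phi> x \<partial>lborel)" by (simp add: algebra_simps)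
    also have "\<dots> = (\<integral>x. W x * \<phi> x \<partial>lborel) - (\<integral>x. g x * \<phi> x \<partial>lborel)" using i by (rule Bochner_Integration.integral_diff)
    also have "\<dots> = 0" using W gw[OF t] t by auto
    finally show "(\<integral>x. (W x - g x) * \<phi> x \<partial>lborel) = 0" .
  qed
  then have "AE x in lborel. g x = W x" by eventually_elim simp
  then have "AE \<xi> in lborel. fourier W \<xi> = fourier g \<xi>"
    using fourier_cong_AE[OF g(1), of W] W by (auto simp: L2_measurable elim: eventually_mono)
  then have "AE \<xi> in lborel. fourier W \<xi> = \<i> * complex_of_real \<xi> * fourier f \<xi>"
    using g(2) by eventually_elim (simp add: h_def)
  then show ?thesis using W by (simp add: W_def)
qed

lemma Lambda_inv4_fourier:
  assumes f: "L2 f"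
  shows "L2 (Lambda_inv4 f) \<and> (AE \<xi> in lborel. fourier (Lambda_inv4 f) \<xi> = fourier f \<xi> / complex_of_real ((1 + \<xi>\<^sup>2)\<^sup>2))"
proof -
  define h where "h \<xi> = fourier f \<xi> / complex_of_real ((1 + \<xi>\<^sup>2)\<^sup>2)" for \<xi>
  have "L2 h"
  proof (rule L2_bound[OF L2_fourier[OF f], of _ 1])
    show "h \<in> borel_measurable borel" unfolding h_def using fourier_measurable[OF f] by measurable
    have "1 \<le> (1 + \<xi>\<^sup>2)\<^sup>2" for \<xi> :: real by (rule one_le_power) simp
    then have "cmod (h \<xi>) \<le> cmod (fourier f \<xi>)" for \<xi>
      by (simp add: h_def norm_divide norm_power divide_le_eq mult_left_le_one_le mult_le_cancel_left1 del: of_real_add of_real_power)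
    then show "AE \<xi> in lborel. norm (h \<xi>) \<le> 1 * norm (fourier f \<xi>)" by simp
  qed
  moreover have "AE \<xi> in lborel. h (- \<xi>) = cnj (h \<xi>)"
    using fourier_hermitian[OF f] by eventually_elim (simp add: h_def)
  ultimately obtain g where "L2 g" "AE \<xi> in lborel. fourier g \<xi> = h \<xi>" using fourier_surjective by blast
  then show ?thesis unfolding Lambda_inv4_def h_def
    by (intro someI[of "\<lambda>g. L2 g \<and> (AE \<xi> in lborel. fourier g \<xi> = fourier f \<xi> / complex_of_real ((1 + \<xi>\<^sup>2)\<^sup>2))"]) auto
qed

definition conv :: "(real \<Rightarrow> complex) \<Rightarrow> (real \<Rightarrow> complex) \<Rightarrow> real \<Rightarrow> complex" where
  "conv A B \<xi> = (\<integral>\<eta>. A (\<xi> - \<eta>) * B \<eta> \<partial>lborel)"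

lemma conv_measurable [measurable]:
  assumes [measurable]: "A \<in> borel_measurable borel" "B \<in> borel_measurable borel"
  shows "conv A B \<in> borel_measurable borel"
  unfolding conv_def by measurable

lemma integral_translate: "(\<integral>x. f (x - c) \<partial>lborel) = (\<integral>x. f x \<partial>lborel)"
  for f :: "real \<Rightarrow> 'a::{banach, second_countable_topology}" and c :: real
  using lborel_integral_real_affine[of 1 f "-c"] by simp

lemma integrable_translate: "integrable lborel f \<Longrightarrow> integrable lborel (\<lambda>x. f (x - c))"
  for f :: "real \<Rightarrow> 'a::{banach, second_countable_topology}" and c :: real
  using lborel_integrable_real_affine[of f 1 "-c"] by simp

lemma integrable_conv_pair:
  fixes A B :: "real \<Rightarrow> 'a::{real_normed_field, banach, second_countable_topology}"
  assumes A: "integrable lborel A" and B: "integrable lborel B"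
  shows "integrable (lborel \<Otimes>\<^sub>M lborel) (\<lambda>(\<eta>, \<xi>). A (\<xi> - \<eta>) * B \<eta>)"
proof (rule lborel_pair.Fubini_integrable)
  have [measurable]: "A \<in> borel_measurable borel" "B \<in> borel_measurable borel" using A B by auto
  show "(\<lambda>(\<eta>, \<xi>). A (\<xi> - \<eta>) * B \<eta>) \<in> borel_measurable (lborel \<Otimes>\<^sub>M lborel)" by measurable
  have "(\<integral>\<xi>. norm (A (\<xi> - \<eta>)) \<partial>lborel) = (\<integral>\<xi>. norm (A \<xi>) \<partial>lborel)" for \<eta>
    using integral_translate[of "\<lambda>x. norm (A x)" \<eta>] by simp
  then show "integrable lborel (\<lambda>\<eta>. \<integral>\<xi>. norm (case (\<eta>, \<xi>) of (\<eta>, \<xi>) \<Rightarrow> A (\<xi> - \<eta>) * B \<eta>) \<partial>lborel)"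
    using B by (simp add: norm_mult)
  show "AE \<eta> in lborel. integrable lborel (\<lambda>\<xi>. case (\<eta>, \<xi>) of (\<eta>, \<xi>) \<Rightarrow> A (\<xi> - \<eta>) * B \<eta>)"
    using integrable_translate[OF A] by simp
qed

lemma
  assumes A: "integrable lborel A" and B: "integrable lborel B"
  shows integrable_conv: "integrable lborel (conv A B)"
    and ft1_conv: "fc * ft1 (conv A B) \<xi> = ft1 A \<xi> * ft1 B \<xi>"
proof -
  have [measurable]: "A \<in> borel_measurable borel" "B \<in> borel_measurable borel" using A B by auto
  show "integrable lborel (conv A B)"
    unfolding conv_def using lborel_pair.integrable_snd[OF integrable_conv_pair[OF A B]] by simp
  have int: "integrable (lborel \<Otimes>\<^sub>M lborel) (\<lambda>(\<eta>, \<zeta>). A (\<zeta> - \<eta>) * B \<eta> * cis (- (\<zeta> * \<xi>)))"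
  proof (rule Bochner_Integration.integrable_bound[OF integrable_conv_pair[OF A B]])
    show "AE p in lborel \<Otimes>\<^sub>M lborel. norm (case p of (\<eta>, \<zeta>) \<Rightarrow> A (\<zeta> - \<eta>) * B \<eta> * cis (- (\<zeta> * \<xi>)))
        \<le> norm (case p of (\<eta>, \<xi>) \<Rightarrow> A (\<xi> - \<eta>) * B \<eta>)"
      by (intro AE_I2) (auto simp: norm_mult)
  qed measurable
  have "(\<integral>\<zeta>. conv A B \<zeta> * cis (- (\<zeta> * \<xi>)) \<partial>lborel) = (\<integral>\<zeta>. (\<integral>\<eta>. A (\<zeta> - \<eta>) * B \<eta> * cis (- (\<zeta> * \<xi>)) \<partial>lborel) \<partial>lborel)"
    unfolding conv_def by (simp only: integral_mult_left_zero)
  also have "\<dots> = (\<integral>\<eta>. (\<integral>\<zeta>. A (\<zeta> - \<eta>) * B \<eta> * cis (- (\<zeta> * \<xi>)) \<partial>lborel) \<partial>lborel)"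
    by (rule lborel_pair.Fubini_integral[OF int])
  also have "\<dots> = (\<integral>\<eta>. (\<integral>\<zeta>. A \<zeta> * cis (- (\<zeta> * \<xi>)) \<partial>lborel) * (B \<eta> * cis (- (\<eta> * \<xi>))) \<partial>lborel)"
  proof (rule Bochner_Integration.integral_cong[OF refl])
    fix \<eta>
    have "(\<integral>\<zeta>. A (\<zeta> - \<eta>) * B \<eta> * cis (- (\<zeta> * \<xi>)) \<partial>lborel)
        = (\<integral>\<zeta>. (\<lambda>\<zeta>. A \<zeta> * cis (- (\<zeta> * \<xi>)) * (B \<eta> * cis (- (\<eta> * \<xi>)))) (\<zeta> - \<eta>) \<partial>lborel)"
    proof (rule Bochner_Integration.integral_cong[OF refl])
      fix \<zeta>
      have "cis (- (\<zeta> * \<xi>)) = cis (- ((\<zeta> - \<eta>) * \<xi>)) * cis (- (\<eta> * \<xi>))" by (simp add: cis_mult algebra_simps)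
      then show "A (\<zeta> - \<eta>) * B \<eta> * cis (- (\<zeta> * \<xi>)) = A (\<zeta> - \<eta>) * cis (- ((\<zeta> - \<eta>) * \<xi>)) * (B \<eta> * cis (- (\<eta> * \<xi>)))"
        by (simp only: mult_ac)
    qed
    also have "\<dots> = (\<integral>\<zeta>. A \<zeta> * cis (- (\<zeta> * \<xi>)) * (B \<eta> * cis (- (\<eta> * \<xi>))) \<partial>lborel)"
      by (rule integral_translate)
    also have "\<dots> = (\<integral>\<zeta>. A \<zeta> * cis (- (\<zeta> * \<xi>)) \<partial>lborel) * (B \<eta> * cis (- (\<eta> * \<xi>)))"
      by (rule integral_mult_left_zero)
    finally show "(\<integral>\<zeta>. A (\<zeta> - \<eta>) * B \<eta> * cis (- (\<zeta> * \<xi>)) \<partial>lborel)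
      = (\<integral>\<zeta>. A \<zeta> * cis (- (\<zeta> * \<xi>)) \<partial>lborel) * (B \<eta> * cis (- (\<eta> * \<xi>)))" .
  qed
  also have "\<dots> = (\<integral>\<zeta>. A \<zeta> * cis (- (\<zeta> * \<xi>)) \<partial>lborel) * (\<integral>\<eta>. B \<eta> * cis (- (\<eta> * \<xi>)) \<partial>lborel)"
    by (rule integral_mult_right_zero)
  finally show "fc * ft1 (conv A B) \<xi> = ft1 A \<xi> * ft1 B \<xi>"
    by (simp only: ft1_def mult_ac)
qed

lemma conv_bounded:
  assumes A: "L2 A" and B: "L2 B" shows "cmod (conv A B \<xi>) \<le> l2n A * l2n B"
proof -
  have *: "L2 (\<lambda>\<eta>. A (\<xi> - \<eta>))" "l2n (\<lambda>\<eta>. A (\<xi> - \<eta>)) = l2n A"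
  proof -
    have "(\<lambda>\<eta>. A (\<xi> - \<eta>)) \<in> borel_measurable borel" using L2_measurable[OF A] by measurable
    moreover have "integrable lborel (\<lambda>\<eta>. (cmod (A (\<xi> - \<eta>)))\<^sup>2)"
      using lborel_integrable_real_affine[OF L2_integrable[OF A], of "-1" \<xi>] by simp
    ultimately show "L2 (\<lambda>\<eta>. A (\<xi> - \<eta>))" by (rule L2_I)
    show "l2n (\<lambda>\<eta>. A (\<xi> - \<eta>)) = l2n A"
      unfolding l2n_def using lborel_integral_real_affine[of "-1" "\<lambda>x. (norm (A x))\<^sup>2" \<xi>] by simp
  qed
  show ?thesis unfolding conv_def using l2n_Cauchy_Schwarz[OF *(1) B] *(2) by simp
qed

text \<open>
  As both transforms are integrable, their convolution is integrable and bounded, hence square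
  integrable, and its inverse transform is the product of the two inverse transforms.
\<close>

lemma fourier_mult:
  assumes f: "L2 f" "integrable lborel (fourier f)" and g: "L2 g" "integrable lborel (fourier g)"
  shows "L2 (\<lambda>x. f x * g x)"
    and "AE \<xi> in lborel. fourier (\<lambda>x. f x * g x) \<xi> = complex_of_real fc * conv (fourier f) (fourier g) \<xi>"
proof -
  have inv: "AE x in lborel. complex_of_real (k x) = ft1 (fourier k) (- x)"
    if k: "L2 k" "integrable lborel (fourier k)" for k
    using F_inv_F[OF L2_of_real[OF k(1)]] AE_reflect[OF F_L1[OF L2_fourier[OF k(1)] k(2)]]
    by eventually_elim (simp add: F_inv_def fourier_eq_F[OF k(1)])
  have [measurable]: "f \<in> borel_measurable borel" "g \<in> borel_measurable borel"
    using f g by (auto simp: L2_measurable)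
  show L: "L2 (\<lambda>x. f x * g x)"
  proof (rule L2_bound[OF g(1)])
    show "AE x in lborel. norm (f x * g x) \<le> fc * (\<integral>x. cmod (fourier f x) \<partial>lborel) * norm (g x)"
      using inv[OF f]
    proof eventually_elim
      case (elim x)
      have "\<bar>f x\<bar> = cmod (ft1 (fourier f) (- x))" unfolding elim[symmetric] by simp
      also have "\<dots> \<le> fc * (\<integral>x. cmod (fourier f x) \<partial>lborel)" by (rule ft1_bound[OF f(2)])
      finally have "\<bar>f x\<bar> * \<bar>g x\<bar> \<le> fc * (\<integral>x. cmod (fourier f x) \<partial>lborel) * \<bar>g x\<bar>"
        by (rule mult_right_mono) simp
      then show ?case by (simp add: abs_mult)
    qed
  qed measurable
  define K where "K \<xi> = complex_of_real fc * conv (fourier f) (fourier g) \<xi>" for \<xi>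
  have [measurable]: "fourier f \<in> borel_measurable borel" "fourier g \<in> borel_measurable borel"
    using f g by auto
  have Ki: "integrable lborel K" unfolding K_def using integrable_conv[OF f(2) g(2)] by simp
  have KL: "L2 K"
  proof (rule L2_I)
    show [measurable]: "K \<in> borel_measurable borel" unfolding K_def by measurable
    define M where "M = fc * (l2n (fourier f) * l2n (fourier g))"
    have M: "cmod (K \<xi>) \<le> M" for \<xi>
      unfolding K_def M_def norm_mult using conv_bounded[OF L2_fourier[OF f(1)] L2_fourier[OF g(1)]]
      by (intro mult_mono) (auto simp: less_imp_le)
    show "integrable lborel (\<lambda>\<xi>. (cmod (K \<xi>))\<^sup>2)"
    proof (rule Bochner_Integration.integrable_bound)
      show "integrable lborel (\<lambda>\<xi>. M * cmod (K \<xi>))" using Ki by simp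
      show "AE \<xi> in lborel. norm ((cmod (K \<xi>))\<^sup>2) \<le> norm (M * cmod (K \<xi>))"
      proof (rule AE_I2)
        fix \<xi>
        have "cmod (K \<xi>) * cmod (K \<xi>) \<le> M * cmod (K \<xi>)" by (intro mult_right_mono M) simp
        then show "norm ((cmod (K \<xi>))\<^sup>2) \<le> norm (M * cmod (K \<xi>))" by (simp add: power2_eq_square)
      qed
    qed measurable
  qed
  have "AE x in lborel. F_inv K x = complex_of_real (f x * g x)"
    using inv[OF f] inv[OF g] AE_reflect[OF F_L1[OF KL Ki]]
  proof eventually_elim
    case (elim x)
    have "F_inv K x = fc * ft1 (conv (fourier f) (fourier g)) (- x)"
      using elim(3) by (simp add: F_inv_def K_def[abs_def] ft1_cmult)
    also have "\<dots> = complex_of_real (f x * g x)"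
      using ft1_conv[OF f(2) g(2)] elim(1,2) by simp
    finally show ?case .
  qed
  then have "AE \<xi> in lborel. F (\<lambda>x. complex_of_real (f x * g x)) \<xi> = F (F_inv K) \<xi>"
    by (intro F_cong_AE[OF L2_F_inv[OF KL]]) auto
  then show "AE \<xi> in lborel. fourier (\<lambda>x. f x * g x) \<xi> = complex_of_real fc * conv (fourier f) (fourier g) \<xi>"
    using F_F_inv[OF KL] by eventually_elim (simp add: fourier_eq_F[OF L] K_def)
qed

section \<open>The weights of the Sobolev norms\<close>

text \<open>
  The power \<open>\<langle>\<xi>\<rangle>\<^sup>q\<close> of the Japanese bracket \<open>\<langle>\<xi>\<rangle> = (1 + \<xi>\<^sup>2)\<^bsup>1/2\<^esup>\<close>.
\<close>

definition jb :: "real \<Rightarrow> real \<Rightarrow> real" where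
  "jb q \<xi> = (1 + \<xi>\<^sup>2) powr (q / 2)"

lemma one_plus_sq_pos [simp]: "0 < 1 + (x::real)\<^sup>2"
  by (simp add: add_pos_nonneg)

lemma one_plus_sq_neq_0 [simp]: "1 + (x::real)\<^sup>2 \<noteq> 0"
  using one_plus_sq_pos[of x] by linarith

lemma sq_triangle: "(x::real)\<^sup>2 \<le> 2 * (x - y)\<^sup>2 + 2 * y\<^sup>2"
proof -
  have "2 * (x - y)\<^sup>2 + 2 * y\<^sup>2 - x\<^sup>2 = (x - 2 * y)\<^sup>2" by (simp add: power2_eq_square algebra_simps)
  then show ?thesis using zero_le_power2[of "x - 2 * y"] by linarith
qed

lemma jb_pos [simp]: "0 < jb q \<xi>"
  by (simp add: jb_def)

lemma jb_nonneg [simp]: "0 \<le> jb q \<xi>"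
  by (simp add: less_imp_le)

lemma jb_measurable [measurable]: "jb q \<in> borel_measurable borel"
  unfolding jb_def by measurable

lemma jb_add: "jb (p + q) \<xi> = jb p \<xi> * jb q \<xi>"
  by (simp add: jb_def add_divide_distrib powr_add)

lemma jb_0 [simp]: "jb 0 \<xi> = 1"
  using one_plus_sq_pos[of \<xi>] by (simp add: jb_def)

lemma jb_uminus [simp]: "jb q (- \<xi>) = jb q \<xi>"
  by (simp add: jb_def)

lemma jb_mono: "p \<le> q \<Longrightarrow> jb p \<xi> \<le> jb q \<xi>"
  unfolding jb_def by (intro powr_mono) auto

lemma jb_square: "(jb q \<xi>)\<^sup>2 = (1 + \<xi>\<^sup>2) powr q"
  by (simp add: jb_def power2_eq_square flip: powr_add)

lemma jb_2: "jb 2 \<xi> = 1 + \<xi>\<^sup>2"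
  using one_plus_sq_pos[of \<xi>] by (simp add: jb_def)

lemma jb_4: "jb 4 \<xi> = (1 + \<xi>\<^sup>2)\<^sup>2"
  using jb_add[of 2 2 \<xi>] by (simp add: jb_2 power2_eq_square)

lemma abs_le_jb_1: "\<bar>\<xi>\<bar> \<le> jb 1 \<xi>"
proof -
  have "(jb 1 \<xi>)\<^sup>2 = 1 + \<xi>\<^sup>2" by (simp add: jb_square)
  then have "\<bar>\<xi>\<bar>\<^sup>2 \<le> (jb 1 \<xi>)\<^sup>2" by simp
  then show ?thesis by (rule power2_le_imp_le) simp
qed

lemma jb_le_scaled:
  assumes "0 \<le> q" "1 + x\<^sup>2 \<le> K * (1 + y\<^sup>2)" "0 \<le> K"
  shows "jb q x \<le> K powr (q / 2) * jb q y"
proof -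
  have "jb q x \<le> (K * (1 + y\<^sup>2)) powr (q / 2)"
    unfolding jb_def using assms by (intro powr_mono2) auto
  also have "\<dots> = K powr (q / 2) * jb q y"
    unfolding jb_def by (rule powr_mult)
  finally show ?thesis .
qed

lemma one_plus_sq_triangle: "1 + \<xi>\<^sup>2 \<le> 2 * (1 + (\<xi> - \<eta>)\<^sup>2) * (1 + (\<eta>::real)\<^sup>2)"
proof -
  have "2 * (1 + (\<xi> - \<eta>)\<^sup>2) * (1 + \<eta>\<^sup>2) = 2 + 2 * (\<xi> - \<eta>)\<^sup>2 + 2 * \<eta>\<^sup>2 + 2 * ((\<xi> - \<eta>)\<^sup>2 * \<eta>\<^sup>2)"
    by (simp add: algebra_simps)
  moreover have "0 \<le> (\<xi> - \<eta>)\<^sup>2 * \<eta>\<^sup>2" by simp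
  ultimately show ?thesis using sq_triangle[of \<xi> \<eta>] by linarith
qed

text \<open>
  Peetre's inequality. For negative exponents, interchange \<open>\<xi>\<close> and \<open>\<eta>\<close> and divide by both weights.
\<close>

lemma jb_peetre: "jb q \<xi> \<le> 2 powr (\<bar>q\<bar> / 2) * jb \<bar>q\<bar> (\<xi> - \<eta>) * jb q \<eta>"
proof -
  have pos: "jb p \<xi> \<le> 2 powr (p / 2) * jb p (\<xi> - \<eta>) * jb p \<eta>" if "0 \<le> p" for p \<xi> \<eta>
  proof -
    have "jb p \<xi> \<le> (2 * (1 + (\<xi> - \<eta>)\<^sup>2) * (1 + \<eta>\<^sup>2)) powr (p / 2)"
      unfolding jb_def using that one_plus_sq_triangle by (intro powr_mono2) auto
    also have "\<dots> = 2 powr (p / 2) * jb p (\<xi> - \<eta>) * jb p \<eta>"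
      unfolding jb_def by (simp only: powr_mult)
    finally show ?thesis .
  qed
  show ?thesis
  proof (cases "0 \<le> q")
    case True then show ?thesis using pos[of q \<xi> \<eta>] by simp
  next
    case False
    have d: "jb \<bar>q\<bar> (\<eta> - \<xi>) = jb \<bar>q\<bar> (\<xi> - \<eta>)" using jb_uminus[of "\<bar>q\<bar>" "\<xi> - \<eta>"] by simp
    have inv: "jb q x * jb \<bar>q\<bar> x = 1" for x using jb_add[of q "\<bar>q\<bar>" x] False by simp
    have "jb q \<xi> = jb q \<xi> * jb q \<eta> * jb \<bar>q\<bar> \<eta>" using inv[of \<eta>] by (simp add: mult.assoc)
    also have "\<dots> \<le> jb q \<xi> * jb q \<eta> * (2 powr (\<bar>q\<bar> / 2) * jb \<bar>q\<bar> (\<eta> - \<xi>) * jb \<bar>q\<bar> \<xi>)"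
      by (intro mult_left_mono pos) auto
    also have "\<dots> = 2 powr (\<bar>q\<bar> / 2) * jb \<bar>q\<bar> (\<eta> - \<xi>) * jb q \<eta> * (jb q \<xi> * jb \<bar>q\<bar> \<xi>)" by (simp only: mult_ac)
    finally show ?thesis by (simp only: inv d mult_1_right)
  qed
qed

text \<open>
  At least one of the frequencies \<open>\<xi> - \<eta>\<close> and \<open>\<eta>\<close> is comparable with \<open>\<xi>\<close>.
\<close>

lemma jb_split: assumes "0 \<le> q" shows "jb q \<xi> \<le> 4 powr (q / 2) * (jb q (\<xi> - \<eta>) + jb q \<eta>)"
proof -
  have "1 + \<xi>\<^sup>2 \<le> 2 * (1 + (\<xi> - \<eta>)\<^sup>2) + 2 * (1 + \<eta>\<^sup>2)" using sq_triangle[of \<xi> \<eta>] by simp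
  then consider "1 + \<xi>\<^sup>2 \<le> 4 * (1 + (\<xi> - \<eta>)\<^sup>2)" | "1 + \<xi>\<^sup>2 \<le> 4 * (1 + \<eta>\<^sup>2)" by linarith
  then have "jb q \<xi> \<le> 4 powr (q / 2) * jb q (\<xi> - \<eta>) \<or> jb q \<xi> \<le> 4 powr (q / 2) * jb q \<eta>"
  proof cases
    case 1 from jb_le_scaled[OF assms 1] show ?thesis by simp
  next
    case 2 from jb_le_scaled[OF assms 2] show ?thesis by simp
  qed
  moreover have "0 \<le> 4 powr (q / 2) * jb q (\<xi> - \<eta>)" "0 \<le> 4 powr (q / 2) * jb q \<eta>" by auto
  ultimately show ?thesis unfolding distrib_left by linarith
qed

text \<open>
  The symbol of the symmetrised transport term. If \<open>\<xi> - \<eta>\<close> is small compared with \<open>\<xi>\<close>, the mean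
  value theorem for \<open>t \<mapsto> t (1 + t\<^sup>2)\<^bsup>-\<sigma>\<^esup>\<close> gains a factor \<open>\<bar>\<xi> - \<eta>\<bar>\<close>; otherwise both frequencies
  are controlled by \<open>\<xi> - \<eta>\<close>.
\<close>

lemma transport_symbol_bound:
  fixes \<sigma> :: real
  defines "m \<equiv> max \<sigma> 0 + max (1 - \<sigma>) 0"
  shows "\<exists>C\<ge>0. \<forall>\<xi> \<eta>. \<bar>\<eta> * (jb \<sigma> \<xi>)\<^sup>2 - \<xi> * (jb \<sigma> \<eta>)\<^sup>2\<bar> \<le> C * jb m (\<xi> - \<eta>) * jb \<sigma> \<xi> * jb \<sigma> \<eta>"
proof -
  define C1 where "C1 = (1 + 2 * \<bar>\<sigma>\<bar>) * 4 powr \<bar>\<sigma>\<bar> * 4 powr (\<bar>\<sigma>\<bar> / 2)"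
  define C2 where "C2 = 2 * 10 powr (m / 2)"
  have C: "0 \<le> C1" "0 \<le> C2" by (auto simp: C1_def C2_def)
  have m1: "1 \<le> m" by (simp add: m_def)
  have scaled: "jb p x \<le> 4 powr (\<bar>p\<bar> / 2) * jb p y" if "1 + x\<^sup>2 \<le> 4 * (1 + y\<^sup>2)" "1 + y\<^sup>2 \<le> 4 * (1 + x\<^sup>2)" for p x y
  proof (cases "0 \<le> p")
    case True then show ?thesis using jb_le_scaled[OF True that(1)] by simp
  next
    case False
    have inv: "jb p z * jb (- p) z = 1" for z using jb_add[of p "- p" z] by simp
    have "jb p x = jb p x * (jb p y * jb (- p) y)" using inv[of y] by simp
    also have "\<dots> \<le> jb p x * (jb p y * (4 powr (- p / 2) * jb (- p) x))"
      using False that(2) by (intro mult_left_mono jb_le_scaled) auto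
    also have "\<dots> = 4 powr (- p / 2) * jb p y * (jb p x * jb (- p) x)" by (simp only: mult_ac)
    finally show ?thesis using False by (simp add: inv)
  qed
  have "\<bar>\<eta> * (jb \<sigma> \<xi>)\<^sup>2 - \<xi> * (jb \<sigma> \<eta>)\<^sup>2\<bar> \<le> (C1 + C2) * jb m (\<xi> - \<eta>) * jb \<sigma> \<xi> * jb \<sigma> \<eta>" for \<xi> \<eta>
  proof (cases "(\<xi> - \<eta>)\<^sup>2 \<le> (1 + \<xi>\<^sup>2) / 4")
    case True
    \<comment> \<open>\<open>\<eta>\<langle>\<xi>\<rangle>\<^bsup>2\<sigma>\<^esup> - \<xi>\<langle>\<eta>\<rangle>\<^bsup>2\<sigma>\<^esup>\<close> is \<open>\<langle>\<xi>\<rangle>\<^bsup>2\<sigma>\<^esup>\<langle>\<eta>\<rangle>\<^bsup>2\<sigma>\<^esup>(g \<eta> - g \<xi>)\<close>\<close>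
    define g where "g t = t * (1 + t\<^sup>2) powr (- \<sigma>)" for t :: real
    define g' where "g' t = (1 + t\<^sup>2) powr (- \<sigma>) - 2 * \<sigma> * (t\<^sup>2 * (1 + t\<^sup>2) powr (- \<sigma> - 1))" for t :: real
    have der: "(g has_real_derivative g' t) (at t)" for t
      unfolding g_def g'_def using one_plus_sq_pos[of t]
      by (auto intro!: derivative_eq_intros simp: power2_eq_square algebra_simps)
    have g'_bound: "\<bar>g' t\<bar> \<le> (1 + 2 * \<bar>\<sigma>\<bar>) * (1 + t\<^sup>2) powr (- \<sigma>)" for t
    proof -
      have "t\<^sup>2 * (1 + t\<^sup>2) powr (- \<sigma> - 1) \<le> (1 + t\<^sup>2) * (1 + t\<^sup>2) powr (- \<sigma> - 1)"
        by (intro mult_right_mono) auto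
      also have "\<dots> = (1 + t\<^sup>2) powr (1 + (- \<sigma> - 1))" unfolding powr_add using one_plus_sq_pos[of t] by simp
      finally have "t\<^sup>2 * (1 + t\<^sup>2) powr (- \<sigma> - 1) \<le> (1 + t\<^sup>2) powr (- \<sigma>)" by simp
      then have "\<bar>2 * \<sigma> * (t\<^sup>2 * (1 + t\<^sup>2) powr (- \<sigma> - 1))\<bar> \<le> 2 * \<bar>\<sigma>\<bar> * (1 + t\<^sup>2) powr (- \<sigma>)"
        by (simp add: abs_mult mult_left_mono)
      moreover have "\<bar>(1 + t\<^sup>2) powr (- \<sigma>)\<bar> = (1 + t\<^sup>2) powr (- \<sigma>)" by simp
      moreover have "\<bar>g' t\<bar> \<le> \<bar>(1 + t\<^sup>2) powr (- \<sigma>)\<bar> + \<bar>2 * \<sigma> * (t\<^sup>2 * (1 + t\<^sup>2) powr (- \<sigma> - 1))\<bar>"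
        unfolding g'_def by (rule abs_triangle_ineq4)
      ultimately show ?thesis unfolding distrib_right mult_1 by linarith
    qed
    have near: "1 + z\<^sup>2 \<le> 4 * (1 + \<xi>\<^sup>2) \<and> 1 + \<xi>\<^sup>2 \<le> 4 * (1 + z\<^sup>2)" if "(\<xi> - z)\<^sup>2 \<le> (1 + \<xi>\<^sup>2) / 4" for z
    proof -
      have "z\<^sup>2 \<le> 2 * (\<xi> - z)\<^sup>2 + 2 * \<xi>\<^sup>2" using sq_triangle[of z \<xi>] by (simp add: power2_commute)
      moreover have "\<xi>\<^sup>2 \<le> 2 * (\<xi> - z)\<^sup>2 + 2 * z\<^sup>2" by (rule sq_triangle)
      moreover have "1 + a \<le> 4 * (1 + b) \<and> 1 + b \<le> 4 * (1 + a)"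
        if "a \<le> 2 * e + 2 * b" "b \<le> 2 * e + 2 * a" "e \<le> (1 + b) / 4" "0 \<le> a" "0 \<le> b" for a b e :: real
        using that by (intro conjI) (simp_all add: field_simps)
      ultimately show ?thesis using that zero_le_power2 by blast
    qed
    \<comment> \<open>on this interval all brackets are comparable with \<open>\<langle>\<xi>\<rangle>\<close>, by \<open>near\<close>\<close>
    define S where "S = cball \<xi> (sqrt (1 + \<xi>\<^sup>2) / 2)"
    have S: "z \<in> S \<longleftrightarrow> (\<xi> - z)\<^sup>2 \<le> (1 + \<xi>\<^sup>2) / 4" for z
    proof -
      have "z \<in> S \<longleftrightarrow> \<bar>\<xi> - z\<bar> \<le> \<bar>sqrt (1 + \<xi>\<^sup>2) / 2\<bar>" by (simp add: S_def dist_real_def)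
      also have "\<dots> \<longleftrightarrow> (\<xi> - z)\<^sup>2 \<le> (sqrt (1 + \<xi>\<^sup>2) / 2)\<^sup>2" by (rule abs_le_square_iff)
      finally show ?thesis by (simp add: power_divide)
    qed
    define B where "B = (1 + 2 * \<bar>\<sigma>\<bar>) * (4 powr \<bar>\<sigma>\<bar> * jb (- 2 * \<sigma>) \<xi>)"
    have "norm (g \<eta> - g \<xi>) \<le> B * norm (\<eta> - \<xi>)"
    proof (rule field_differentiable_bound[of S])
      show "convex S" by (simp add: S_def)
      show "(g has_field_derivative g' z) (at z within S)" for z using der by (rule DERIV_subset) simp
      show "norm (g' z) \<le> B" if "z \<in> S" for z
      proof -
        have "jb (- 2 * \<sigma>) z \<le> 4 powr (\<bar>- 2 * \<sigma>\<bar> / 2) * jb (- 2 * \<sigma>) \<xi>"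
          using near[of z] that S by (intro scaled) auto
        then have "(1 + z\<^sup>2) powr (- \<sigma>) \<le> 4 powr \<bar>\<sigma>\<bar> * jb (- 2 * \<sigma>) \<xi>" by (simp add: jb_def abs_mult)
        then have "(1 + 2 * \<bar>\<sigma>\<bar>) * (1 + z\<^sup>2) powr (- \<sigma>) \<le> B" unfolding B_def by (intro mult_left_mono) auto
        then show ?thesis using g'_bound[of z] by simp
      qed
    qed (use True S in auto)
    then have gb: "\<bar>g \<eta> - g \<xi>\<bar> \<le> B * \<bar>\<xi> - \<eta>\<bar>" by (simp add: abs_minus_commute)
    have Wg: "(jb \<sigma> t)\<^sup>2 * g t = t" for t
    proof -
      have "(1 + t\<^sup>2) powr \<sigma> * (1 + t\<^sup>2) powr (- \<sigma>) = 1" by (simp flip: powr_add)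
      then show ?thesis by (simp add: g_def jb_square mult.left_commute)
    qed
    have W1: "(jb \<sigma> t)\<^sup>2 * jb (- 2 * \<sigma>) t = 1" for t
      unfolding power2_eq_square jb_add[symmetric] by simp
    have "\<eta> * (jb \<sigma> \<xi>)\<^sup>2 - \<xi> * (jb \<sigma> \<eta>)\<^sup>2 = (jb \<sigma> \<xi>)\<^sup>2 * (jb \<sigma> \<eta>)\<^sup>2 * (g \<eta> - g \<xi>)"
    proof -
      have "(jb \<sigma> \<xi>)\<^sup>2 * (jb \<sigma> \<eta>)\<^sup>2 * (g \<eta> - g \<xi>) = (jb \<sigma> \<xi>)\<^sup>2 * ((jb \<sigma> \<eta>)\<^sup>2 * g \<eta>) - (jb \<sigma> \<eta>)\<^sup>2 * ((jb \<sigma> \<xi>)\<^sup>2 * g \<xi>)"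
        by (simp add: algebra_simps)
      then show ?thesis unfolding Wg by (simp only: mult.commute)
    qed
    then have "\<bar>\<eta> * (jb \<sigma> \<xi>)\<^sup>2 - \<xi> * (jb \<sigma> \<eta>)\<^sup>2\<bar> = (jb \<sigma> \<xi>)\<^sup>2 * (jb \<sigma> \<eta>)\<^sup>2 * \<bar>g \<eta> - g \<xi>\<bar>" by (simp add: abs_mult)
    also have "\<dots> \<le> (jb \<sigma> \<xi>)\<^sup>2 * (jb \<sigma> \<eta>)\<^sup>2 * (B * \<bar>\<xi> - \<eta>\<bar>)" by (intro mult_left_mono gb) auto
    also have "\<dots> = ((jb \<sigma> \<xi>)\<^sup>2 * jb (- 2 * \<sigma>) \<xi>) * ((1 + 2 * \<bar>\<sigma>\<bar>) * 4 powr \<bar>\<sigma>\<bar> * \<bar>\<xi> - \<eta>\<bar> * jb \<sigma> \<eta> * jb \<sigma> \<eta>)"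
      unfolding B_def power2_eq_square by (simp only: mult_ac)
    also have "\<dots> = (1 + 2 * \<bar>\<sigma>\<bar>) * 4 powr \<bar>\<sigma>\<bar> * \<bar>\<xi> - \<eta>\<bar> * jb \<sigma> \<eta> * jb \<sigma> \<eta>" unfolding W1 by simp
    also have "\<dots> \<le> (1 + 2 * \<bar>\<sigma>\<bar>) * 4 powr \<bar>\<sigma>\<bar> * jb m (\<xi> - \<eta>) * (4 powr (\<bar>\<sigma>\<bar> / 2) * jb \<sigma> \<xi>) * jb \<sigma> \<eta>"
    proof (intro mult_mono order.refl)
      show "\<bar>\<xi> - \<eta>\<bar> \<le> jb m (\<xi> - \<eta>)" using abs_le_jb_1[of "\<xi> - \<eta>"] jb_mono[OF m1] by (rule order_trans)
      show "jb \<sigma> \<eta> \<le> 4 powr (\<bar>\<sigma>\<bar> / 2) * jb \<sigma> \<xi>" using near[OF True] by (intro scaled) auto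
    qed auto
    also have "\<dots> = C1 * jb m (\<xi> - \<eta>) * jb \<sigma> \<xi> * jb \<sigma> \<eta>" by (simp add: C1_def mult_ac)
    also have "\<dots> \<le> (C1 + C2) * jb m (\<xi> - \<eta>) * jb \<sigma> \<xi> * jb \<sigma> \<eta>" using C by (intro mult_right_mono) auto
    finally show ?thesis .
  next
    case False
    \<comment> \<open>here \<open>1 + \<xi>\<^sup>2 < 4 d\<^sup>2\<close>, and \<open>\<eta>\<^sup>2 \<le> 2 d\<^sup>2 + 2 \<xi>\<^sup>2\<close> is then below \<open>10 d\<^sup>2\<close>\<close>
    define d where "d = \<xi> - \<eta>"
    have k: "1 + \<xi>\<^sup>2 < 4 * d\<^sup>2" using False by (simp add: d_def)
    have x: "1 + \<xi>\<^sup>2 \<le> 10 * (1 + d\<^sup>2)"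
    proof -
      have "1 + a \<le> 10 * (1 + e)" if "1 + a < 4 * e" "0 \<le> e" for a e :: real using that by simp
      then show ?thesis using k zero_le_power2 by blast
    qed
    have "\<eta>\<^sup>2 \<le> 2 * d\<^sup>2 + 2 * \<xi>\<^sup>2" using sq_triangle[of \<eta> \<xi>] by (simp add: d_def power2_commute)
    moreover have "1 + c \<le> 10 * (1 + e)" if "c \<le> 2 * e + 2 * a" "1 + a < 4 * e" "0 \<le> e" for a c e :: real
      using that by simp
    ultimately have y: "1 + \<eta>\<^sup>2 \<le> 10 * (1 + d\<^sup>2)" using k zero_le_power2 by blast
    have far: "jb p z \<le> 10 powr (max p 0 / 2) * jb (max p 0) d" if "1 + z\<^sup>2 \<le> 10 * (1 + d\<^sup>2)" for p z
      using jb_mono[of p "max p 0" z] jb_le_scaled[of "max p 0", OF _ that] by simp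
    have prod: "jb (1 - \<sigma>) z * jb \<sigma> z' \<le> 10 powr (m / 2) * jb m d"
      if "1 + z\<^sup>2 \<le> 10 * (1 + d\<^sup>2)" "1 + z'\<^sup>2 \<le> 10 * (1 + d\<^sup>2)" for z z'
    proof -
      have "jb (1 - \<sigma>) z * jb \<sigma> z' \<le> (10 powr (max (1 - \<sigma>) 0 / 2) * jb (max (1 - \<sigma>) 0) d) * (10 powr (max \<sigma> 0 / 2) * jb (max \<sigma> 0) d)"
        using that by (intro mult_mono far) auto
      also have "\<dots> = (10 powr (max \<sigma> 0 / 2) * 10 powr (max (1 - \<sigma>) 0 / 2)) * (jb (max \<sigma> 0) d * jb (max (1 - \<sigma>) 0) d)"
        by (simp only: mult_ac)
      also have "\<dots> = 10 powr (m / 2) * jb m d"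
        unfolding m_def add_divide_distrib powr_add jb_add ..
      finally show ?thesis .
    qed
    have one: "\<bar>y * (jb \<sigma> x)\<^sup>2\<bar> \<le> (10 powr (m / 2) * jb m d) * jb \<sigma> x * jb \<sigma> y"
      if "1 + x\<^sup>2 \<le> 10 * (1 + d\<^sup>2)" "1 + y\<^sup>2 \<le> 10 * (1 + d\<^sup>2)" for x y
    proof -
      have "\<bar>y * (jb \<sigma> x)\<^sup>2\<bar> \<le> jb 1 y * (jb \<sigma> x)\<^sup>2"
        using abs_le_jb_1[of y] by (simp add: abs_mult mult_right_mono)
      also have "jb 1 y = jb (1 - \<sigma>) y * jb \<sigma> y" by (simp flip: jb_add)
      also have "jb (1 - \<sigma>) y * jb \<sigma> y * (jb \<sigma> x)\<^sup>2 = (jb (1 - \<sigma>) y * jb \<sigma> x) * (jb \<sigma> x * jb \<sigma> y)"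
        unfolding power2_eq_square by (simp only: mult_ac)
      also have "\<dots> \<le> (10 powr (m / 2) * jb m d) * (jb \<sigma> x * jb \<sigma> y)"
        using that by (intro mult_right_mono prod) auto
      finally show ?thesis by (simp only: mult.assoc)
    qed
    have "\<bar>\<eta> * (jb \<sigma> \<xi>)\<^sup>2 - \<xi> * (jb \<sigma> \<eta>)\<^sup>2\<bar> \<le> \<bar>\<eta> * (jb \<sigma> \<xi>)\<^sup>2\<bar> + \<bar>\<xi> * (jb \<sigma> \<eta>)\<^sup>2\<bar>" by (rule abs_triangle_ineq4)
    also have "\<dots> \<le> (10 powr (m / 2) * jb m d) * jb \<sigma> \<xi> * jb \<sigma> \<eta> + (10 powr (m / 2) * jb m d) * jb \<sigma> \<eta> * jb \<sigma> \<xi>"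
      by (intro add_mono one x y)
    also have "\<dots> = C2 * jb m d * jb \<sigma> \<xi> * jb \<sigma> \<eta>" by (simp add: C2_def mult_ac)
    also have "\<dots> \<le> (C1 + C2) * jb m d * jb \<sigma> \<xi> * jb \<sigma> \<eta>" using C by (intro mult_right_mono) auto
    finally show ?thesis by (simp add: d_def)
  qed
  then show ?thesis using C by (intro exI[of _ "C1 + C2"]) auto
qed

text \<open>
  Comparison with \<open>(1 + \<bar>x\<bar>)\<^bsup>-2p\<^esup>\<close>, which has an explicit antiderivative.
\<close>

lemma jb_L2:
  assumes p: "p > 1 / 2" shows "L2 (jb (- p))"
proof (rule L2_I)
  define A where "A x = indicator {0..} x * (1 + x) powr (- 2 * p)" for x :: real
  have [measurable]: "A \<in> borel_measurable borel" unfolding A_def by measurable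
  have "(\<integral>\<^sup>+x. ennreal ((1 + x) powr (- 2 * p)) * indicator {0..} x \<partial>lborel)
      = ennreal (0 - (1 + 0) powr (1 - 2 * p) / (1 - 2 * p))"
  proof (rule nn_integral_FTC_atLeast)
    show "((\<lambda>x. (1 + x) powr (1 - 2 * p) / (1 - 2 * p)) has_real_derivative (1 + x) powr (- 2 * p)) (at x)" if "0 \<le> x" for x
    proof -
      have "((\<lambda>x. (1 + x) powr (1 - 2 * p)) has_real_derivative (1 - 2 * p) * (1 + x) powr (1 - 2 * p - of_nat 1) * (0 + 1)) (at x)"
        using that by (intro DERIV_fun_powr DERIV_add DERIV_const DERIV_ident) auto
      from DERIV_cdivide[OF this, of "1 - 2 * p"] p show ?thesis by simp
    qed
    have "((\<lambda>x::real. (1 + x) powr (1 - 2 * p)) \<longlongrightarrow> 0) at_top"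
      using p by (intro tendsto_neg_powr filterlim_tendsto_add_at_top[OF tendsto_const filterlim_ident]) auto
    from tendsto_divide[OF this tendsto_const, of "1 - 2 * p"] p
    show "((\<lambda>x. (1 + x) powr (1 - 2 * p) / (1 - 2 * p)) \<longlongrightarrow> 0) at_top" by simp
  qed auto
  moreover have "(\<lambda>x. ennreal ((1 + x) powr (- 2 * p)) * indicator {0..} x) = (\<lambda>x. ennreal (A x))"
    by (auto simp: A_def indicator_def)
  ultimately have "(\<integral>\<^sup>+x. ennreal (A x) \<partial>lborel) < \<infinity>" by simp
  then have Ai: "integrable lborel A" by (auto simp: integrable_iff_bounded A_def)
  have Ai': "integrable lborel (\<lambda>x. A (- x))"
    using lborel_integrable_real_affine[OF Ai, of "-1" 0] by simp
  show "integrable lborel (\<lambda>x. (norm (jb (- p) x))\<^sup>2)"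
  proof (rule Bochner_Integration.integrable_bound)
    show "integrable lborel (\<lambda>x. 2 powr p * (A x + A (- x)))" using Ai Ai' by simp
    have b: "(jb (- p) x)\<^sup>2 \<le> 2 powr p * (A x + A (- x))" for x
    proof -
      have "(1 + \<bar>x\<bar>)\<^sup>2 \<le> 2 * (1 + x\<^sup>2)" using sum_squares_bound[of 1 "\<bar>x\<bar>"] by (simp add: power2_sum)
      then have "((1 + \<bar>x\<bar>)\<^sup>2 / 2) \<le> 1 + x\<^sup>2" by simp
      then have "(1 + x\<^sup>2) powr (- p) \<le> ((1 + \<bar>x\<bar>)\<^sup>2 / 2) powr (- p)" using p by (intro powr_mono2') auto
      also have "\<dots> = 2 powr p * (1 + \<bar>x\<bar>) powr (- 2 * p)"
      proof -
        have "(1 + \<bar>x\<bar>)\<^sup>2 = (1 + \<bar>x\<bar>) powr 2" by simp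
        then have A: "((1 + \<bar>x\<bar>)\<^sup>2) powr (- p) = (1 + \<bar>x\<bar>) powr (- 2 * p)" by (simp only: powr_powr) simp
        have B: "((1 + \<bar>x\<bar>)\<^sup>2 / 2) powr (- p) = ((1 + \<bar>x\<bar>)\<^sup>2) powr (- p) / 2 powr (- p)"
          by (rule powr_divide)
        have C: "inverse ((2::real) powr (- p)) = 2 powr p" by (simp add: powr_minus)
        have "((1 + \<bar>x\<bar>)\<^sup>2 / 2) powr (- p) = (1 + \<bar>x\<bar>) powr (- 2 * p) * inverse (2 powr (- p))"
          by (simp only: B A divide_inverse[of "_ powr _"])
        then show ?thesis by (simp only: C mult.commute)
      qed
      also have "\<dots> \<le> 2 powr p * (A x + A (- x))"
        by (intro mult_left_mono) (auto simp: A_def indicator_def)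
      finally show ?thesis by (simp add: jb_square)
    qed
    have n: "0 \<le> 2 powr p * (A x + A (- x))" for x by (simp add: A_def)
    show "AE x in lborel. norm ((norm (jb (- p) x))\<^sup>2) \<le> norm (2 powr p * (A x + A (- x)))"
    proof (rule AE_I2)
      fix x
      show "norm ((norm (jb (- p) x))\<^sup>2) \<le> norm (2 powr p * (A x + A (- x)))"
      proof -
        have "norm ((norm (jb (- p) x))\<^sup>2) = (jb (- p) x)\<^sup>2" by simp
        moreover have "norm (2 powr p * (A x + A (- x))) = 2 powr p * (A x + A (- x))"
          unfolding real_norm_def by (rule abs_of_nonneg[OF n])
        ultimately show ?thesis using b[of x] by (simp only:)
      qed
    qed
  qed measurable
qed (rule jb_measurable)

section \<open>Sobolev norms as weighted norms of the transform\<close>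

definition wt :: "real \<Rightarrow> (real \<Rightarrow> real) \<Rightarrow> real \<Rightarrow> complex" where
  "wt q f \<xi> = complex_of_real (jb q \<xi>) * fourier f \<xi>"

lemma wt_measurable [measurable]: "L2 f \<Longrightarrow> wt q f \<in> borel_measurable borel"
  using fourier_measurable[of f] unfolding wt_def by measurable

lemma cmod_wt: "cmod (wt q f \<xi>) = jb q \<xi> * cmod (fourier f \<xi>)"
  by (simp add: wt_def norm_mult abs_of_pos)

lemma cmod_wt_sq: "(cmod (wt q f \<xi>))\<^sup>2 = (1 + \<xi>\<^sup>2) powr q * (cmod (fourier f \<xi>))\<^sup>2"
  by (simp only: cmod_wt power_mult_distrib jb_square)

lemma sobolev_iff: "f \<in> sobolev q \<longleftrightarrow> L2 f \<and> L2 (wt q f)"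
  using wt_measurable[of f q] by (auto simp: sobolev_def L2_def[of "wt q f"] cmod_wt_sq)

lemma sobolev_norm_eq: "sobolev_norm q f = l2n (wt q f)"
  by (simp add: sobolev_norm_def l2n_def cmod_wt_sq)

lemma sobolev_norm_nonneg [simp]: "0 \<le> sobolev_norm q f"
  by (simp add: sobolev_norm_eq)

lemma sobolev_L2: "f \<in> sobolev q \<Longrightarrow> L2 f" and sobolev_wt: "f \<in> sobolev q \<Longrightarrow> L2 (wt q f)"
  by (auto simp: sobolev_iff)

lemma sobolev_bound:
  assumes f: "f \<in> sobolev q" and g: "L2 g" and K: "0 \<le> K"
    and le: "AE \<xi> in lborel. cmod (wt p g \<xi>) \<le> K * cmod (wt q f \<xi>)"
  shows "g \<in> sobolev p" "sobolev_norm p g \<le> K * sobolev_norm q f"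
  using L2_bound[OF sobolev_wt[OF f] wt_measurable[OF g] le] g
    l2n_mono[OF sobolev_wt[OF f] wt_measurable[OF g] le K]
  by (simp_all add: sobolev_iff sobolev_norm_eq)

lemma
  assumes f: "f \<in> sobolev q" and "p \<le> q"
  shows sobolev_mono: "f \<in> sobolev p" and sobolev_norm_mono: "sobolev_norm p f \<le> sobolev_norm q f"
proof -
  have "AE \<xi> in lborel. cmod (wt p f \<xi>) \<le> 1 * cmod (wt q f \<xi>)"
    using jb_mono[OF assms(2)] by (intro AE_I2) (simp add: cmod_wt mult_right_mono)
  from sobolev_bound[OF f sobolev_L2[OF f] _ this]
  show "f \<in> sobolev p" "sobolev_norm p f \<le> sobolev_norm q f" by auto
qed

lemma sobolev_0: "L2 f \<Longrightarrow> f \<in> sobolev 0"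
  by (simp add: sobolev_iff wt_def[abs_def])

lemma sobolev_cong_AE:
  assumes f: "f \<in> sobolev q" and g: "g \<in> borel_measurable borel" and eq: "AE x in lborel. f x = g x"
  shows "g \<in> sobolev q" "sobolev_norm q g = sobolev_norm q f"
proof -
  have gL: "L2 g" by (rule L2_cong_AE[OF sobolev_L2[OF f] g eq])
  have w: "AE \<xi> in lborel. wt q g \<xi> = wt q f \<xi>"
    using fourier_cong_AE[OF sobolev_L2[OF f] g eq] by eventually_elim (simp add: wt_def)
  then have "AE \<xi> in lborel. wt q f \<xi> = wt q g \<xi>" by eventually_elim simp
  from L2_cong_AE[OF sobolev_wt[OF f] wt_measurable[OF gL] this] gL
  show "g \<in> sobolev q" by (simp add: sobolev_iff)
  show "sobolev_norm q g = sobolev_norm q f" unfolding sobolev_norm_eq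
    by (rule l2n_cong_AE[OF wt_measurable[OF gL] wt_measurable[OF sobolev_L2[OF f]] w])
qed

lemma wt_add: "L2 f \<Longrightarrow> L2 g \<Longrightarrow> AE \<xi> in lborel. wt q (\<lambda>x. f x + g x) \<xi> = wt q f \<xi> + wt q g \<xi>"
  using fourier_add[of f g] by (auto simp: wt_def distrib_left elim: eventually_mono)

lemma wt_cmult: "L2 f \<Longrightarrow> AE \<xi> in lborel. wt q (\<lambda>x. c * f x) \<xi> = complex_of_real c * wt q f \<xi>"
  using fourier_cmult[of f c] by (auto simp: wt_def elim: eventually_mono)

lemma
  assumes f: "f \<in> sobolev q" and g: "g \<in> sobolev q"
  shows sobolev_add: "(\<lambda>x. f x + g x) \<in> sobolev q"
    and sobolev_norm_add: "sobolev_norm q (\<lambda>x. f x + g x) \<le> sobolev_norm q f + sobolev_norm q g"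
proof -
  have L: "L2 (\<lambda>x. f x + g x)" using f g by (intro L2_add sobolev_L2)
  have w: "AE \<xi> in lborel. wt q f \<xi> + wt q g \<xi> = wt q (\<lambda>x. f x + g x) \<xi>"
    using wt_add[OF sobolev_L2[OF f] sobolev_L2[OF g], of q] by eventually_elim simp
  note m = L2_measurable[OF L2_add[OF sobolev_wt[OF f] sobolev_wt[OF g]]]
  show "(\<lambda>x. f x + g x) \<in> sobolev q"
    using L2_cong_AE[OF L2_add[OF sobolev_wt[OF f] sobolev_wt[OF g]] wt_measurable[OF L] w] L by (simp add: sobolev_iff)
  show "sobolev_norm q (\<lambda>x. f x + g x) \<le> sobolev_norm q f + sobolev_norm q g"
    using l2n_cong_AE[OF m wt_measurable[OF L] w] l2n_triangle[OF sobolev_wt[OF f] sobolev_wt[OF g]]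
    by (simp add: sobolev_norm_eq)
qed

lemma
  assumes f: "f \<in> sobolev q"
  shows sobolev_cmult: "(\<lambda>x. c * f x) \<in> sobolev q"
    and sobolev_norm_cmult: "sobolev_norm q (\<lambda>x. c * f x) = \<bar>c\<bar> * sobolev_norm q f"
proof -
  have L: "L2 (\<lambda>x. c * f x)" using f by (intro L2_cmult sobolev_L2)
  have w: "AE \<xi> in lborel. complex_of_real c * wt q f \<xi> = wt q (\<lambda>x. c * f x) \<xi>"
    using wt_cmult[OF sobolev_L2[OF f], of q c] by eventually_elim simp
  note m = L2_measurable[OF L2_cmult[OF sobolev_wt[OF f]]]
  show "(\<lambda>x. c * f x) \<in> sobolev q"
    using L2_cong_AE[OF L2_cmult[OF sobolev_wt[OF f]] wt_measurable[OF L] w] L by (simp add: sobolev_iff)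
  show "sobolev_norm q (\<lambda>x. c * f x) = \<bar>c\<bar> * sobolev_norm q f"
    using l2n_cong_AE[OF m wt_measurable[OF L] w] by (simp add: sobolev_norm_eq l2n_cmult)
qed

lemma
  assumes f: "f \<in> sobolev q" and g: "g \<in> sobolev q"
  shows sobolev_diff: "(\<lambda>x. f x - g x) \<in> sobolev q"
    and sobolev_norm_diff: "sobolev_norm q (\<lambda>x. f x - g x) \<le> sobolev_norm q f + sobolev_norm q g"
  using sobolev_add[OF f sobolev_cmult[OF g, of "-1"]] sobolev_norm_add[OF f sobolev_cmult[OF g, of "-1"]]
    sobolev_norm_cmult[OF g, of "-1"] by simp_all

lemma sobolev_norm_diff_commute: "f \<in> sobolev q \<Longrightarrow> g \<in> sobolev q \<Longrightarrow>
    sobolev_norm q (\<lambda>x. f x - g x) = sobolev_norm q (\<lambda>x. g x - f x)"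
  using sobolev_norm_cmult[OF sobolev_diff[of f q g], of "-1"] by simp

lemma sobolev_norm_0D:
  assumes f: "f \<in> sobolev q" and z: "sobolev_norm q f = 0" shows "AE x in lborel. f x = 0"
proof -
  have "AE \<xi> in lborel. wt q f \<xi> = 0"
    using l2n_eq_0D[OF sobolev_wt[OF f]] z by (simp add: sobolev_norm_eq)
  then have "AE \<xi> in lborel. fourier f \<xi> = fourier (\<lambda>x. 0) \<xi>"
    using fourier_zero
  proof eventually_elim
    case (elim \<xi>) then show ?case using jb_pos[of q \<xi>] by (simp add: wt_def del: jb_pos)
  qed
  from fourier_injective[OF sobolev_L2[OF f] L2_zero this] show ?thesis .
qed

lemma sobolev_zero: "(\<lambda>x. 0) \<in> sobolev q" "sobolev_norm q (\<lambda>x. 0) = 0"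
proof -
  have z: "AE \<xi> in lborel. (0::complex) = wt q (\<lambda>x. 0) \<xi>"
    using fourier_zero by eventually_elim (simp add: wt_def)
  show "(\<lambda>x. 0) \<in> sobolev q"
    using L2_cong_AE[OF L2_zero wt_measurable[OF L2_zero] z] by (simp add: sobolev_iff)
  show "sobolev_norm q (\<lambda>x. 0) = 0"
    using l2n_cong_AE[OF _ wt_measurable[OF L2_zero] z] by (simp add: sobolev_norm_eq) (simp add: l2n_def)
qed

text \<open>
  The inner product of \<open>H\<^sup>q\<close>. The integral is real for real functions, as the transforms are Hermitian;
  taking the real part makes the symmetry immediate.
\<close>

definition ip :: "real \<Rightarrow> (real \<Rightarrow> real) \<Rightarrow> (real \<Rightarrow> real) \<Rightarrow> real" where
  "ip q f g = Re (\<integral>\<xi>. wt q f \<xi> * cnj (wt q g \<xi>) \<partial>lborel)"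

lemma ip_integrable: "f \<in> sobolev q \<Longrightarrow> g \<in> sobolev q \<Longrightarrow> integrable lborel (\<lambda>\<xi>. wt q f \<xi> * cnj (wt q g \<xi>))"
  by (intro L2_mult_integrable L2_cnj sobolev_wt)

lemma ip_bound: assumes "f \<in> sobolev q" "g \<in> sobolev q"
  shows "\<bar>ip q f g\<bar> \<le> sobolev_norm q f * sobolev_norm q g"
proof -
  have "\<bar>ip q f g\<bar> \<le> cmod (\<integral>\<xi>. wt q f \<xi> * cnj (wt q g \<xi>) \<partial>lborel)" unfolding ip_def by (rule abs_Re_le_cmod)
  also have "\<dots> \<le> l2n (wt q f) * l2n (\<lambda>\<xi>. cnj (wt q g \<xi>))"
    using assms by (intro l2n_Cauchy_Schwarz L2_cnj sobolev_wt)
  finally show ?thesis by (simp add: sobolev_norm_eq l2n_cnj)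
qed

lemma ip_self: "ip q f f = (sobolev_norm q f)\<^sup>2"
  by (simp only: ip_def integral_mult_cnj_self sobolev_norm_eq Re_complex_of_real)

lemma ip_add:
  assumes f: "f \<in> sobolev q" and g: "g \<in> sobolev q" and h: "h \<in> sobolev q"
  shows "ip q f (\<lambda>x. g x + h x) = ip q f g + ip q f h"
proof -
  have "(\<integral>\<xi>. wt q f \<xi> * cnj (wt q (\<lambda>x. g x + h x) \<xi>) \<partial>lborel)
     = (\<integral>\<xi>. wt q f \<xi> * cnj (wt q g \<xi>) + wt q f \<xi> * cnj (wt q h \<xi>) \<partial>lborel)"
  proof (rule integral_cong_AE)
    show "AE \<xi> in lborel. wt q f \<xi> * cnj (wt q (\<lambda>x. g x + h x) \<xi>) = wt q f \<xi> * cnj (wt q g \<xi>) + wt q f \<xi> * cnj (wt q h \<xi>)"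
      using wt_add[OF sobolev_L2[OF g] sobolev_L2[OF h], of q] by eventually_elim (simp add: algebra_simps)
    show "(\<lambda>\<xi>. wt q f \<xi> * cnj (wt q (\<lambda>x. g x + h x) \<xi>)) \<in> borel_measurable lborel"
      using ip_integrable[OF f sobolev_add[OF g h]] by auto
    show "(\<lambda>\<xi>. wt q f \<xi> * cnj (wt q g \<xi>) + wt q f \<xi> * cnj (wt q h \<xi>)) \<in> borel_measurable lborel"
      using ip_integrable[OF f g] ip_integrable[OF f h] by auto
  qed
  then show ?thesis using ip_integrable[OF f g] ip_integrable[OF f h] by (simp add: ip_def)
qed

lemma ip_cmult:
  assumes f: "f \<in> sobolev q" and g: "g \<in> sobolev q"
  shows "ip q f (\<lambda>x. c * g x) = c * ip q f g"
proof -
  have "(\<integral>\<xi>. wt q f \<xi> * cnj (wt q (\<lambda>x. c * g x) \<xi>) \<partial>lborel)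
     = (\<integral>\<xi>. complex_of_real c * (wt q f \<xi> * cnj (wt q g \<xi>)) \<partial>lborel)"
  proof (rule integral_cong_AE)
    show "AE \<xi> in lborel. wt q f \<xi> * cnj (wt q (\<lambda>x. c * g x) \<xi>) = complex_of_real c * (wt q f \<xi> * cnj (wt q g \<xi>))"
      using wt_cmult[OF sobolev_L2[OF g], of q c] by eventually_elim simp
    show "(\<lambda>\<xi>. wt q f \<xi> * cnj (wt q (\<lambda>x. c * g x) \<xi>)) \<in> borel_measurable lborel"
      using ip_integrable[OF f sobolev_cmult[OF g]] by auto
    show "(\<lambda>\<xi>. complex_of_real c * (wt q f \<xi> * cnj (wt q g \<xi>))) \<in> borel_measurable lborel"
      using ip_integrable[OF f g] by auto
  qed
  then show ?thesis by (simp add: ip_def)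
qed

lemma ip_cong_AE:
  assumes f: "f \<in> sobolev q" and g: "g \<in> sobolev q" and h: "h \<in> borel_measurable borel" and eq: "AE x in lborel. g x = h x"
  shows "ip q f h = ip q f g"
  unfolding ip_def
proof (rule arg_cong[where f = Re], rule integral_cong_AE)
  show "AE \<xi> in lborel. wt q f \<xi> * cnj (wt q h \<xi>) = wt q f \<xi> * cnj (wt q g \<xi>)"
    using fourier_cong_AE[OF sobolev_L2[OF g] h eq] by eventually_elim (simp add: wt_def)
  show "(\<lambda>\<xi>. wt q f \<xi> * cnj (wt q h \<xi>)) \<in> borel_measurable lborel"
    using ip_integrable[OF f sobolev_cong_AE(1)[OF g h eq]] by auto
  show "(\<lambda>\<xi>. wt q f \<xi> * cnj (wt q g \<xi>)) \<in> borel_measurable lborel"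
    using ip_integrable[OF f g] by auto
qed

lemma ip_commute: "ip q f g = ip q g f"
proof -
  have "(\<integral>\<xi>. wt q g \<xi> * cnj (wt q f \<xi>) \<partial>lborel) = (\<integral>\<xi>. cnj (wt q f \<xi> * cnj (wt q g \<xi>)) \<partial>lborel)"
    by (simp add: mult.commute)
  also have "\<dots> = cnj (\<integral>\<xi>. wt q f \<xi> * cnj (wt q g \<xi>) \<partial>lborel)" by (rule Bochner_Integration.integral_cnj)
  finally show ?thesis by (simp add: ip_def)
qed

lemma sobolev_norm_sq_add:
  assumes f: "f \<in> sobolev q" and g: "g \<in> sobolev q"
  shows "(sobolev_norm q (\<lambda>x. f x + g x))\<^sup>2 = (sobolev_norm q f)\<^sup>2 + 2 * ip q f g + (sobolev_norm q g)\<^sup>2"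
  using ip_add[OF sobolev_add[OF f g] f g] ip_add[OF f f g] ip_add[OF g f g]
    ip_commute[of q "\<lambda>x. f x + g x"] ip_commute[of q g f] by (simp add: ip_self)

section \<open>Operators between Sobolev spaces\<close>

lemma sobolev_weak_deriv_L2:
  assumes "f \<in> sobolev 1"
  shows "L2 (weak_deriv f)" "AE \<xi> in lborel. fourier (weak_deriv f) \<xi> = \<i> * complex_of_real \<xi> * fourier f \<xi>"
proof -
  note [measurable] = fourier_measurable[OF sobolev_L2[OF assms]]
  have "L2 (\<lambda>\<xi>. complex_of_real \<xi> * fourier f \<xi>)"
  proof (rule L2_bound[OF sobolev_wt[OF assms]])
    show "AE \<xi> in lborel. cmod (complex_of_real \<xi> * fourier f \<xi>) \<le> 1 * cmod (wt 1 f \<xi>)"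
      using abs_le_jb_1 by (intro AE_I2) (simp add: cmod_wt norm_mult mult_right_mono)
  qed measurable
  from weak_deriv_fourier[OF sobolev_L2[OF assms] this]
  show "L2 (weak_deriv f)" "AE \<xi> in lborel. fourier (weak_deriv f) \<xi> = \<i> * complex_of_real \<xi> * fourier f \<xi>" by auto
qed

lemma
  assumes f1: "f \<in> sobolev 1" and f: "f \<in> sobolev (q + 1)"
  shows sobolev_weak_deriv: "weak_deriv f \<in> sobolev q"
    and sobolev_norm_weak_deriv: "sobolev_norm q (weak_deriv f) \<le> sobolev_norm (q + 1) f"
proof -
  have "AE \<xi> in lborel. cmod (wt q (weak_deriv f) \<xi>) \<le> 1 * cmod (wt (q + 1) f \<xi>)"
    using sobolev_weak_deriv_L2(2)[OF f1]
  proof eventually_elim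
    case (elim \<xi>)
    have "jb q \<xi> * (\<bar>\<xi>\<bar> * cmod (fourier f \<xi>)) \<le> jb q \<xi> * (jb 1 \<xi> * cmod (fourier f \<xi>))"
      by (intro mult_left_mono mult_right_mono abs_le_jb_1) auto
    then show ?case by (simp add: cmod_wt elim norm_mult jb_add mult.assoc)
  qed
  from sobolev_bound[OF f sobolev_weak_deriv_L2(1)[OF f1] _ this]
  show "weak_deriv f \<in> sobolev q" "sobolev_norm q (weak_deriv f) \<le> sobolev_norm (q + 1) f" by auto
qed

lemma weak_deriv_diff:
  assumes f: "f \<in> sobolev 1" and g: "g \<in> sobolev 1"
  shows "AE x in lborel. weak_deriv (\<lambda>x. f x - g x) x = weak_deriv f x - weak_deriv g x"
proof (rule fourier_injective)
  note d = sobolev_weak_deriv_L2[OF f] sobolev_weak_deriv_L2[OF g] sobolev_weak_deriv_L2[OF sobolev_diff[OF f g]]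
  show "L2 (weak_deriv (\<lambda>x. f x - g x))" "L2 (\<lambda>x. weak_deriv f x - weak_deriv g x)"
    using d by (auto intro: L2_diff)
  show "AE \<xi> in lborel. fourier (weak_deriv (\<lambda>x. f x - g x)) \<xi> = fourier (\<lambda>x. weak_deriv f x - weak_deriv g x) \<xi>"
    using fourier_diff[OF d(1) d(3)] fourier_diff[OF sobolev_L2[OF f] sobolev_L2[OF g]] d(2,4,6)
    by eventually_elim (simp add: right_diff_distrib)
qed

lemma weak_deriv_cong_AE:
  assumes f: "f \<in> sobolev 1" and g: "g \<in> borel_measurable borel" and eq: "AE x in lborel. f x = g x"
  shows "AE x in lborel. weak_deriv g x = weak_deriv f x"
proof (rule fourier_injective)
  note d = sobolev_weak_deriv_L2[OF f] sobolev_weak_deriv_L2[OF sobolev_cong_AE(1)[OF f g eq]]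
  show "L2 (weak_deriv f)" "L2 (weak_deriv g)" using d by auto
  show "AE \<xi> in lborel. fourier (weak_deriv g) \<xi> = fourier (weak_deriv f) \<xi>"
    using fourier_cong_AE[OF sobolev_L2[OF f] g eq] d(2,4) by eventually_elim simp
qed

abbreviation nonlocal :: "(real \<Rightarrow> real) \<Rightarrow> real \<Rightarrow> real" where
  "nonlocal f \<equiv> weak_deriv (Lambda_inv4 f)"

lemma nonlocal_fourier:
  assumes f: "L2 f"
  shows "L2 (nonlocal f)"
    "AE \<xi> in lborel. fourier (nonlocal f) \<xi> = \<i> * complex_of_real \<xi> * (fourier f \<xi> / complex_of_real ((1 + \<xi>\<^sup>2)\<^sup>2))"
proof -
  note L = Lambda_inv4_fourier[OF f]
  have "Lambda_inv4 f \<in> sobolev 1"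
  proof (rule sobolev_bound(1)[OF sobolev_0[OF f], where K = 1])
    show "AE \<xi> in lborel. cmod (wt 1 (Lambda_inv4 f) \<xi>) \<le> 1 * cmod (wt 0 f \<xi>)"
      using conjunct2[OF L]
    proof eventually_elim
      case (elim \<xi>)
      have "cmod (wt 1 (Lambda_inv4 f) \<xi>) = jb 1 \<xi> / jb 4 \<xi> * cmod (fourier f \<xi>)"
        by (simp add: cmod_wt elim norm_divide jb_4 norm_power del: of_real_add of_real_power)
      also have "\<dots> \<le> 1 * cmod (fourier f \<xi>)"
        using jb_mono[of 1 4 \<xi>] by (intro mult_right_mono) auto
      finally show ?case by (simp add: cmod_wt)
    qed
  qed (use L in auto)
  from sobolev_weak_deriv_L2[OF this] L
  show "L2 (nonlocal f)" "AE \<xi> in lborel. fourier (nonlocal f) \<xi> = \<i> * complex_of_real \<xi> * (fourier f \<xi> / complex_of_real ((1 + \<xi>\<^sup>2)\<^sup>2))"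
    by (auto elim!: eventually_elim2)
qed

text \<open>
  The symbol of the operator is \<open>\<i>\<xi>/(1 + \<xi>\<^sup>2)\<^sup>2\<close>, of order \<open>1 - 4 = -3\<close>.
\<close>

lemma
  assumes f: "f \<in> sobolev (q - 3)"
  shows sobolev_nonlocal: "nonlocal f \<in> sobolev q"
    and sobolev_norm_nonlocal: "sobolev_norm q (nonlocal f) \<le> sobolev_norm (q - 3) f"
proof -
  have "AE \<xi> in lborel. cmod (wt q (nonlocal f) \<xi>) \<le> 1 * cmod (wt (q - 3) f \<xi>)"
    using nonlocal_fourier(2)[OF sobolev_L2[OF f]]
  proof eventually_elim
    case (elim \<xi>)
    have "cmod (wt q (nonlocal f) \<xi>) = jb q \<xi> * \<bar>\<xi>\<bar> / jb 4 \<xi> * cmod (fourier f \<xi>)"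
      by (simp add: cmod_wt elim norm_divide norm_mult jb_4 norm_power del: of_real_add of_real_power)
    also have "\<dots> \<le> jb q \<xi> * jb 1 \<xi> / jb 4 \<xi> * cmod (fourier f \<xi>)"
      by (intro mult_right_mono divide_right_mono mult_left_mono abs_le_jb_1) auto
    also have "jb q \<xi> * jb 1 \<xi> / jb 4 \<xi> = jb (q - 3) \<xi>"
    proof -
      have "jb (q - 3) \<xi> * jb 4 \<xi> = jb q \<xi> * jb 1 \<xi>" by (simp add: add.commute flip: jb_add)
      moreover have "jb 4 \<xi> \<noteq> 0" using jb_pos[of 4 \<xi>] by linarith
      ultimately show ?thesis by (simp add: divide_eq_eq)
    qed
    finally show ?case by (simp add: cmod_wt)
  qed
  from sobolev_bound[OF f nonlocal_fourier(1)[OF sobolev_L2[OF f]] _ this]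
  show "nonlocal f \<in> sobolev q" "sobolev_norm q (nonlocal f) \<le> sobolev_norm (q - 3) f" by auto
qed

lemma nonlocal_diff:
  assumes f: "L2 f" and g: "L2 g"
  shows "AE x in lborel. nonlocal (\<lambda>x. f x - g x) x = nonlocal f x - nonlocal g x"
proof (rule fourier_injective)
  note d = nonlocal_fourier[OF f] nonlocal_fourier[OF g] nonlocal_fourier[OF L2_diff[OF f g]]
  show "L2 (nonlocal (\<lambda>x. f x - g x))" "L2 (\<lambda>x. nonlocal f x - nonlocal g x)"
    using d by (auto intro: L2_diff)
  show "AE \<xi> in lborel. fourier (nonlocal (\<lambda>x. f x - g x)) \<xi> = fourier (\<lambda>x. nonlocal f x - nonlocal g x) \<xi>"
    using fourier_diff[OF d(1) d(3)] fourier_diff[OF f g] d(2,4,6)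
    by eventually_elim (simp add: right_diff_distrib diff_divide_distrib)
qed

lemma nonlocal_cong_AE:
  assumes f: "L2 f" and g: "g \<in> borel_measurable borel" and eq: "AE x in lborel. f x = g x"
  shows "AE x in lborel. nonlocal g x = nonlocal f x"
proof (rule fourier_injective)
  note d = nonlocal_fourier[OF f] nonlocal_fourier[OF L2_cong_AE[OF f g eq]]
  show "L2 (nonlocal f)" "L2 (nonlocal g)" using d by auto
  show "AE \<xi> in lborel. fourier (nonlocal g) \<xi> = fourier (nonlocal f) \<xi>"
    using fourier_cong_AE[OF f g eq] d(2,4) by eventually_elim simp
qed

definition embed_const :: "real \<Rightarrow> real" where "embed_const p = l2n (jb (- p))"

lemma embed_const_nonneg [simp]: "0 \<le> embed_const p" by (simp add: embed_const_def)

text \<open>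
  The Sobolev embedding on the Fourier side, by the Cauchy-Schwarz inequality.
\<close>

lemma sobolev_weighted_L1:
  assumes f: "f \<in> sobolev q" and m: "m < q - 1 / 2"
  shows "integrable lborel (\<lambda>\<xi>. jb m \<xi> * cmod (fourier f \<xi>))"
    "(\<integral>\<xi>. jb m \<xi> * cmod (fourier f \<xi>) \<partial>lborel) \<le> embed_const (q - m) * sobolev_norm q f"
proof -
  have L: "L2 (jb (- (q - m)))" using m by (intro jb_L2) auto
  have eq: "jb (- (q - m)) \<xi> * cmod (wt q f \<xi>) = jb m \<xi> * cmod (fourier f \<xi>)" for \<xi>
  proof -
    have "jb (- (q - m)) \<xi> * jb q \<xi> = jb m \<xi>" by (simp flip: jb_add)
    then show ?thesis by (simp add: cmod_wt flip: mult.assoc)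
  qed
  show "integrable lborel (\<lambda>\<xi>. jb m \<xi> * cmod (fourier f \<xi>))"
    using L2_mult_integrable[OF L L2_norm[OF sobolev_wt[OF f]]] unfolding eq .
  show "(\<integral>\<xi>. jb m \<xi> * cmod (fourier f \<xi>) \<partial>lborel) \<le> embed_const (q - m) * sobolev_norm q f"
    using l2n_Cauchy_Schwarz_norm[OF L L2_norm[OF sobolev_wt[OF f]]]
    unfolding real_norm_def abs_norm_cancel abs_of_pos[OF jb_pos] eq l2n_norm embed_const_def sobolev_norm_eq .
qed

lemma sobolev_fourier_L1:
  assumes "f \<in> sobolev q" "q > 1 / 2" shows "integrable lborel (fourier f)"
proof -
  have "fourier f \<in> borel_measurable lborel" using fourier_measurable[OF sobolev_L2[OF assms(1)]] by simp
  then show ?thesis using sobolev_weighted_L1(1)[OF assms(1), of 0] assms(2) by (simp add: integrable_norm_iff)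
qed

section \<open>Product estimates\<close>

lemma nn_Cauchy_Schwarz:
  fixes a b :: "real \<Rightarrow> real"
  assumes [measurable]: "a \<in> borel_measurable borel" "b \<in> borel_measurable borel"
    and nn: "\<And>x. 0 \<le> a x" "\<And>x. 0 \<le> b x"
  shows "(\<integral>\<^sup>+x. ennreal (a x * b x) \<partial>lborel)\<^sup>2 \<le> (\<integral>\<^sup>+x. ennreal ((a x)\<^sup>2) \<partial>lborel) * (\<integral>\<^sup>+x. ennreal ((b x)\<^sup>2) \<partial>lborel)"
proof -
  let ?A = "\<integral>\<^sup>+x. ennreal ((a x)\<^sup>2) \<partial>lborel" and ?B = "\<integral>\<^sup>+x. ennreal ((b x)\<^sup>2) \<partial>lborel"
  consider "?A = 0" | "?B = 0" | "?A \<noteq> 0" "?B \<noteq> 0" "?A = \<infinity> \<or> ?B = \<infinity>" | "?A \<noteq> \<infinity>" "?B \<noteq> \<infinity>"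
    by blast
  then show ?thesis
  proof cases
    case 1
    then have "AE x in lborel. ennreal ((a x)\<^sup>2) = 0" by (subst (asm) nn_integral_0_iff_AE) auto
    then have "AE x in lborel. ennreal (a x * b x) = 0" by eventually_elim (simp add: ennreal_eq_0_iff)
    then have "(\<integral>\<^sup>+x. ennreal (a x * b x) \<partial>lborel) = 0" by (subst nn_integral_0_iff_AE) auto
    then show ?thesis by simp
  next
    case 2
    then have "AE x in lborel. ennreal ((b x)\<^sup>2) = 0" by (subst (asm) nn_integral_0_iff_AE) auto
    then have "AE x in lborel. ennreal (a x * b x) = 0" by eventually_elim (simp add: ennreal_eq_0_iff)
    then have "(\<integral>\<^sup>+x. ennreal (a x * b x) \<partial>lborel) = 0" by (subst nn_integral_0_iff_AE) auto
    then show ?thesis by simp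
  next
    case 3
    then have "?A * ?B = \<infinity>" by (auto simp: ennreal_top_mult ennreal_mult_top)
    then show ?thesis by simp
  next
    case 4
    have L: "L2 a" "L2 b" using 4 by (auto simp: L2_def integrable_iff_bounded less_top)
    have "integrable lborel (\<lambda>x. a x * b x)" by (rule L2_mult_integrable[OF L])
    then have "(\<integral>\<^sup>+x. ennreal (a x * b x) \<partial>lborel) = ennreal (\<integral>x. a x * b x \<partial>lborel)"
      using nn by (intro nn_integral_eq_integral) auto
    also have "\<dots> \<le> ennreal (l2n a * l2n b)"
      using l2n_Cauchy_Schwarz_norm[OF L] nn by (intro ennreal_leI) simp
    finally have "(\<integral>\<^sup>+x. ennreal (a x * b x) \<partial>lborel)\<^sup>2 \<le> (ennreal (l2n a * l2n b))\<^sup>2" by (rule power_mono) simp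
    also have "\<dots> = ?A * ?B"
      using l2n_nn_integral[OF L(1)] l2n_nn_integral[OF L(2)]
      by (simp add: ennreal_power power_mult_distrib flip: ennreal_mult)
    finally show ?thesis .
  qed
qed

lemma nn_integral_translate:
  fixes f :: "real \<Rightarrow> ennreal"
  assumes [measurable]: "f \<in> borel_measurable borel"
  shows "(\<integral>\<^sup>+x. f (x - c) \<partial>lborel) = (\<integral>\<^sup>+x. f x \<partial>lborel)" "(\<integral>\<^sup>+x. f (c - x) \<partial>lborel) = (\<integral>\<^sup>+x. f x \<partial>lborel)"
  using nn_integral_real_affine[of f 1 "-c"] nn_integral_real_affine[of f "-1" c] by simp_all

text \<open>
  The value may be infinite, which allows Young's inequality to be stated before any convergence is
  known.
\<close>

definition nnconv :: "(real \<Rightarrow> real) \<Rightarrow> (real \<Rightarrow> real) \<Rightarrow> real \<Rightarrow> ennreal" where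
  "nnconv A B \<xi> = (\<integral>\<^sup>+\<eta>. ennreal (A (\<xi> - \<eta>) * B \<eta>) \<partial>lborel)"

lemma nnconv_measurable [measurable]:
  assumes [measurable]: "A \<in> borel_measurable borel" "B \<in> borel_measurable borel"
  shows "nnconv A B \<in> borel_measurable borel"
  unfolding nnconv_def by measurable

lemma nnconv_commute:
  assumes [measurable]: "A \<in> borel_measurable borel" "B \<in> borel_measurable borel"
  shows "nnconv A B \<xi> = nnconv B A \<xi>"
  unfolding nnconv_def using nn_integral_translate(2)[of "\<lambda>\<eta>. ennreal (A (\<xi> - \<eta>) * B \<eta>)" \<xi>]
  by (simp add: mult.commute)

text \<open>
  The Cauchy-Schwarz inequality for the measure \<open>A(\<xi> - \<eta>) d\<eta>\<close> bounds the square of the convolution by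
  the mass of \<open>A\<close> times the convolution of \<open>A\<close> with \<open>B\<^sup>2\<close>, and Fubini's theorem integrates the latter.
\<close>

lemma young:
  assumes [measurable]: "A \<in> borel_measurable borel" "B \<in> borel_measurable borel"
    and nn: "\<And>x. 0 \<le> A x" "\<And>x. 0 \<le> B x"
  shows "(\<integral>\<^sup>+\<xi>. (nnconv A B \<xi>)\<^sup>2 \<partial>lborel) \<le> (\<integral>\<^sup>+x. ennreal (A x) \<partial>lborel)\<^sup>2 * (\<integral>\<^sup>+x. ennreal ((B x)\<^sup>2) \<partial>lborel)"
proof -
  let ?I = "\<integral>\<^sup>+x. ennreal (A x) \<partial>lborel"
  have "(nnconv A B \<xi>)\<^sup>2 \<le> ?I * (\<integral>\<^sup>+\<eta>. ennreal (A (\<xi> - \<eta>)) * ennreal ((B \<eta>)\<^sup>2) \<partial>lborel)" for \<xi>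
  proof -
    have "nnconv A B \<xi> = (\<integral>\<^sup>+\<eta>. ennreal (sqrt (A (\<xi> - \<eta>)) * (sqrt (A (\<xi> - \<eta>)) * B \<eta>)) \<partial>lborel)"
      unfolding nnconv_def using nn by (simp flip: mult.assoc)
    also have "\<dots>\<^sup>2 \<le> (\<integral>\<^sup>+\<eta>. ennreal ((sqrt (A (\<xi> - \<eta>)))\<^sup>2) \<partial>lborel) * (\<integral>\<^sup>+\<eta>. ennreal ((sqrt (A (\<xi> - \<eta>)) * B \<eta>)\<^sup>2) \<partial>lborel)"
      by (rule nn_Cauchy_Schwarz) (use nn in auto)
    also have "\<dots> = (\<integral>\<^sup>+\<eta>. ennreal (A (\<xi> - \<eta>)) \<partial>lborel) * (\<integral>\<^sup>+\<eta>. ennreal (A (\<xi> - \<eta>)) * ennreal ((B \<eta>)\<^sup>2) \<partial>lborel)"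
      using nn by (simp add: power_mult_distrib ennreal_mult)
    also have "(\<integral>\<^sup>+\<eta>. ennreal (A (\<xi> - \<eta>)) \<partial>lborel) = ?I"
      by (rule nn_integral_translate(2)) measurable
    finally show ?thesis .
  qed
  then have "(\<integral>\<^sup>+\<xi>. (nnconv A B \<xi>)\<^sup>2 \<partial>lborel) \<le> (\<integral>\<^sup>+\<xi>. ?I * (\<integral>\<^sup>+\<eta>. ennreal (A (\<xi> - \<eta>)) * ennreal ((B \<eta>)\<^sup>2) \<partial>lborel) \<partial>lborel)"
    by (intro nn_integral_mono)
  also have "\<dots> = ?I * (\<integral>\<^sup>+\<xi>. \<integral>\<^sup>+\<eta>. ennreal (A (\<xi> - \<eta>)) * ennreal ((B \<eta>)\<^sup>2) \<partial>lborel \<partial>lborel)"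
    by (rule nn_integral_cmult) measurable
  also have "(\<integral>\<^sup>+\<xi>. \<integral>\<^sup>+\<eta>. ennreal (A (\<xi> - \<eta>)) * ennreal ((B \<eta>)\<^sup>2) \<partial>lborel \<partial>lborel)
      = (\<integral>\<^sup>+\<eta>. \<integral>\<^sup>+\<xi>. ennreal (A (\<xi> - \<eta>)) * ennreal ((B \<eta>)\<^sup>2) \<partial>lborel \<partial>lborel)"
    by (rule lborel_pair.Fubini'[symmetric]) measurable
  also have "\<dots> = (\<integral>\<^sup>+\<eta>. ?I * ennreal ((B \<eta>)\<^sup>2) \<partial>lborel)"
  proof (rule nn_integral_cong)
    fix \<eta>
    have "(\<integral>\<^sup>+\<xi>. ennreal (A (\<xi> - \<eta>)) * ennreal ((B \<eta>)\<^sup>2) \<partial>lborel) = (\<integral>\<^sup>+\<xi>. ennreal (A (\<xi> - \<eta>)) \<partial>lborel) * ennreal ((B \<eta>)\<^sup>2)"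
      by (rule nn_integral_multc) measurable
    also have "(\<integral>\<^sup>+\<xi>. ennreal (A (\<xi> - \<eta>)) \<partial>lborel) = ?I"
      by (rule nn_integral_translate(1)) measurable
    finally show "(\<integral>\<^sup>+\<xi>. ennreal (A (\<xi> - \<eta>)) * ennreal ((B \<eta>)\<^sup>2) \<partial>lborel) = ?I * ennreal ((B \<eta>)\<^sup>2)" .
  qed
  also have "\<dots> = ?I * (\<integral>\<^sup>+x. ennreal ((B x)\<^sup>2) \<partial>lborel)"
    by (rule nn_integral_cmult) measurable
  finally show ?thesis by (simp add: power2_eq_square mult.assoc)
qed

text \<open>
  The assumption on the weights distributes the weight of the product over the factors. In each of the
  two summands one factor is square integrable and the other one is integrable by the Sobolev
  embedding, so Young's inequality applies.
\<close>

lemma sobolev_mult: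
  fixes a b c m m' C :: real
  assumes m: "m < a - 1 / 2" "m' < b - 1 / 2" and C0: "0 \<le> C"
    and C: "\<And>\<xi> \<eta>. jb c \<xi> \<le> C * (jb a (\<xi> - \<eta>) * jb m' \<eta> + jb m (\<xi> - \<eta>) * jb b \<eta>)"
  shows "\<exists>K\<ge>0. \<forall>f g. f \<in> sobolev a \<longrightarrow> g \<in> sobolev b \<longrightarrow> integrable lborel (fourier f) \<longrightarrow> integrable lborel (fourier g) \<longrightarrow>
     (\<lambda>x. f x * g x) \<in> sobolev c \<and> sobolev_norm c (\<lambda>x. f x * g x) \<le> K * sobolev_norm a f * sobolev_norm b g"
proof -
  define K where "K = sqrt (2 * (fc * C)\<^sup>2 * ((embed_const (b - m'))\<^sup>2 + (embed_const (a - m))\<^sup>2))"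
  have "(\<lambda>x. f x * g x) \<in> sobolev c \<and> sobolev_norm c (\<lambda>x. f x * g x) \<le> K * sobolev_norm a f * sobolev_norm b g"
    if f: "f \<in> sobolev a" and g: "g \<in> sobolev b" and fi: "integrable lborel (fourier f)" and gi: "integrable lborel (fourier g)" for f g
  proof -
    let ?h = "\<lambda>x. f x * g x"
    note fm = fourier_mult[OF sobolev_L2[OF f] fi sobolev_L2[OF g] gi]
    note [measurable] = fourier_measurable[OF sobolev_L2[OF f]] fourier_measurable[OF sobolev_L2[OF g]]
    define A1 B1 A2 B2 where "A1 \<xi> = jb a \<xi> * cmod (fourier f \<xi>)" and "B1 \<xi> = jb m' \<xi> * cmod (fourier g \<xi>)"
      and "A2 \<xi> = jb m \<xi> * cmod (fourier f \<xi>)" and "B2 \<xi> = jb b \<xi> * cmod (fourier g \<xi>)" for \<xi>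
    have [measurable]: "A1 \<in> borel_measurable borel" "B1 \<in> borel_measurable borel"
      "A2 \<in> borel_measurable borel" "B2 \<in> borel_measurable borel"
      unfolding A1_def B1_def A2_def B2_def by measurable
    have nn: "0 \<le> A1 x" "0 \<le> B1 x" "0 \<le> A2 x" "0 \<le> B2 x" for x
      unfolding A1_def B1_def A2_def B2_def by auto
    have conv_le: "ennreal (jb c \<xi> * cmod (conv (fourier f) (fourier g) \<xi>)) \<le> ennreal C * (nnconv B1 A1 \<xi> + nnconv A2 B2 \<xi>)" for \<xi>
    proof -
      have "ennreal (cmod (conv (fourier f) (fourier g) \<xi>)) \<le> (\<integral>\<^sup>+\<eta>. ennreal (cmod (fourier f (\<xi> - \<eta>) * fourier g \<eta>)) \<partial>lborel)"
      proof (cases "integrable lborel (\<lambda>\<eta>. fourier f (\<xi> - \<eta>) * fourier g \<eta>)")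
        case True then show ?thesis unfolding conv_def by (rule integral_norm_bound_ennreal)
      qed (simp add: conv_def not_integrable_integral_eq)
      then have "ennreal (jb c \<xi>) * ennreal (cmod (conv (fourier f) (fourier g) \<xi>))
          \<le> ennreal (jb c \<xi>) * (\<integral>\<^sup>+\<eta>. ennreal (cmod (fourier f (\<xi> - \<eta>) * fourier g \<eta>)) \<partial>lborel)"
        by (rule mult_left_mono) simp
      also have "\<dots> = (\<integral>\<^sup>+\<eta>. ennreal (jb c \<xi>) * ennreal (cmod (fourier f (\<xi> - \<eta>) * fourier g \<eta>)) \<partial>lborel)"
        by (rule nn_integral_cmult[symmetric]) measurable
      also have "\<dots> \<le> (\<integral>\<^sup>+\<eta>. ennreal C * (ennreal (A1 (\<xi> - \<eta>) * B1 \<eta>) + ennreal (A2 (\<xi> - \<eta>) * B2 \<eta>)) \<partial>lborel)"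
      proof (rule nn_integral_mono)
        fix \<eta>
        have "jb c \<xi> * (cmod (fourier f (\<xi> - \<eta>)) * cmod (fourier g \<eta>))
            \<le> C * (jb a (\<xi> - \<eta>) * jb m' \<eta> + jb m (\<xi> - \<eta>) * jb b \<eta>) * (cmod (fourier f (\<xi> - \<eta>)) * cmod (fourier g \<eta>))"
          by (intro mult_right_mono C) auto
        also have "\<dots> = C * (A1 (\<xi> - \<eta>) * B1 \<eta> + A2 (\<xi> - \<eta>) * B2 \<eta>)"
          unfolding A1_def B1_def A2_def B2_def by (simp add: algebra_simps)
        finally have "ennreal (jb c \<xi> * (cmod (fourier f (\<xi> - \<eta>)) * cmod (fourier g \<eta>)))
            \<le> ennreal (C * (A1 (\<xi> - \<eta>) * B1 \<eta> + A2 (\<xi> - \<eta>) * B2 \<eta>))" by (rule ennreal_leI)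
        then show "ennreal (jb c \<xi>) * ennreal (cmod (fourier f (\<xi> - \<eta>) * fourier g \<eta>))
            \<le> ennreal C * (ennreal (A1 (\<xi> - \<eta>) * B1 \<eta>) + ennreal (A2 (\<xi> - \<eta>) * B2 \<eta>))"
          using C0 nn by (simp add: norm_mult ennreal_mult ennreal_plus)
      qed
      also have "\<dots> = ennreal C * (nnconv A1 B1 \<xi> + nnconv A2 B2 \<xi>)"
        unfolding nnconv_def by (subst nn_integral_cmult, measurable, subst nn_integral_add, measurable)
      also have "nnconv A1 B1 \<xi> = nnconv B1 A1 \<xi>" by (rule nnconv_commute) measurable
      finally show ?thesis by (simp add: ennreal_mult)
    qed
    have I: "(\<integral>\<^sup>+x. ennreal (B1 x) \<partial>lborel) \<le> ennreal (embed_const (b - m') * sobolev_norm b g)"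
      "(\<integral>\<^sup>+x. ennreal (A2 x) \<partial>lborel) \<le> ennreal (embed_const (a - m) * sobolev_norm a f)"
      unfolding A2_def B1_def
      using sobolev_weighted_L1[OF g m(2)] sobolev_weighted_L1[OF f m(1)]
      by (auto simp: nn_integral_eq_integral intro!: ennreal_leI)
    have S: "(\<integral>\<^sup>+x. ennreal ((A1 x)\<^sup>2) \<partial>lborel) = ennreal ((sobolev_norm a f)\<^sup>2)"
      "(\<integral>\<^sup>+x. ennreal ((B2 x)\<^sup>2) \<partial>lborel) = ennreal ((sobolev_norm b g)\<^sup>2)"
      using l2n_nn_integral[OF sobolev_wt[OF f]] l2n_nn_integral[OF sobolev_wt[OF g]]
      by (simp_all add: A1_def B2_def cmod_wt sobolev_norm_eq)
    have Y1: "(\<integral>\<^sup>+\<xi>. (nnconv B1 A1 \<xi>)\<^sup>2 \<partial>lborel) \<le> ennreal ((embed_const (b - m'))\<^sup>2 * ((sobolev_norm a f)\<^sup>2 * (sobolev_norm b g)\<^sup>2))"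
    proof -
      have "(\<integral>\<^sup>+\<xi>. (nnconv B1 A1 \<xi>)\<^sup>2 \<partial>lborel) \<le> (\<integral>\<^sup>+x. ennreal (B1 x) \<partial>lborel)\<^sup>2 * (\<integral>\<^sup>+x. ennreal ((A1 x)\<^sup>2) \<partial>lborel)"
        by (rule young) (use nn in auto)
      also have "\<dots> \<le> (ennreal (embed_const (b - m') * sobolev_norm b g))\<^sup>2 * ennreal ((sobolev_norm a f)\<^sup>2)"
        unfolding S by (intro mult_right_mono power_mono I) auto
      also have "\<dots> = ennreal ((embed_const (b - m'))\<^sup>2 * ((sobolev_norm a f)\<^sup>2 * (sobolev_norm b g)\<^sup>2))"
        by (simp add: ennreal_power power_mult_distrib mult_ac flip: ennreal_mult)
      finally show ?thesis .
    qed
    have Y2: "(\<integral>\<^sup>+\<xi>. (nnconv A2 B2 \<xi>)\<^sup>2 \<partial>lborel) \<le> ennreal ((embed_const (a - m))\<^sup>2 * ((sobolev_norm a f)\<^sup>2 * (sobolev_norm b g)\<^sup>2))"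
    proof -
      have "(\<integral>\<^sup>+\<xi>. (nnconv A2 B2 \<xi>)\<^sup>2 \<partial>lborel) \<le> (\<integral>\<^sup>+x. ennreal (A2 x) \<partial>lborel)\<^sup>2 * (\<integral>\<^sup>+x. ennreal ((B2 x)\<^sup>2) \<partial>lborel)"
        by (rule young) (use nn in auto)
      also have "\<dots> \<le> (ennreal (embed_const (a - m) * sobolev_norm a f))\<^sup>2 * ennreal ((sobolev_norm b g)\<^sup>2)"
        unfolding S by (intro mult_right_mono power_mono I) auto
      also have "\<dots> = ennreal ((embed_const (a - m))\<^sup>2 * ((sobolev_norm a f)\<^sup>2 * (sobolev_norm b g)\<^sup>2))"
        by (simp add: ennreal_power power_mult_distrib mult_ac flip: ennreal_mult)
      finally show ?thesis .
    qed
    have sq: "(x + y)\<^sup>2 \<le> 2 * (x\<^sup>2 + y\<^sup>2)" for x y :: ennreal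
    proof (cases "x = \<infinity> \<or> y = \<infinity>")
      case True then show ?thesis by (auto simp: power2_eq_square ennreal_top_mult ennreal_mult_top)
    next
      case False
      then obtain p q where pq: "x = ennreal p" "y = ennreal q" "0 \<le> p" "0 \<le> q"
        by (metis ennreal_cases infinity_ennreal_def)
      have "(p + q)\<^sup>2 \<le> 2 * (p\<^sup>2 + q\<^sup>2)" using sum_squares_bound[of p q] by (simp add: power2_sum)
      then have "ennreal ((p + q)\<^sup>2) \<le> ennreal (2 * (p\<^sup>2 + q\<^sup>2))" by (rule ennreal_leI)
      also have "ennreal ((p + q)\<^sup>2) = (x + y)\<^sup>2"
        using pq by (simp add: ennreal_power[symmetric] ennreal_plus)
      also have "ennreal (2 * (p\<^sup>2 + q\<^sup>2)) = 2 * (x\<^sup>2 + y\<^sup>2)"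
        using pq by (simp add: ennreal_mult ennreal_plus ennreal_power)
      finally show ?thesis .
    qed
    have "(\<integral>\<^sup>+\<xi>. ennreal ((cmod (wt c ?h \<xi>))\<^sup>2) \<partial>lborel) \<le> (\<integral>\<^sup>+\<xi>. ennreal (2 * (fc * C)\<^sup>2) * ((nnconv B1 A1 \<xi>)\<^sup>2 + (nnconv A2 B2 \<xi>)\<^sup>2) \<partial>lborel)"
    proof (rule nn_integral_mono_AE, use fm(2) in eventually_elim)
      case (elim \<xi>)
      have "ennreal (cmod (wt c ?h \<xi>)) = ennreal fc * ennreal (jb c \<xi> * cmod (conv (fourier f) (fourier g) \<xi>))"
        by (simp add: cmod_wt elim norm_mult less_imp_le mult.left_commute flip: ennreal_mult)
      also have "\<dots> \<le> ennreal fc * (ennreal C * (nnconv B1 A1 \<xi> + nnconv A2 B2 \<xi>))"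
        by (intro mult_left_mono conv_le) auto
      finally have "(ennreal (cmod (wt c ?h \<xi>)))\<^sup>2 \<le> (ennreal fc * (ennreal C * (nnconv B1 A1 \<xi> + nnconv A2 B2 \<xi>)))\<^sup>2"
        by (rule power_mono) simp
      also have "\<dots> = (ennreal (fc * C))\<^sup>2 * (nnconv B1 A1 \<xi> + nnconv A2 B2 \<xi>)\<^sup>2"
        using C0 by (simp add: ennreal_mult less_imp_le power_mult_distrib mult.assoc)
      also have "\<dots> \<le> (ennreal (fc * C))\<^sup>2 * (2 * ((nnconv B1 A1 \<xi>)\<^sup>2 + (nnconv A2 B2 \<xi>)\<^sup>2))"
        by (intro mult_left_mono sq) simp
      also have "\<dots> = ennreal (2 * (fc * C)\<^sup>2) * ((nnconv B1 A1 \<xi>)\<^sup>2 + (nnconv A2 B2 \<xi>)\<^sup>2)"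
      proof -
        have p: "0 \<le> fc * C" using C0 by (simp add: less_imp_le)
        have "ennreal (2 * (fc * C)\<^sup>2) = ennreal 2 * ennreal ((fc * C)\<^sup>2)" by (rule ennreal_mult) auto
        also have "\<dots> = 2 * (ennreal (fc * C))\<^sup>2" using ennreal_power[OF p, of 2] by simp
        finally show ?thesis by (simp only: mult_ac)
      qed
      finally show ?case by (simp add: ennreal_power)
    qed
    also have "\<dots> = ennreal (2 * (fc * C)\<^sup>2) * ((\<integral>\<^sup>+\<xi>. (nnconv B1 A1 \<xi>)\<^sup>2 \<partial>lborel) + (\<integral>\<^sup>+\<xi>. (nnconv A2 B2 \<xi>)\<^sup>2 \<partial>lborel))"
      by (subst nn_integral_cmult, measurable, subst nn_integral_add, measurable)
    also have "\<dots> \<le> ennreal (2 * (fc * C)\<^sup>2) * (ennreal ((embed_const (b - m'))\<^sup>2 * ((sobolev_norm a f)\<^sup>2 * (sobolev_norm b g)\<^sup>2))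
        + ennreal ((embed_const (a - m))\<^sup>2 * ((sobolev_norm a f)\<^sup>2 * (sobolev_norm b g)\<^sup>2)))"
      by (intro mult_left_mono add_mono Y1 Y2) simp
    also have "\<dots> = ennreal (2 * (fc * C)\<^sup>2 * ((embed_const (b - m'))\<^sup>2 * ((sobolev_norm a f)\<^sup>2 * (sobolev_norm b g)\<^sup>2)
        + (embed_const (a - m))\<^sup>2 * ((sobolev_norm a f)\<^sup>2 * (sobolev_norm b g)\<^sup>2)))"
      by (simp add: ennreal_plus[symmetric] ennreal_mult[symmetric] del: ennreal_plus)
    also have "\<dots> = ennreal ((K * sobolev_norm a f * sobolev_norm b g)\<^sup>2)"
      unfolding K_def power_mult_distrib by (subst real_sqrt_pow2) (auto simp: algebra_simps)
    finally have le: "(\<integral>\<^sup>+\<xi>. ennreal ((cmod (wt c ?h \<xi>))\<^sup>2) \<partial>lborel) \<le> ennreal ((K * sobolev_norm a f * sobolev_norm b g)\<^sup>2)" .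
    have "0 \<le> K * sobolev_norm a f * sobolev_norm b g" by (simp add: K_def)
    from L2_from_nn_integral[OF wt_measurable[OF fm(1)] le this] fm(1)
    show ?thesis by (simp add: sobolev_iff sobolev_norm_eq)
  qed
  then show ?thesis by (intro exI[of _ K]) (auto simp: K_def)
qed

text \<open>
  Integrability of the transforms makes the product square integrable, which does not follow from
  membership in \<open>H\<^sup>a\<close> and \<open>H\<^sup>b\<close> when an index is small or negative.
\<close>

definition mult_ok :: "real \<Rightarrow> real \<Rightarrow> real \<Rightarrow> real \<Rightarrow> bool" where
  "mult_ok a b c K \<longleftrightarrow> 0 \<le> K \<and> (\<forall>f g. f \<in> sobolev a \<longrightarrow> g \<in> sobolev b \<longrightarrow> integrable lborel (fourier f) \<longrightarrow> integrable lborel (fourier g) \<longrightarrow>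
     (\<lambda>x. f x * g x) \<in> sobolev c \<and> sobolev_norm c (\<lambda>x. f x * g x) \<le> K * sobolev_norm a f * sobolev_norm b g)"

text \<open>
  The second factor carries the weight, and the first one pays for the shift of the frequency with
  \<open>\<bar>c'\<bar>\<close> derivatives. The intermediate index \<open>c'\<close> reduces this price when \<open>c\<close> is very negative.
\<close>

lemma mult_ok_peetre:
  assumes "c \<le> c'" "c' \<le> b" "\<bar>c'\<bar> < a - 1 / 2"
  shows "\<exists>K. mult_ok a b c K"
proof -
  \<comment> \<open>the bound comes from the second summand alone; \<open>b - 1\<close> stands for any index below \<open>b - 1/2\<close>\<close>
  have "jb c \<xi> \<le> 2 powr (\<bar>c'\<bar> / 2) * (jb a (\<xi> - \<eta>) * jb (b - 1) \<eta> + jb \<bar>c'\<bar> (\<xi> - \<eta>) * jb b \<eta>)" for \<xi> \<eta>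
  proof -
    have "jb c \<xi> \<le> jb c' \<xi>" by (rule jb_mono[OF assms(1)])
    also have "\<dots> \<le> 2 powr (\<bar>c'\<bar> / 2) * jb \<bar>c'\<bar> (\<xi> - \<eta>) * jb c' \<eta>" by (rule jb_peetre)
    also have "\<dots> \<le> 2 powr (\<bar>c'\<bar> / 2) * jb \<bar>c'\<bar> (\<xi> - \<eta>) * jb b \<eta>"
      by (intro mult_left_mono jb_mono assms(2)) auto
    also have "\<dots> \<le> 2 powr (\<bar>c'\<bar> / 2) * (jb a (\<xi> - \<eta>) * jb (b - 1) \<eta> + jb \<bar>c'\<bar> (\<xi> - \<eta>) * jb b \<eta>)"
      unfolding mult.assoc by (intro mult_left_mono) auto
    finally show ?thesis .
  qed
  from sobolev_mult[OF assms(3) _ _ this] show ?thesis unfolding mult_ok_def by auto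
qed

text \<open>
  Sharing the weight between the factors covers the case \<open>c = a\<close>, in which the first factor has no
  derivatives to spare.
\<close>

lemma mult_ok_split:
  assumes "0 \<le> c" "c \<le> a" "c \<le> b" "1 / 2 < a" "1 / 2 < b"
  shows "\<exists>K. mult_ok a b c K"
proof -
  have "jb c \<xi> \<le> 4 powr (c / 2) * (jb a (\<xi> - \<eta>) * jb 0 \<eta> + jb 0 (\<xi> - \<eta>) * jb b \<eta>)" for \<xi> \<eta>
  proof -
    have "jb c \<xi> \<le> 4 powr (c / 2) * (jb c (\<xi> - \<eta>) + jb c \<eta>)" by (rule jb_split[OF assms(1)])
    also have "\<dots> \<le> 4 powr (c / 2) * (jb a (\<xi> - \<eta>) + jb b \<eta>)"
      by (intro mult_left_mono add_mono jb_mono assms) auto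
    finally show ?thesis by simp
  qed
  from sobolev_mult[OF _ _ _ this] assms show ?thesis unfolding mult_ok_def by auto
qed

section \<open>The transport term\<close>

lemma conv_cong_AE:
  assumes [measurable]: "A \<in> borel_measurable borel" "A' \<in> borel_measurable borel"
      "B \<in> borel_measurable borel" "B' \<in> borel_measurable borel"
    and A: "AE x in lborel. A x = A' x" and B: "AE x in lborel. B x = B' x"
  shows "conv A B \<xi> = conv A' B' \<xi>"
  unfolding conv_def
proof (rule integral_cong_AE)
  have "AE \<eta> in lborel. A (\<xi> - \<eta>) = A' (\<xi> - \<eta>)"
    using AE_affine[OF A, of "-1" \<xi>] by simp
  then show "AE \<eta> in lborel. A (\<xi> - \<eta>) * B \<eta> = A' (\<xi> - \<eta>) * B' \<eta>"
    using B by eventually_elim simp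
qed measurable

text \<open>
  From \<open>2\<bar>\<alpha>(\<xi>)\<gamma>(\<eta>)\<bar> \<le> \<alpha>(\<xi>)\<^sup>2 + \<gamma>(\<eta>)\<^sup>2\<close>: integrating \<open>\<beta>\<close> first in the free variable leaves its mass.
\<close>

lemma integrable_trilinear:
  fixes \<alpha> \<beta> \<gamma> :: "real \<Rightarrow> real"
  assumes \<alpha>: "L2 \<alpha>" and \<gamma>: "L2 \<gamma>" and \<beta>: "integrable lborel \<beta>" and nn: "\<And>x. 0 \<le> \<beta> x"
  shows "integrable (lborel \<Otimes>\<^sub>M lborel) (\<lambda>(\<xi>, \<eta>). \<alpha> \<xi> * \<beta> (\<xi> - \<eta>) * \<gamma> \<eta>)"
    and "(\<integral>(\<xi>, \<eta>). \<bar>\<alpha> \<xi>\<bar> * \<beta> (\<xi> - \<eta>) * \<bar>\<gamma> \<eta>\<bar> \<partial>(lborel \<Otimes>\<^sub>M lborel)) \<le> (\<integral>x. \<beta> x \<partial>lborel) * (((l2n \<alpha>)\<^sup>2 + (l2n \<gamma>)\<^sup>2) / 2)"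
proof -
  note [measurable] = L2_measurable[OF \<alpha>] L2_measurable[OF \<gamma>]
  have [measurable]: "\<beta> \<in> borel_measurable borel" using \<beta> by auto
  have a2: "integrable lborel (\<lambda>x. (\<alpha> x)\<^sup>2)" and g2: "integrable lborel (\<lambda>x. (\<gamma> x)\<^sup>2)"
    using L2_integrable[OF \<alpha>] L2_integrable[OF \<gamma>] by simp_all
  have \<beta>': "integrable lborel (\<lambda>x. \<beta> (- x))"
    using lborel_integrable_real_affine[OF \<beta>, of "-1" 0] by simp
  have trans: "(\<integral>\<eta>. \<beta> (\<xi> - \<eta>) \<partial>lborel) = (\<integral>x. \<beta> x \<partial>lborel)" for \<xi>
    using lborel_integral_real_affine[of "-1" \<beta> \<xi>] by simp
  have i1: "integrable (lborel \<Otimes>\<^sub>M lborel) (\<lambda>(\<eta>, \<xi>). \<beta> (\<xi> - \<eta>) * (\<gamma> \<eta>)\<^sup>2)"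
    by (rule integrable_conv_pair[OF \<beta> g2])
  then have I1: "integrable (lborel \<Otimes>\<^sub>M lborel) (\<lambda>(\<xi>, \<eta>). \<beta> (\<xi> - \<eta>) * (\<gamma> \<eta>)\<^sup>2)"
    using lborel_pair.integrable_product_swap[OF i1] by (simp add: case_prod_beta')
  have I2: "integrable (lborel \<Otimes>\<^sub>M lborel) (\<lambda>(\<xi>, \<eta>). \<beta> (\<xi> - \<eta>) * (\<alpha> \<xi>)\<^sup>2)"
    using integrable_conv_pair[OF \<beta>' a2] by simp
  have v1: "(\<integral>(\<xi>, \<eta>). \<beta> (\<xi> - \<eta>) * (\<gamma> \<eta>)\<^sup>2 \<partial>(lborel \<Otimes>\<^sub>M lborel)) = (\<integral>x. \<beta> x \<partial>lborel) * (l2n \<gamma>)\<^sup>2"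
  proof -
    have "(\<integral>(\<xi>, \<eta>). \<beta> (\<xi> - \<eta>) * (\<gamma> \<eta>)\<^sup>2 \<partial>(lborel \<Otimes>\<^sub>M lborel)) = (\<integral>\<eta>. (\<integral>\<xi>. \<beta> (\<xi> - \<eta>) * (\<gamma> \<eta>)\<^sup>2 \<partial>lborel) \<partial>lborel)"
      by (rule lborel_pair.integral_snd[symmetric, OF I1])
    also have "\<dots> = (\<integral>\<eta>. (\<integral>x. \<beta> x \<partial>lborel) * (\<gamma> \<eta>)\<^sup>2 \<partial>lborel)"
      using integral_translate[of \<beta>] by simp
    finally show ?thesis by (simp add: l2n_sq)
  qed
  have v2: "(\<integral>(\<xi>, \<eta>). \<beta> (\<xi> - \<eta>) * (\<alpha> \<xi>)\<^sup>2 \<partial>(lborel \<Otimes>\<^sub>M lborel)) = (\<integral>x. \<beta> x \<partial>lborel) * (l2n \<alpha>)\<^sup>2"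
  proof -
    have "(\<integral>(\<xi>, \<eta>). \<beta> (\<xi> - \<eta>) * (\<alpha> \<xi>)\<^sup>2 \<partial>(lborel \<Otimes>\<^sub>M lborel)) = (\<integral>\<xi>. (\<integral>\<eta>. \<beta> (\<xi> - \<eta>) * (\<alpha> \<xi>)\<^sup>2 \<partial>lborel) \<partial>lborel)"
      by (rule lborel_pair.integral_fst[symmetric, OF I2])
    also have "\<dots> = (\<integral>\<xi>. (\<integral>x. \<beta> x \<partial>lborel) * (\<alpha> \<xi>)\<^sup>2 \<partial>lborel)"
      using trans by simp
    finally show ?thesis by (simp add: l2n_sq)
  qed
  define H where "H p = (\<beta> (fst p - snd p) * (\<gamma> (snd p))\<^sup>2 + \<beta> (fst p - snd p) * (\<alpha> (fst p))\<^sup>2) / 2" for p :: "real \<times> real"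
  have Hi: "integrable (lborel \<Otimes>\<^sub>M lborel) H"
    using I1 I2 unfolding H_def by (simp add: case_prod_beta')
  have Hv: "(\<integral>p. H p \<partial>(lborel \<Otimes>\<^sub>M lborel)) = (\<integral>x. \<beta> x \<partial>lborel) * (((l2n \<alpha>)\<^sup>2 + (l2n \<gamma>)\<^sup>2) / 2)"
    using I1 I2 v1 v2 unfolding H_def by (simp add: case_prod_beta' algebra_simps)
  have le: "\<bar>\<alpha> \<xi>\<bar> * \<beta> (\<xi> - \<eta>) * \<bar>\<gamma> \<eta>\<bar> \<le> H (\<xi>, \<eta>)" for \<xi> \<eta>
  proof -
    have "2 * \<bar>\<alpha> \<xi>\<bar> * \<bar>\<gamma> \<eta>\<bar> \<le> \<bar>\<alpha> \<xi>\<bar>\<^sup>2 + \<bar>\<gamma> \<eta>\<bar>\<^sup>2" by (rule sum_squares_bound)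
    then have "\<beta> (\<xi> - \<eta>) * (\<bar>\<alpha> \<xi>\<bar> * \<bar>\<gamma> \<eta>\<bar>) \<le> \<beta> (\<xi> - \<eta>) * (((\<alpha> \<xi>)\<^sup>2 + (\<gamma> \<eta>)\<^sup>2) / 2)"
      by (intro mult_left_mono nn) simp
    then show ?thesis by (simp add: H_def algebra_simps add_divide_distrib)
  qed
  show i: "integrable (lborel \<Otimes>\<^sub>M lborel) (\<lambda>(\<xi>, \<eta>). \<alpha> \<xi> * \<beta> (\<xi> - \<eta>) * \<gamma> \<eta>)"
  proof (rule Bochner_Integration.integrable_bound[OF Hi])
    show "AE p in lborel \<Otimes>\<^sub>M lborel. norm (case p of (\<xi>, \<eta>) \<Rightarrow> \<alpha> \<xi> * \<beta> (\<xi> - \<eta>) * \<gamma> \<eta>) \<le> norm (H p)"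
    proof (intro AE_I2, clarify)
      fix \<xi> \<eta>
      have "norm (\<alpha> \<xi> * \<beta> (\<xi> - \<eta>) * \<gamma> \<eta>) = \<bar>\<alpha> \<xi>\<bar> * \<beta> (\<xi> - \<eta>) * \<bar>\<gamma> \<eta>\<bar>" using nn by (simp add: abs_mult)
      also have "\<dots> \<le> \<bar>H (\<xi>, \<eta>)\<bar>" using le[of \<xi> \<eta>] by linarith
      finally show "norm (\<alpha> \<xi> * \<beta> (\<xi> - \<eta>) * \<gamma> \<eta>) \<le> norm (H (\<xi>, \<eta>))" by simp
    qed
  qed measurable
  have "integrable (lborel \<Otimes>\<^sub>M lborel) (\<lambda>(\<xi>, \<eta>). \<bar>\<alpha> \<xi>\<bar> * \<beta> (\<xi> - \<eta>) * \<bar>\<gamma> \<eta>\<bar>)"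
    using integrable_abs[OF i] nn by (simp add: case_prod_beta' abs_mult)
  then have "(\<integral>(\<xi>, \<eta>). \<bar>\<alpha> \<xi>\<bar> * \<beta> (\<xi> - \<eta>) * \<bar>\<gamma> \<eta>\<bar> \<partial>(lborel \<Otimes>\<^sub>M lborel)) \<le> (\<integral>p. H p \<partial>(lborel \<Otimes>\<^sub>M lborel))"
    using Hi le by (intro integral_mono) auto
  then show "(\<integral>(\<xi>, \<eta>). \<bar>\<alpha> \<xi>\<bar> * \<beta> (\<xi> - \<eta>) * \<bar>\<gamma> \<eta>\<bar> \<partial>(lborel \<Otimes>\<^sub>M lborel)) \<le> (\<integral>x. \<beta> x \<partial>lborel) * (((l2n \<alpha>)\<^sup>2 + (l2n \<gamma>)\<^sup>2) / 2)"
    unfolding Hv .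
qed

text \<open>
  The estimate is quadratic in the \<open>H\<^sup>\<sigma>\<close> norm of \<open>w\<close>, although \<open>u w'\<close> contains a derivative of \<open>w\<close>. The last
  two assumptions give a meaning to the product also for negative \<open>\<sigma>\<close>.
\<close>

definition transport_ok :: "real \<Rightarrow> real \<Rightarrow> real \<Rightarrow> bool" where
  "transport_ok a \<sigma> K \<longleftrightarrow> 0 \<le> K \<and> (\<forall>u w. u \<in> sobolev a \<longrightarrow> w \<in> sobolev (\<sigma> + 1) \<longrightarrow> w \<in> sobolev 1 \<longrightarrow>
     integrable lborel (fourier (weak_deriv w)) \<longrightarrow>
     \<bar>ip \<sigma> w (\<lambda>x. u x * weak_deriv w x)\<bar> \<le> K * sobolev_norm a u * (sobolev_norm \<sigma> w)\<^sup>2)"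

text \<open>
  On the Fourier side \<open>\<langle>w, u w'\<rangle>\<close> is a double integral whose kernel may be averaged with its
  conjugate transpose, as \<open>u\<close> is real. The average replaces the unbounded symbol of \<open>w'\<close> by the
  symbol of \<open>transport_symbol_bound\<close>, so no derivative of \<open>w\<close> is lost.
\<close>

lemma transport_estimate:
  fixes \<sigma> a :: real
  assumes m: "max \<sigma> 0 + max (1 - \<sigma>) 0 < a - 1 / 2"
  shows "\<exists>K. transport_ok a \<sigma> K"
proof -
  define m where "m = max \<sigma> 0 + max (1 - \<sigma>) 0"
  have ma: "m < a - 1 / 2" and m1: "1 \<le> m" and m\<sigma>: "\<bar>\<sigma>\<bar> \<le> m" using m by (auto simp: m_def)
  obtain C where C0: "0 \<le> C" and C: "\<And>\<xi> \<eta>. \<bar>\<eta> * (jb \<sigma> \<xi>)\<^sup>2 - \<xi> * (jb \<sigma> \<eta>)\<^sup>2\<bar> \<le> C * jb m (\<xi> - \<eta>) * jb \<sigma> \<xi> * jb \<sigma> \<eta>"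
    using transport_symbol_bound[of \<sigma>] unfolding m_def by blast
  define K where "K = fc * C * embed_const (a - m) / 2"
  have K0: "0 \<le> K" using C0 by (simp add: K_def less_imp_le)
  have "\<bar>ip \<sigma> w (\<lambda>x. u x * weak_deriv w x)\<bar> \<le> K * sobolev_norm a u * (sobolev_norm \<sigma> w)\<^sup>2"
    if u: "u \<in> sobolev a" and w: "w \<in> sobolev (\<sigma> + 1)" and w1: "w \<in> sobolev 1"
      and wi: "integrable lborel (fourier (weak_deriv w))" for u w
  proof -
    note wd = sobolev_weak_deriv_L2[OF w1]
    have ui: "integrable lborel (fourier u)" using u ma m1 by (intro sobolev_fourier_L1) auto
    have w\<sigma>: "w \<in> sobolev \<sigma>" using w by (rule sobolev_mono) simp
    define g where "g x = u x * weak_deriv w x" for x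
    note fm = fourier_mult[OF sobolev_L2[OF u] ui wd(1) wi]
    note [measurable] = fourier_measurable[OF sobolev_L2[OF u]] fourier_measurable[OF sobolev_L2[OF w]]
      fourier_measurable[OF wd(1)]
    define W where "W = fourier w"
    \<comment> \<open>a representative of the transform of \<open>u\<close> that is Hermitian at every point\<close>
    define h where "h \<xi> = (fourier u \<xi> + cnj (fourier u (- \<xi>))) / 2" for \<xi>
    have [measurable]: "W \<in> borel_measurable borel" "h \<in> borel_measurable borel" unfolding W_def h_def by measurable
    have herm: "h (- \<xi>) = cnj (h \<xi>)" for \<xi> by (simp add: h_def add.commute)
    have h: "AE \<xi> in lborel. fourier u \<xi> = h \<xi>"
      using fourier_hermitian[OF sobolev_L2[OF u]] by eventually_elim (simp add: h_def)
    define J where "J \<xi> = (jb \<sigma> \<xi>)\<^sup>2" for \<xi>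
    have [measurable]: "J \<in> borel_measurable borel" unfolding J_def by measurable
    define G where "G p = complex_of_real (J (fst p)) * W (fst p) * cnj (h (fst p - snd p) * (\<i> * complex_of_real (snd p) * W (snd p)))"
      for p :: "real \<times> real"
    have [measurable]: "G \<in> borel_measurable (lborel \<Otimes>\<^sub>M lborel)" unfolding G_def by measurable
    define \<alpha> where "\<alpha> \<xi> = jb \<sigma> \<xi> * cmod (W \<xi>)" for \<xi>
    define \<gamma> where "\<gamma> \<xi> = jb (\<sigma> + 1) \<xi> * cmod (W \<xi>)" for \<xi>
    have \<alpha>L: "L2 \<alpha>" "l2n \<alpha> = sobolev_norm \<sigma> w"
      using L2_norm[OF sobolev_wt[OF w\<sigma>]] l2n_norm[of "wt \<sigma> w"]
      unfolding \<alpha>_def[abs_def] W_def cmod_wt sobolev_norm_eq by auto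
    have \<gamma>L: "L2 \<gamma>" using L2_norm[OF sobolev_wt[OF w]] unfolding \<gamma>_def[abs_def] W_def cmod_wt .
    have hL1: "integrable lborel (\<lambda>\<xi>. jb p \<xi> * cmod (h \<xi>))" "(\<integral>\<xi>. jb p \<xi> * cmod (h \<xi>) \<partial>lborel) \<le> embed_const (a - p) * sobolev_norm a u"
      if "p < a - 1 / 2" for p
    proof -
      have e: "AE \<xi> in lborel. jb p \<xi> * cmod (fourier u \<xi>) = jb p \<xi> * cmod (h \<xi>)" using h by eventually_elim simp
      note l = sobolev_weighted_L1[OF u that]
      show "integrable lborel (\<lambda>\<xi>. jb p \<xi> * cmod (h \<xi>))"
        using l(1) e by (subst integrable_cong_AE[OF _ _ e, symmetric]) auto
      show "(\<integral>\<xi>. jb p \<xi> * cmod (h \<xi>) \<partial>lborel) \<le> embed_const (a - p) * sobolev_norm a u"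
        using l(2) by (subst integral_cong_AE[OF _ _ e, symmetric]) auto
    qed
    have Gi: "integrable (lborel \<Otimes>\<^sub>M lborel) G"
    proof (rule Bochner_Integration.integrable_bound)
      have "\<bar>\<sigma>\<bar> < a - 1 / 2" using m\<sigma> ma by linarith
      from integrable_trilinear(1)[OF \<alpha>L(1) \<gamma>L hL1(1)[OF this]]
      show "integrable (lborel \<Otimes>\<^sub>M lborel) (\<lambda>p. 2 powr (\<bar>\<sigma>\<bar> / 2) * (case p of (\<xi>, \<eta>) \<Rightarrow> \<alpha> \<xi> * (jb \<bar>\<sigma>\<bar> (\<xi> - \<eta>) * cmod (h (\<xi> - \<eta>))) * \<gamma> \<eta>))"
        by simp
      show "AE p in lborel \<Otimes>\<^sub>M lborel. norm (G p) \<le> norm (2 powr (\<bar>\<sigma>\<bar> / 2) * (case p of (\<xi>, \<eta>) \<Rightarrow> \<alpha> \<xi> * (jb \<bar>\<sigma>\<bar> (\<xi> - \<eta>) * cmod (h (\<xi> - \<eta>))) * \<gamma> \<eta>))"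
      proof (intro AE_I2, clarify)
        fix \<xi> \<eta>
        have "norm (G (\<xi>, \<eta>)) = jb \<sigma> \<xi> * \<bar>\<eta>\<bar> * (\<alpha> \<xi> * (cmod (h (\<xi> - \<eta>)) * cmod (W \<eta>)))"
          by (simp add: G_def J_def \<alpha>_def norm_mult power2_eq_square mult_ac)
        also have "\<dots> \<le> (2 powr (\<bar>\<sigma>\<bar> / 2) * jb \<bar>\<sigma>\<bar> (\<xi> - \<eta>) * jb \<sigma> \<eta>) * jb 1 \<eta> * (\<alpha> \<xi> * (cmod (h (\<xi> - \<eta>)) * cmod (W \<eta>)))"
          by (intro mult_right_mono mult_mono jb_peetre abs_le_jb_1) (auto simp: \<alpha>_def)
        also have "\<dots> = 2 powr (\<bar>\<sigma>\<bar> / 2) * (\<alpha> \<xi> * (jb \<bar>\<sigma>\<bar> (\<xi> - \<eta>) * cmod (h (\<xi> - \<eta>))) * \<gamma> \<eta>)"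
          unfolding \<gamma>_def jb_add by (simp only: mult_ac)
        finally show "norm (G (\<xi>, \<eta>)) \<le> norm (2 powr (\<bar>\<sigma>\<bar> / 2) * (\<alpha> \<xi> * (jb \<bar>\<sigma>\<bar> (\<xi> - \<eta>) * cmod (h (\<xi> - \<eta>))) * \<gamma> \<eta>))"
          by simp
      qed
    qed (auto simp: less_imp_le)
    have ipG: "ip \<sigma> w g = fc * Re (\<integral>p. G p \<partial>(lborel \<Otimes>\<^sub>M lborel))"
    proof -
      have gL: "L2 g" unfolding g_def by (rule fm(1))
      have "(\<integral>\<xi>. wt \<sigma> w \<xi> * cnj (wt \<sigma> g \<xi>) \<partial>lborel) = (\<integral>\<xi>. complex_of_real fc * (\<integral>\<eta>. G (\<xi>, \<eta>) \<partial>lborel) \<partial>lborel)"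
      proof (rule integral_cong_AE)
        show "AE \<xi> in lborel. wt \<sigma> w \<xi> * cnj (wt \<sigma> g \<xi>) = complex_of_real fc * (\<integral>\<eta>. G (\<xi>, \<eta>) \<partial>lborel)"
          using fm(2)
        proof eventually_elim
          case (elim \<xi>)
          have "conv (fourier u) (fourier (weak_deriv w)) \<xi> = conv h (\<lambda>\<eta>. \<i> * complex_of_real \<eta> * W \<eta>) \<xi>"
            by (rule conv_cong_AE) (use h wd(2) in \<open>auto simp: W_def\<close>)
          then have "fourier g \<xi> = complex_of_real fc * (\<integral>\<eta>. h (\<xi> - \<eta>) * (\<i> * complex_of_real \<eta> * W \<eta>) \<partial>lborel)"
            using elim by (simp add: g_def[abs_def] conv_def)
          then have "cnj (fourier g \<xi>) = complex_of_real fc * (\<integral>\<eta>. cnj (h (\<xi> - \<eta>) * (\<i> * complex_of_real \<eta> * W \<eta>)) \<partial>lborel)"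
            unfolding Bochner_Integration.integral_cnj by simp
          moreover have "(\<integral>\<eta>. G (\<xi>, \<eta>) \<partial>lborel) = complex_of_real (J \<xi>) * W \<xi> * (\<integral>\<eta>. cnj (h (\<xi> - \<eta>) * (\<i> * complex_of_real \<eta> * W \<eta>)) \<partial>lborel)"
            unfolding G_def fst_conv snd_conv by (rule integral_mult_right_zero)
          ultimately show ?case
            by (simp only: wt_def J_def W_def power2_eq_square of_real_mult complex_cnj_mult complex_cnj_complex_of_real mult_ac)
        qed
        show "(\<lambda>\<xi>. wt \<sigma> w \<xi> * cnj (wt \<sigma> g \<xi>)) \<in> borel_measurable lborel"
          using wt_measurable[OF gL, of \<sigma>] wt_measurable[OF sobolev_L2[OF w], of \<sigma>] by measurable
      qed measurable
      also have "\<dots> = complex_of_real fc * (\<integral>\<xi>. (\<integral>\<eta>. G (\<xi>, \<eta>) \<partial>lborel) \<partial>lborel)" by (rule integral_mult_right_zero)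
      also have "(\<integral>\<xi>. (\<integral>\<eta>. G (\<xi>, \<eta>) \<partial>lborel) \<partial>lborel) = (\<integral>p. G p \<partial>(lborel \<Otimes>\<^sub>M lborel))"
        by (rule lborel_pair.integral_fst'[OF Gi])
      finally show ?thesis by (simp add: ip_def)
    qed
    \<comment> \<open>the sum of the kernel and its conjugate transpose has twice the real part of the integral\<close>
    define S where "S p = G p + cnj (G (snd p, fst p))" for p
    have Gs: "integrable (lborel \<Otimes>\<^sub>M lborel) (\<lambda>p. G (snd p, fst p))" "(\<integral>p. G (snd p, fst p) \<partial>(lborel \<Otimes>\<^sub>M lborel)) = (\<integral>p. G p \<partial>(lborel \<Otimes>\<^sub>M lborel))"
      using lborel_pair.integrable_product_swap[OF Gi] lborel_pair.integral_product_swap[of G]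
      by (simp_all add: case_prod_beta')
    have Si: "integrable (lborel \<Otimes>\<^sub>M lborel) S" unfolding S_def using Gi Gs(1) by simp
    have "(\<integral>p. S p \<partial>(lborel \<Otimes>\<^sub>M lborel)) = (\<integral>p. G p \<partial>(lborel \<Otimes>\<^sub>M lborel)) + cnj (\<integral>p. G p \<partial>(lborel \<Otimes>\<^sub>M lborel))"
      unfolding S_def using Gi Gs by (subst Bochner_Integration.integral_add) auto
    then have ReS: "2 * Re (\<integral>p. G p \<partial>(lborel \<Otimes>\<^sub>M lborel)) = Re (\<integral>p. S p \<partial>(lborel \<Otimes>\<^sub>M lborel))" by simp
    have Sb: "norm (S (\<xi>, \<eta>)) \<le> C * (\<bar>\<alpha> \<xi>\<bar> * (jb m (\<xi> - \<eta>) * cmod (h (\<xi> - \<eta>))) * \<bar>\<alpha> \<eta>\<bar>)" for \<xi> \<eta>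
    proof -
      have hh: "h (\<eta> - \<xi>) = cnj (h (\<xi> - \<eta>))" using herm[of "\<xi> - \<eta>"] by simp
      have "S (\<xi>, \<eta>) = - \<i> * W \<xi> * cnj (W \<eta>) * cnj (h (\<xi> - \<eta>)) * complex_of_real (\<eta> * J \<xi> - \<xi> * J \<eta>)"
        by (simp add: S_def G_def hh algebra_simps)
      then have "norm (S (\<xi>, \<eta>)) = cmod (W \<xi>) * cmod (W \<eta>) * cmod (h (\<xi> - \<eta>)) * \<bar>\<eta> * J \<xi> - \<xi> * J \<eta>\<bar>"
        by (simp add: norm_mult del: of_real_diff of_real_mult)
      also have "\<dots> \<le> cmod (W \<xi>) * cmod (W \<eta>) * cmod (h (\<xi> - \<eta>)) * (C * jb m (\<xi> - \<eta>) * jb \<sigma> \<xi> * jb \<sigma> \<eta>)"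
        unfolding J_def by (intro mult_left_mono C) auto
      also have "\<dots> = C * (\<alpha> \<xi> * (jb m (\<xi> - \<eta>) * cmod (h (\<xi> - \<eta>))) * \<alpha> \<eta>)"
        unfolding \<alpha>_def by (simp only: mult_ac)
      finally have le: "norm (S (\<xi>, \<eta>)) \<le> C * (\<alpha> \<xi> * (jb m (\<xi> - \<eta>) * cmod (h (\<xi> - \<eta>))) * \<alpha> \<eta>)" .
      have "\<bar>\<alpha> \<xi>\<bar> = \<alpha> \<xi>" "\<bar>\<alpha> \<eta>\<bar> = \<alpha> \<eta>" by (simp_all add: \<alpha>_def)
      with le show ?thesis by (simp only:)
    qed
    have tri: "integrable (lborel \<Otimes>\<^sub>M lborel) (\<lambda>p. C * (case p of (\<xi>, \<eta>) \<Rightarrow> \<bar>\<alpha> \<xi>\<bar> * (jb m (\<xi> - \<eta>) * cmod (h (\<xi> - \<eta>))) * \<bar>\<alpha> \<eta>\<bar>))"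
    proof -
      have "(\<lambda>x. \<bar>\<alpha> x\<bar>) = \<alpha>" by (auto simp: \<alpha>_def)
      then have "L2 (\<lambda>x. \<bar>\<alpha> x\<bar>)" using \<alpha>L by simp
      from integrable_trilinear(1)[OF this this hL1(1)[OF ma]] show ?thesis by simp
    qed
    have "\<bar>Re (\<integral>p. S p \<partial>(lborel \<Otimes>\<^sub>M lborel))\<bar> \<le> norm (\<integral>p. S p \<partial>(lborel \<Otimes>\<^sub>M lborel))" by (rule abs_Re_le_cmod)
    also have "\<dots> \<le> (\<integral>p. norm (S p) \<partial>(lborel \<Otimes>\<^sub>M lborel))" by (rule integral_norm_bound)
    also have "\<dots> \<le> (\<integral>p. C * (case p of (\<xi>, \<eta>) \<Rightarrow> \<bar>\<alpha> \<xi>\<bar> * (jb m (\<xi> - \<eta>) * cmod (h (\<xi> - \<eta>))) * \<bar>\<alpha> \<eta>\<bar>) \<partial>(lborel \<Otimes>\<^sub>M lborel))"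
      using Si tri Sb by (intro integral_mono) (auto simp: case_prod_beta')
    also have "\<dots> = C * (\<integral>(\<xi>, \<eta>). \<bar>\<alpha> \<xi>\<bar> * (jb m (\<xi> - \<eta>) * cmod (h (\<xi> - \<eta>))) * \<bar>\<alpha> \<eta>\<bar> \<partial>(lborel \<Otimes>\<^sub>M lborel))"
      by (rule integral_mult_right_zero)
    also have "\<dots> \<le> C * ((\<integral>x. jb m x * cmod (h x) \<partial>lborel) * (((l2n \<alpha>)\<^sup>2 + (l2n \<alpha>)\<^sup>2) / 2))"
      by (intro mult_left_mono integrable_trilinear(2)[OF \<alpha>L(1) \<alpha>L(1) hL1(1)[OF ma]] C0) auto
    also have "\<dots> \<le> C * ((embed_const (a - m) * sobolev_norm a u) * (((l2n \<alpha>)\<^sup>2 + (l2n \<alpha>)\<^sup>2) / 2))"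
      by (intro mult_left_mono mult_right_mono hL1(2)[OF ma] C0) auto
    finally have "2 * \<bar>Re (\<integral>p. G p \<partial>(lborel \<Otimes>\<^sub>M lborel))\<bar> \<le> C * embed_const (a - m) * sobolev_norm a u * (sobolev_norm \<sigma> w)\<^sup>2"
      unfolding ReS[symmetric] \<alpha>L(2) by (simp add: abs_mult mult_ac)
    then have "fc * (2 * \<bar>Re (\<integral>p. G p \<partial>(lborel \<Otimes>\<^sub>M lborel))\<bar>) \<le> fc * (C * embed_const (a - m) * sobolev_norm a u * (sobolev_norm \<sigma> w)\<^sup>2)"
      by (rule mult_left_mono) (simp add: less_imp_le)
    moreover have "\<bar>ip \<sigma> w g\<bar> = fc * \<bar>Re (\<integral>p. G p \<partial>(lborel \<Otimes>\<^sub>M lborel))\<bar>" unfolding ipG by (simp add: abs_mult abs_of_pos)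
    ultimately show ?thesis by (simp add: K_def g_def[abs_def] algebra_simps)
  qed
  then show ?thesis using K0 unfolding transport_ok_def by blast
qed

section \<open>The energy estimate for the difference of two solutions\<close>

text \<open>
  Joining membership and norm bound lets bounds for compound expressions be derived by resolution.
\<close>

definition sb :: "real \<Rightarrow> (real \<Rightarrow> real) \<Rightarrow> real \<Rightarrow> bool" where
  "sb q f B \<longleftrightarrow> f \<in> sobolev q \<and> sobolev_norm q f \<le> B"

lemma sb_nonneg: "sb q f B \<Longrightarrow> 0 \<le> B"
  unfolding sb_def using sobolev_norm_nonneg[of q f] by linarith

lemma sb_sobolev: "sb q f B \<Longrightarrow> p \<le> q \<Longrightarrow> f \<in> sobolev p"
  unfolding sb_def using sobolev_mono by blast

lemma sb_mono: "sb q f B \<Longrightarrow> p \<le> q \<Longrightarrow> sb p f B"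
  unfolding sb_def using sobolev_mono[of f q p] sobolev_norm_mono[of f q p] by fastforce

lemma sb_add: "sb q f A \<Longrightarrow> sb q g B \<Longrightarrow> sb q (\<lambda>x. f x + g x) (A + B)"
  unfolding sb_def using sobolev_add[of f q g] sobolev_norm_add[of f q g] by fastforce

lemma sb_diff: "sb q f A \<Longrightarrow> sb q g B \<Longrightarrow> sb q (\<lambda>x. f x - g x) (A + B)"
  unfolding sb_def using sobolev_diff[of f q g] sobolev_norm_diff[of f q g] by fastforce

lemma sb_cmult: "sb q f A \<Longrightarrow> sb q (\<lambda>x. c * f x) (\<bar>c\<bar> * A)"
  unfolding sb_def using sobolev_cmult[of f q c] sobolev_norm_cmult[of f q c] by (simp add: mult_left_mono)

lemma sb_weak_deriv: "sb p f A \<Longrightarrow> f \<in> sobolev 1 \<Longrightarrow> p = q + 1 \<Longrightarrow> sb q (weak_deriv f) A"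
  unfolding sb_def using sobolev_weak_deriv[of f q] sobolev_norm_weak_deriv[of f q] by auto

lemma sb_nonlocal: "sb p f A \<Longrightarrow> p = q - 3 \<Longrightarrow> sb q (nonlocal f) A"
  unfolding sb_def using sobolev_nonlocal[of f q] sobolev_norm_nonlocal[of f q] by auto

lemma sb_mult:
  assumes k: "mult_ok a b c K" and f: "sb a f A" and g: "sb b g B"
    and p: "f \<in> sobolev p" "g \<in> sobolev p" "1 / 2 < p"
  shows "sb c (\<lambda>x. f x * g x) (K * A * B)"
proof -
  have K: "0 \<le> K" and h: "(\<lambda>x. f x * g x) \<in> sobolev c" "sobolev_norm c (\<lambda>x. f x * g x) \<le> K * sobolev_norm a f * sobolev_norm b g"
    using k f g sobolev_fourier_L1[OF p(1,3)] sobolev_fourier_L1[OF p(2,3)] unfolding mult_ok_def sb_def by blast+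
  have "K * sobolev_norm a f * sobolev_norm b g \<le> K * A * B"
    using K f g sb_nonneg[OF f] unfolding sb_def by (intro mult_mono mult_nonneg_nonneg) auto
  then show ?thesis using h unfolding sb_def by auto
qed

lemma sobolev_prod_L2:
  "f \<in> sobolev p \<Longrightarrow> g \<in> sobolev p \<Longrightarrow> 1 / 2 < p \<Longrightarrow> L2 (\<lambda>x. f x * g x)"
  by (rule fourier_mult(1)) (auto intro: sobolev_L2 sobolev_fourier_L1)

text \<open>
  The argument of \<open>\<partial>\<^sub>x\<Lambda>\<^bsup>-4\<^esup>\<close> in the first equation, with its squares written as products.
\<close>

definition flux :: "real \<Rightarrow> real \<Rightarrow> real \<Rightarrow> (real \<Rightarrow> real) \<Rightarrow> (real \<Rightarrow> real) \<Rightarrow> real \<Rightarrow> real" where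
  "flux b \<kappa> \<alpha> U P x = b / 2 * (U x * U x) + (3 - b) * (weak_deriv U x * weak_deriv U x)
     - (b + 5) / 2 * (weak_deriv (weak_deriv U) x * weak_deriv (weak_deriv U) x)
     + (b - 5) * (weak_deriv U x * weak_deriv (weak_deriv (weak_deriv U)) x)
     + \<kappa> / 2 * (P x * P x) - \<alpha> * U x"

lemma nonlocal_term_flux: "nonlocal_term b \<kappa> \<alpha> U P = nonlocal (flux b \<kappa> \<alpha> U P)"
  unfolding nonlocal_term_def flux_def[abs_def] Let_def power2_eq_square ..

lemma velocity_derivatives:
  assumes s: "s > 7 / 2" and U: "sb s U M"
  shows "U \<in> sobolev 1" "weak_deriv U \<in> sobolev 1" "weak_deriv (weak_deriv U) \<in> sobolev 1"
    "sb (s - 1) (weak_deriv U) M" "sb (s - 2) (weak_deriv (weak_deriv U)) M"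
    "sb (s - 3) (weak_deriv (weak_deriv (weak_deriv U))) M"
proof -
  show 0: "U \<in> sobolev 1" by (rule sb_sobolev[OF U]) (use s in simp)
  show a: "sb (s - 1) (weak_deriv U) M" by (rule sb_weak_deriv[OF U 0]) simp
  show 1: "weak_deriv U \<in> sobolev 1" by (rule sb_sobolev[OF a]) (use s in simp)
  show b: "sb (s - 2) (weak_deriv (weak_deriv U)) M" by (rule sb_weak_deriv[OF a 1]) simp
  show 2: "weak_deriv (weak_deriv U) \<in> sobolev 1" by (rule sb_sobolev[OF b]) (use s in simp)
  show "sb (s - 3) (weak_deriv (weak_deriv (weak_deriv U))) M" by (rule sb_weak_deriv[OF b 2]) simp
qed

lemma flux_L2:
  assumes s: "s > 7 / 2" and U: "sb s U M" and P: "sb (s - 2) P M'"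
  shows "L2 (flux b \<kappa> \<alpha> U P)"
proof -
  note d = velocity_derivatives[OF s U]
  have p: "1 / 2 < s - 3" using s by simp
  have m: "U \<in> sobolev (s - 3)" "weak_deriv U \<in> sobolev (s - 3)" "weak_deriv (weak_deriv U) \<in> sobolev (s - 3)"
    "weak_deriv (weak_deriv (weak_deriv U)) \<in> sobolev (s - 3)" "P \<in> sobolev (s - 3)"
    using sb_sobolev[OF U] sb_sobolev[OF d(4)] sb_sobolev[OF d(5)] sb_sobolev[OF d(6)] sb_sobolev[OF P] by auto
  show ?thesis unfolding flux_def[abs_def]
    by (intro L2_add L2_diff L2_cmult sobolev_prod_L2[OF _ _ p] m sobolev_L2[OF m(1)])
qed

text \<open>
  Subtracting the equations of the two solutions gives, for \<open>w = U - V\<close> and \<open>\<eta> = P - Q\<close>,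
  \<open>w\<^sub>t = - U w\<^sub>x - V\<^sub>x w - nonlocal R\<close> and
  \<open>\<eta>\<^sub>t = - U \<eta>\<^sub>x - Q\<^sub>x w - (b - 1)(U\<^sub>x \<eta> + Q w\<^sub>x)\<close>, where the difference \<open>R\<close> of the fluxes is linear in
  \<open>w\<close> and \<open>\<eta>\<close>. The first term of each equation is handled by the transport estimate, the others by
  product estimates. The assumptions list the products that occur, with one common constant.
\<close>

lemma energy_estimate_from_products:
  fixes b \<kappa> \<alpha> s r M K :: real
  assumes s: "s > 7 / 2" and r: "1 \<le> r" "r \<le> s - 1" and M0: "0 \<le> M"
    and k1: "mult_ok s r r K" and k2: "mult_ok (s - 1) r r K"
    and k3: "mult_ok s r (r - 3) K" and k4: "mult_ok (s - 1) (r - 1) (r - 3) K"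
    and k5: "mult_ok (s - 2) (r - 2) (r - 3) K" and k6: "mult_ok (s - 1) (r - 3) (r - 3) K"
    and k7: "mult_ok (s - 3) (r - 1) (r - 3) K" and k8: "mult_ok s (r - 2) (r - 2) K"
    and k9: "mult_ok (s - 3) r (r - 2) K" and k10: "mult_ok (s - 1) (r - 2) (r - 2) K"
    and k11: "mult_ok (s - 2) (r - 1) (r - 2) K"
    and t1: "transport_ok s r K" and t2: "transport_ok s (r - 2) K"
    and U: "sb s U M" and V: "sb s V M" and P: "sb (s - 2) P M" and Q: "sb (s - 2) Q M"
    and Ut: "Ut \<in> sobolev (s - 1)" and Vt: "Vt \<in> sobolev (s - 1)"
    and Pt: "Pt \<in> sobolev (s - 3)" and Qt: "Qt \<in> sobolev (s - 3)"
    and eU: "AE x in lborel. Ut x + U x * weak_deriv U x + nonlocal_term b \<kappa> \<alpha> U P x = 0"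
    and eV: "AE x in lborel. Vt x + V x * weak_deriv V x + nonlocal_term b \<kappa> \<alpha> V Q x = 0"
    and eP: "AE x in lborel. Pt x + U x * weak_deriv P x + (b - 1) * weak_deriv U x * P x = 0"
    and eQ: "AE x in lborel. Qt x + V x * weak_deriv Q x + (b - 1) * weak_deriv V x * Q x = 0"
    and N: "N = sobolev_norm r (\<lambda>x. U x - V x) + sobolev_norm (r - 2) (\<lambda>x. P x - Q x)"
  shows "\<bar>ip r (\<lambda>x. U x - V x) (\<lambda>x. Ut x - Vt x)\<bar> + \<bar>ip (r - 2) (\<lambda>x. P x - Q x) (\<lambda>x. Pt x - Qt x)\<bar>
    \<le> (2 * K * M + (\<bar>b / 2\<bar> * (K * (M + M)) + \<bar>3 - b\<bar> * (K * (M + M)) + \<bar>(b + 5) / 2\<bar> * (K * (M + M))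
        + \<bar>b - 5\<bar> * (K * M + K * M) + \<bar>\<kappa> / 2\<bar> * (K * (M + M)) + \<bar>\<alpha>\<bar>)
      + 2 * K * M + \<bar>b - 1\<bar> * (K * M + K * M)) * N\<^sup>2"
proof -
  have p: "1 / 2 < s - 3" using s by simp
  define w \<eta> where "w x = U x - V x" and "\<eta> x = P x - Q x" for x
  let ?D = "weak_deriv"
  have N0: "0 \<le> N" by (simp add: N)
  note dU = velocity_derivatives[OF s U] and dV = velocity_derivatives[OF s V]
  have wS: "sb s w (M + M)" unfolding w_def by (rule sb_diff[OF U V])
  note dw = velocity_derivatives[OF s wS]
  have wN: "sb r w N"
    using sb_sobolev[OF wS, of r] r by (simp add: sb_def N w_def[abs_def])
  have w1N: "sb (r - 1) (?D w) N" by (rule sb_weak_deriv[OF wN dw(1)]) simp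
  have w2N: "sb (r - 2) (?D (?D w)) N" by (rule sb_weak_deriv[OF w1N dw(2)]) simp
  have w3N: "sb (r - 3) (?D (?D (?D w))) N" by (rule sb_weak_deriv[OF w2N dw(3)]) simp
  have \<eta>S: "sb (s - 2) \<eta> (M + M)" unfolding \<eta>_def by (rule sb_diff[OF P Q])
  have \<eta>N: "sb (r - 2) \<eta> N"
    using sb_sobolev[OF \<eta>S, of "r - 2"] r by (simp add: sb_def N \<eta>_def[abs_def])
  have P1: "P \<in> sobolev 1" "Q \<in> sobolev 1" "\<eta> \<in> sobolev 1"
    using sb_sobolev[OF P, of 1] sb_sobolev[OF Q, of 1] sb_sobolev[OF \<eta>S, of 1] s by auto
  have Q1: "sb (s - 3) (?D Q) M" by (rule sb_weak_deriv[OF Q P1(2)]) simp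
  have \<eta>1: "sb (s - 3) (?D \<eta>) (M + M)" by (rule sb_weak_deriv[OF \<eta>S P1(3)]) simp
  \<comment> \<open>everything lies in \<open>H\<^bsup>s-3\<^esup>\<close>, whose elements have integrable transforms\<close>
  have mem: "U \<in> sobolev (s - 3)" "V \<in> sobolev (s - 3)" "?D U \<in> sobolev (s - 3)" "?D V \<in> sobolev (s - 3)"
    "?D (?D U) \<in> sobolev (s - 3)" "?D (?D V) \<in> sobolev (s - 3)" "?D (?D (?D V)) \<in> sobolev (s - 3)"
    "w \<in> sobolev (s - 3)" "?D w \<in> sobolev (s - 3)" "?D (?D w) \<in> sobolev (s - 3)" "?D (?D (?D w)) \<in> sobolev (s - 3)"
    "P \<in> sobolev (s - 3)" "Q \<in> sobolev (s - 3)" "\<eta> \<in> sobolev (s - 3)" "?D Q \<in> sobolev (s - 3)" "?D \<eta> \<in> sobolev (s - 3)"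
    by (rule sb_sobolev[OF U] sb_sobolev[OF V] sb_sobolev[OF dU(4)] sb_sobolev[OF dV(4)] sb_sobolev[OF dU(5)]
      sb_sobolev[OF dV(5)] sb_sobolev[OF dV(6)] sb_sobolev[OF wS] sb_sobolev[OF dw(4)] sb_sobolev[OF dw(5)] sb_sobolev[OF dw(6)]
      sb_sobolev[OF P] sb_sobolev[OF Q] sb_sobolev[OF \<eta>S] sb_sobolev[OF Q1] sb_sobolev[OF \<eta>1], simp)+
  have w1: "AE x in lborel. ?D w x = ?D U x - ?D V x"
    unfolding w_def[abs_def] by (rule weak_deriv_diff[OF dU(1) dV(1)])
  have w2: "AE x in lborel. ?D (?D w) x = ?D (?D U) x - ?D (?D V) x"
  proof -
    have "AE x in lborel. ?D U x - ?D V x = ?D w x" using w1 by eventually_elim simp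
    from weak_deriv_cong_AE[OF sobolev_diff[OF dU(2) dV(2)] L2_measurable[OF sobolev_L2[OF dw(2)]] this]
      weak_deriv_diff[OF dU(2) dV(2)]
    show ?thesis by eventually_elim simp
  qed
  have w3: "AE x in lborel. ?D (?D (?D w)) x = ?D (?D (?D U)) x - ?D (?D (?D V)) x"
  proof -
    have "AE x in lborel. ?D (?D U) x - ?D (?D V) x = ?D (?D w) x" using w2 by eventually_elim simp
    from weak_deriv_cong_AE[OF sobolev_diff[OF dU(3) dV(3)] L2_measurable[OF sobolev_L2[OF dw(3)]] this]
      weak_deriv_diff[OF dU(3) dV(3)]
    show ?thesis by eventually_elim simp
  qed
  have \<eta>D: "AE x in lborel. ?D \<eta> x = ?D P x - ?D Q x"
    unfolding \<eta>_def[abs_def] by (rule weak_deriv_diff[OF P1(1,2)])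

  \<comment> \<open>a difference of squares is the sum times the difference; in \<open>U\<^sub>x U\<^sub>x\<^sub>x\<^sub>x - V\<^sub>x V\<^sub>x\<^sub>x\<^sub>x\<close> the third
    derivative of \<open>w\<close> gets the smoother coefficient \<open>U\<^sub>x\<close>\<close>
  define R where "R x = b / 2 * ((U x + V x) * w x) + (3 - b) * ((?D U x + ?D V x) * ?D w x)
    - (b + 5) / 2 * ((?D (?D U) x + ?D (?D V) x) * ?D (?D w) x)
    + (b - 5) * (?D U x * ?D (?D (?D w)) x + ?D (?D (?D V)) x * ?D w x)
    + \<kappa> / 2 * ((P x + Q x) * \<eta> x) - \<alpha> * w x" for x
  define RB where "RB = \<bar>b / 2\<bar> * (K * (M + M) * N) + \<bar>3 - b\<bar> * (K * (M + M) * N) + \<bar>(b + 5) / 2\<bar> * (K * (M + M) * N)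
    + \<bar>b - 5\<bar> * (K * M * N + K * M * N) + \<bar>\<kappa> / 2\<bar> * (K * (M + M) * N) + \<bar>\<alpha>\<bar> * N"
  have RS: "sb (r - 3) R RB"
  proof -
    have a7: "sb (r - 3) w N" by (rule sb_mono[OF wN]) simp
    note a1 = sb_mult[OF k3 sb_add[OF U V] wN sobolev_add[OF mem(1,2)] mem(8) p]
    note a2 = sb_mult[OF k4 sb_add[OF dU(4) dV(4)] w1N sobolev_add[OF mem(3,4)] mem(9) p]
    note a3 = sb_mult[OF k5 sb_add[OF dU(5) dV(5)] w2N sobolev_add[OF mem(5,6)] mem(10) p]
    note a4 = sb_mult[OF k6 dU(4) w3N mem(3) mem(11) p] and a5 = sb_mult[OF k7 dV(6) w1N mem(7) mem(9) p]
    note a6 = sb_mult[OF k5 sb_add[OF P Q] \<eta>N sobolev_add[OF mem(12,13)] mem(14) p]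
    show ?thesis
      unfolding R_def[abs_def] RB_def
      by (rule sb_diff[OF sb_add[OF sb_add[OF sb_diff[OF sb_add[OF sb_cmult[OF a1] sb_cmult[OF a2]]
          sb_cmult[OF a3]] sb_cmult[OF sb_add[OF a4 a5]]] sb_cmult[OF a6]] sb_cmult[OF a7]])
  qed
  have eqR: "AE x in lborel. flux b \<kappa> \<alpha> U P x - flux b \<kappa> \<alpha> V Q x = R x"
    using w1 w2 w3
  proof eventually_elim
    case (elim x)
    show ?case unfolding R_def flux_def elim w_def \<eta>_def by (simp add: algebra_simps)
  qed
  note LU = flux_L2[OF s U P, of b \<kappa> \<alpha>] and LV = flux_L2[OF s V Q, of b \<kappa> \<alpha>]
  have RL: "L2 R" using RS by (auto simp: sb_def sobolev_L2)
  have nR: "AE x in lborel. nonlocal R x = nonlocal_term b \<kappa> \<alpha> U P x - nonlocal_term b \<kappa> \<alpha> V Q x"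
    using nonlocal_cong_AE[OF L2_diff[OF LU LV] L2_measurable[OF RL] eqR] nonlocal_diff[OF LU LV]
    unfolding nonlocal_term_flux by eventually_elim simp
  have nRS: "sb r (nonlocal R) RB" by (rule sb_nonlocal[OF RS]) simp

  \<comment> \<open>the bound of \<open>A1\<close> does not involve \<open>N\<close> and serves only to place the term in \<open>H\<^sup>r\<close>; its
    contribution is bounded by the transport estimate\<close>
  have A1: "sb r (\<lambda>x. U x * ?D w x) (K * M * (M + M))"
    by (rule sb_mult[OF k1 U _ mem(1) mem(9) p]) (rule sb_mono[OF dw(4)], use r in simp)
  have A2: "sb r (\<lambda>x. ?D V x * w x) (K * M * N)"
    by (rule sb_mult[OF k2 dV(4) wN mem(4) mem(8) p])
  have wr: "w \<in> sobolev r" using wN by (simp add: sb_def)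
  have u_part: "\<bar>ip r w (\<lambda>x. Ut x - Vt x)\<bar> \<le> K * M * N\<^sup>2 + N * (K * M * N) + N * RB"
  proof -
    let ?g = "\<lambda>x. - 1 * (U x * ?D w x + (?D V x * w x + nonlocal R x))"
    have m1: "(\<lambda>x. U x * ?D w x) \<in> sobolev r" "(\<lambda>x. ?D V x * w x) \<in> sobolev r" "nonlocal R \<in> sobolev r"
      using A1 A2 nRS by (auto simp: sb_def)
    have "ip r w (\<lambda>x. Ut x - Vt x) = ip r w ?g"
    proof (rule ip_cong_AE[OF wr])
      show "?g \<in> sobolev r" by (intro sobolev_cmult sobolev_add m1)
      show "(\<lambda>x. Ut x - Vt x) \<in> borel_measurable borel"
        using L2_measurable[OF L2_diff[OF sobolev_L2[OF Ut] sobolev_L2[OF Vt]]] .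
      show "AE x in lborel. ?g x = Ut x - Vt x" using eU eV nR w1
      proof eventually_elim
        case (elim x)
        have "Ut x = - (U x * ?D U x) - nonlocal_term b \<kappa> \<alpha> U P x" "Vt x = - (V x * ?D V x) - nonlocal_term b \<kappa> \<alpha> V Q x"
          using elim(1,2) by linarith+
        then show ?case unfolding elim(3,4) w_def by (simp add: algebra_simps)
      qed
    qed
    also have "\<dots> = - (ip r w (\<lambda>x. U x * ?D w x) + (ip r w (\<lambda>x. ?D V x * w x) + ip r w (nonlocal R)))"
      using ip_cmult[OF wr sobolev_add[OF m1(1) sobolev_add[OF m1(2,3)]], of "- 1"]
        ip_add[OF wr m1(1) sobolev_add[OF m1(2,3)]] ip_add[OF wr m1(2,3)] by simp
    finally have eq: "\<bar>ip r w (\<lambda>x. Ut x - Vt x)\<bar> \<le> \<bar>ip r w (\<lambda>x. U x * ?D w x)\<bar> + \<bar>ip r w (\<lambda>x. ?D V x * w x)\<bar> + \<bar>ip r w (nonlocal R)\<bar>"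
      by linarith
    have "\<bar>ip r w (\<lambda>x. U x * ?D w x)\<bar> \<le> K * sobolev_norm s U * (sobolev_norm r w)\<^sup>2"
      using t1 U sb_sobolev[OF wS, of "r + 1"] r dw(1) sobolev_fourier_L1[OF mem(9) p]
      unfolding transport_ok_def sb_def by auto
    also have "\<dots> \<le> K * M * N\<^sup>2"
      using t1 U wN M0 unfolding transport_ok_def sb_def by (intro mult_mono power_mono) auto
    finally have b1: "\<bar>ip r w (\<lambda>x. U x * ?D w x)\<bar> \<le> K * M * N\<^sup>2" .
    have b2: "\<bar>ip r w (\<lambda>x. ?D V x * w x)\<bar> \<le> N * (K * M * N)"
      using ip_bound[OF wr m1(2)] wN A2 N0 unfolding sb_def
      by (meson mult_mono order_trans sobolev_norm_nonneg)
    have b3: "\<bar>ip r w (nonlocal R)\<bar> \<le> N * RB"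
      using ip_bound[OF wr m1(3)] wN nRS N0 unfolding sb_def
      by (meson mult_mono order_trans sobolev_norm_nonneg)
    show ?thesis using eq b1 b2 b3 by linarith
  qed
  have \<eta>r: "\<eta> \<in> sobolev (r - 2)" using \<eta>N by (simp add: sb_def)
  have \<rho>_part: "\<bar>ip (r - 2) \<eta> (\<lambda>x. Pt x - Qt x)\<bar> \<le> K * M * N\<^sup>2 + N * (K * M * N) + N * (\<bar>b - 1\<bar> * (K * M * N + K * M * N))"
  proof -
    have B1: "sb (r - 2) (\<lambda>x. U x * ?D \<eta> x) (K * M * (M + M))"
      by (rule sb_mult[OF k8 U _ mem(1) mem(16) p]) (rule sb_mono[OF \<eta>1], use r in simp)
    have B2: "sb (r - 2) (\<lambda>x. ?D Q x * w x) (K * M * N)" by (rule sb_mult[OF k9 Q1 wN mem(15) mem(8) p])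
    have B3: "sb (r - 2) (\<lambda>x. (b - 1) * (?D U x * \<eta> x + Q x * ?D w x)) (\<bar>b - 1\<bar> * (K * M * N + K * M * N))"
      by (intro sb_cmult sb_add sb_mult[OF k10 dU(4) \<eta>N mem(3) mem(14) p] sb_mult[OF k11 Q w1N mem(13) mem(9) p])
    note m1 = B1[unfolded sb_def, THEN conjunct1] B2[unfolded sb_def, THEN conjunct1] B3[unfolded sb_def, THEN conjunct1]
    let ?g = "\<lambda>x. - 1 * (U x * ?D \<eta> x + (?D Q x * w x + (b - 1) * (?D U x * \<eta> x + Q x * ?D w x)))"
    have "ip (r - 2) \<eta> (\<lambda>x. Pt x - Qt x) = ip (r - 2) \<eta> ?g"
    proof (rule ip_cong_AE[OF \<eta>r])
      show "?g \<in> sobolev (r - 2)" by (intro sobolev_cmult sobolev_add m1)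
      show "(\<lambda>x. Pt x - Qt x) \<in> borel_measurable borel"
        using L2_measurable[OF L2_diff[OF sobolev_L2[OF Pt] sobolev_L2[OF Qt]]] .
      show "AE x in lborel. ?g x = Pt x - Qt x" using eP eQ w1 \<eta>D
      proof eventually_elim
        case (elim x)
        have "Pt x = - (U x * ?D P x) - (b - 1) * ?D U x * P x" "Qt x = - (V x * ?D Q x) - (b - 1) * ?D V x * Q x"
          using elim(1,2) by linarith+
        then show ?case unfolding elim(3,4) w_def \<eta>_def by (simp add: algebra_simps)
      qed
    qed
    also have "\<dots> = - (ip (r - 2) \<eta> (\<lambda>x. U x * ?D \<eta> x) + (ip (r - 2) \<eta> (\<lambda>x. ?D Q x * w x)
        + ip (r - 2) \<eta> (\<lambda>x. (b - 1) * (?D U x * \<eta> x + Q x * ?D w x))))"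
      using ip_cmult[OF \<eta>r sobolev_add[OF m1(1) sobolev_add[OF m1(2,3)]], of "- 1"]
        ip_add[OF \<eta>r m1(1) sobolev_add[OF m1(2,3)]] ip_add[OF \<eta>r m1(2,3)] by simp
    finally have eq: "\<bar>ip (r - 2) \<eta> (\<lambda>x. Pt x - Qt x)\<bar> \<le> \<bar>ip (r - 2) \<eta> (\<lambda>x. U x * ?D \<eta> x)\<bar>
        + \<bar>ip (r - 2) \<eta> (\<lambda>x. ?D Q x * w x)\<bar> + \<bar>ip (r - 2) \<eta> (\<lambda>x. (b - 1) * (?D U x * \<eta> x + Q x * ?D w x))\<bar>"
      by linarith
    have "\<bar>ip (r - 2) \<eta> (\<lambda>x. U x * ?D \<eta> x)\<bar> \<le> K * sobolev_norm s U * (sobolev_norm (r - 2) \<eta>)\<^sup>2"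
      using t2 U sb_sobolev[OF \<eta>S, of "r - 2 + 1"] r P1(3) sobolev_fourier_L1[OF mem(16) p]
      unfolding transport_ok_def sb_def by auto
    also have "\<dots> \<le> K * M * N\<^sup>2"
      using t2 U \<eta>N M0 unfolding transport_ok_def sb_def by (intro mult_mono power_mono) auto
    finally have b1: "\<bar>ip (r - 2) \<eta> (\<lambda>x. U x * ?D \<eta> x)\<bar> \<le> K * M * N\<^sup>2" .
    have b2: "\<bar>ip (r - 2) \<eta> (\<lambda>x. ?D Q x * w x)\<bar> \<le> N * (K * M * N)"
      using ip_bound[OF \<eta>r m1(2)] \<eta>N B2 N0 unfolding sb_def
      by (meson mult_mono order_trans sobolev_norm_nonneg)
    have b3: "\<bar>ip (r - 2) \<eta> (\<lambda>x. (b - 1) * (?D U x * \<eta> x + Q x * ?D w x))\<bar> \<le> N * (\<bar>b - 1\<bar> * (K * M * N + K * M * N))"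
      using ip_bound[OF \<eta>r m1(3)] \<eta>N B3 N0 unfolding sb_def
      by (meson mult_mono order_trans sobolev_norm_nonneg)
    show ?thesis using eq b1 b2 b3 by linarith
  qed
  have fin: "K * M * N\<^sup>2 + N * (K * M * N) + N * RB + (K * M * N\<^sup>2 + N * (K * M * N) + N * (\<bar>b - 1\<bar> * (K * M * N + K * M * N)))
    = (2 * K * M + (\<bar>b / 2\<bar> * (K * (M + M)) + \<bar>3 - b\<bar> * (K * (M + M)) + \<bar>(b + 5) / 2\<bar> * (K * (M + M))
        + \<bar>b - 5\<bar> * (K * M + K * M) + \<bar>\<kappa> / 2\<bar> * (K * (M + M)) + \<bar>\<alpha>\<bar>)
      + 2 * K * M + \<bar>b - 1\<bar> * (K * M + K * M)) * N\<^sup>2"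
    unfolding RB_def power2_eq_square by (simp only: distrib_left distrib_right mult_ac add_ac mult_2)
  show ?thesis using u_part \<rho>_part unfolding fin[symmetric] w_def[abs_def] \<eta>_def[abs_def] by linarith
qed

lemma mult_ok_mono:
  assumes k: "mult_ok a b c K" and le: "K \<le> K'" shows "mult_ok a b c K'"
proof -
  have "K * sobolev_norm a f * sobolev_norm b g \<le> K' * sobolev_norm a f * sobolev_norm b g" for f g
    by (intro mult_right_mono le) auto
  then show ?thesis using k le unfolding mult_ok_def by (meson order_trans)
qed

lemma transport_ok_mono:
  assumes k: "transport_ok a \<sigma> K" and le: "K \<le> K'" shows "transport_ok a \<sigma> K'"
proof -
  have "K * sobolev_norm a u * (sobolev_norm \<sigma> w)\<^sup>2 \<le> K' * sobolev_norm a u * (sobolev_norm \<sigma> w)\<^sup>2" for u w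
    by (intro mult_right_mono le) auto
  then show ?thesis using k le unfolding transport_ok_def by (meson order_trans)
qed

text \<open>
  In each use of \<open>mult_ok_peetre\<close> the index \<open>c'\<close> lies between the index of the product and that of the second
  factor, and \<open>\<bar>c'\<bar>\<close> is less than the index of the first factor minus \<open>1/2\<close>. For \<open>r\<close> close to \<open>1\<close> the
  value \<open>r - 3\<close> is often too negative, and \<open>r - 2\<close> or \<open>0\<close> takes its place. Splitting replaces
  Peetre's inequality where \<open>r = s - 1\<close> leaves no derivatives to spare.
\<close>

lemma energy_estimate:
  fixes b \<kappa> \<alpha> s r M :: real
  assumes s: "s > 7 / 2" and r: "1 \<le> r" "r \<le> s - 1" and M0: "0 \<le> M"
  shows "\<exists>L\<ge>0. \<forall>U V P Q Ut Vt Pt Qt. sb s U M \<longrightarrow> sb s V M \<longrightarrow> sb (s - 2) P M \<longrightarrow> sb (s - 2) Q M \<longrightarrow>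
    Ut \<in> sobolev (s - 1) \<longrightarrow> Vt \<in> sobolev (s - 1) \<longrightarrow> Pt \<in> sobolev (s - 3) \<longrightarrow> Qt \<in> sobolev (s - 3) \<longrightarrow>
    (AE x in lborel. Ut x + U x * weak_deriv U x + nonlocal_term b \<kappa> \<alpha> U P x = 0) \<longrightarrow>
    (AE x in lborel. Vt x + V x * weak_deriv V x + nonlocal_term b \<kappa> \<alpha> V Q x = 0) \<longrightarrow>
    (AE x in lborel. Pt x + U x * weak_deriv P x + (b - 1) * weak_deriv U x * P x = 0) \<longrightarrow>
    (AE x in lborel. Qt x + V x * weak_deriv Q x + (b - 1) * weak_deriv V x * Q x = 0) \<longrightarrow>
    \<bar>ip r (\<lambda>x. U x - V x) (\<lambda>x. Ut x - Vt x)\<bar> + \<bar>ip (r - 2) (\<lambda>x. P x - Q x) (\<lambda>x. Pt x - Qt x)\<bar>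
      \<le> L * (sobolev_norm r (\<lambda>x. U x - V x) + sobolev_norm (r - 2) (\<lambda>x. P x - Q x))\<^sup>2"
proof -
  have "\<exists>K. mult_ok s r r K"
    by (rule mult_ok_peetre[where c' = "r"]) (use s r in linarith)+
  then obtain K1 where k1: "mult_ok s r r K1" by blast
  have "\<exists>K. mult_ok (s - 1) r r K"
    by (rule mult_ok_split) (use s r in linarith)+
  then obtain K2 where k2: "mult_ok (s - 1) r r K2" by blast
  have "\<exists>K. mult_ok s r (r - 3) K"
    by (rule mult_ok_peetre[where c' = "r - 2"]) (use s r in linarith)+
  then obtain K3 where k3: "mult_ok s r (r - 3) K3" by blast
  have "\<exists>K. mult_ok (s - 1) (r - 1) (r - 3) K"
    by (rule mult_ok_peetre[where c' = "r - 2"]) (use s r in linarith)+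
  then obtain K4 where k4: "mult_ok (s - 1) (r - 1) (r - 3) K4" by blast
  have "\<exists>K. mult_ok (s - 2) (r - 2) (r - 3) K"
    by (rule mult_ok_peetre[where c' = "r - 2"]) (use s r in linarith)+
  then obtain K5 where k5: "mult_ok (s - 2) (r - 2) (r - 3) K5" by blast
  have "\<exists>K. mult_ok (s - 1) (r - 3) (r - 3) K"
    by (rule mult_ok_peetre[where c' = "r - 3"]) (use s r in linarith)+
  then obtain K6 where k6: "mult_ok (s - 1) (r - 3) (r - 3) K6" by blast
  have "\<exists>K. mult_ok (s - 3) (r - 1) (r - 3) K"
    by (rule mult_ok_peetre[where c' = "max 0 (r - 3)"]) (use s r in linarith)+
  then obtain K7 where k7: "mult_ok (s - 3) (r - 1) (r - 3) K7" by blast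
  have "\<exists>K. mult_ok s (r - 2) (r - 2) K"
    by (rule mult_ok_peetre[where c' = "r - 2"]) (use s r in linarith)+
  then obtain K8 where k8: "mult_ok s (r - 2) (r - 2) K8" by blast
  have "\<exists>K. mult_ok (s - 3) r (r - 2) K"
  proof (cases "r \<le> 2")
    case True
    show ?thesis by (rule mult_ok_peetre[where c' = 0]) (use s r True in linarith)+
  next
    case False
    show ?thesis by (rule mult_ok_split) (use s r False in linarith)+
  qed
  then obtain K9 where k9: "mult_ok (s - 3) r (r - 2) K9" by blast
  have "\<exists>K. mult_ok (s - 1) (r - 2) (r - 2) K"
    by (rule mult_ok_peetre[where c' = "r - 2"]) (use s r in linarith)+
  then obtain K10 where k10: "mult_ok (s - 1) (r - 2) (r - 2) K10" by blast
  have "\<exists>K. mult_ok (s - 2) (r - 1) (r - 2) K"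
    by (rule mult_ok_peetre[where c' = "r - 2"]) (use s r in linarith)+
  then obtain K11 where k11: "mult_ok (s - 2) (r - 1) (r - 2) K11" by blast
  have "\<exists>K. transport_ok s r K" by (rule transport_estimate) (use s r in linarith)
  then obtain K12 where t1: "transport_ok s r K12" by blast
  have "\<exists>K. transport_ok s (r - 2) K" by (rule transport_estimate) (use s r in linarith)
  then obtain K13 where t2: "transport_ok s (r - 2) K13" by blast
  define K where "K = K1 + K2 + K3 + K4 + K5 + K6 + K7 + K8 + K9 + K10 + K11 + K12 + K13"
  have nn: "0 \<le> K1" "0 \<le> K2" "0 \<le> K3" "0 \<le> K4" "0 \<le> K5" "0 \<le> K6" "0 \<le> K7" "0 \<le> K8" "0 \<le> K9" "0 \<le> K10" "0 \<le> K11" "0 \<le> K12" "0 \<le> K13"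
    using k1 k2 k3 k4 k5 k6 k7 k8 k9 k10 k11 t1 t2 by (auto simp: mult_ok_def transport_ok_def)
  then have "K1 \<le> K" "K2 \<le> K" "K3 \<le> K" "K4 \<le> K" "K5 \<le> K" "K6 \<le> K" "K7 \<le> K" "K8 \<le> K" "K9 \<le> K" "K10 \<le> K" "K11 \<le> K" "K12 \<le> K" "K13 \<le> K"
    unfolding K_def by linarith+
  note k = k1[THEN mult_ok_mono, OF this(1)] k2[THEN mult_ok_mono, OF this(2)] k3[THEN mult_ok_mono, OF this(3)]
    k4[THEN mult_ok_mono, OF this(4)] k5[THEN mult_ok_mono, OF this(5)] k6[THEN mult_ok_mono, OF this(6)]
    k7[THEN mult_ok_mono, OF this(7)] k8[THEN mult_ok_mono, OF this(8)] k9[THEN mult_ok_mono, OF this(9)]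
    k10[THEN mult_ok_mono, OF this(10)] k11[THEN mult_ok_mono, OF this(11)]
    t1[THEN transport_ok_mono, OF this(12)] t2[THEN transport_ok_mono, OF this(13)]
  have K0: "0 \<le> K" using nn unfolding K_def by linarith
  define L where "L = (2 * K * M + (\<bar>b / 2\<bar> * (K * (M + M)) + \<bar>3 - b\<bar> * (K * (M + M)) + \<bar>(b + 5) / 2\<bar> * (K * (M + M))
        + \<bar>b - 5\<bar> * (K * M + K * M) + \<bar>\<kappa> / 2\<bar> * (K * (M + M)) + \<bar>\<alpha>\<bar>)
      + 2 * K * M + \<bar>b - 1\<bar> * (K * M + K * M))"
  have "0 \<le> L" unfolding L_def using K0 M0 by (intro add_nonneg_nonneg mult_nonneg_nonneg) auto
  moreover have "\<bar>ip r (\<lambda>x. U x - V x) (\<lambda>x. Ut x - Vt x)\<bar> + \<bar>ip (r - 2) (\<lambda>x. P x - Q x) (\<lambda>x. Pt x - Qt x)\<bar>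
      \<le> L * (sobolev_norm r (\<lambda>x. U x - V x) + sobolev_norm (r - 2) (\<lambda>x. P x - Q x))\<^sup>2"
    if A: "sb s U M" "sb s V M" "sb (s - 2) P M" "sb (s - 2) Q M" "Ut \<in> sobolev (s - 1)" "Vt \<in> sobolev (s - 1)"
      "Pt \<in> sobolev (s - 3)" "Qt \<in> sobolev (s - 3)"
      "AE x in lborel. Ut x + U x * weak_deriv U x + nonlocal_term b \<kappa> \<alpha> U P x = 0"
      "AE x in lborel. Vt x + V x * weak_deriv V x + nonlocal_term b \<kappa> \<alpha> V Q x = 0"
      "AE x in lborel. Pt x + U x * weak_deriv P x + (b - 1) * weak_deriv U x * P x = 0"
      "AE x in lborel. Qt x + V x * weak_deriv Q x + (b - 1) * weak_deriv V x * Q x = 0"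
    for U V P Q Ut Vt Pt Qt
    unfolding L_def by (rule energy_estimate_from_products[OF s r M0 k A refl])
  ultimately show ?thesis by blast
qed

section \<open>Curves in Sobolev spaces\<close>

lemma sobolev_C_mono:
  assumes f: "sobolev_C q I f" and pq: "p \<le> q" and J: "J \<subseteq> I" shows "sobolev_C p J f"
  unfolding sobolev_C_def
proof (intro conjI ballI)
  have mem: "f t \<in> sobolev q" if "t \<in> J" for t using f J that by (auto simp: sobolev_C_def)
  then show "f t \<in> sobolev p" if "t \<in> J" for t using sobolev_mono[OF _ pq] that by blast
  fix t assume t: "t \<in> J"
  have "((\<lambda>\<tau>. sobolev_norm q (\<lambda>x. f \<tau> x - f t x)) \<longlongrightarrow> 0) (at t within I)"
    using f J t by (auto simp: sobolev_C_def)
  from tendsto_within_subset[OF this J]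
  show "((\<lambda>\<tau>. sobolev_norm p (\<lambda>x. f \<tau> x - f t x)) \<longlongrightarrow> 0) (at t within J)"
  proof (rule Lim_null_comparison[rotated])
    have "norm (sobolev_norm p (\<lambda>x. f \<tau> x - f t x)) \<le> sobolev_norm q (\<lambda>x. f \<tau> x - f t x)" if "\<tau> \<in> J" for \<tau>
      using sobolev_norm_mono[OF sobolev_diff[OF mem[OF that] mem[OF t]] pq] by simp
    then show "\<forall>\<^sub>F \<tau> in at t within J. norm (sobolev_norm p (\<lambda>x. f \<tau> x - f t x)) \<le> sobolev_norm q (\<lambda>x. f \<tau> x - f t x)"
      unfolding eventually_at_filter by (intro always_eventually) blast
  qed
qed

lemma sobolev_C_diff:
  assumes f: "sobolev_C q I f" and g: "sobolev_C q I g" shows "sobolev_C q I (\<lambda>t x. f t x - g t x)"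
  unfolding sobolev_C_def
proof (intro conjI ballI)
  fix t assume t: "t \<in> I"
  then show "(\<lambda>x. f t x - g t x) \<in> sobolev q" using f g by (auto simp: sobolev_C_def intro: sobolev_diff)
  have "((\<lambda>\<tau>. sobolev_norm q (\<lambda>x. f \<tau> x - f t x) + sobolev_norm q (\<lambda>x. g \<tau> x - g t x)) \<longlongrightarrow> 0) (at t within I)"
    using f g t tendsto_add[of _ 0 _ _ 0] by (fastforce simp: sobolev_C_def)
  then show "((\<lambda>\<tau>. sobolev_norm q (\<lambda>x. f \<tau> x - g \<tau> x - (f t x - g t x))) \<longlongrightarrow> 0) (at t within I)"
  proof (rule Lim_null_comparison[rotated])
    have "sobolev_norm q (\<lambda>x. f \<tau> x - g \<tau> x - (f t x - g t x)) \<le> sobolev_norm q (\<lambda>x. f \<tau> x - f t x) + sobolev_norm q (\<lambda>x. g \<tau> x - g t x)"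
      if "\<tau> \<in> I" for \<tau>
    proof -
      have "(\<lambda>x. f \<tau> x - g \<tau> x - (f t x - g t x)) = (\<lambda>x. (f \<tau> x - f t x) - (g \<tau> x - g t x))" by auto
      then show ?thesis using sobolev_norm_diff[of "\<lambda>x. f \<tau> x - f t x" q "\<lambda>x. g \<tau> x - g t x"] f g t that
        by (auto simp: sobolev_C_def sobolev_diff)
    qed
    then show "\<forall>\<^sub>F \<tau> in at t within I. norm (sobolev_norm q (\<lambda>x. f \<tau> x - g \<tau> x - (f t x - g t x)))
        \<le> sobolev_norm q (\<lambda>x. f \<tau> x - f t x) + sobolev_norm q (\<lambda>x. g \<tau> x - g t x)"
      unfolding eventually_at_filter by (intro always_eventually) auto
  qed
qed

lemma sobolev_diff_quotient:
  assumes "f \<in> sobolev q" "g \<in> sobolev q" "h \<in> sobolev q"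
  shows "(\<lambda>x. (f x - g x) / c - h x) \<in> sobolev q"
  using sobolev_diff[OF sobolev_cmult[OF sobolev_diff[OF assms(1,2)], of "1 / c"] assms(3)] by simp

lemma sobolev_C1_diff:
  assumes f: "sobolev_C1 q I f f'" and g: "sobolev_C1 q I g g'"
  shows "sobolev_C1 q I (\<lambda>t x. f t x - g t x) (\<lambda>t x. f' t x - g' t x)"
  unfolding sobolev_C1_def
proof (intro conjI ballI)
  show "sobolev_C q I (\<lambda>t x. f t x - g t x)" "sobolev_C q I (\<lambda>t x. f' t x - g' t x)"
    using f g by (auto simp: sobolev_C1_def intro: sobolev_C_diff)
  have mem: "f \<tau> \<in> sobolev q" "g \<tau> \<in> sobolev q" "f' \<tau> \<in> sobolev q" "g' \<tau> \<in> sobolev q" if "\<tau> \<in> I" for \<tau>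
    using f g that by (auto simp: sobolev_C1_def sobolev_C_def)
  fix t assume t: "t \<in> I"
  let ?F = "\<lambda>\<tau> x. (f \<tau> x - f t x) / (\<tau> - t) - f' t x" and ?G = "\<lambda>\<tau> x. (g \<tau> x - g t x) / (\<tau> - t) - g' t x"
  have "((\<lambda>\<tau>. sobolev_norm q (?F \<tau>) + sobolev_norm q (?G \<tau>)) \<longlongrightarrow> 0) (at t within I)"
    using f g t tendsto_add[of _ 0 _ _ 0] by (fastforce simp: sobolev_C1_def)
  then show "((\<lambda>\<tau>. sobolev_norm q (\<lambda>x. (f \<tau> x - g \<tau> x - (f t x - g t x)) / (\<tau> - t) - (f' t x - g' t x))) \<longlongrightarrow> 0) (at t within I)"
  proof (rule Lim_null_comparison[rotated])
    have "sobolev_norm q (\<lambda>x. (f \<tau> x - g \<tau> x - (f t x - g t x)) / (\<tau> - t) - (f' t x - g' t x)) \<le> sobolev_norm q (?F \<tau>) + sobolev_norm q (?G \<tau>)"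
      if "\<tau> \<in> I" for \<tau>
    proof -
      have "(\<lambda>x. (f \<tau> x - g \<tau> x - (f t x - g t x)) / (\<tau> - t) - (f' t x - g' t x)) = (\<lambda>x. ?F \<tau> x - ?G \<tau> x)"
        by (intro ext) (simp add: diff_divide_distrib)
      then show ?thesis using sobolev_norm_diff[of "?F \<tau>" q "?G \<tau>"] mem[OF t] mem[OF that]
        by (simp add: sobolev_diff_quotient)
    qed
    then show "\<forall>\<^sub>F \<tau> in at t within I. norm (sobolev_norm q (\<lambda>x. (f \<tau> x - g \<tau> x - (f t x - g t x)) / (\<tau> - t) - (f' t x - g' t x)))
        \<le> sobolev_norm q (?F \<tau>) + sobolev_norm q (?G \<tau>)"
      unfolding eventually_at_filter by (intro always_eventually) auto
  qed
qed

lemma sobolev_C1_mono: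
  assumes f: "sobolev_C1 q I f f'" and pq: "p \<le> q" and J: "J \<subseteq> I" shows "sobolev_C1 p J f f'"
  unfolding sobolev_C1_def
proof (intro conjI ballI)
  show "sobolev_C p J f" "sobolev_C p J f'" using f by (auto simp: sobolev_C1_def intro: sobolev_C_mono[OF _ pq J])
  have mem: "f t \<in> sobolev q" "f' t \<in> sobolev q" if "t \<in> J" for t using f J that by (auto simp: sobolev_C1_def sobolev_C_def)
  fix t assume t: "t \<in> J"
  have "((\<lambda>\<tau>. sobolev_norm q (\<lambda>x. (f \<tau> x - f t x) / (\<tau> - t) - f' t x)) \<longlongrightarrow> 0) (at t within I)"
    using f J t by (auto simp: sobolev_C1_def)
  from tendsto_within_subset[OF this J]
  show "((\<lambda>\<tau>. sobolev_norm p (\<lambda>x. (f \<tau> x - f t x) / (\<tau> - t) - f' t x)) \<longlongrightarrow> 0) (at t within J)"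
  proof (rule Lim_null_comparison[rotated])
    have "norm (sobolev_norm p (\<lambda>x. (f \<tau> x - f t x) / (\<tau> - t) - f' t x)) \<le> sobolev_norm q (\<lambda>x. (f \<tau> x - f t x) / (\<tau> - t) - f' t x)"
      if "\<tau> \<in> J" for \<tau>
      using sobolev_norm_mono[OF sobolev_diff_quotient[OF mem(1)[OF that] mem(1)[OF t] mem(2)[OF t]] pq] by simp
    then show "\<forall>\<^sub>F \<tau> in at t within J. norm (sobolev_norm p (\<lambda>x. (f \<tau> x - f t x) / (\<tau> - t) - f' t x)) \<le> sobolev_norm q (\<lambda>x. (f \<tau> x - f t x) / (\<tau> - t) - f' t x)"
      unfolding eventually_at_filter by (intro always_eventually) blast
  qed
qed

text \<open>
  Writing \<open>f(\<tau>) = f(t) + (\<tau> - t)(f'(t) + e(\<tau>))\<close> with \<open>e(\<tau>)\<close> tending to zero in norm, expand the square.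
\<close>

lemma sobolev_norm_sq_deriv:
  assumes f: "sobolev_C1 q I f f'" and t: "t \<in> I"
  shows "((\<lambda>\<tau>. (sobolev_norm q (f \<tau>))\<^sup>2) has_real_derivative 2 * ip q (f t) (f' t)) (at t within I)"
proof -
  have mem: "f \<tau> \<in> sobolev q" "f' \<tau> \<in> sobolev q" if "\<tau> \<in> I" for \<tau>
    using f that by (auto simp: sobolev_C1_def sobolev_C_def)
  define e where "e \<tau> x = (f \<tau> x - f t x) / (\<tau> - t) - f' t x" for \<tau> x
  have eS: "e \<tau> \<in> sobolev q" if "\<tau> \<in> I" for \<tau>
    unfolding e_def by (rule sobolev_diff_quotient[OF mem(1)[OF that] mem(1)[OF t] mem(2)[OF t]])
  have e0: "((\<lambda>\<tau>. sobolev_norm q (e \<tau>)) \<longlongrightarrow> 0) (at t within I)"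
    using f t unfolding e_def sobolev_C1_def by blast
  have bound: "norm (((sobolev_norm q (f \<tau>))\<^sup>2 - (sobolev_norm q (f t))\<^sup>2) / (\<tau> - t) - 2 * ip q (f t) (f' t))
      \<le> 2 * (sobolev_norm q (f t) * sobolev_norm q (e \<tau>)) + \<bar>\<tau> - t\<bar> * (sobolev_norm q (e \<tau>) + sobolev_norm q (f' t))\<^sup>2"
    if \<tau>: "\<tau> \<in> I" "\<tau> \<noteq> t" for \<tau>
  proof -
    define d where "d x = e \<tau> x + f' t x" for x
    have dS: "d \<in> sobolev q" unfolding d_def by (intro sobolev_add eS mem \<tau> t)
    have f\<tau>: "f \<tau> = (\<lambda>x. f t x + (\<tau> - t) * d x)" using \<tau>(2) by (intro ext) (simp add: d_def e_def)
    have "(sobolev_norm q (f \<tau>))\<^sup>2 = (sobolev_norm q (f t))\<^sup>2 + 2 * ((\<tau> - t) * ip q (f t) d) + (\<bar>\<tau> - t\<bar> * sobolev_norm q d)\<^sup>2"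
      unfolding f\<tau> sobolev_norm_sq_add[OF mem(1)[OF t] sobolev_cmult[OF dS]] ip_cmult[OF mem(1)[OF t] dS] sobolev_norm_cmult[OF dS] ..
    then have "((sobolev_norm q (f \<tau>))\<^sup>2 - (sobolev_norm q (f t))\<^sup>2) / (\<tau> - t) = 2 * ip q (f t) d + (\<tau> - t) * (sobolev_norm q d)\<^sup>2"
      using \<tau>(2) by (simp add: power_mult_distrib field_simps power2_eq_square)
    also have "ip q (f t) d = ip q (f t) (e \<tau>) + ip q (f t) (f' t)"
      unfolding d_def by (rule ip_add[OF mem(1)[OF t] eS[OF \<tau>(1)] mem(2)[OF t]])
    finally have eq: "((sobolev_norm q (f \<tau>))\<^sup>2 - (sobolev_norm q (f t))\<^sup>2) / (\<tau> - t) - 2 * ip q (f t) (f' t)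
        = 2 * ip q (f t) (e \<tau>) + (\<tau> - t) * (sobolev_norm q d)\<^sup>2" by simp
    have "\<bar>2 * ip q (f t) (e \<tau>) + (\<tau> - t) * (sobolev_norm q d)\<^sup>2\<bar> \<le> 2 * \<bar>ip q (f t) (e \<tau>)\<bar> + \<bar>\<tau> - t\<bar> * (sobolev_norm q d)\<^sup>2"
      using abs_triangle_ineq[of "2 * ip q (f t) (e \<tau>)" "(\<tau> - t) * (sobolev_norm q d)\<^sup>2"] by (simp add: abs_mult)
    also have "\<dots> \<le> 2 * (sobolev_norm q (f t) * sobolev_norm q (e \<tau>)) + \<bar>\<tau> - t\<bar> * (sobolev_norm q (e \<tau>) + sobolev_norm q (f' t))\<^sup>2"
      using sobolev_norm_add[OF eS[OF \<tau>(1)] mem(2)[OF t]]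
      by (intro add_mono mult_left_mono power_mono ip_bound mem t eS \<tau>) (auto simp: d_def[abs_def])
    finally show ?thesis unfolding eq by simp
  qed
  have id: "((\<lambda>\<tau>. \<bar>\<tau> - t\<bar>) \<longlongrightarrow> \<bar>t - t\<bar>) (at t within I)" by (intro tendsto_intros)
  have "((\<lambda>\<tau>. 2 * (sobolev_norm q (f t) * sobolev_norm q (e \<tau>)) + \<bar>\<tau> - t\<bar> * (sobolev_norm q (e \<tau>) + sobolev_norm q (f' t))\<^sup>2)
      \<longlongrightarrow> 2 * (sobolev_norm q (f t) * 0) + \<bar>t - t\<bar> * (0 + sobolev_norm q (f' t))\<^sup>2) (at t within I)"
    by (intro tendsto_intros e0)
  then have "((\<lambda>\<tau>. 2 * (sobolev_norm q (f t) * sobolev_norm q (e \<tau>)) + \<bar>\<tau> - t\<bar> * (sobolev_norm q (e \<tau>) + sobolev_norm q (f' t))\<^sup>2)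
      \<longlongrightarrow> 0) (at t within I)" by simp
  then have "((\<lambda>\<tau>. ((sobolev_norm q (f \<tau>))\<^sup>2 - (sobolev_norm q (f t))\<^sup>2) / (\<tau> - t) - 2 * ip q (f t) (f' t)) \<longlongrightarrow> 0) (at t within I)"
  proof (rule Lim_null_comparison[rotated])
    show "\<forall>\<^sub>F \<tau> in at t within I. norm (((sobolev_norm q (f \<tau>))\<^sup>2 - (sobolev_norm q (f t))\<^sup>2) / (\<tau> - t) - 2 * ip q (f t) (f' t))
      \<le> 2 * (sobolev_norm q (f t) * sobolev_norm q (e \<tau>)) + \<bar>\<tau> - t\<bar> * (sobolev_norm q (e \<tau>) + sobolev_norm q (f' t))\<^sup>2"
      unfolding eventually_at_filter using bound by (intro always_eventually) blast
  qed
  then show ?thesis unfolding has_field_derivative_iff by (simp add: LIM_zero_iff)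
qed

text \<open>
  The inequality is assumed in the open interval only, since the equations hold for positive times.
\<close>

lemma gronwall:
  fixes E E' :: "real \<Rightarrow> real"
  assumes der: "\<And>t. t \<in> {0..T} \<Longrightarrow> (E has_real_derivative E' t) (at t within {0..T})"
    and le: "\<And>t. 0 < t \<Longrightarrow> t < T \<Longrightarrow> E' t \<le> C * E t" and t: "t \<in> {0..T}"
  shows "E t \<le> exp (C * t) * E 0"
proof (cases "t = 0")
  case False
  with t have t0: "0 < t" by simp
  define g where "g \<tau> = - (exp (- C * \<tau>) * E \<tau>)" for \<tau>
  have "g 0 \<le> g t"
  proof (rule DERIV_nonneg_imp_increasing_open[of 0 t g])
    show "0 \<le> t" using t0 by simp
    fix x assume x: "0 < x" "x < t"
    then have xT: "x \<in> {0<..<T}" using t by auto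
    then have "at x within {0..T} = at x" by (intro at_within_interior) (simp add: interior_atLeastAtMost_real)
    then have "(E has_real_derivative E' x) (at x)" using der[of x] xT by auto
    then have "(g has_real_derivative exp (- C * x) * (C * E x - E' x)) (at x)"
      unfolding g_def by (auto intro!: derivative_eq_intros simp: algebra_simps)
    moreover have "0 \<le> exp (- C * x) * (C * E x - E' x)" using le[of x] xT by simp
    ultimately show "\<exists>y. (g has_real_derivative y) (at x) \<and> 0 \<le> y" by blast
  next
    have "continuous_on {0..T} E"
      unfolding continuous_on_eq_continuous_within using der has_field_derivative_imp_has_derivative has_derivative_continuous by blast
    then show "continuous_on {0..t} g" unfolding g_def
      using t by (intro continuous_intros) (auto elim: continuous_on_subset)
  qed
  then have "exp (- C * t) * E t \<le> E 0" by (simp add: g_def)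
  then have "exp (C * t) * (exp (- C * t) * E t) \<le> exp (C * t) * E 0" by (intro mult_left_mono) auto
  then show ?thesis by (simp add: mult.assoc[symmetric] flip: exp_add)
qed simp

text \<open>
  Measurability of the data is assumed because they agree with the solutions at time zero only almost
  everywhere.
\<close>

definition lipschitz_const :: "real \<Rightarrow> real \<Rightarrow> real \<Rightarrow> real \<Rightarrow> real \<Rightarrow> real \<Rightarrow> real \<Rightarrow> real \<Rightarrow> bool" where
  "lipschitz_const b \<kappa> \<alpha> s r M T0 c \<longleftrightarrow> (\<forall>u0 \<rho>0 v0 \<theta>0 Tu u \<rho> Tv v \<theta>.
    CH_solution b \<kappa> \<alpha> s u0 \<rho>0 Tu u \<rho> \<longrightarrow> CH_solution b \<kappa> \<alpha> s v0 \<theta>0 Tv v \<theta> \<longrightarrow>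
    ereal T0 < Tu \<longrightarrow> ereal T0 < Tv \<longrightarrow>
    u0 \<in> borel_measurable borel \<longrightarrow> \<rho>0 \<in> borel_measurable borel \<longrightarrow> v0 \<in> borel_measurable borel \<longrightarrow> \<theta>0 \<in> borel_measurable borel \<longrightarrow>
    (\<forall>t\<in>{0..T0}. pair_norm s (u t) (\<rho> t) \<le> M) \<longrightarrow> (\<forall>t\<in>{0..T0}. pair_norm s (v t) (\<theta> t) \<le> M) \<longrightarrow>
    (\<forall>t\<in>{0..T0}. pair_norm r (\<lambda>x. u t x - v t x) (\<lambda>x. \<rho> t x - \<theta> t x)
        \<le> c * pair_norm r (\<lambda>x. u0 x - v0 x) (\<lambda>x. \<rho>0 x - \<theta>0 x)))"

lemma lipschitz_constD:
  assumes "lipschitz_const b \<kappa> \<alpha> s r M T0 c"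
    "CH_solution b \<kappa> \<alpha> s u0 \<rho>0 Tu u \<rho>" "CH_solution b \<kappa> \<alpha> s v0 \<theta>0 Tv v \<theta>"
    "ereal T0 < Tu" "ereal T0 < Tv"
    "u0 \<in> borel_measurable borel" "\<rho>0 \<in> borel_measurable borel" "v0 \<in> borel_measurable borel" "\<theta>0 \<in> borel_measurable borel"
    "\<forall>t\<in>{0..T0}. pair_norm s (u t) (\<rho> t) \<le> M" "\<forall>t\<in>{0..T0}. pair_norm s (v t) (\<theta> t) \<le> M" "t \<in> {0..T0}"
  shows "pair_norm r (\<lambda>x. u t x - v t x) (\<lambda>x. \<rho> t x - \<theta> t x)
    \<le> c * pair_norm r (\<lambda>x. u0 x - v0 x) (\<lambda>x. \<rho>0 x - \<theta>0 x)"
  by (rule assms(1)[unfolded lipschitz_const_def, rule_format (no_asm), OF assms(2-)])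

text \<open>
  In the range \<open>1 \<le> r \<le> s - 1\<close> the time derivatives lie in \<open>H\<^sup>r \<times> H\<^bsup>r-2\<^esup>\<close>, so the squared distance of
  two solutions is differentiable and Gronwall's lemma applies: the dependence on the data is Lipschitz.
\<close>

lemma lipschitz_estimate:
  fixes b \<kappa> \<alpha> s r M T0 :: real
  assumes s: "s > 7 / 2" and r: "1 \<le> r" "r \<le> s - 1" and M0: "0 \<le> M" and T0: "0 < T0"
  shows "\<exists>c>0. lipschitz_const b \<kappa> \<alpha> s r M T0 c"
proof -
  obtain L where L0: "0 \<le> L" and L: "\<And>U V P Q Ut Vt Pt Qt. sb s U M \<Longrightarrow> sb s V M \<Longrightarrow> sb (s - 2) P M \<Longrightarrow> sb (s - 2) Q M \<Longrightarrow>
    Ut \<in> sobolev (s - 1) \<Longrightarrow> Vt \<in> sobolev (s - 1) \<Longrightarrow> Pt \<in> sobolev (s - 3) \<Longrightarrow> Qt \<in> sobolev (s - 3) \<Longrightarrow>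
    (AE x in lborel. Ut x + U x * weak_deriv U x + nonlocal_term b \<kappa> \<alpha> U P x = 0) \<Longrightarrow>
    (AE x in lborel. Vt x + V x * weak_deriv V x + nonlocal_term b \<kappa> \<alpha> V Q x = 0) \<Longrightarrow>
    (AE x in lborel. Pt x + U x * weak_deriv P x + (b - 1) * weak_deriv U x * P x = 0) \<Longrightarrow>
    (AE x in lborel. Qt x + V x * weak_deriv Q x + (b - 1) * weak_deriv V x * Q x = 0) \<Longrightarrow>
    \<bar>ip r (\<lambda>x. U x - V x) (\<lambda>x. Ut x - Vt x)\<bar> + \<bar>ip (r - 2) (\<lambda>x. P x - Q x) (\<lambda>x. Pt x - Qt x)\<bar>
      \<le> L * (sobolev_norm r (\<lambda>x. U x - V x) + sobolev_norm (r - 2) (\<lambda>x. P x - Q x))\<^sup>2"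
    using energy_estimate[OF s r M0, of b \<kappa> \<alpha>] by blast
  \<comment> \<open>one factor \<open>2\<close> is from the derivative of the squares, the other one from \<open>(x + y)\<^sup>2 \<le> 2(x\<^sup>2 + y\<^sup>2)\<close>\<close>
  define C where "C = 4 * L"
  define c where "c = sqrt (2 * exp (C * T0))"
  have "pair_norm r (\<lambda>x. u t x - v t x) (\<lambda>x. \<rho> t x - \<theta> t x) \<le> c * pair_norm r (\<lambda>x. u0 x - v0 x) (\<lambda>x. \<rho>0 x - \<theta>0 x)"
    if u: "CH_solution b \<kappa> \<alpha> s u0 \<rho>0 Tu u \<rho>" and v: "CH_solution b \<kappa> \<alpha> s v0 \<theta>0 Tv v \<theta>"
      and Tu: "ereal T0 < Tu" and Tv: "ereal T0 < Tv"
      and meas: "u0 \<in> borel_measurable borel" "\<rho>0 \<in> borel_measurable borel" "v0 \<in> borel_measurable borel" "\<theta>0 \<in> borel_measurable borel"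
      and uM: "\<forall>t\<in>{0..T0}. pair_norm s (u t) (\<rho> t) \<le> M" and vM: "\<forall>t\<in>{0..T0}. pair_norm s (v t) (\<theta> t) \<le> M"
      and t: "t \<in> {0..T0}"
    for u0 \<rho>0 v0 \<theta>0 Tu u \<rho> Tv v \<theta> t
  proof -
    let ?Iu = "{t. 0 \<le> t \<and> ereal t < Tu}" and ?Iv = "{t. 0 \<le> t \<and> ereal t < Tv}"
    have I: "{0..T0} \<subseteq> ?Iu" "{0..T0} \<subseteq> ?Iv" using Tu Tv by (auto intro: le_less_trans[of "ereal _" "ereal T0"])
    obtain ut \<rho>t where ut: "sobolev_C1 (s - 1) ?Iu u ut" "sobolev_C1 (s - 3) ?Iu \<rho> \<rho>t"
      and eu: "\<And>t. 0 < t \<Longrightarrow> ereal t < Tu \<Longrightarrow> AE x in lborel. ut t x + u t x * weak_deriv (u t) x + nonlocal_term b \<kappa> \<alpha> (u t) (\<rho> t) x = 0"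
      and e\<rho>: "\<And>t. 0 < t \<Longrightarrow> ereal t < Tu \<Longrightarrow> AE x in lborel. \<rho>t t x + u t x * weak_deriv (\<rho> t) x + (b - 1) * weak_deriv (u t) x * \<rho> t x = 0"
      using u unfolding CH_solution_def Let_def by blast
    obtain vt \<theta>t where vt: "sobolev_C1 (s - 1) ?Iv v vt" "sobolev_C1 (s - 3) ?Iv \<theta> \<theta>t"
      and ev: "\<And>t. 0 < t \<Longrightarrow> ereal t < Tv \<Longrightarrow> AE x in lborel. vt t x + v t x * weak_deriv (v t) x + nonlocal_term b \<kappa> \<alpha> (v t) (\<theta> t) x = 0"
      and e\<theta>: "\<And>t. 0 < t \<Longrightarrow> ereal t < Tv \<Longrightarrow> AE x in lborel. \<theta>t t x + v t x * weak_deriv (\<theta> t) x + (b - 1) * weak_deriv (v t) x * \<theta> t x = 0"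
      using v unfolding CH_solution_def Let_def by blast
    have mu: "u t \<in> sobolev s" "\<rho> t \<in> sobolev (s - 2)" "ut t \<in> sobolev (s - 1)" "\<rho>t t \<in> sobolev (s - 3)" if "t \<in> {0..T0}" for t
    proof -
      have "sobolev_C s ?Iu u" "sobolev_C (s - 2) ?Iu \<rho>" using u unfolding CH_solution_def Let_def by blast+
      moreover have "sobolev_C (s - 1) ?Iu ut" "sobolev_C (s - 3) ?Iu \<rho>t" using ut unfolding sobolev_C1_def by blast+
      moreover have "t \<in> ?Iu" using that I(1) by blast
      ultimately show "u t \<in> sobolev s" "\<rho> t \<in> sobolev (s - 2)" "ut t \<in> sobolev (s - 1)" "\<rho>t t \<in> sobolev (s - 3)"
        unfolding sobolev_C_def by blast+
    qed
    have mv: "v t \<in> sobolev s" "\<theta> t \<in> sobolev (s - 2)" "vt t \<in> sobolev (s - 1)" "\<theta>t t \<in> sobolev (s - 3)" if "t \<in> {0..T0}" for t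
    proof -
      have "sobolev_C s ?Iv v" "sobolev_C (s - 2) ?Iv \<theta>" using v unfolding CH_solution_def Let_def by blast+
      moreover have "sobolev_C (s - 1) ?Iv vt" "sobolev_C (s - 3) ?Iv \<theta>t" using vt unfolding sobolev_C1_def by blast+
      moreover have "t \<in> ?Iv" using that I(2) by blast
      ultimately show "v t \<in> sobolev s" "\<theta> t \<in> sobolev (s - 2)" "vt t \<in> sobolev (s - 1)" "\<theta>t t \<in> sobolev (s - 3)"
        unfolding sobolev_C_def by blast+
    qed
    have sbs: "sb s (u t) M" "sb (s - 2) (\<rho> t) M" "sb s (v t) M" "sb (s - 2) (\<theta> t) M" if t: "t \<in> {0..T0}" for t
    proof -
      have "sobolev_norm s (u t) + sobolev_norm (s - 2) (\<rho> t) \<le> M" "sobolev_norm s (v t) + sobolev_norm (s - 2) (\<theta> t) \<le> M"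
        using uM vM t unfolding pair_norm_def by blast+
      moreover note sobolev_norm_nonneg[of s "u t"] sobolev_norm_nonneg[of "s - 2" "\<rho> t"]
        sobolev_norm_nonneg[of s "v t"] sobolev_norm_nonneg[of "s - 2" "\<theta> t"]
      ultimately have "sobolev_norm s (u t) \<le> M" "sobolev_norm (s - 2) (\<rho> t) \<le> M"
        "sobolev_norm s (v t) \<le> M" "sobolev_norm (s - 2) (\<theta> t) \<le> M" by linarith+
      then show "sb s (u t) M" "sb (s - 2) (\<rho> t) M" "sb s (v t) M" "sb (s - 2) (\<theta> t) M"
        using mu[OF t] mv[OF t] by (simp_all add: sb_def)
    qed
    define w where "w t x = u t x - v t x" for t x
    define \<eta> where "\<eta> t x = \<rho> t x - \<theta> t x" for t x
    define wt where "wt t x = ut t x - vt t x" for t x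
    define \<eta>t where "\<eta>t t x = \<rho>t t x - \<theta>t t x" for t x
    have w1: "sobolev_C1 r {0..T0} w wt" unfolding w_def[abs_def] wt_def[abs_def]
      using r by (intro sobolev_C1_diff sobolev_C1_mono[OF ut(1) _ I(1)] sobolev_C1_mono[OF vt(1) _ I(2)]) auto
    have \<eta>1: "sobolev_C1 (r - 2) {0..T0} \<eta> \<eta>t" unfolding \<eta>_def[abs_def] \<eta>t_def[abs_def]
      using r by (intro sobolev_C1_diff sobolev_C1_mono[OF ut(2) _ I(1)] sobolev_C1_mono[OF vt(2) _ I(2)]) auto
    define E where "E t = (sobolev_norm r (w t))\<^sup>2 + (sobolev_norm (r - 2) (\<eta> t))\<^sup>2" for t
    have "E t \<le> exp (C * t) * E 0"
    proof (rule gronwall[OF _ _ t])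
      show "(E has_real_derivative 2 * ip r (w \<tau>) (wt \<tau>) + 2 * ip (r - 2) (\<eta> \<tau>) (\<eta>t \<tau>)) (at \<tau> within {0..T0})"
        if "\<tau> \<in> {0..T0}" for \<tau>
        unfolding E_def by (intro DERIV_add sobolev_norm_sq_deriv[OF w1 that] sobolev_norm_sq_deriv[OF \<eta>1 that])
      fix \<tau> assume \<tau>: "0 < \<tau>" "\<tau> < T0"
      then have "\<tau> \<in> {0..T0}" by simp
      then have \<tau>': "\<tau> \<in> {0..T0}" "ereal \<tau> < Tu" "ereal \<tau> < Tv" using I by blast+
      have "\<bar>ip r (w \<tau>) (wt \<tau>)\<bar> + \<bar>ip (r - 2) (\<eta> \<tau>) (\<eta>t \<tau>)\<bar> \<le> L * (sobolev_norm r (w \<tau>) + sobolev_norm (r - 2) (\<eta> \<tau>))\<^sup>2"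
        unfolding w_def[abs_def] wt_def[abs_def] \<eta>_def[abs_def] \<eta>t_def[abs_def]
        by (rule L[OF sbs(1)[OF \<tau>'(1)] sbs(3)[OF \<tau>'(1)] sbs(2)[OF \<tau>'(1)] sbs(4)[OF \<tau>'(1)] mu(3)[OF \<tau>'(1)] mv(3)[OF \<tau>'(1)]
            mu(4)[OF \<tau>'(1)] mv(4)[OF \<tau>'(1)] eu[OF \<tau>(1) \<tau>'(2)] ev[OF \<tau>(1) \<tau>'(3)] e\<rho>[OF \<tau>(1) \<tau>'(2)] e\<theta>[OF \<tau>(1) \<tau>'(3)]])
      also have "\<dots> \<le> L * (2 * E \<tau>)"
        using sum_squares_bound[of "sobolev_norm r (w \<tau>)" "sobolev_norm (r - 2) (\<eta> \<tau>)"]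
        by (intro mult_left_mono L0) (simp add: E_def power2_sum)
      finally show "2 * ip r (w \<tau>) (wt \<tau>) + 2 * ip (r - 2) (\<eta> \<tau>) (\<eta>t \<tau>) \<le> C * E \<tau>"
        unfolding C_def by linarith
    qed
    also have "\<dots> \<le> exp (C * T0) * E 0"
      using t L0 by (intro mult_right_mono) (auto simp: C_def E_def mult_left_mono)
    finally have Et: "E t \<le> exp (C * T0) * E 0" .
    have E0: "E 0 \<le> (pair_norm r (w 0) (\<eta> 0))\<^sup>2" by (simp add: E_def pair_norm_def power2_sum)
    have "(pair_norm r (w t) (\<eta> t))\<^sup>2 \<le> 2 * E t"
      using sum_squares_bound[of "sobolev_norm r (w t)" "sobolev_norm (r - 2) (\<eta> t)"]
      by (simp add: E_def pair_norm_def power2_sum)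
    also have "\<dots> \<le> 2 * (exp (C * T0) * (pair_norm r (w 0) (\<eta> 0))\<^sup>2)"
    proof -
      have "exp (C * T0) * E 0 \<le> exp (C * T0) * (pair_norm r (w 0) (\<eta> 0))\<^sup>2" by (intro mult_left_mono E0) simp
      then show ?thesis using Et by linarith
    qed
    also have "\<dots> = (c * pair_norm r (w 0) (\<eta> 0))\<^sup>2" by (simp add: c_def power_mult_distrib)
    finally have "pair_norm r (w t) (\<eta> t) \<le> c * pair_norm r (w 0) (\<eta> 0)"
      by (rule power2_le_imp_le) (simp add: c_def pair_norm_def)
    moreover have "pair_norm r (w 0) (\<eta> 0) = pair_norm r (\<lambda>x. u0 x - v0 x) (\<lambda>x. \<rho>0 x - \<theta>0 x)"
    proof -
      have z: "0 \<in> {0..T0}" using T0 by simp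
      have "w 0 \<in> sobolev r" "\<eta> 0 \<in> sobolev (r - 2)" using w1 \<eta>1 z by (auto simp: sobolev_C1_def sobolev_C_def)
      moreover have "AE x in lborel. w 0 x = u0 x - v0 x" "AE x in lborel. \<eta> 0 x = \<rho>0 x - \<theta>0 x"
        using u v unfolding CH_solution_def w_def \<eta>_def by (auto elim!: eventually_elim2)
      ultimately show ?thesis unfolding pair_norm_def using meas
        by (subst (1 2) sobolev_cong_AE(2)) auto
    qed
    ultimately show ?thesis by (simp only: w_def[abs_def] \<eta>_def[abs_def])
  qed
  moreover have "c > 0" by (simp add: c_def)
  ultimately show ?thesis unfolding lipschitz_const_def by blast
qed

section \<open>Interpolation\<close>

lemma weighted_am_gm:
  fixes x y \<theta> :: real
  assumes "0 < x" "0 < y" "0 \<le> \<theta>" "\<theta> \<le> 1"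
  shows "x powr \<theta> * y powr (1 - \<theta>) \<le> \<theta> * x + (1 - \<theta>) * y"
proof -
  have "exp ((1 - \<theta>) * ln y + \<theta> * ln x) \<le> (1 - \<theta>) * exp (ln y) + \<theta> * exp (ln x)"
    using convex_onD[OF exp_convex, of \<theta> "ln y" "ln x"] assms by simp
  then show ?thesis using assms by (simp add: powr_def add.commute flip: exp_add)
qed

text \<open>
  The weight at \<open>s - \<theta>\<close> is a geometric mean of those at \<open>s - 1\<close> and \<open>s\<close>. Dividing them by \<open>A\<^sup>2\<close> and \<open>B\<^sup>2\<close>
  before comparing with the arithmetic mean makes the two integrals add up to the product of powers.
\<close>

lemma sobolev_interpolation:
  assumes f: "f \<in> sobolev s" and \<theta>: "0 \<le> \<theta>" "\<theta> \<le> 1"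
    and A: "sobolev_norm (s - 1) f \<le> A" "0 < A" and B: "sobolev_norm s f \<le> B" "0 < B"
  shows "sobolev_norm (s - \<theta>) f \<le> A powr \<theta> * B powr (1 - \<theta>)"
proof -
  have f1: "f \<in> sobolev (s - 1)" "f \<in> sobolev (s - \<theta>)" using sobolev_mono[OF f] \<theta> by auto
  define Z where "Z = (A\<^sup>2) powr \<theta> * (B\<^sup>2) powr (1 - \<theta>)"
  have Z0: "0 \<le> Z" by (simp add: Z_def)
  have AB: "0 < A\<^sup>2" "0 < B\<^sup>2" using A B by auto
  have pt: "(cmod (wt (s - \<theta>) f \<xi>))\<^sup>2 \<le> Z * (\<theta> / A\<^sup>2) * (cmod (wt (s - 1) f \<xi>))\<^sup>2 + Z * ((1 - \<theta>) / B\<^sup>2) * (cmod (wt s f \<xi>))\<^sup>2" for \<xi>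
  proof -
    define p q where "p = (1 + \<xi>\<^sup>2) powr (s - 1)" and "q = (1 + \<xi>\<^sup>2) powr s"
    have pq: "0 < p" "0 < q" by (simp_all add: p_def q_def)
    have "(1 + \<xi>\<^sup>2) powr (s - \<theta>) = p powr \<theta> * q powr (1 - \<theta>)"
      unfolding p_def q_def powr_powr powr_add[symmetric] by (simp add: algebra_simps)
    also have "\<dots> = Z * ((p / A\<^sup>2) powr \<theta> * (q / B\<^sup>2) powr (1 - \<theta>))"
      using AB by (simp add: Z_def powr_divide)
    also have "\<dots> \<le> Z * (\<theta> * (p / A\<^sup>2) + (1 - \<theta>) * (q / B\<^sup>2))"
      using pq AB \<theta> by (intro mult_left_mono weighted_am_gm Z0) auto
    finally have "(1 + \<xi>\<^sup>2) powr (s - \<theta>) * (cmod (fourier f \<xi>))\<^sup>2 \<le> Z * (\<theta> * (p / A\<^sup>2) + (1 - \<theta>) * (q / B\<^sup>2)) * (cmod (fourier f \<xi>))\<^sup>2"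
      by (rule mult_right_mono) simp
    also have "\<dots> = Z * (\<theta> / A\<^sup>2) * (p * (cmod (fourier f \<xi>))\<^sup>2) + Z * ((1 - \<theta>) / B\<^sup>2) * (q * (cmod (fourier f \<xi>))\<^sup>2)"
      by (simp add: distrib_left distrib_right mult_ac)
    finally show ?thesis unfolding cmod_wt_sq p_def q_def .
  qed
  have i: "integrable lborel (\<lambda>\<xi>. (cmod (wt q f \<xi>))\<^sup>2)" if "f \<in> sobolev q" for q
    using L2_integrable[OF sobolev_wt[OF that]] .
  have sq: "(\<integral>\<xi>. (cmod (wt q f \<xi>))\<^sup>2 \<partial>lborel) = (sobolev_norm q f)\<^sup>2" for q
    by (simp add: sobolev_norm_eq l2n_sq)
  have "(sobolev_norm (s - \<theta>) f)\<^sup>2 \<le> (\<integral>\<xi>. Z * (\<theta> / A\<^sup>2) * (cmod (wt (s - 1) f \<xi>))\<^sup>2 + Z * ((1 - \<theta>) / B\<^sup>2) * (cmod (wt s f \<xi>))\<^sup>2 \<partial>lborel)"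
    unfolding sq[symmetric] using i[OF f] i[OF f1(1)] i[OF f1(2)] pt by (intro integral_mono) auto
  also have "\<dots> = Z * (\<theta> / A\<^sup>2) * (sobolev_norm (s - 1) f)\<^sup>2 + Z * ((1 - \<theta>) / B\<^sup>2) * (sobolev_norm s f)\<^sup>2"
    using i[OF f] i[OF f1(1)] by (simp add: sq)
  also have "\<dots> \<le> Z * (\<theta> / A\<^sup>2) * A\<^sup>2 + Z * ((1 - \<theta>) / B\<^sup>2) * B\<^sup>2"
    using A B Z0 \<theta> by (intro add_mono mult_left_mono power_mono) auto
  also have "\<dots> = Z * \<theta> + Z * (1 - \<theta>)" using AB by simp
  also have "\<dots> = Z" by (simp add: algebra_simps)
  also have "Z = (A powr \<theta> * B powr (1 - \<theta>))\<^sup>2"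
  proof -
    have "(x\<^sup>2) powr e = (x powr e)\<^sup>2" if "0 < x" for x e :: real
      using that by (simp add: power2_eq_square powr_mult)
    then show ?thesis using A B by (simp add: Z_def power_mult_distrib)
  qed
  finally show ?thesis by (rule power2_le_imp_le) simp
qed

section \<open>A priori bounds up to the common time\<close>

lemma sobolev_C_cong:
  assumes f: "sobolev_C q I f" and eq: "\<And>t. t \<in> I \<Longrightarrow> f t = g t" shows "sobolev_C q I g"
  unfolding sobolev_C_def
proof (intro conjI ballI)
  show "g t \<in> sobolev q" if "t \<in> I" for t using f eq[OF that] that by (auto simp: sobolev_C_def)
  fix t assume t: "t \<in> I"
  have "((\<lambda>\<tau>. sobolev_norm q (\<lambda>x. f \<tau> x - f t x)) \<longlongrightarrow> 0) (at t within I)" using f t by (auto simp: sobolev_C_def)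
  moreover have "\<forall>\<^sub>F \<tau> in at t within I. sobolev_norm q (\<lambda>x. f \<tau> x - f t x) = sobolev_norm q (\<lambda>x. g \<tau> x - g t x)"
    unfolding eventually_at_filter using eq t by (intro always_eventually) simp
  ultimately show "((\<lambda>\<tau>. sobolev_norm q (\<lambda>x. g \<tau> x - g t x)) \<longlongrightarrow> 0) (at t within I)"
    by (rule Lim_transform_eventually)
qed

lemma sobolev_C1_cong:
  assumes f: "sobolev_C1 q I f f'" and eq: "\<And>t. t \<in> I \<Longrightarrow> f t = g t" shows "sobolev_C1 q I g f'"
  unfolding sobolev_C1_def
proof (intro conjI ballI)
  show "sobolev_C q I g" "sobolev_C q I f'" using f sobolev_C_cong[OF _ eq] by (auto simp: sobolev_C1_def)
  fix t assume t: "t \<in> I"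
  have "((\<lambda>\<tau>. sobolev_norm q (\<lambda>x. (f \<tau> x - f t x) / (\<tau> - t) - f' t x)) \<longlongrightarrow> 0) (at t within I)" using f t by (auto simp: sobolev_C1_def)
  moreover have "\<forall>\<^sub>F \<tau> in at t within I. sobolev_norm q (\<lambda>x. (f \<tau> x - f t x) / (\<tau> - t) - f' t x) = sobolev_norm q (\<lambda>x. (g \<tau> x - g t x) / (\<tau> - t) - f' t x)"
    unfolding eventually_at_filter using eq t by (intro always_eventually) simp
  ultimately show "((\<lambda>\<tau>. sobolev_norm q (\<lambda>x. (g \<tau> x - g t x) / (\<tau> - t) - f' t x)) \<longlongrightarrow> 0) (at t within I)"
    by (rule Lim_transform_eventually)
qed

lemma CH_solution_cong:
  assumes u: "CH_solution b \<kappa> \<alpha> s u0 \<rho>0 T u \<rho>"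
    and eq: "\<And>t. 0 \<le> t \<Longrightarrow> ereal t < T \<Longrightarrow> u t = u' t \<and> \<rho> t = \<rho>' t"
  shows "CH_solution b \<kappa> \<alpha> s u0 \<rho>0 T u' \<rho>'"
proof -
  let ?I = "{t. 0 \<le> t \<and> ereal t < T}"
  have T: "0 < T" and C: "sobolev_C s ?I u" "sobolev_C (s - 2) ?I \<rho>"
    and init: "AE x in lborel. u 0 x = u0 x" "AE x in lborel. \<rho> 0 x = \<rho>0 x"
    using u unfolding CH_solution_def Let_def by blast+
  obtain ut \<rho>t where C1: "sobolev_C1 (s - 1) ?I u ut" "sobolev_C1 (s - 3) ?I \<rho> \<rho>t"
    and eqs: "\<And>t. 0 < t \<Longrightarrow> ereal t < T \<Longrightarrow> AE x in lborel. ut t x + u t x * weak_deriv (u t) x + nonlocal_term b \<kappa> \<alpha> (u t) (\<rho> t) x = 0"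
      "\<And>t. 0 < t \<Longrightarrow> ereal t < T \<Longrightarrow> AE x in lborel. \<rho>t t x + u t x * weak_deriv (\<rho> t) x + (b - 1) * weak_deriv (u t) x * \<rho> t x = 0"
    using u unfolding CH_solution_def Let_def by blast
  have 0: "u 0 = u' 0" "\<rho> 0 = \<rho>' 0" using eq[of 0] T by (auto simp: zero_ereal_def)
  have "sobolev_C s ?I u'" "sobolev_C (s - 2) ?I \<rho>'"
    using sobolev_C_cong[OF C(1), of u'] sobolev_C_cong[OF C(2), of \<rho>'] eq by auto
  moreover have "sobolev_C1 (s - 1) ?I u' ut" "sobolev_C1 (s - 3) ?I \<rho>' \<rho>t"
    using sobolev_C1_cong[OF C1(1), of u'] sobolev_C1_cong[OF C1(2), of \<rho>'] eq by auto
  moreover have "AE x in lborel. ut t x + u' t x * weak_deriv (u' t) x + nonlocal_term b \<kappa> \<alpha> (u' t) (\<rho>' t) x = 0"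
      "AE x in lborel. \<rho>t t x + u' t x * weak_deriv (\<rho>' t) x + (b - 1) * weak_deriv (u' t) x * \<rho>' t x = 0"
    if "0 < t" "ereal t < T" for t
    using eqs[OF that] eq[of t] that by auto
  ultimately show ?thesis using T init unfolding CH_solution_def Let_def 0 by blast
qed

lemma weak_deriv_AE_zero:
  assumes "AE x in lborel. f x = 0" "f \<in> borel_measurable borel"
  shows "AE x in lborel. weak_deriv f x = 0" "weak_deriv f \<in> borel_measurable borel"
proof -
  have z: "AE x in lborel. (0::real) = f x" using assms(1) by eventually_elim simp
  note d0 = sobolev_weak_deriv_L2[OF sobolev_zero(1)]
  have "AE \<xi> in lborel. fourier (weak_deriv (\<lambda>x. 0)) \<xi> = fourier (\<lambda>x. 0) \<xi>"
    using d0(2) fourier_zero by eventually_elim simp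
  from fourier_injective[OF d0(1) L2_zero this] weak_deriv_cong_AE[OF sobolev_zero(1) assms(2) z]
  show "AE x in lborel. weak_deriv f x = 0" by eventually_elim simp
  show "weak_deriv f \<in> borel_measurable borel"
    using sobolev_weak_deriv_L2(1)[OF sobolev_cong_AE(1)[OF sobolev_zero(1) assms(2) z]] by (rule L2_measurable)
qed

lemma nonlocal_term_zero: "AE x in lborel. nonlocal_term b \<kappa> \<alpha> (\<lambda>x. 0) (\<lambda>x. 0) x = 0"
proof -
  let ?D = "weak_deriv" and ?z = "\<lambda>x::real. 0::real"
  have z0: "AE x in lborel. ?z x = 0" "?z \<in> borel_measurable borel" by auto
  note z1 = weak_deriv_AE_zero[OF z0] note z2 = weak_deriv_AE_zero[OF z1] note z3 = weak_deriv_AE_zero[OF z2]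
  have "AE x in lborel. 0 = flux b \<kappa> \<alpha> ?z ?z x"
    using z1(1) z2(1) z3(1) by eventually_elim (simp add: flux_def)
  moreover have "flux b \<kappa> \<alpha> ?z ?z \<in> borel_measurable borel"
    unfolding flux_def[abs_def] using z1(2) z2(2) z3(2) by measurable
  ultimately have 1: "AE x in lborel. nonlocal (flux b \<kappa> \<alpha> ?z ?z) x = nonlocal ?z x"
    by (intro nonlocal_cong_AE[OF L2_zero])
  have "AE \<xi> in lborel. fourier (nonlocal ?z) \<xi> = fourier ?z \<xi>"
    using nonlocal_fourier(2)[OF L2_zero] fourier_zero by eventually_elim simp
  from fourier_injective[OF nonlocal_fourier(1)[OF L2_zero] L2_zero this] 1
  show ?thesis unfolding nonlocal_term_flux by eventually_elim simp
qed

lemma CH_solution_zero: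
  assumes "AE x in lborel. u0 x = 0" "AE x in lborel. \<rho>0 x = 0"
  shows "CH_solution b \<kappa> \<alpha> s u0 \<rho>0 \<infinity> (\<lambda>t x. 0) (\<lambda>t x. 0)"
proof -
  have C: "sobolev_C q I (\<lambda>t x. 0)" for q I by (simp add: sobolev_C_def sobolev_zero)
  have C1: "sobolev_C1 q I (\<lambda>t x. 0) (\<lambda>t x. 0)" for q I by (simp add: sobolev_C1_def C sobolev_zero)
  have "AE x in lborel. 0 + 0 * weak_deriv (\<lambda>x. 0) x + nonlocal_term b \<kappa> \<alpha> (\<lambda>x. 0) (\<lambda>x. 0) x = 0"
    using nonlocal_term_zero by eventually_elim simp
  moreover have "AE x in lborel. 0 = u0 x" "AE x in lborel. 0 = \<rho>0 x"
    using assms by (auto elim: eventually_mono)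
  ultimately show ?thesis unfolding CH_solution_def Let_def
    by (intro conjI C exI[of _ "\<lambda>t x. 0"] C1) auto
qed

lemma sobolev_C_bounded:
  assumes f: "sobolev_C q {0..T} f" shows "\<exists>B. \<forall>t\<in>{0..T}. sobolev_norm q (f t) \<le> B"
proof -
  have mem: "f t \<in> sobolev q" if "t \<in> {0..T}" for t using f that by (auto simp: sobolev_C_def)
  have "continuous_on {0..T} (\<lambda>t. sobolev_norm q (f t))"
    unfolding continuous_on_def
  proof
    fix t assume t: "t \<in> {0..T}"
    have "((\<lambda>\<tau>. sobolev_norm q (\<lambda>x. f \<tau> x - f t x)) \<longlongrightarrow> 0) (at t within {0..T})" using f t by (auto simp: sobolev_C_def)
    then have "((\<lambda>\<tau>. sobolev_norm q (f \<tau>) - sobolev_norm q (f t)) \<longlongrightarrow> 0) (at t within {0..T})"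
    proof (rule Lim_null_comparison[rotated])
      have "norm (sobolev_norm q (f \<tau>) - sobolev_norm q (f t)) \<le> sobolev_norm q (\<lambda>x. f \<tau> x - f t x)" if "\<tau> \<in> {0..T}" for \<tau>
        using sobolev_norm_add[OF sobolev_diff[OF mem[OF that] mem[OF t]] mem[OF t]]
          sobolev_norm_add[OF sobolev_diff[OF mem[OF t] mem[OF that]] mem[OF that]]
          sobolev_norm_diff_commute[OF mem[OF that] mem[OF t]] by (simp add: abs_le_iff)
      then show "\<forall>\<^sub>F \<tau> in at t within {0..T}. norm (sobolev_norm q (f \<tau>) - sobolev_norm q (f t)) \<le> sobolev_norm q (\<lambda>x. f \<tau> x - f t x)"
        unfolding eventually_at_filter by (intro always_eventually) blast
    qed
    then show "((\<lambda>t. sobolev_norm q (f t)) \<longlongrightarrow> sobolev_norm q (f t)) (at t within {0..T})" by (rule LIM_zero_cancel)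
  qed
  then have "bounded ((\<lambda>t. sobolev_norm q (f t)) ` {0..T})"
    by (intro compact_imp_bounded compact_continuous_image) auto
  then obtain B where "\<forall>y\<in>(\<lambda>t. sobolev_norm q (f t)) ` {0..T}. norm y \<le> B" unfolding bounded_iff by blast
  then show ?thesis by (intro exI[of _ B]) auto
qed

text \<open>
  The zero function is a solution for all times, so the lifespan of a maximal solution with vanishing
  data is infinite; the Lipschitz estimate in \<open>H\<^sup>1 \<times> H\<^bsup>-1\<^esup>\<close> then identifies the two solutions.
\<close>

lemma CH_maximal_solution_zero:
  fixes b \<kappa> \<alpha> s T0 :: real
  assumes s: "s > 7 / 2" and T0: "0 < T0"
    and mem: "u0 \<in> sobolev s" "\<rho>0 \<in> sobolev (s - 2)" and zero: "pair_norm s u0 \<rho>0 = 0"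
    and max: "CH_maximal_solution b \<kappa> \<alpha> s u0 \<rho>0 T u \<rho>"
  shows "ereal T0 < T" "\<forall>t\<in>{0..T0}. pair_norm s (u t) (\<rho> t) = 0"
proof -
  have "sobolev_norm s u0 = 0" "sobolev_norm (s - 2) \<rho>0 = 0"
    using zero sobolev_norm_nonneg[of s u0] sobolev_norm_nonneg[of "s - 2" \<rho>0] unfolding pair_norm_def by linarith+
  then have z: "AE x in lborel. u0 x = 0" "AE x in lborel. \<rho>0 x = 0"
    using sobolev_norm_0D[OF mem(1)] sobolev_norm_0D[OF mem(2)] by auto
  note zsol = CH_solution_zero[OF z, of b \<kappa> \<alpha> s]
  have "\<infinity> \<le> T" using max zsol unfolding CH_maximal_solution_def by blast
  then show TT: "ereal T0 < T" by simp
  have sol: "CH_solution b \<kappa> \<alpha> s u0 \<rho>0 T u \<rho>" using max unfolding CH_maximal_solution_def by blast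
  let ?I = "{t. 0 \<le> t \<and> ereal t < T}"
  have I: "{0..T0} \<subseteq> ?I" using TT by (auto intro: le_less_trans[of "ereal _" "ereal T0"])
  have C: "sobolev_C s {0..T0} u" "sobolev_C (s - 2) {0..T0} \<rho>"
    using sol sobolev_C_mono[OF _ order.refl I] unfolding CH_solution_def Let_def by blast+
  obtain B1 where B1: "\<forall>t\<in>{0..T0}. sobolev_norm s (u t) \<le> B1" using sobolev_C_bounded[OF C(1)] by blast
  obtain B2 where B2: "\<forall>t\<in>{0..T0}. sobolev_norm (s - 2) (\<rho> t) \<le> B2" using sobolev_C_bounded[OF C(2)] by blast
  define M where "M = max 0 (B1 + B2)"
  have M: "\<forall>t\<in>{0..T0}. pair_norm s (u t) (\<rho> t) \<le> M" using B1 B2 unfolding pair_norm_def M_def by (auto intro!: max.coboundedI2 add_mono)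
  have "\<exists>c>0. lipschitz_const b \<kappa> \<alpha> s 1 M T0 c"
    by (rule lipschitz_estimate) (use s T0 in \<open>auto simp: M_def\<close>)
  then obtain c where L: "lipschitz_const b \<kappa> \<alpha> s 1 M T0 c" by blast
  have ms: "u0 \<in> borel_measurable borel" "\<rho>0 \<in> borel_measurable borel" "(\<lambda>x::real. 0::real) \<in> borel_measurable borel"
    using mem by (auto simp: sobolev_L2 L2_measurable)
  have z0: "CH_solution b \<kappa> \<alpha> s (\<lambda>x. 0) (\<lambda>x. 0) \<infinity> (\<lambda>t x. 0) (\<lambda>t x. 0)" by (rule CH_solution_zero) auto
  have zM: "\<forall>t\<in>{0..T0}. pair_norm s (\<lambda>x. 0) (\<lambda>x. 0) \<le> M" by (simp add: pair_norm_def sobolev_zero M_def)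
  have inf: "ereal T0 < \<infinity>" by simp
  have c: "pair_norm 1 (\<lambda>x. u t x - 0) (\<lambda>x. \<rho> t x - 0) \<le> c * pair_norm 1 (\<lambda>x. u0 x - 0) (\<lambda>x. \<rho>0 x - 0)" if "t \<in> {0..T0}" for t
    by (rule lipschitz_constD[OF L sol z0 TT inf ms(1,2,3,3) M zM that])
  show "\<forall>t\<in>{0..T0}. pair_norm s (u t) (\<rho> t) = 0"
  proof
    fix t assume t: "t \<in> {0..T0}"
    have zn: "sobolev_norm q f = 0" if "AE x in lborel. f x = 0" "f \<in> borel_measurable borel" for q f
    proof -
      have "AE x in lborel. (0::real) = f x" using that(1) by eventually_elim simp
      from sobolev_cong_AE(2)[OF sobolev_zero(1) that(2) this] show ?thesis by (simp add: sobolev_zero)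
    qed
    have "pair_norm 1 u0 \<rho>0 = 0" unfolding pair_norm_def
      using zn[OF z(1)] zn[OF z(2)] mem by (simp add: sobolev_L2 L2_measurable)
    then have "sobolev_norm 1 (u t) + sobolev_norm (1 - 2) (\<rho> t) \<le> 0" using c[OF t] by (simp add: pair_norm_def)
    then have n: "sobolev_norm 1 (u t) = 0" "sobolev_norm (1 - 2) (\<rho> t) = 0"
      using sobolev_norm_nonneg[of 1 "u t"] sobolev_norm_nonneg[of "1 - 2" "\<rho> t"] by linarith+
    have m: "u t \<in> sobolev s" "\<rho> t \<in> sobolev (s - 2)" using C t by (auto simp: sobolev_C_def)
    have "AE x in lborel. u t x = 0" by (rule sobolev_norm_0D[OF sobolev_mono[OF m(1)] n(1)]) (use s in simp)
    moreover have "AE x in lborel. \<rho> t x = 0" by (rule sobolev_norm_0D[OF sobolev_mono[OF m(2)] n(2)]) (use s in simp)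
    ultimately show "pair_norm s (u t) (\<rho> t) = 0"
      unfolding pair_norm_def using zn m by (simp add: sobolev_L2 L2_measurable)
  qed
qed

text \<open>
  The bound on the closed interval forces \<open>T0 < T\<close>: otherwise the solution could be given an
  arbitrary value at time \<open>T\<close>. The choice of the lifespan turns the exponential into a square root.
\<close>

lemma lifespan_a_priori_bound:
  fixes b \<kappa> \<alpha> s cs h T0 :: real
  assumes s: "s > 7 / 2" and T0: "0 < T0" and cs: "lifespan_constant b \<kappa> \<alpha> s cs"
    and ball: "(u0, \<rho>0) \<in> data_ball s h" and life: "ereal T0 \<le> lifespan cs s u0 \<rho>0"
    and max: "CH_maximal_solution b \<kappa> \<alpha> s u0 \<rho>0 T u \<rho>"
  shows "ereal T0 < T" "\<forall>t\<in>{0..T0}. pair_norm s (u t) (\<rho> t) \<le> 2 * sqrt (h\<^sup>2 + h)"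
proof -
  define N where "N = pair_norm s u0 \<rho>0"
  have mem: "u0 \<in> sobolev s" "\<rho>0 \<in> sobolev (s - 2)" and Nh: "N \<le> h" using ball by (auto simp: data_ball_def N_def)
  have N0: "0 \<le> N" by (simp add: N_def pair_norm_def)
  have "ereal T0 < T \<and> (\<forall>t\<in>{0..T0}. pair_norm s (u t) (\<rho> t) \<le> 2 * sqrt (h\<^sup>2 + h))"
  proof (cases "N = 0")
    case True
    have "0 \<le> h\<^sup>2 + h" using N0 Nh by simp
    then show ?thesis using CH_maximal_solution_zero[OF s T0 mem True[unfolded N_def] max] by simp
  next
    case False
    then have Np: "0 < N" using N0 by simp
    define l where "l = lifespan_bound cs s u0 \<rho>0"
    have cs0: "0 < cs" using cs by (simp add: lifespan_constant_def)
    have lb: "ereal l \<le> T' \<and> (\<forall>t\<in>{0..l}. pair_norm s (u' t) (\<rho>' t) \<le> 2 * exp (cs * l) * N)"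
      if "CH_maximal_solution b \<kappa> \<alpha> s u0 \<rho>0 T' u' \<rho>'" for T' u' \<rho>'
      using cs mem False that unfolding lifespan_constant_def l_def N_def by blast
    have T0l: "T0 \<le> l" using life False by (simp add: lifespan_def l_def N_def)
    have "cs * l = ln (1 + 1 / N) / 2" using cs0 by (simp add: l_def lifespan_bound_def N_def)
    then have "exp (cs * l) = sqrt (1 + 1 / N)"
      using Np by (simp add: ln_sqrt[symmetric] add_pos_pos)
    then have "2 * exp (cs * l) * N = 2 * sqrt (N\<^sup>2 + N)"
    proof -
      assume e: "exp (cs * l) = sqrt (1 + 1 / N)"
      have "N\<^sup>2 + N = (1 + 1 / N) * N\<^sup>2" using Np by (simp add: field_simps power2_eq_square)
      then have "sqrt (N\<^sup>2 + N) = sqrt (1 + 1 / N) * N" using N0 by (simp add: real_sqrt_mult)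
      then show ?thesis using e by simp
    qed
    also have "\<dots> \<le> 2 * sqrt (h\<^sup>2 + h)" using N0 Nh by (simp add: add_mono power_mono)
    finally have M: "2 * exp (cs * l) * N \<le> 2 * sqrt (h\<^sup>2 + h)" .
    have "ereal T0 < T"
    proof (rule ccontr)
      assume "\<not> ereal T0 < T"
      then have "T \<le> ereal T0" by simp
      moreover have "ereal l \<le> T" using lb[OF max] by blast
      moreover from this \<open>T \<le> ereal T0\<close> have "ereal l \<le> ereal T0" by (rule order_trans)
      ultimately have lT: "l = T0" and TT: "T = ereal T0" using T0l by (auto intro: antisym)
      \<comment> \<open>a multiple of the data that violates the bound at time \<open>l\<close>\<close>
      define k where "k = 2 * exp (cs * l) + 1"
      have k: "2 * exp (cs * l) < k" "0 < k" by (simp_all add: k_def add_pos_pos)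
      define u' \<rho>' where "u' t = (if t = T0 then (\<lambda>x. k * u0 x) else u t)"
        and "\<rho>' t = (if t = T0 then (\<lambda>x. k * \<rho>0 x) else \<rho> t)" for t
      have "CH_solution b \<kappa> \<alpha> s u0 \<rho>0 T u' \<rho>'"
        by (rule CH_solution_cong[of _ _ _ _ _ _ _ u \<rho>])
          (use max in \<open>auto simp: CH_maximal_solution_def u'_def \<rho>'_def TT\<close>)
      then have "CH_maximal_solution b \<kappa> \<alpha> s u0 \<rho>0 T u' \<rho>'" using max unfolding CH_maximal_solution_def by blast
      from lb[OF this] have "pair_norm s (u' T0) (\<rho>' T0) \<le> 2 * exp (cs * l) * N" using lT T0 by auto
      moreover have "pair_norm s (u' T0) (\<rho>' T0) = k * N"
        using k(2) by (simp add: u'_def \<rho>'_def pair_norm_def N_def sobolev_norm_cmult[OF mem(1)] sobolev_norm_cmult[OF mem(2)] distrib_left)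
      ultimately show False using k(1) Np by simp
    qed
    moreover have "\<forall>t\<in>{0..T0}. pair_norm s (u t) (\<rho> t) \<le> 2 * sqrt (h\<^sup>2 + h)"
    proof
      fix t assume "t \<in> {0..T0}"
      then have "t \<in> {0..l}" using T0l by simp
      then have "pair_norm s (u t) (\<rho> t) \<le> 2 * exp (cs * l) * N" using lb[OF max] by blast
      then show "pair_norm s (u t) (\<rho> t) \<le> 2 * sqrt (h\<^sup>2 + h)" using M by (rule order_trans)
    qed
    ultimately show ?thesis by blast
  qed
  then show "ereal T0 < T" "\<forall>t\<in>{0..T0}. pair_norm s (u t) (\<rho> t) \<le> 2 * sqrt (h\<^sup>2 + h)" by blast+
qed

section \<open>Hoelder continuity of the solution map\<close>

text \<open>
  For \<open>X \<le> H\<close> the product \<open>H\<^bsup>1-\<beta>\<^esup>X\<^sup>\<beta>\<close> dominates \<open>X\<close>.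
\<close>

lemma holder_from_lipschitz:
  fixes X Y c H \<beta> :: real
  assumes "Y \<le> c * X" "0 \<le> X" "X \<le> H" "0 \<le> c" "0 < \<beta>" "\<beta> \<le> 1"
  shows "Y \<le> c * H powr (1 - \<beta>) * X powr \<beta>"
proof (cases "X = 0")
  case False
  then have X: "0 < X" using assms by simp
  have "X = X powr (1 - \<beta>) * X powr \<beta>" using X by (simp flip: powr_add)
  also have "\<dots> \<le> H powr (1 - \<beta>) * X powr \<beta>" using assms by (intro mult_right_mono powr_mono2) auto
  finally have "c * X \<le> c * (H powr (1 - \<beta>) * X powr \<beta>)" using assms by (intro mult_left_mono) auto
  then show ?thesis using assms(1) by (simp add: mult.assoc)
qed (use assms in simp)

text \<open>
  The factor \<open>2\<close> accounts for the two components. For \<open>A = 0\<close> both functions vanish almost everywhere.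
\<close>

lemma pair_norm_interpolation:
  assumes f: "f \<in> sobolev s" and g: "g \<in> sobolev (s - 2)" and \<theta>: "0 < \<theta>" "\<theta> \<le> 1"
    and A: "pair_norm (s - 1) f g \<le> A" and B: "pair_norm s f g \<le> B" "0 < B"
  shows "pair_norm (s - \<theta>) f g \<le> 2 * (A powr \<theta> * B powr (1 - \<theta>))"
proof -
  have A0: "0 \<le> A" using A sobolev_norm_nonneg[of "s - 1" f] sobolev_norm_nonneg[of "s - 1 - 2" g] unfolding pair_norm_def by linarith
  have a: "sobolev_norm (s - 1) f \<le> A" "sobolev_norm (s - 2 - 1) g \<le> A" "sobolev_norm s f \<le> B" "sobolev_norm (s - 2) g \<le> B"
  proof -
    have "s - 1 - 2 = s - 2 - 1" by simp
    then have "sobolev_norm (s - 1) f + sobolev_norm (s - 2 - 1) g \<le> A" "sobolev_norm s f + sobolev_norm (s - 2) g \<le> B"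
      using A B by (simp_all only: pair_norm_def)
    moreover note sobolev_norm_nonneg[of "s - 1" f] sobolev_norm_nonneg[of "s - 2 - 1" g] sobolev_norm_nonneg[of s f] sobolev_norm_nonneg[of "s - 2" g]
    ultimately show "sobolev_norm (s - 1) f \<le> A" "sobolev_norm (s - 2 - 1) g \<le> A" "sobolev_norm s f \<le> B" "sobolev_norm (s - 2) g \<le> B"
      by linarith+
  qed
  show ?thesis
  proof (cases "A = 0")
    case False
    then have Ap: "0 < A" using A0 by simp
    have "sobolev_norm (s - \<theta>) f \<le> A powr \<theta> * B powr (1 - \<theta>)" "sobolev_norm (s - 2 - \<theta>) g \<le> A powr \<theta> * B powr (1 - \<theta>)"
      using sobolev_interpolation[OF f _ \<theta>(2) a(1) Ap a(3) B(2)] sobolev_interpolation[OF g _ \<theta>(2) a(2) Ap a(4) B(2)] \<theta> by auto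
    then show ?thesis unfolding pair_norm_def by (simp add: diff_diff_eq add.commute)
  next
    case True
    have z: "sobolev_norm p k = 0" if k: "k \<in> sobolev q" and n: "sobolev_norm (q - 1) k \<le> 0" for p q k
    proof -
      have "AE x in lborel. k x = 0"
        by (rule sobolev_norm_0D[OF sobolev_mono[OF k, of "q - 1"]]) (use n sobolev_norm_nonneg[of "q - 1" k] in linarith)+
      then have "AE x in lborel. 0 = k x" by eventually_elim simp
      from sobolev_cong_AE(2)[OF sobolev_zero(1) L2_measurable[OF sobolev_L2[OF k]] this] show ?thesis by (simp add: sobolev_zero)
    qed
    have "sobolev_norm (s - \<theta>) f = 0" "sobolev_norm (s - \<theta> - 2) g = 0"
      using z[OF f] z[OF g] a(1,2) True by auto
    then show ?thesis unfolding pair_norm_def by simp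
  qed
qed

lemma C_pair_norm_le:
  assumes "0 \<le> T" "\<And>t. t \<in> {0..T} \<Longrightarrow> pair_norm q (f t) (g t) \<le> C" shows "C_pair_norm q T f g \<le> C"
  unfolding C_pair_norm_def by (rule cSUP_least) (use assms in auto)

theorem theorem3p1:
  fixes b \<kappa> \<alpha> s r h cs T0 :: real
  assumes "b \<noteq> 1"
    and "s > 7 / 2"
    and "1 \<le> r" and "r < s"
    and "lifespan_constant b \<kappa> \<alpha> s cs"
    and "T0 > 0"
  shows "\<exists>c>0. \<forall>u0 \<rho>0 v0 \<theta>0 Tu u \<rho> Tv v \<theta>.
    (u0, \<rho>0) \<in> data_ball s h \<and> (v0, \<theta>0) \<in> data_ball s h \<and>
    ereal T0 \<le> lifespan cs s u0 \<rho>0 \<and> ereal T0 \<le> lifespan cs s v0 \<theta>0 \<and>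
    CH_maximal_solution b \<kappa> \<alpha> s u0 \<rho>0 Tu u \<rho> \<and> CH_maximal_solution b \<kappa> \<alpha> s v0 \<theta>0 Tv v \<theta> \<longrightarrow>
      sobolev_C r {0..T0} u \<and> sobolev_C (r - 2) {0..T0} \<rho> \<and>
      sobolev_C r {0..T0} v \<and> sobolev_C (r - 2) {0..T0} \<theta> \<and>
      C_pair_norm r T0 (\<lambda>t x. u t x - v t x) (\<lambda>t x. \<rho> t x - \<theta> t x)
        \<le> c * pair_norm r (\<lambda>x. u0 x - v0 x) (\<lambda>x. \<rho>0 x - \<theta>0 x) powr holder_exponent s r"
proof -
  note s = assms(2) and r = assms(3,4)
  \<comment> \<open>for negative \<open>h\<close> the ball is empty\<close>
  define H where "H = max h 0"
  define M where "M = 2 * sqrt (H\<^sup>2 + H)"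
  have H0: "0 \<le> H" by (simp add: H_def)
  have M0: "0 \<le> M" using H0 by (simp add: M_def)
  define p where "p = min r (s - 1)"
  have p: "1 \<le> p" "p \<le> s - 1" using r s by (auto simp: p_def)
  obtain c1 where c1: "c1 > 0" and lip: "lipschitz_const b \<kappa> \<alpha> s p M T0 c1"
    using lipschitz_estimate[OF s p M0 assms(6), of b \<kappa> \<alpha>] by blast
  define \<beta> where "\<beta> = holder_exponent s r"
  \<comment> \<open>the summands \<open>1\<close> keep the bases, and hence \<open>c\<close>, positive\<close>
  define c where "c = (if r \<le> s - 1 then c1 * (2 * H + 1) powr (1 - \<beta>) else 2 * (c1 powr \<beta> * (2 * M + 1) powr (1 - \<beta>)))"
  have c0: "c > 0" using c1 H0 M0 by (simp add: c_def)
  have \<beta>: "0 < \<beta>" "\<beta> \<le> 1" "r > s - 1 \<Longrightarrow> \<beta> = s - r"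
    using s r by (auto simp: \<beta>_def holder_exponent_def divide_le_eq)
  have main: "sobolev_C r {0..T0} u \<and> sobolev_C (r - 2) {0..T0} \<rho> \<and>
      sobolev_C r {0..T0} v \<and> sobolev_C (r - 2) {0..T0} \<theta> \<and>
      C_pair_norm r T0 (\<lambda>t x. u t x - v t x) (\<lambda>t x. \<rho> t x - \<theta> t x)
        \<le> c * pair_norm r (\<lambda>x. u0 x - v0 x) (\<lambda>x. \<rho>0 x - \<theta>0 x) powr \<beta>"
    if u0: "(u0, \<rho>0) \<in> data_ball s h" and v0: "(v0, \<theta>0) \<in> data_ball s h"
      and lu: "ereal T0 \<le> lifespan cs s u0 \<rho>0" and lv: "ereal T0 \<le> lifespan cs s v0 \<theta>0"
      and mu: "CH_maximal_solution b \<kappa> \<alpha> s u0 \<rho>0 Tu u \<rho>" and mv: "CH_maximal_solution b \<kappa> \<alpha> s v0 \<theta>0 Tv v \<theta>"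
    for u0 \<rho>0 v0 \<theta>0 Tu u \<rho> Tv v \<theta>
  proof -
    have m0: "u0 \<in> sobolev s" "\<rho>0 \<in> sobolev (s - 2)" "v0 \<in> sobolev s" "\<theta>0 \<in> sobolev (s - 2)"
      and n0: "pair_norm s u0 \<rho>0 \<le> h" "pair_norm s v0 \<theta>0 \<le> h" using u0 v0 by (auto simp: data_ball_def)
    have "0 \<le> pair_norm s u0 \<rho>0" by (simp add: pair_norm_def)
    then have Hh: "H = h" using n0(1) by (simp add: H_def)
    note bu = lifespan_a_priori_bound[OF s assms(6,5) u0 lu mu] and bv = lifespan_a_priori_bound[OF s assms(6,5) v0 lv mv]
    have su: "CH_solution b \<kappa> \<alpha> s u0 \<rho>0 Tu u \<rho>" and sv: "CH_solution b \<kappa> \<alpha> s v0 \<theta>0 Tv v \<theta>"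
      using mu mv by (auto simp: CH_maximal_solution_def)
    have Iu: "{0..T0} \<subseteq> {t. 0 \<le> t \<and> ereal t < Tu}" and Iv: "{0..T0} \<subseteq> {t. 0 \<le> t \<and> ereal t < Tv}"
      using bu(1) bv(1) by (auto intro: le_less_trans[of "ereal _" "ereal T0"])
    have C: "sobolev_C s {0..T0} u" "sobolev_C (s - 2) {0..T0} \<rho>" "sobolev_C s {0..T0} v" "sobolev_C (s - 2) {0..T0} \<theta>"
      using su sv sobolev_C_mono[OF _ order.refl Iu] sobolev_C_mono[OF _ order.refl Iv] unfolding CH_solution_def Let_def by blast+
    have "sobolev_C r {0..T0} u" "sobolev_C (r - 2) {0..T0} \<rho>" "sobolev_C r {0..T0} v" "sobolev_C (r - 2) {0..T0} \<theta>"
      using r by (auto intro!: sobolev_C_mono[OF C(1)] sobolev_C_mono[OF C(2)] sobolev_C_mono[OF C(3)] sobolev_C_mono[OF C(4)])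
    moreover have "C_pair_norm r T0 (\<lambda>t x. u t x - v t x) (\<lambda>t x. \<rho> t x - \<theta> t x)
        \<le> c * pair_norm r (\<lambda>x. u0 x - v0 x) (\<lambda>x. \<rho>0 x - \<theta>0 x) powr \<beta>"
    proof (rule C_pair_norm_le)
      fix t assume t: "t \<in> {0..T0}"
      define X where "X q = pair_norm q (\<lambda>x. u0 x - v0 x) (\<lambda>x. \<rho>0 x - \<theta>0 x)" for q
      define Y where "Y q = pair_norm q (\<lambda>x. u t x - v t x) (\<lambda>x. \<rho> t x - \<theta> t x)" for q
      have md: "(\<lambda>x. u0 x - v0 x) \<in> sobolev s" "(\<lambda>x. \<rho>0 x - \<theta>0 x) \<in> sobolev (s - 2)" using m0 by (auto intro: sobolev_diff)
      have X0: "0 \<le> X q" for q by (simp add: X_def pair_norm_def)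
      have Xmono: "X q \<le> X q'" if "q \<le> q'" "q' \<le> s" for q q'
        unfolding X_def pair_norm_def using that md
        by (intro add_mono sobolev_norm_mono) (auto intro: sobolev_mono)
      have Xs: "X s \<le> 2 * H"
      proof -
        have "X s \<le> pair_norm s u0 \<rho>0 + pair_norm s v0 \<theta>0"
          unfolding X_def pair_norm_def using sobolev_norm_diff[OF m0(1,3)] sobolev_norm_diff[OF m0(2,4)] by simp
        then show ?thesis using n0 Hh by simp
      qed
      have Yp: "Y p \<le> c1 * X p"
        unfolding X_def Y_def
        by (rule lipschitz_constD[OF lip su sv bu(1) bv(1) _ _ _ _ bu(2)[folded Hh, folded M_def] bv(2)[folded Hh, folded M_def] t])
          (use m0 in \<open>auto simp: sobolev_L2 L2_measurable\<close>)
      show "pair_norm r (\<lambda>x. u t x - v t x) (\<lambda>x. \<rho> t x - \<theta> t x) \<le> c * pair_norm r (\<lambda>x. u0 x - v0 x) (\<lambda>x. \<rho>0 x - \<theta>0 x) powr \<beta>"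
      proof (cases "r \<le> s - 1")
        case True
        then have pr: "p = r" by (simp add: p_def)
        have "X r \<le> 2 * H + 1" using Xmono[of r s] Xs r by simp
        from holder_from_lipschitz[OF Yp[unfolded pr] X0 this _ \<beta>(1,2)] c1 True
        show ?thesis by (simp add: X_def Y_def c_def)
      next
        case False
        then have pr: "p = s - 1" and \<beta>r: "\<beta> = s - r" using \<beta>(3) by (auto simp: p_def)
        have mt: "u t \<in> sobolev s" "\<rho> t \<in> sobolev (s - 2)" "v t \<in> sobolev s" "\<theta> t \<in> sobolev (s - 2)"
          using C t by (auto simp: sobolev_C_def)
        have "Y s \<le> pair_norm s (u t) (\<rho> t) + pair_norm s (v t) (\<theta> t)"
          unfolding Y_def pair_norm_def using sobolev_norm_diff[OF mt(1,3)] sobolev_norm_diff[OF mt(2,4)] by simp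
        also have "\<dots> \<le> 2 * M" using bspec[OF bu(2) t] bspec[OF bv(2) t] unfolding M_def Hh by linarith
        finally have Ys: "Y s \<le> 2 * M + 1" by simp
        \<comment> \<open>the Lipschitz estimate in \<open>H\<^bsup>s-1\<^esup>\<close> is read with the stronger \<open>H\<^sup>r\<close> distance of the data\<close>
        have Y1: "Y (s - 1) \<le> c1 * X r"
        proof -
          have "c1 * X (s - 1) \<le> c1 * X r" using Xmono[of "s - 1" r] False r c1 by simp
          then show ?thesis using Yp unfolding pr by linarith
        qed
        have "Y (s - \<beta>) \<le> 2 * ((c1 * X r) powr \<beta> * (2 * M + 1) powr (1 - \<beta>))"
          unfolding Y_def by (rule pair_norm_interpolation[OF sobolev_diff[OF mt(1,3)] sobolev_diff[OF mt(2,4)] \<beta>(1,2)])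
            (use Y1 Ys M0 in \<open>auto simp: Y_def\<close>)
        also have "\<dots> = c * X r powr \<beta>" using False by (simp add: c_def powr_mult)
        finally show ?thesis by (simp add: X_def Y_def \<beta>r)
      qed
    qed (use assms(6) in simp)
    ultimately show ?thesis by blast
  qed
  show ?thesis using c0 main unfolding \<beta>_def by blast
qed

end
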